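(* Let $\mathcal{C}$ be the monoidal category of finite dimensional complex $\mathfrak{sl}_2$-modules. (1) Fix $\xi\in\mathbb{C}\setminus\{0\}$ and $\lambda\in\mathbb{Z}+\frac12$. For $\nu\in\mathbb{Z}+\frac12$ let $M(\nu,\xi)$ be the quotient of $U(\mathfrak{sl}_2)$ by the left ideal generated by $\mathtt{c}-(\nu+1)^2$ and $e-\xi$, where $\mathtt{c}=(h+1)^2+4fe$. Let $\mathcal{X}_1$ be the additive closure of all $M(\lambda+i,\xi)$, $i\in\mathbb{Z}$, with $\mathcal{C}$ acting by tensoring over $\mathbb{C}$. (2) Let $\mathfrak{g}$ be the Schrödinger Lie algebra with its natural projection $\mathfrak{g}\to\mathfrak{sl}_2$. Fix $\theta\in\mathbb{C}\setminus\{0\}$ and let $\mathcal{X}_2$ be the additive closure of the simple $\mathfrak{g}$-modules $V(n,\theta)$, $n\in\mathbb{Z}$, with $\mathcal{C}$ acting by pulling back along the projection and tensoring over $\mathbb{C}$. Then $\mathcal{X}_1$ and $\mathcal{X}_2$ are simple transitive $\mathcal{C}$-module categories of type $T_\infty$.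
   Context: Everything is over $\mathbb{C}$; $\mathfrak{sl}_2$ has standard basis $e,f,h$. $\mathcal{C}$ is the monoidal category (under $\otimes_{\mathbb{C}}$) of finite dimensional $\mathfrak{sl}_2$-modules; for $m\in\mathbb{Z}_{\ge 0}$, $L(m)$ is the simple module of dimension $m+1$. The additive closure of a set of modules is the full subcategory of modules isomorphic to direct summands of finite direct sums of them. Schrödinger Lie algebra $\mathfrak{g}$: basis $\{e,f,h,p,q,z\}$, with $z$ central and $[h,e]=2e$, $[h,f]=-2f$, $[e,f]=h$, $[e,q]=p$, $[e,p]=0$, $[h,p]=p$, $[f,p]=q$, $[f,q]=0$, $[h,q]=-q$, $[p,q]=z$. The projection to $\mathfrak{sl}_2$ factors out the ideal spanned by $p,q,z$. For $\theta\in\mathbb{C}\setminus\{0\}$ and $n\in\mathbb{Z}$, $V(n,\theta)$ is the simple $\mathfrak{g}$-module on which $z$ acts as $\theta$ and whose restriction to $\mathfrak{sl}_2$ is isomorphic to $L(|n|)\oplus L(|n|+1)\oplus L(|n|+2)\oplus\cdots$; one has $V(n,\theta)\cong V(n',\theta')$ if and only if $\theta'=\theta$ and $n'=\pm n$. A $\mathcal{C}$-module category $\mathcal{M}$ is locally finitary if it is $\mathbb{C}$-linear, additive, idempotent split, Krull-Schmidt, has at most countably many indecomposable objects up to isomorphism, and has finite dimensional hom-spaces. It is simple transitive if it has no non-trivial $\mathcal{C}$-invariant ideals (ideals other than $0$ and $\mathcal{M}$). A locally finitary $\mathcal{C}$-module category is of type $T_\infty$ if its indecomposables, up to isomorphism,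 can be listed without repetition as $X_0,X_1,X_2,\dots$ so that $L(1)\cdot X_0\cong X_0\oplus X_1$ and $L(1)\cdot X_i\cong X_{i-1}\oplus X_{i+1}$ for $i\geq 1$. *)

theory Defs
  imports
    Complex_Main
    "HOL-Library.Poly_Mapping"
    "HOL-Library.FuncSet"
    "HOL-Library.Countable_Set"
    "HOL-Library.Nat_Bijection"
begin

record 'v cvec =
  carr :: "'v set"
  vadd :: "'v \<Rightarrow> 'v \<Rightarrow> 'v"
  vzero :: 'v
  vsmul :: "complex \<Rightarrow> 'v \<Rightarrow> 'v"

definition cvspace :: "('v, 'm) cvec_scheme \<Rightarrow> bool" where
  "cvspace V \<longleftrightarrow>
     vzero V \<in> carr V \<and>
     (\<forall>u\<in>carr V. \<forall>v\<in>carr V. vadd V u v \<in> carr V) \<and>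
     (\<forall>c. \<forall>v\<in>carr V. vsmul V c v \<in> carr V) \<and>
     (\<forall>u\<in>carr V. \<forall>v\<in>carr V. \<forall>w\<in>carr V. vadd V (vadd V u v) w = vadd V u (vadd V v w)) \<and>
     (\<forall>u\<in>carr V. \<forall>v\<in>carr V. vadd V u v = vadd V v u) \<and>
     (\<forall>v\<in>carr V. vadd V (vzero V) v = v) \<and>
     (\<forall>v\<in>carr V. \<exists>w\<in>carr V. vadd V v w = vzero V) \<and>
     (\<forall>c. \<forall>u\<in>carr V. \<forall>v\<in>carr V. vsmul V c (vadd V u v) = vadd V (vsmul V c u) (vsmul V c v)) \<and>
     (\<forall>c d. \<forall>v\<in>carr V. vsmul V (c + d) v = vadd V (vsmul V c v) (vsmul V d v)) \<and>
     (\<forall>c d. \<forall>v\<in>carr V. vsmul V (c * d) v = vsmul V c (vsmul V d v)) \<and>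
     (\<forall>v\<in>carr V. vsmul V 1 v = v)"

definition csubspace :: "'v set \<Rightarrow> ('v, 'm) cvec_scheme \<Rightarrow> bool" where
  "csubspace W V \<longleftrightarrow>
     W \<subseteq> carr V \<and> vzero V \<in> W \<and>
     (\<forall>u\<in>W. \<forall>v\<in>W. vadd V u v \<in> W) \<and>
     (\<forall>c. \<forall>v\<in>W. vsmul V c v \<in> W)"

definition fin_dim :: "('v, 'm) cvec_scheme \<Rightarrow> bool" where
  "fin_dim V \<longleftrightarrow>
     (\<exists>B. finite B \<and> B \<subseteq> carr V \<and> (\<forall>W. csubspace W V \<and> B \<subseteq> W \<longrightarrow> W = carr V))"

definition clinear_map ::
    "('v, 'm) cvec_scheme \<Rightarrow> ('w, 'n) cvec_scheme \<Rightarrow> ('v \<Rightarrow> 'w) \<Rightarrow> bool" where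
  "clinear_map V W f \<longleftrightarrow>
     f \<in> carr V \<rightarrow> carr W \<and>
     (\<forall>u\<in>carr V. \<forall>v\<in>carr V. f (vadd V u v) = vadd W (f u) (f v)) \<and>
     (\<forall>c. \<forall>v\<in>carr V. f (vsmul V c v) = vsmul W c (f v))"

text \<open>
  A Lie algebra is given by a type \<open>'b\<close> indexing a basis and a table of brackets of basis
  elements.  A list \<open>[(c\<^sub>1, b\<^sub>1), (c\<^sub>2, b\<^sub>2), \<dots>]\<close> stands for the linear combination
  \<open>c\<^sub>1 b\<^sub>1 + c\<^sub>2 b\<^sub>2 + \<dots>\<close>, so the empty list is \<open>0\<close>.  A module is given by the action of
  the basis elements.  The values of the operations outside the carrier are irrelevant.
\<close>

type_synonym 'b lincomb = "(complex \<times> 'b) list"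

record ('b, 'v) lmod = "'v cvec" +
  act :: "'b \<Rightarrow> 'v \<Rightarrow> 'v"

definition lincomb_act :: "('b, 'v, 'm) lmod_scheme \<Rightarrow> 'b lincomb \<Rightarrow> 'v \<Rightarrow> 'v" where
  "lincomb_act V l v = foldr (\<lambda>(c, b) w. vadd V (vsmul V c (act V b v)) w) l (vzero V)"

definition lie_module :: "('b \<Rightarrow> 'b \<Rightarrow> 'b lincomb) \<Rightarrow> ('b, 'v, 'm) lmod_scheme \<Rightarrow> bool" where
  "lie_module br V \<longleftrightarrow>
     cvspace V \<and>
     (\<forall>b. clinear_map V V (act V b)) \<and>
     (\<forall>x y. \<forall>v\<in>carr V.
        act V x (act V y v) = vadd V (act V y (act V x v)) (lincomb_act V (br x y) v))"

definition submodule :: "'v set \<Rightarrow> ('b, 'v, 'm) lmod_scheme \<Rightarrow> bool" where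
  "submodule W V \<longleftrightarrow> csubspace W V \<and> (\<forall>b. \<forall>v\<in>W. act V b v \<in> W)"

definition simple_module :: "('b, 'v, 'm) lmod_scheme \<Rightarrow> bool" where
  "simple_module V \<longleftrightarrow>
     carr V \<noteq> {vzero V} \<and> (\<forall>W. submodule W V \<longrightarrow> W = {vzero V} \<or> W = carr V)"

definition lmod_hom ::
    "('b, 'v, 'm) lmod_scheme \<Rightarrow> ('b, 'w, 'n) lmod_scheme \<Rightarrow> ('v \<Rightarrow> 'w) \<Rightarrow> bool" where
  "lmod_hom V W f \<longleftrightarrow>
     clinear_map V W f \<and> (\<forall>b. \<forall>v\<in>carr V. f (act V b v) = act W b (f v))"

definition lmod_iso :: "('b, 'v, 'm) lmod_scheme \<Rightarrow> ('b, 'w, 'n) lmod_scheme \<Rightarrow> bool" where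
  "lmod_iso V W \<longleftrightarrow> (\<exists>f. lmod_hom V W f \<and> bij_betw f (carr V) (carr W))"

definition pullback :: "('b \<Rightarrow> 'c lincomb) \<Rightarrow> ('c, 'v) lmod \<Rightarrow> ('b, 'v) lmod" where
  "pullback \<phi> V =
     \<lparr>carr = carr V, vadd = vadd V, vzero = vzero V, vsmul = vsmul V,
      act = (\<lambda>b. lincomb_act V (\<phi> b))\<rparr>"

definition dsum :: "nat set \<Rightarrow> (nat \<Rightarrow> ('b, 'v) lmod) \<Rightarrow> ('b, nat \<Rightarrow> 'v) lmod" where
  "dsum K M =
     \<lparr>carr = {f \<in> Pi\<^sub>E K (\<lambda>k. carr (M k)). finite {k \<in> K. f k \<noteq> vzero (M k)}},
      vadd = (\<lambda>f g. \<lambda>k\<in>K. vadd (M k) (f k) (g k)),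
      vzero = (\<lambda>k\<in>K. vzero (M k)),
      vsmul = (\<lambda>c f. \<lambda>k\<in>K. vsmul (M k) c (f k)),
      act = (\<lambda>b f. \<lambda>k\<in>K. act (M k) b (f k))\<rparr>"

definition direct_summand :: "'v set \<Rightarrow> ('b, 'v) lmod \<Rightarrow> bool" where
  "direct_summand D V \<longleftrightarrow>
     submodule D V \<and>
     (\<exists>D'. submodule D' V \<and> D \<inter> D' = {vzero V} \<and>
        (\<forall>v\<in>carr V. \<exists>d\<in>D. \<exists>d'\<in>D'. v = vadd V d d'))"

definition in_add_closure :: "('b, 'v) lmod set \<Rightarrow> ('b, 'w) lmod \<Rightarrow> bool" where
  "in_add_closure S N \<longleftrightarrow>
     (\<exists>n M D. (\<forall>k<n. M k \<in> S) \<and>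
        direct_summand D (dsum {..<n} M) \<and>
        lmod_iso N ((dsum {..<n} M)\<lparr>carr := D\<rparr>))"

text \<open>
  All modules in question have countable dimension.  The categories are built on modules
  whose underlying space is a subspace of the space \<open>vec\<close> of finitely supported sequences
  (with an arbitrary action); every module of countable dimension is isomorphic to one of these.
\<close>

type_synonym vec = "nat \<Rightarrow>\<^sub>0 complex"

definition vscale :: "complex \<Rightarrow> vec \<Rightarrow> vec" where
  "vscale c v = Poly_Mapping.map ((*) c) v"

lemma lookup_vscale [simp]: "Poly_Mapping.lookup (vscale c v) n = c * Poly_Mapping.lookup v n"
  unfolding vscale_def by (transfer, simp add: when_def)

interpretation vec: vector_space vscale
  by standard (auto intro!: poly_mapping_eqI simp: lookup_add algebra_simps)

definition vmod :: "vec set \<Rightarrow> ('b \<Rightarrow> vec \<Rightarrow> vec) \<Rightarrow> ('b, vec) lmod" where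
  "vmod V a = \<lparr>carr = V, vadd = (+), vzero = 0, vsmul = vscale, act = a\<rparr>"

definition is_vmod :: "('b \<Rightarrow> 'b \<Rightarrow> 'b lincomb) \<Rightarrow> ('b, vec) lmod \<Rightarrow> bool" where
  "is_vmod br V \<longleftrightarrow> (\<exists>U a. V = vmod U a) \<and> lie_module br V"

text \<open>
  Identifying \<open>\<nat> \<times> \<nat>\<close> with \<open>\<nat>\<close> identifies \<open>vec \<otimes> vec\<close> with \<open>vec\<close>.  For subspaces
  \<open>V\<close>, \<open>W\<close> of \<open>vec\<close>, the tensor product \<open>V \<otimes> W\<close> is the span of the pure tensors in
  \<open>vec \<otimes> vec\<close>, and a bilinear map \<open>\<beta>\<close> on \<open>V \<times> W\<close> induces the linear map
  \<open>tlift V W \<beta>\<close> on \<open>V \<otimes> W\<close>.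
\<close>

definition tensor_vec :: "vec \<Rightarrow> vec \<Rightarrow> vec" where
  "tensor_vec u v =
     (\<Sum>i\<in>Poly_Mapping.keys u. \<Sum>j\<in>Poly_Mapping.keys v.
        Poly_Mapping.single (prod_encode (i, j)) (Poly_Mapping.lookup u i * Poly_Mapping.lookup v j))"

definition tspace :: "vec set \<Rightarrow> vec set \<Rightarrow> vec set" where
  "tspace V W = vec.span {tensor_vec u v | u v. u \<in> V \<and> v \<in> W}"

definition tlift :: "vec set \<Rightarrow> vec set \<Rightarrow> (vec \<Rightarrow> vec \<Rightarrow> vec) \<Rightarrow> vec \<Rightarrow> vec" where
  "tlift V W \<beta> =
     (THE T. T \<in> extensional (tspace V W) \<and>
        (\<forall>s\<in>tspace V W. \<forall>t\<in>tspace V W. T (s + t) = T s + T t) \<and>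
        (\<forall>c. \<forall>t\<in>tspace V W. T (vscale c t) = vscale c (T t)) \<and>
        (\<forall>u\<in>V. \<forall>v\<in>W. T (tensor_vec u v) = \<beta> u v))"

definition tmap :: "vec set \<Rightarrow> vec set \<Rightarrow> (vec \<Rightarrow> vec) \<Rightarrow> (vec \<Rightarrow> vec) \<Rightarrow> vec \<Rightarrow> vec" where
  "tmap V W f g = tlift V W (\<lambda>u v. tensor_vec (f u) (g v))"

definition tassoc :: "vec set \<Rightarrow> vec set \<Rightarrow> vec set \<Rightarrow> vec \<Rightarrow> vec" where
  "tassoc U V W =
     tlift (tspace U V) W
       (\<lambda>t w. tlift U V (\<lambda>u v. tensor_vec u (tensor_vec v w)) t)"

definition tensor_mod :: "('b, vec) lmod \<Rightarrow> ('b, vec) lmod \<Rightarrow> ('b, vec) lmod" where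
  "tensor_mod A X =
     vmod (tspace (carr A) (carr X))
       (\<lambda>b t. tmap (carr A) (carr X) (act A b) (\<lambda>x. x) t
            + tmap (carr A) (carr X) (\<lambda>a. a) (act X b) t)"

definition unit_space :: "vec set" where
  "unit_space = vec.span {Poly_Mapping.single 0 1}"

definition triv_mod :: "('b, vec) lmod" where
  "triv_mod = vmod unit_space (\<lambda>_ _. 0)"

definition tlunit :: "vec set \<Rightarrow> vec \<Rightarrow> vec" where
  "tlunit V = tlift unit_space V (\<lambda>s v. vscale (Poly_Mapping.lookup s 0) v)"

definition trunit :: "vec set \<Rightarrow> vec \<Rightarrow> vec" where
  "trunit V = tlift V unit_space (\<lambda>v s. vscale (Poly_Mapping.lookup s 0) v)"

record ('o, 'a) lincat =
  Obj :: "'o set"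
  Arr :: "'a set"
  Dom :: "'a \<Rightarrow> 'o"
  Cod :: "'a \<Rightarrow> 'o"
  Ide :: "'o \<Rightarrow> 'a"
  Comp :: "'a \<Rightarrow> 'a \<Rightarrow> 'a"
  Hadd :: "'a \<Rightarrow> 'a \<Rightarrow> 'a"
  Hzero :: "'o \<Rightarrow> 'o \<Rightarrow> 'a"
  Hsmul :: "complex \<Rightarrow> 'a \<Rightarrow> 'a"

definition Hom :: "('o, 'a, 'm) lincat_scheme \<Rightarrow> 'o \<Rightarrow> 'o \<Rightarrow> 'a set" where
  "Hom C X Y = {f \<in> Arr C. Dom C f = X \<and> Cod C f = Y}"

definition homspace :: "('o, 'a, 'm) lincat_scheme \<Rightarrow> 'o \<Rightarrow> 'o \<Rightarrow> 'a cvec" where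
  "homspace C X Y =
     \<lparr>carr = Hom C X Y, vadd = Hadd C, vzero = Hzero C X Y, vsmul = Hsmul C\<rparr>"

locale linear_category =
  fixes C :: "('o, 'a, 'm) lincat_scheme"
  assumes Dom_in: "f \<in> Arr C \<Longrightarrow> Dom C f \<in> Obj C"
    and Cod_in: "f \<in> Arr C \<Longrightarrow> Cod C f \<in> Obj C"
    and Ide_in: "X \<in> Obj C \<Longrightarrow> Ide C X \<in> Hom C X X"
    and Comp_in: "f \<in> Hom C X Y \<Longrightarrow> g \<in> Hom C Y Z \<Longrightarrow> Comp C g f \<in> Hom C X Z"
    and Comp_assoc: "f \<in> Hom C W X \<Longrightarrow> g \<in> Hom C X Y \<Longrightarrow> h \<in> Hom C Y Z \<Longrightarrow>
          Comp C (Comp C h g) f = Comp C h (Comp C g f)"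
    and Comp_Ide: "f \<in> Hom C X Y \<Longrightarrow> Comp C f (Ide C X) = f"
    and Ide_Comp: "f \<in> Hom C X Y \<Longrightarrow> Comp C (Ide C Y) f = f"
    and Hom_cvspace: "X \<in> Obj C \<Longrightarrow> Y \<in> Obj C \<Longrightarrow> cvspace (homspace C X Y)"
    and Comp_add_right: "f \<in> Hom C X Y \<Longrightarrow> f' \<in> Hom C X Y \<Longrightarrow> g \<in> Hom C Y Z \<Longrightarrow>
          Comp C g (Hadd C f f') = Hadd C (Comp C g f) (Comp C g f')"
    and Comp_add_left: "f \<in> Hom C X Y \<Longrightarrow> g \<in> Hom C Y Z \<Longrightarrow> g' \<in> Hom C Y Z \<Longrightarrow>
          Comp C (Hadd C g g') f = Hadd C (Comp C g f) (Comp C g' f)"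
    and Comp_smul_right: "f \<in> Hom C X Y \<Longrightarrow> g \<in> Hom C Y Z \<Longrightarrow>
          Comp C g (Hsmul C c f) = Hsmul C c (Comp C g f)"
    and Comp_smul_left: "f \<in> Hom C X Y \<Longrightarrow> g \<in> Hom C Y Z \<Longrightarrow>
          Comp C (Hsmul C c g) f = Hsmul C c (Comp C g f)"

definition iso_arr :: "('o, 'a, 'm) lincat_scheme \<Rightarrow> 'a \<Rightarrow> bool" where
  "iso_arr C f \<longleftrightarrow> f \<in> Arr C \<and>
     (\<exists>g \<in> Hom C (Cod C f) (Dom C f).
        Comp C g f = Ide C (Dom C f) \<and> Comp C f g = Ide C (Cod C f))"

definition isomorphic :: "('o, 'a, 'm) lincat_scheme \<Rightarrow> 'o \<Rightarrow> 'o \<Rightarrow> bool" where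
  "isomorphic C X Y \<longleftrightarrow> (\<exists>f \<in> Hom C X Y. iso_arr C f)"

definition zero_obj :: "('o, 'a, 'm) lincat_scheme \<Rightarrow> 'o \<Rightarrow> bool" where
  "zero_obj C Z \<longleftrightarrow> Z \<in> Obj C \<and>
     (\<forall>X\<in>Obj C. (\<exists>!f. f \<in> Hom C X Z) \<and> (\<exists>!f. f \<in> Hom C Z X))"

text \<open>\<open>biproduct C X Y S\<close> says that \<open>S \<cong> X \<oplus> Y\<close>.\<close>

definition biproduct :: "('o, 'a, 'm) lincat_scheme \<Rightarrow> 'o \<Rightarrow> 'o \<Rightarrow> 'o \<Rightarrow> bool" where
  "biproduct C X Y S \<longleftrightarrow> X \<in> Obj C \<and> Y \<in> Obj C \<and> S \<in> Obj C \<and>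
     (\<exists>i\<in>Hom C X S. \<exists>j\<in>Hom C Y S. \<exists>p\<in>Hom C S X. \<exists>q\<in>Hom C S Y.
        Comp C p i = Ide C X \<and> Comp C q j = Ide C Y \<and>
        Comp C p j = Hzero C Y X \<and> Comp C q i = Hzero C X Y \<and>
        Hadd C (Comp C i p) (Comp C j q) = Ide C S)"

inductive direct_sum :: "('o, 'a, 'm) lincat_scheme \<Rightarrow> 'o list \<Rightarrow> 'o \<Rightarrow> bool"
  for C :: "('o, 'a, 'm) lincat_scheme" where
  "zero_obj C Z \<Longrightarrow> direct_sum C [] Z"
| "direct_sum C Xs S \<Longrightarrow> biproduct C X S T \<Longrightarrow> direct_sum C (X # Xs) T"

definition additive_cat :: "('o, 'a, 'm) lincat_scheme \<Rightarrow> bool" where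
  "additive_cat C \<longleftrightarrow> (\<exists>Z. zero_obj C Z) \<and>
     (\<forall>X\<in>Obj C. \<forall>Y\<in>Obj C. \<exists>S. biproduct C X Y S)"

definition idempotent_split :: "('o, 'a, 'm) lincat_scheme \<Rightarrow> bool" where
  "idempotent_split C \<longleftrightarrow>
     (\<forall>X\<in>Obj C. \<forall>e\<in>Hom C X X. Comp C e e = e \<longrightarrow>
        (\<exists>Y\<in>Obj C. \<exists>r\<in>Hom C X Y. \<exists>s\<in>Hom C Y X. Comp C r s = Ide C Y \<and> Comp C s r = e))"

definition indecomposable :: "('o, 'a, 'm) lincat_scheme \<Rightarrow> 'o \<Rightarrow> bool" where
  "indecomposable C X \<longleftrightarrow> X \<in> Obj C \<and> \<not> zero_obj C X \<and>
     (\<forall>Y Z. biproduct C Y Z X \<longrightarrow> zero_obj C Y \<or> zero_obj C Z)"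

definition local_end :: "('o, 'a, 'm) lincat_scheme \<Rightarrow> 'o \<Rightarrow> bool" where
  "local_end C X \<longleftrightarrow> Ide C X \<noteq> Hzero C X X \<and>
     (\<forall>f\<in>Hom C X X. \<forall>g\<in>Hom C X X. \<not> iso_arr C f \<longrightarrow> \<not> iso_arr C g \<longrightarrow> \<not> iso_arr C (Hadd C f g))"

definition krull_schmidt :: "('o, 'a, 'm) lincat_scheme \<Rightarrow> bool" where
  "krull_schmidt C \<longleftrightarrow>
     (\<forall>X\<in>Obj C. \<exists>Xs. (\<forall>Y\<in>set Xs. Y \<in> Obj C \<and> local_end C Y) \<and> direct_sum C Xs X)"

definition countably_many_indecomposables :: "('o, 'a, 'm) lincat_scheme \<Rightarrow> bool" where
  "countably_many_indecomposables C \<longleftrightarrow>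
     (\<exists>S. countable S \<and> (\<forall>X. indecomposable C X \<longrightarrow> (\<exists>Y\<in>S. isomorphic C X Y)))"

definition locally_finitary :: "('o, 'a, 'm) lincat_scheme \<Rightarrow> bool" where
  "locally_finitary C \<longleftrightarrow>
     linear_category C \<and> additive_cat C \<and> idempotent_split C \<and> krull_schmidt C \<and>
     countably_many_indecomposables C \<and>
     (\<forall>X\<in>Obj C. \<forall>Y\<in>Obj C. fin_dim (homspace C X Y))"

record ('o, 'a) moncat = "('o, 'a) lincat" +
  tob :: "'o \<Rightarrow> 'o \<Rightarrow> 'o"
  tarr :: "'a \<Rightarrow> 'a \<Rightarrow> 'a"
  tunit :: 'o
  assoc :: "'o \<Rightarrow> 'o \<Rightarrow> 'o \<Rightarrow> 'a"
  lunit :: "'o \<Rightarrow> 'a"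
  runit :: "'o \<Rightarrow> 'a"

locale monoidal_linear_category = linear_category C
  for C :: "('o, 'a, 'm) moncat_scheme" +
  assumes tob_in: "A \<in> Obj C \<Longrightarrow> B \<in> Obj C \<Longrightarrow> tob C A B \<in> Obj C"
    and tarr_in: "f \<in> Hom C A A' \<Longrightarrow> g \<in> Hom C B B' \<Longrightarrow>
          tarr C f g \<in> Hom C (tob C A B) (tob C A' B')"
    and tarr_Ide: "A \<in> Obj C \<Longrightarrow> B \<in> Obj C \<Longrightarrow>
          tarr C (Ide C A) (Ide C B) = Ide C (tob C A B)"
    and tarr_Comp: "f \<in> Hom C A A' \<Longrightarrow> f' \<in> Hom C A' A'' \<Longrightarrow>
          g \<in> Hom C B B' \<Longrightarrow> g' \<in> Hom C B' B'' \<Longrightarrow>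
          tarr C (Comp C f' f) (Comp C g' g) = Comp C (tarr C f' g') (tarr C f g)"
    and tarr_add_left: "f \<in> Hom C A A' \<Longrightarrow> f' \<in> Hom C A A' \<Longrightarrow> g \<in> Hom C B B' \<Longrightarrow>
          tarr C (Hadd C f f') g = Hadd C (tarr C f g) (tarr C f' g)"
    and tarr_add_right: "f \<in> Hom C A A' \<Longrightarrow> g \<in> Hom C B B' \<Longrightarrow> g' \<in> Hom C B B' \<Longrightarrow>
          tarr C f (Hadd C g g') = Hadd C (tarr C f g) (tarr C f g')"
    and tarr_smul_left: "f \<in> Hom C A A' \<Longrightarrow> g \<in> Hom C B B' \<Longrightarrow>
          tarr C (Hsmul C c f) g = Hsmul C c (tarr C f g)"
    and tarr_smul_right: "f \<in> Hom C A A' \<Longrightarrow> g \<in> Hom C B B' \<Longrightarrow>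
          tarr C f (Hsmul C c g) = Hsmul C c (tarr C f g)"
    and tunit_in: "tunit C \<in> Obj C"
    and assoc_in: "A \<in> Obj C \<Longrightarrow> B \<in> Obj C \<Longrightarrow> D \<in> Obj C \<Longrightarrow>
          assoc C A B D \<in> Hom C (tob C (tob C A B) D) (tob C A (tob C B D))"
    and assoc_iso: "A \<in> Obj C \<Longrightarrow> B \<in> Obj C \<Longrightarrow> D \<in> Obj C \<Longrightarrow> iso_arr C (assoc C A B D)"
    and assoc_natural: "f \<in> Hom C A A' \<Longrightarrow> g \<in> Hom C B B' \<Longrightarrow> h \<in> Hom C D D' \<Longrightarrow>
          Comp C (assoc C A' B' D') (tarr C (tarr C f g) h) =
          Comp C (tarr C f (tarr C g h)) (assoc C A B D)"
    and lunit_in: "A \<in> Obj C \<Longrightarrow> lunit C A \<in> Hom C (tob C (tunit C) A) A"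
    and lunit_iso: "A \<in> Obj C \<Longrightarrow> iso_arr C (lunit C A)"
    and lunit_natural: "f \<in> Hom C A A' \<Longrightarrow>
          Comp C (lunit C A') (tarr C (Ide C (tunit C)) f) = Comp C f (lunit C A)"
    and runit_in: "A \<in> Obj C \<Longrightarrow> runit C A \<in> Hom C (tob C A (tunit C)) A"
    and runit_iso: "A \<in> Obj C \<Longrightarrow> iso_arr C (runit C A)"
    and runit_natural: "f \<in> Hom C A A' \<Longrightarrow>
          Comp C (runit C A') (tarr C f (Ide C (tunit C))) = Comp C f (runit C A)"
    and pentagon: "A \<in> Obj C \<Longrightarrow> B \<in> Obj C \<Longrightarrow> D \<in> Obj C \<Longrightarrow> E \<in> Obj C \<Longrightarrow>
          Comp C (assoc C A B (tob C D E)) (assoc C (tob C A B) D E) =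
          Comp C (tarr C (Ide C A) (assoc C B D E))
            (Comp C (assoc C A (tob C B D) E) (tarr C (assoc C A B D) (Ide C E)))"
    and triangle: "A \<in> Obj C \<Longrightarrow> B \<in> Obj C \<Longrightarrow>
          Comp C (tarr C (Ide C A) (lunit C B)) (assoc C A (tunit C) B) =
          tarr C (runit C A) (Ide C B)"

text \<open>
  In \<open>('o, 'a, 'c, 'k) modcat\<close>, the types \<open>'c\<close> and \<open>'k\<close> are those of the objects and arrows
  of the acting monoidal category; \<open>massoc A B X : (A \<otimes> B) \<cdot> X \<rightarrow> A \<cdot> (B \<cdot> X)\<close> and
  \<open>munit X : 1 \<cdot> X \<rightarrow> X\<close>.
\<close>

record ('o, 'a, 'c, 'k) modcat = "('o, 'a) lincat" +
  aob :: "'c \<Rightarrow> 'o \<Rightarrow> 'o"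
  aarr :: "'k \<Rightarrow> 'a \<Rightarrow> 'a"
  massoc :: "'c \<Rightarrow> 'c \<Rightarrow> 'o \<Rightarrow> 'a"
  munit :: "'o \<Rightarrow> 'a"

locale module_category = C: monoidal_linear_category C + M: linear_category M
  for C :: "('c, 'k, 'm) moncat_scheme" and M :: "('o, 'a, 'c, 'k, 'n) modcat_scheme" +
  assumes aob_in: "A \<in> Obj C \<Longrightarrow> X \<in> Obj M \<Longrightarrow> aob M A X \<in> Obj M"
    and aarr_in: "f \<in> Hom C A A' \<Longrightarrow> g \<in> Hom M X X' \<Longrightarrow>
          aarr M f g \<in> Hom M (aob M A X) (aob M A' X')"
    and aarr_Ide: "A \<in> Obj C \<Longrightarrow> X \<in> Obj M \<Longrightarrow>
          aarr M (Ide C A) (Ide M X) = Ide M (aob M A X)"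
    and aarr_Comp: "f \<in> Hom C A A' \<Longrightarrow> f' \<in> Hom C A' A'' \<Longrightarrow>
          g \<in> Hom M X X' \<Longrightarrow> g' \<in> Hom M X' X'' \<Longrightarrow>
          aarr M (Comp C f' f) (Comp M g' g) = Comp M (aarr M f' g') (aarr M f g)"
    and aarr_add_left: "f \<in> Hom C A A' \<Longrightarrow> f' \<in> Hom C A A' \<Longrightarrow> g \<in> Hom M X X' \<Longrightarrow>
          aarr M (Hadd C f f') g = Hadd M (aarr M f g) (aarr M f' g)"
    and aarr_add_right: "f \<in> Hom C A A' \<Longrightarrow> g \<in> Hom M X X' \<Longrightarrow> g' \<in> Hom M X X' \<Longrightarrow>
          aarr M f (Hadd M g g') = Hadd M (aarr M f g) (aarr M f g')"
    and aarr_smul_left: "f \<in> Hom C A A' \<Longrightarrow> g \<in> Hom M X X' \<Longrightarrow>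
          aarr M (Hsmul C c f) g = Hsmul M c (aarr M f g)"
    and aarr_smul_right: "f \<in> Hom C A A' \<Longrightarrow> g \<in> Hom M X X' \<Longrightarrow>
          aarr M f (Hsmul M c g) = Hsmul M c (aarr M f g)"
    and massoc_in: "A \<in> Obj C \<Longrightarrow> B \<in> Obj C \<Longrightarrow> X \<in> Obj M \<Longrightarrow>
          massoc M A B X \<in> Hom M (aob M (tob C A B) X) (aob M A (aob M B X))"
    and massoc_iso: "A \<in> Obj C \<Longrightarrow> B \<in> Obj C \<Longrightarrow> X \<in> Obj M \<Longrightarrow> iso_arr M (massoc M A B X)"
    and massoc_natural: "f \<in> Hom C A A' \<Longrightarrow> k \<in> Hom C B B' \<Longrightarrow> g \<in> Hom M X X' \<Longrightarrow>
          Comp M (massoc M A' B' X') (aarr M (tarr C f k) g) =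
          Comp M (aarr M f (aarr M k g)) (massoc M A B X)"
    and munit_in: "X \<in> Obj M \<Longrightarrow> munit M X \<in> Hom M (aob M (tunit C) X) X"
    and munit_iso: "X \<in> Obj M \<Longrightarrow> iso_arr M (munit M X)"
    and munit_natural: "g \<in> Hom M X X' \<Longrightarrow>
          Comp M (munit M X') (aarr M (Ide C (tunit C)) g) = Comp M g (munit M X)"
    and module_pentagon: "A \<in> Obj C \<Longrightarrow> B \<in> Obj C \<Longrightarrow> D \<in> Obj C \<Longrightarrow> X \<in> Obj M \<Longrightarrow>
          Comp M (massoc M A B (aob M D X)) (massoc M (tob C A B) D X) =
          Comp M (aarr M (Ide C A) (massoc M B D X))
            (Comp M (massoc M A (tob C B D) X) (aarr M (assoc C A B D) (Ide M X)))"
    and module_triangle: "A \<in> Obj C \<Longrightarrow> X \<in> Obj M \<Longrightarrow>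
          Comp M (aarr M (Ide C A) (munit M X)) (massoc M A (tunit C) X) =
          aarr M (runit C A) (Ide M X)"

definition invariant_ideal ::
    "('c, 'k, 'm) moncat_scheme \<Rightarrow> ('o, 'a, 'c, 'k, 'n) modcat_scheme \<Rightarrow> 'a set \<Rightarrow> bool" where
  "invariant_ideal C M I \<longleftrightarrow>
     I \<subseteq> Arr M \<and>
     (\<forall>X\<in>Obj M. \<forall>Y\<in>Obj M. csubspace (I \<inter> Hom M X Y) (homspace M X Y)) \<and>
     (\<forall>f\<in>I. \<forall>g\<in>Arr M. Dom M g = Cod M f \<longrightarrow> Comp M g f \<in> I) \<and>
     (\<forall>f\<in>I. \<forall>g\<in>Arr M. Cod M g = Dom M f \<longrightarrow> Comp M f g \<in> I) \<and>
     (\<forall>A\<in>Obj C. \<forall>f\<in>I. aarr M (Ide C A) f \<in> I)"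

definition simple_transitive ::
    "('c, 'k, 'm) moncat_scheme \<Rightarrow> ('o, 'a, 'c, 'k, 'n) modcat_scheme \<Rightarrow> bool" where
  "simple_transitive C M \<longleftrightarrow>
     module_category C M \<and>
     (\<forall>I. invariant_ideal C M I \<longrightarrow>
        I = {Hzero M X Y | X Y. X \<in> Obj M \<and> Y \<in> Obj M} \<or> I = Arr M)"

text \<open>
  An arrow is a triple of domain, codomain and a homomorphism, the latter being
  undefined outside the carrier of the domain.
\<close>

type_synonym 'b vobj = "('b, vec) lmod"
type_synonym 'b varr = "'b vobj \<times> 'b vobj \<times> (vec \<Rightarrow> vec)"

definition mod_lincat :: "'b vobj set \<Rightarrow> ('b vobj, 'b varr) lincat" where
  "mod_lincat \<O> =
     \<lparr>Obj = \<O>,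
      Arr = {(X, Y, f). X \<in> \<O> \<and> Y \<in> \<O> \<and> lmod_hom X Y f \<and> f \<in> extensional (carr X)},
      Dom = (\<lambda>(X, Y, f). X),
      Cod = (\<lambda>(X, Y, f). Y),
      Ide = (\<lambda>X. (X, X, \<lambda>v\<in>carr X. v)),
      Comp = (\<lambda>(Y', Z, g) (X, Y, f). (X, Z, compose (carr X) g f)),
      Hadd = (\<lambda>(X, Y, f) (X', Y', g). (X, Y, \<lambda>v\<in>carr X. f v + g v)),
      Hzero = (\<lambda>X Y. (X, Y, \<lambda>v\<in>carr X. 0)),
      Hsmul = (\<lambda>c (X, Y, f). (X, Y, \<lambda>v\<in>carr X. vscale c (f v)))\<rparr>"

definition mod_moncat :: "'b vobj set \<Rightarrow> ('b vobj, 'b varr) moncat" where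
  "mod_moncat \<O> = lincat.extend (mod_lincat \<O>) (moncat.fields
     tensor_mod
     (\<lambda>(A, A', f) (B, B', g). (tensor_mod A B, tensor_mod A' B', tmap (carr A) (carr B) f g))
     triv_mod
     (\<lambda>A B D. (tensor_mod (tensor_mod A B) D, tensor_mod A (tensor_mod B D),
                tassoc (carr A) (carr B) (carr D)))
     (\<lambda>A. (tensor_mod triv_mod A, A, tlunit (carr A)))
     (\<lambda>A. (tensor_mod A triv_mod, A, trunit (carr A))))"

text \<open>
  Here \<open>r\<close> turns modules over the acting Lie algebra into modules over the given one,
  without changing the underlying spaces.
\<close>

definition mod_modcat ::
    "('c vobj \<Rightarrow> 'b vobj) \<Rightarrow> 'b vobj set \<Rightarrow> ('b vobj, 'b varr, 'c vobj, 'c varr) modcat" where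
  "mod_modcat r \<O> = lincat.extend (mod_lincat \<O>) (modcat.fields
     (\<lambda>A X. tensor_mod (r A) X)
     (\<lambda>(A, A', f) (X, X', g).
        (tensor_mod (r A) X, tensor_mod (r A') X', tmap (carr A) (carr X) f g))
     (\<lambda>A B X. (tensor_mod (r (tensor_mod A B)) X, tensor_mod (r A) (tensor_mod (r B) X),
                tassoc (carr A) (carr B) (carr X)))
     (\<lambda>X. (tensor_mod (r triv_mod) X, X, tlunit (carr X))))"

datatype sl2 = E | F | H

fun sl2_br :: "sl2 \<Rightarrow> sl2 \<Rightarrow> sl2 lincomb" where
  "sl2_br H E = [(2, E)]"
| "sl2_br E H = [(-2, E)]"
| "sl2_br H F = [(-2, F)]"
| "sl2_br F H = [(2, F)]"
| "sl2_br E F = [(1, H)]"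
| "sl2_br F E = [(-1, H)]"
| "sl2_br _ _ = []"

definition sl2_fin :: "(sl2 vobj, sl2 varr) moncat" where
  "sl2_fin = mod_moncat {V. is_vmod sl2_br V \<and> fin_dim V}"

text \<open>The choices in \<open>L_mod\<close> and \<open>V_mod\<close> below are unique up to isomorphism.\<close>

definition L_mod :: "nat \<Rightarrow> sl2 vobj" where
  "L_mod m = (SOME V. is_vmod sl2_br V \<and> simple_module V \<and> vec.dim (carr V) = m + 1)"

definition type_T_infinity :: "('o, 'a, sl2 vobj, sl2 varr, 'n) modcat_scheme \<Rightarrow> bool" where
  "type_T_infinity M \<longleftrightarrow>
     module_category sl2_fin M \<and> locally_finitary M \<and>
     (\<exists>X :: nat \<Rightarrow> 'o.
        (\<forall>i. indecomposable M (X i)) \<and>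
        (\<forall>i j. isomorphic M (X i) (X j) \<longrightarrow> i = j) \<and>
        (\<forall>Y. indecomposable M Y \<longrightarrow> (\<exists>i. isomorphic M Y (X i))) \<and>
        biproduct M (X 0) (X 1) (aob M (L_mod 1) (X 0)) \<and>
        (\<forall>i\<ge>1. biproduct M (X (i - 1)) (X (i + 1)) (aob M (L_mod 1) (X i))))"

inductive_set left_ideal :: "'a::ring_1 set \<Rightarrow> 'a set" for S :: "'a set" where
  "0 \<in> left_ideal S"
| "s \<in> S \<Longrightarrow> a * s \<in> left_ideal S"
| "x \<in> left_ideal S \<Longrightarrow> y \<in> left_ideal S \<Longrightarrow> x + y \<in> left_ideal S"

inductive_set two_sided_ideal :: "'a::ring_1 set \<Rightarrow> 'a set" for S :: "'a set" where
  zero: "0 \<in> two_sided_ideal S"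
| gen: "s \<in> S \<Longrightarrow> a * s * b \<in> two_sided_ideal S"
| add: "x \<in> two_sided_ideal S \<Longrightarrow> y \<in> two_sided_ideal S \<Longrightarrow> x + y \<in> two_sided_ideal S"

lemma two_sided_ideal_mult_left:
  "x \<in> two_sided_ideal S \<Longrightarrow> c * x \<in> two_sided_ideal S"
proof (induction rule: two_sided_ideal.induct)
  case (gen s a b)
  then show ?case using two_sided_ideal.gen[of s S "c * a" b] by (simp add: mult.assoc)
qed (auto simp: distrib_left intro: two_sided_ideal.intros)

lemma two_sided_ideal_mult_right:
  "x \<in> two_sided_ideal S \<Longrightarrow> x * c \<in> two_sided_ideal S"
proof (induction rule: two_sided_ideal.induct)
  case (gen s a b)
  then show ?case using two_sided_ideal.gen[of s S a "b * c"] by (simp add: mult.assoc)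
qed (auto simp: distrib_right intro: two_sided_ideal.intros)

lemma two_sided_ideal_uminus:
  "x \<in> two_sided_ideal S \<Longrightarrow> - x \<in> two_sided_ideal S"
  using two_sided_ideal_mult_left[of x S "- 1"] by simp

text \<open>
  With concatenation as monoid structure on words, \<open>'b list \<Rightarrow>\<^sub>0 complex\<close> (with the
  convolution product) is the free associative algebra on \<open>'b\<close>.
\<close>

instantiation list :: (type) monoid_add
begin

definition zero_list :: "'a list" where "zero_list = []"

definition plus_list :: "'a list \<Rightarrow> 'a list \<Rightarrow> 'a list" where "plus_list = (@)"

instance
  by standard (simp_all add: zero_list_def plus_list_def)

end

type_synonym 'b free_alg = "'b list \<Rightarrow>\<^sub>0 complex"

definition fgen :: "'b \<Rightarrow> 'b free_alg" where
  "fgen b = Poly_Mapping.single [b] 1"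

definition fconst :: "complex \<Rightarrow> 'b free_alg" where
  "fconst c = Poly_Mapping.single [] c"

definition lie_relations :: "('b \<Rightarrow> 'b \<Rightarrow> 'b lincomb) \<Rightarrow> 'b free_alg set" where
  "lie_relations br =
     {fgen x * fgen y - fgen y * fgen x - (\<Sum>(c, b)\<leftarrow>br x y. fconst c * fgen b) | x y. True}"

lemma lookup_mult_Nil:
  fixes u v :: "'b free_alg"
  shows "Poly_Mapping.lookup (u * v) [] = Poly_Mapping.lookup u [] * Poly_Mapping.lookup v []"
proof -
  let ?a = "Poly_Mapping.lookup u" and ?b = "Poly_Mapping.lookup v"
  have "(\<lambda>q. ?b q when [] = l @ q) = (\<lambda>q. (?b [] when l = []) when q = [])" for l
    by (auto simp: when_def)
  then have "(\<lambda>l. ?a l * (\<Sum>q. ?b q when [] = l @ q)) = (\<lambda>l. ?a [] * ?b [] when l = [])"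
    by (auto simp: when_def)
  then show ?thesis by (simp only: lookup_mult plus_list_def Sum_any_when_equal)
qed

lemma lookup_lie_relations_Nil:
  assumes "r \<in> two_sided_ideal (lie_relations br)"
  shows "Poly_Mapping.lookup r [] = 0"
  using assms
proof induction
  case (gen s a b)
  have "Poly_Mapping.lookup (\<Sum>(c, b)\<leftarrow>l. fconst c * fgen b) [] = 0" for l :: "'a lincomb"
    by (induction l) (auto simp: lookup_add lookup_mult_Nil fgen_def lookup_single)
  with gen show ?case
    by (auto simp: lie_relations_def lookup_minus lookup_mult_Nil fgen_def lookup_single)
qed (auto simp: lookup_add)

definition usl2_rel :: "sl2 free_alg \<Rightarrow> sl2 free_alg \<Rightarrow> bool" where
  "usl2_rel u v \<longleftrightarrow> u - v \<in> two_sided_ideal (lie_relations sl2_br)"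

lemma equivp_usl2_rel: "equivp usl2_rel"
proof (rule equivpI)
  show "reflp usl2_rel"
    by (auto simp: reflp_def usl2_rel_def intro: two_sided_ideal.zero)
  show "symp usl2_rel"
    unfolding symp_def usl2_rel_def by (metis minus_diff_eq two_sided_ideal_uminus)
  show "transp usl2_rel"
  proof (rule transpI)
    fix x y z assume "usl2_rel x y" "usl2_rel y z"
    then have "(x - y) + (y - z) \<in> two_sided_ideal (lie_relations sl2_br)"
      unfolding usl2_rel_def by (rule two_sided_ideal.add)
    then show "usl2_rel x z" by (simp add: usl2_rel_def)
  qed
qed

quotient_type usl2 = "sl2 free_alg" / usl2_rel
  by (rule equivp_usl2_rel)

instantiation usl2 :: ring_1
begin

lift_definition zero_usl2 :: usl2 is 0 .

lift_definition one_usl2 :: usl2 is 1 .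

lift_definition plus_usl2 :: "usl2 \<Rightarrow> usl2 \<Rightarrow> usl2" is "(+)"
proof -
  fix a b c d assume "usl2_rel a b" "usl2_rel c d"
  then have "(a - b) + (c - d) \<in> two_sided_ideal (lie_relations sl2_br)"
    unfolding usl2_rel_def by (rule two_sided_ideal.add)
  then show "usl2_rel (a + c) (b + d)" by (simp add: usl2_rel_def algebra_simps)
qed

lift_definition uminus_usl2 :: "usl2 \<Rightarrow> usl2" is uminus
  unfolding usl2_rel_def using two_sided_ideal_uminus by fastforce

lift_definition minus_usl2 :: "usl2 \<Rightarrow> usl2 \<Rightarrow> usl2" is "(-)"
proof -
  fix a b c d assume "usl2_rel a b" "usl2_rel c d"
  then have "(a - b) + - (c - d) \<in> two_sided_ideal (lie_relations sl2_br)"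
    unfolding usl2_rel_def by (intro two_sided_ideal.add two_sided_ideal_uminus)
  then show "usl2_rel (a - c) (b - d)" by (simp add: usl2_rel_def algebra_simps)
qed

lift_definition times_usl2 :: "usl2 \<Rightarrow> usl2 \<Rightarrow> usl2" is "(*)"
proof -
  fix a b c d assume "usl2_rel a b" "usl2_rel c d"
  then have "(a - b) * c + b * (c - d) \<in> two_sided_ideal (lie_relations sl2_br)"
    unfolding usl2_rel_def
    by (intro two_sided_ideal.add two_sided_ideal_mult_left two_sided_ideal_mult_right)
  then show "usl2_rel (a * c) (b * d)" by (simp add: usl2_rel_def algebra_simps)
qed

instance
proof
  show "(0::usl2) \<noteq> 1"
  proof (transfer, unfold usl2_rel_def, rule notI)
    assume "(0::sl2 free_alg) - 1 \<in> two_sided_ideal (lie_relations sl2_br)"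
    then have "Poly_Mapping.lookup ((0::sl2 free_alg) - 1) [] = 0" by (rule lookup_lie_relations_Nil)
    then show False by (simp add: lookup_one zero_list_def)
  qed
qed (transfer; simp add: usl2_rel_def algebra_simps two_sided_ideal.zero)+

end

lift_definition ugen :: "sl2 \<Rightarrow> usl2" is fgen .

lift_definition uconst :: "complex \<Rightarrow> usl2" is fconst .

definition casimir :: usl2 where
  "casimir = (ugen H + 1)^2 + 4 * ugen F * ugen E"

definition usl2_quot :: "usl2 set \<Rightarrow> (sl2, usl2 set) lmod" where
  "usl2_quot J =
     \<lparr>carr = {{u + j | j. j \<in> J} | u. True},
      vadd = (\<lambda>A B. {a + b | a b. a \<in> A \<and> b \<in> B}),
      vzero = J,
      vsmul = (\<lambda>c A. {uconst c * a + j | a j. a \<in> A \<and> j \<in> J}),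
      act = (\<lambda>x A. {ugen x * a + j | a j. a \<in> A \<and> j \<in> J})\<rparr>"

definition M_mod :: "complex \<Rightarrow> complex \<Rightarrow> (sl2, usl2 set) lmod" where
  "M_mod \<nu> \<xi> = usl2_quot (left_ideal {casimir - uconst ((\<nu> + 1)^2), ugen E - uconst \<xi>})"

definition X1 :: "complex \<Rightarrow> complex \<Rightarrow> (sl2 vobj, sl2 varr, sl2 vobj, sl2 varr) modcat" where
  "X1 \<mu> \<xi> = mod_modcat (\<lambda>A. A)
     {N. is_vmod sl2_br N \<and> in_add_closure {M_mod (\<mu> + of_int i) \<xi> | i. True} N}"

datatype schr = SE | SF | SH | SP | SQ | SZ

fun schr_br :: "schr \<Rightarrow> schr \<Rightarrow> schr lincomb" where
  "schr_br SH SE = [(2, SE)]"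
| "schr_br SE SH = [(-2, SE)]"
| "schr_br SH SF = [(-2, SF)]"
| "schr_br SF SH = [(2, SF)]"
| "schr_br SE SF = [(1, SH)]"
| "schr_br SF SE = [(-1, SH)]"
| "schr_br SE SQ = [(1, SP)]"
| "schr_br SQ SE = [(-1, SP)]"
| "schr_br SH SP = [(1, SP)]"
| "schr_br SP SH = [(-1, SP)]"
| "schr_br SF SP = [(1, SQ)]"
| "schr_br SP SF = [(-1, SQ)]"
| "schr_br SH SQ = [(-1, SQ)]"
| "schr_br SQ SH = [(1, SQ)]"
| "schr_br SP SQ = [(1, SZ)]"
| "schr_br SQ SP = [(-1, SZ)]"
| "schr_br _ _ = []"

fun schr_incl :: "sl2 \<Rightarrow> schr lincomb" where
  "schr_incl E = [(1, SE)]"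
| "schr_incl F = [(1, SF)]"
| "schr_incl H = [(1, SH)]"

fun schr_proj :: "schr \<Rightarrow> sl2 lincomb" where
  "schr_proj SE = [(1, E)]"
| "schr_proj SF = [(1, F)]"
| "schr_proj SH = [(1, H)]"
| "schr_proj _ = []"

definition V_mod :: "int \<Rightarrow> complex \<Rightarrow> schr vobj" where
  "V_mod n \<theta> = (SOME V. is_vmod schr_br V \<and> simple_module V \<and>
     (\<forall>v\<in>carr V. act V SZ v = vscale \<theta> v) \<and>
     lmod_iso (pullback schr_incl V) (dsum {nat \<bar>n\<bar>..} L_mod))"

definition X2 :: "complex \<Rightarrow> (schr vobj, schr varr, sl2 vobj, sl2 varr) modcat" where
  "X2 \<theta> = mod_modcat (pullback schr_proj)
     {N. is_vmod schr_br N \<and> in_add_closure {V_mod n \<theta> | n. True} N}"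

end

theory Submission
  imports Defs "HOL-Computational_Algebra.Fundamental_Theorem_Algebra"
begin

text \<open>
  Both categories arise from a sequence \<open>X\<^sub>0, X\<^sub>1, \<dots>\<close> of pairwise non-isomorphic simple modules with only
  scalar endomorphisms such that \<open>L(1) \<otimes> X\<^sub>i\<close> is the direct sum of \<open>X\<^sub>i\<^sub>-\<^sub>1\<close> and \<open>X\<^sub>i\<^sub>+\<^sub>1\<close>, where \<open>X\<^sub>-\<^sub>1 = X\<^sub>0\<close>.
  Since \<open>L(m)\<close> is a direct summand of \<open>L(1)\<^sup>\<otimes>\<^sup>m\<close>, Weyl's theorem shows that finite direct sums of the \<open>X\<^sub>i\<close> are
  stable under tensoring with finite-dimensional modules. A nonzero invariant ideal contains the identity of some
  \<open>X\<^sub>i\<close>, hence, tensoring with \<open>L(1)\<close>, those of its neighbours, and so all of them.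

  The module \<open>M(\<nu>,\<xi>)\<close> is \<open>\<complex>[h]\<close> with \<open>e\<close> and \<open>f\<close> acting by shifts and depends only on \<open>(\<nu> + 1)\<^sup>2\<close>; homomorphisms
  out of it correspond to Whittaker vectors with a prescribed Casimir eigenvalue. The module \<open>V(n,\<theta>)\<close> consists
  of the polynomials in \<open>x, y\<close> all of whose terms have degree \<open>\<ge> n\<close>; homomorphisms out of it correspond to highest
  weight vectors of weight \<open>n\<close> annihilated by \<open>(n + 1) q - f p\<close>. In both cases \<open>L(1) \<otimes> X\<^sub>i\<close> is generated by two explicit
  vectors of this kind.
\<close>

section \<open>Linear maps and tensor products of sequence spaces\<close>

text \<open>Membership in the additive closure asks for a complement inside a direct sum, a
  condition that is awkward to carry through tensor products. It is traded for \<open>gen\<close>: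
  being a finite sum, direct or not, of images of the \<open>X i\<close>. This passes to homomorphic
  images and finite sums by composing maps, and simplicity of the \<open>X i\<close> recovers direct
  sums when they are wanted. Accordingly Weyl's theorem serves as a supply of maps: a finite
  dimensional module is spanned by finitely many images of modules \<open>Lc k\<close>, and
  \<open>Lc (Suc k)\<close> is an image of the tensor product of \<open>Lc 1\<close> and
  \<open>Lc k\<close>.

  The loop at \<open>X 0\<close> has its own source in each family. The half-integers 1/2 and -1/2
  have the same square, so stepping down from \<open>i = 0\<close> leads back to the same Whittaker
  module. In the Schroedinger case with \<open>n = 0\<close> there is no weight
  \<open>n - 1\<close>, and a vector of weight 0 takes its place. Truncated subtraction on
  \<open>nat\<close> turns both into instances of \<open>X (i - 1)\<close>.\<close>

interpretation vp: vector_space_pair vscale vscale ..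

abbreviation lin :: "(vec \<Rightarrow> vec) \<Rightarrow> bool" where
  "lin \<equiv> Vector_Spaces.linear vscale vscale"

definition bas :: "nat \<Rightarrow> vec" where
  "bas k = Poly_Mapping.single k 1"

abbreviation lu :: "vec \<Rightarrow> nat \<Rightarrow> complex" where
  "lu \<equiv> Poly_Mapping.lookup"

lemma lookup_bas [simp]: "lu (bas k) n = (if k = n then 1 else 0)"
  by (simp add: bas_def lookup_single when_def)

lemma keys_bas [simp]: "Poly_Mapping.keys (bas k) = {k}"
  by (simp add: bas_def)

text \<open>Actions and homomorphisms are unconstrained off the carrier, so linearity is recorded
  relative to a set; \<open>lin\<close> is reserved for maps that are linear on all of
  \<open>vec\<close>.\<close>

definition linon :: "vec set \<Rightarrow> (vec \<Rightarrow> vec) \<Rightarrow> bool" where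
  "linon V f \<longleftrightarrow> (\<forall>u\<in>V. \<forall>v\<in>V. f (u + v) = f u + f v) \<and> (\<forall>c. \<forall>v\<in>V. f (vscale c v) = vscale c (f v))"

lemma linI:
  assumes "\<And>u v. f (u + v) = f u + f v" "\<And>c v. f (vscale c v) = vscale c (f v)"
  shows "lin f"
  using assms by unfold_locales auto

lemma lin_add: "lin f \<Longrightarrow> f (u + v) = f u + f v"
  and lin_scale: "lin f \<Longrightarrow> f (vscale c v) = vscale c (f v)"
  and lin_diff: "lin f \<Longrightarrow> f (u - v) = f u - f v"
  and lin_uminus: "lin f \<Longrightarrow> f (- u) = - f u"
  and lin_zero: "lin f \<Longrightarrow> f 0 = 0"
  and lin_sum: "lin f \<Longrightarrow> f (sum g S) = (\<Sum>x\<in>S. f (g x))"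
  by (simp_all add: vp.linear_add vp.linear_scale vp.linear_diff vp.linear_neg vp.linear_0 vp.linear_sum)

lemma lin_compose: "lin f \<Longrightarrow> lin g \<Longrightarrow> lin (\<lambda>x. g (f x))"
  by (rule linI) (simp_all add: lin_add lin_scale)

lemma linonI:
  assumes "\<And>u v. u \<in> V \<Longrightarrow> v \<in> V \<Longrightarrow> f (u + v) = f u + f v"
    and "\<And>c v. v \<in> V \<Longrightarrow> f (vscale c v) = vscale c (f v)"
  shows "linon V f"
  using assms by (auto simp: linon_def)

lemma linon_add: "linon V f \<Longrightarrow> u \<in> V \<Longrightarrow> v \<in> V \<Longrightarrow> f (u + v) = f u + f v"
  and linon_scale: "linon V f \<Longrightarrow> v \<in> V \<Longrightarrow> f (vscale c v) = vscale c (f v)"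
  by (auto simp: linon_def)

lemma linon_zero: "linon V f \<Longrightarrow> 0 \<in> V \<Longrightarrow> f 0 = 0"
  using linon_scale[of V f 0 0] by simp

lemma linon_diff:
  assumes "linon V f" "u \<in> V" "v \<in> V" "vec.subspace V"
  shows "f (u - v) = f u - f v"
proof -
  have "f (u - v + v) = f (u - v) + f v"
    using assms by (intro linon_add) (auto intro: vec.subspace_diff)
  then show ?thesis by simp
qed

lemma lin_imp_linon: "lin f \<Longrightarrow> linon V f"
  by (auto intro!: linonI simp: lin_add lin_scale)

lemma linon_mono: "linon V f \<Longrightarrow> W \<subseteq> V \<Longrightarrow> linon W f"
  unfolding linon_def by blast

lemma linon_comp: "linon V f \<Longrightarrow> (\<And>v. v \<in> V \<Longrightarrow> f v \<in> W) \<Longrightarrow> linon W g \<Longrightarrow> linon V (\<lambda>v. g (f v))"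
  by (auto simp: linon_def)

lemma linon_plus: "linon V f \<Longrightarrow> linon V g \<Longrightarrow> linon V (\<lambda>v. f v + g v)"
  by (auto simp: linon_def algebra_simps vec.scale_right_distrib)

lemma linon_smult: "linon V f \<Longrightarrow> linon V (\<lambda>v. vscale c (f v))"
  by (auto simp: linon_def vec.scale_right_distrib mult.commute)

lemma linon_id: "linon V (\<lambda>v. v)"
  by (auto simp: linon_def)

lemma linon_cong: "linon V f \<Longrightarrow> vec.subspace V \<Longrightarrow> (\<And>v. v \<in> V \<Longrightarrow> f v = g v) \<Longrightarrow> linon V g"
  by (intro linonI) (metis linon_add vec.subspace_add, metis linon_scale vec.subspace_scale)

lemma linon_restrict: "linon V f \<Longrightarrow> vec.subspace V \<Longrightarrow> linon V (restrict f V)"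
  by (erule linon_cong) auto

lemma linon_image_subspace:
  assumes "linon V f" "vec.subspace V" "vec.subspace W" "W \<subseteq> V"
  shows "vec.subspace (f ` W)"
proof (rule vec.subspaceI)
  show "0 \<in> f ` W" using linon_zero[OF assms(1)] vec.subspace_0 assms by (metis image_eqI)
next
  fix x y assume "x \<in> f ` W" "y \<in> f ` W"
  then show "x + y \<in> f ` W" using assms
    by (smt (verit) imageE image_eqI linon_add subsetD vec.subspace_add)
next
  fix c x assume "x \<in> f ` W"
  then show "vscale c x \<in> f ` W" using assms
    by (smt (verit) imageE image_eqI linon_scale subsetD vec.subspace_scale)
qed

lemma linon_image_span:
  assumes "linon V f" "vec.subspace V" "B \<subseteq> V"
  shows "f ` vec.span B = vec.span (f ` B)"
proof
  have sp: "vec.span B \<subseteq> V" using assms by (simp add: vec.span_minimal)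
  show "f ` vec.span B \<subseteq> vec.span (f ` B)"
  proof
    fix y assume "y \<in> f ` vec.span B"
    then obtain x where x: "x \<in> vec.span B" "y = f x" by auto
    have "f x \<in> vec.span (f ` B) \<and> x \<in> V" using x(1)
    proof (induction rule: vec.span_induct_alt)
      case base then show ?case using linon_zero[OF assms(1)] vec.subspace_0[OF assms(2)] by (simp add: vec.span_zero)
    next
      case (step c x y)
      then have "x \<in> V" using assms by auto
      then show ?case using step assms
        by (simp add: linon_add[OF assms(1)] linon_scale[OF assms(1)] vec.subspace_scale vec.subspace_add
            vec.span_add vec.span_scale vec.span_base)
    qed
    then show "y \<in> vec.span (f ` B)" using x by simp
  qed
  show "vec.span (f ` B) \<subseteq> f ` vec.span B"
    using linon_image_subspace[OF assms(1,2) vec.subspace_span sp]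
    by (intro vec.span_minimal) (auto intro: vec.span_base)
qed

text \<open>A linear left inverse of the inclusion of \<open>V\<close>. Composing with it turns data
  given on \<open>V\<close> only into total linear data; this is done for bilinear maps and for
  module actions.\<close>

lemma subspace_projection:
  assumes "vec.subspace V"
  obtains \<pi> where "lin \<pi>" "\<And>v. \<pi> v \<in> V" "\<And>v. v \<in> V \<Longrightarrow> \<pi> v = v"
proof -
  have "lin (\<lambda>x. x)" by (rule linI) auto
  from vp.linear_exists_left_inverse_on[OF this assms] obtain g where
    "g ` UNIV \<subseteq> V" "lin g" "\<forall>v\<in>V. g v = v" by auto
  then show thesis by (intro that[of g]) auto
qed

text \<open>Linear extension of a function given on the basis vectors \<open>bas k\<close>; the
  operators on monomials below are defined through its two-index form \<open>lext2\<close>.\<close>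

definition lext :: "(nat \<Rightarrow> vec) \<Rightarrow> vec \<Rightarrow> vec" where
  "lext g t = (\<Sum>k\<in>Poly_Mapping.keys t. vscale (lu t k) (g k))"

lemma lext_superset:
  assumes "finite S" "Poly_Mapping.keys t \<subseteq> S"
  shows "lext g t = (\<Sum>k\<in>S. vscale (lu t k) (g k))"
  unfolding lext_def using assms by (intro sum.mono_neutral_left) (auto simp: in_keys_iff)

lemma lin_lext: "lin (lext g)"
proof (rule linI)
  fix u v :: vec and c
  let ?S = "Poly_Mapping.keys u \<union> Poly_Mapping.keys v"
  have "Poly_Mapping.keys (u + v) \<subseteq> ?S" by (rule Poly_Mapping.keys_add)
  then show "lext g (u + v) = lext g u + lext g v"
    by (simp add: lext_superset[of ?S] lookup_add vec.scale_left_distrib sum.distrib)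
  have "Poly_Mapping.keys (vscale c v) \<subseteq> Poly_Mapping.keys v" by (auto simp: in_keys_iff)
  then show "lext g (vscale c v) = vscale c (lext g v)"
    by (simp add: lext_superset[of "Poly_Mapping.keys v"] vec.scale_sum_right)
qed

lemma lext_bas [simp]: "lext g (bas k) = g k"
  by (simp add: lext_def)

lemma vec_eq_lext: "v = lext bas v"
proof (rule poly_mapping_eqI)
  fix n
  have "lu (lext bas v) n = (\<Sum>k\<in>Poly_Mapping.keys v. if n = k then lu v n else 0)"
    unfolding lext_def lookup_sum by (rule sum.cong) auto
  then show "lu v n = lu (lext bas v) n" by (simp add: in_keys_iff)
qed

lemma lin_eq_lext:
  assumes "lin f" shows "f v = lext (\<lambda>k. f (bas k)) v"
  by (subst (1) vec_eq_lext) (simp add: lext_def lin_sum[OF assms] lin_scale[OF assms])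

lemma lin_ext:
  assumes "lin f" "lin g" "\<And>k. f (bas k) = g (bas k)" shows "f v = g v"
  unfolding lin_eq_lext[OF assms(1), of v] lin_eq_lext[OF assms(2), of v] assms(3) ..

section \<open>Pure tensors and the spaces they span\<close>

lemma lookup_tensor_vec: "lu (tensor_vec u v) n = lu u (fst (prod_decode n)) * lu v (snd (prod_decode n))"
proof -
  obtain i j where ij: "prod_decode n = (i, j)" by (cases "prod_decode n")
  then have n: "n = prod_encode (i, j)" by (metis prod_decode_inverse)
  have "lu (tensor_vec u v) n =
     (\<Sum>a\<in>Poly_Mapping.keys u. \<Sum>b\<in>Poly_Mapping.keys v. if b = j then (if a = i then lu u a * lu v b else 0) else 0)"
    by (auto simp: tensor_vec_def lookup_sum lookup_single when_def n prod_encode_eq intro!: sum.cong)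
  also have "\<dots> = (\<Sum>a\<in>Poly_Mapping.keys u. if a = i then lu u a * lu v j else 0)"
    by (intro sum.cong refl) (simp add: sum.delta in_keys_iff)
  also have "\<dots> = lu u i * lu v j"
    by (simp add: sum.delta in_keys_iff)
  finally show ?thesis using ij by simp
qed

lemma tensor_add_left: "tensor_vec (u + u') v = tensor_vec u v + tensor_vec u' v"
  and tensor_add_right: "tensor_vec u (v + v') = tensor_vec u v + tensor_vec u v'"
  and tensor_scale_left: "tensor_vec (vscale c u) v = vscale c (tensor_vec u v)"
  and tensor_scale_right: "tensor_vec u (vscale c v) = vscale c (tensor_vec u v)"
  by (auto intro!: poly_mapping_eqI simp: lookup_tensor_vec lookup_add algebra_simps)

lemma tensor_zero_left [simp]: "tensor_vec 0 v = 0"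
  and tensor_zero_right [simp]: "tensor_vec u 0 = 0"
  by (auto intro!: poly_mapping_eqI simp: lookup_tensor_vec)

lemma tensor_diff_right: "tensor_vec u (v - v') = tensor_vec u v - tensor_vec u v'"
  by (rule poly_mapping_eqI, simp add: lookup_tensor_vec lookup_minus right_diff_distrib)

lemma tensor_bas: "tensor_vec (bas i) (bas j) = bas (prod_encode (i, j))"
  by (simp add: tensor_vec_def) (simp add: bas_def)

lemma lin_tensor_left: "lin (\<lambda>u. tensor_vec u v)"
  and lin_tensor_right: "lin (\<lambda>v. tensor_vec u v)"
  by (auto intro!: linI simp: tensor_add_left tensor_add_right tensor_scale_left tensor_scale_right)

text \<open>For fixed \<open>j\<close>, the coefficients at \<open>prod_encode (i, j)\<close> over
  all \<open>i\<close> form a linear relation between \<open>x\<close> and \<open>y\<close>, whose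
  scalars are the \<open>j\<close>-th coefficients of \<open>m\<close> and
  \<open>m'\<close>.\<close>

lemma tensor_independent:
  assumes ind: "\<And>a b. vscale a x + vscale b y = 0 \<Longrightarrow> a = 0 \<and> b = 0"
    and eq: "tensor_vec x m + tensor_vec y m' = 0"
  shows "m = 0 \<and> m' = 0"
proof -
  have "lu m j = 0 \<and> lu m' j = 0" for j
  proof (rule ind, rule poly_mapping_eqI)
    fix i
    have "lu (tensor_vec x m + tensor_vec y m') (prod_encode (i, j)) = 0" using eq by simp
    then show "lu (vscale (lu m j) x + vscale (lu m' j) y) i = lu 0 i"
      by (simp add: lookup_add lookup_tensor_vec algebra_simps)
  qed
  then show ?thesis by (auto intro!: poly_mapping_eqI)
qed

lemma subspace_tspace: "vec.subspace (tspace V W)"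
  by (simp add: tspace_def vec.subspace_span)

lemma tensor_in_tspace: "u \<in> V \<Longrightarrow> v \<in> W \<Longrightarrow> tensor_vec u v \<in> tspace V W"
  unfolding tspace_def by (rule vec.span_base) auto

lemma tspace_minimal:
  assumes "vec.subspace S" "\<And>u v. u \<in> V \<Longrightarrow> v \<in> W \<Longrightarrow> tensor_vec u v \<in> S"
  shows "tspace V W \<subseteq> S"
  unfolding tspace_def using assms by (intro vec.span_minimal) auto

lemma tspace_into:
  assumes "linon (tspace V W) T" "vec.subspace S"
    and "\<And>u v. u \<in> V \<Longrightarrow> v \<in> W \<Longrightarrow> T (tensor_vec u v) \<in> S" "t \<in> tspace V W"
  shows "T t \<in> S"
proof -
  have "T ` vec.span {tensor_vec u v | u v. u \<in> V \<and> v \<in> W} = vec.span (T ` {tensor_vec u v | u v. u \<in> V \<and> v \<in> W})"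
    using assms(1) by (intro linon_image_span[OF _ subspace_tspace[of V W]])
      (auto intro: tensor_in_tspace)
  also have "\<dots> \<subseteq> S" using assms(2,3) by (intro vec.span_minimal) auto
  finally show ?thesis using assms(4) unfolding tspace_def by blast
qed

text \<open>The difference of the two maps sends pure tensors into the zero subspace, so this is
  \<open>tspace_into\<close> for the target \<open>{0}\<close>.\<close>

lemma tspace_ext:
  assumes "linon (tspace V W) S" "linon (tspace V W) T"
    and "\<And>u v. u \<in> V \<Longrightarrow> v \<in> W \<Longrightarrow> S (tensor_vec u v) = T (tensor_vec u v)" "t \<in> tspace V W"
  shows "S t = T t"
proof -
  have "linon (tspace V W) (\<lambda>t. S t + vscale (-1) (T t))"
    using assms by (intro linon_plus linon_smult)
  from tspace_into[OF this, of "{0}" t] assms(3,4) have "S t + vscale (-1) (T t) = 0"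
    by auto
  then show ?thesis by (simp add: eq_neg_iff_add_eq_0)
qed

lemma tspace_ext3_left:
  assumes "linon (tspace (tspace U V) W) S" "linon (tspace (tspace U V) W) T"
    and "\<And>u v w. u \<in> U \<Longrightarrow> v \<in> V \<Longrightarrow> w \<in> W \<Longrightarrow>
       S (tensor_vec (tensor_vec u v) w) = T (tensor_vec (tensor_vec u v) w)"
    and "t \<in> tspace (tspace U V) W"
  shows "S t = T t"
proof (rule tspace_ext[OF assms(1,2) _ assms(4)])
  fix r w assume r: "r \<in> tspace U V" and w: "w \<in> W"
  have *: "linon (tspace U V) (\<lambda>r. Q (tensor_vec r w))" if "linon (tspace (tspace U V) W) Q" for Q
    by (rule linon_comp[OF lin_imp_linon[OF lin_tensor_left] _ that]) (use w in \<open>auto intro: tensor_in_tspace\<close>)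
  show "S (tensor_vec r w) = T (tensor_vec r w)"
    by (rule tspace_ext[OF *[OF assms(1)] *[OF assms(2)] _ r]) (use assms(3) w in auto)
qed

lemma tspace_ext3_right:
  assumes "linon (tspace U (tspace V W)) S" "linon (tspace U (tspace V W)) T"
    and "\<And>u v w. u \<in> U \<Longrightarrow> v \<in> V \<Longrightarrow> w \<in> W \<Longrightarrow>
       S (tensor_vec u (tensor_vec v w)) = T (tensor_vec u (tensor_vec v w))"
    and "t \<in> tspace U (tspace V W)"
  shows "S t = T t"
proof (rule tspace_ext[OF assms(1,2) _ assms(4)])
  fix r u assume r: "r \<in> tspace V W" and u: "u \<in> U"
  have *: "linon (tspace V W) (\<lambda>r. Q (tensor_vec u r))" if "linon (tspace U (tspace V W)) Q" for Q
    by (rule linon_comp[OF lin_imp_linon[OF lin_tensor_right] _ that]) (use u in \<open>auto intro: tensor_in_tspace\<close>)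
  show "S (tensor_vec u r) = T (tensor_vec u r)"
    by (rule tspace_ext[OF *[OF assms(1)] *[OF assms(2)] _ r]) (use assms(3) u in auto)
qed

lemma tspace_ext4_left:
  assumes "linon (tspace (tspace (tspace Z U) V) W) S" "linon (tspace (tspace (tspace Z U) V) W) T"
    and "\<And>z u v w. z \<in> Z \<Longrightarrow> u \<in> U \<Longrightarrow> v \<in> V \<Longrightarrow> w \<in> W \<Longrightarrow>
       S (tensor_vec (tensor_vec (tensor_vec z u) v) w) = T (tensor_vec (tensor_vec (tensor_vec z u) v) w)"
    and "t \<in> tspace (tspace (tspace Z U) V) W"
  shows "S t = T t"
proof (rule tspace_ext[OF assms(1,2) _ assms(4)])
  fix r w assume r: "r \<in> tspace (tspace Z U) V" and w: "w \<in> W"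
  have *: "linon (tspace (tspace Z U) V) (\<lambda>r. Q (tensor_vec r w))"
    if "linon (tspace (tspace (tspace Z U) V) W) Q" for Q
    by (rule linon_comp[OF lin_imp_linon[OF lin_tensor_left] _ that]) (use w in \<open>auto intro: tensor_in_tspace\<close>)
  show "S (tensor_vec r w) = T (tensor_vec r w)"
    by (rule tspace_ext3_left[OF *[OF assms(1)] *[OF assms(2)] _ r]) (use assms(3) w in auto)
qed

section \<open>Lifting bilinear maps to tensor spaces\<close>

definition bilinon :: "vec set \<Rightarrow> vec set \<Rightarrow> (vec \<Rightarrow> vec \<Rightarrow> vec) \<Rightarrow> bool" where
  "bilinon V W \<beta> \<longleftrightarrow> (\<forall>v\<in>W. linon V (\<lambda>u. \<beta> u v)) \<and> (\<forall>u\<in>V. linon W (\<beta> u))"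

lemma bilinonI:
  assumes "\<And>v. v \<in> W \<Longrightarrow> linon V (\<lambda>u. \<beta> u v)" "\<And>u. u \<in> V \<Longrightarrow> linon W (\<lambda>v. \<beta> u v)"
  shows "bilinon V W \<beta>"
  using assms by (auto simp: bilinon_def)

text \<open>Precomposing with projections onto \<open>V\<close> and \<open>W\<close> makes \<beta>
  bilinear on all of \<open>vec\<close>. There it is determined by pairs of basis vectors, and
  tensors of basis vectors are again basis vectors (\<open>tensor_bas\<close>), so a linear
  extension does the rest.\<close>

lemma tensor_factorization:
  assumes V: "vec.subspace V" and W: "vec.subspace W" and \<beta>: "bilinon V W \<beta>"
  obtains T where "lin T" "\<And>u v. u \<in> V \<Longrightarrow> v \<in> W \<Longrightarrow> T (tensor_vec u v) = \<beta> u v"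
proof -
  obtain \<pi> where \<pi>: "lin \<pi>" "\<And>v. \<pi> v \<in> V" "\<And>v. v \<in> V \<Longrightarrow> \<pi> v = v" using subspace_projection[OF V] by metis
  obtain \<rho> where \<rho>: "lin \<rho>" "\<And>v. \<rho> v \<in> W" "\<And>v. v \<in> W \<Longrightarrow> \<rho> v = v" using subspace_projection[OF W] by metis
  define B where "B u v = \<beta> (\<pi> u) (\<rho> v)" for u v
  have Bl: "lin (\<lambda>u. B u v)" and Br: "lin (B u)" for u v
    using \<beta> \<pi> \<rho> unfolding B_def bilinon_def linon_def
    by (auto intro!: linI simp: lin_add lin_scale)
  define T where "T = lext (\<lambda>n. B (bas (fst (prod_decode n))) (bas (snd (prod_decode n))))"
  have T: "lin T" by (simp add: T_def lin_lext)
  have "T (tensor_vec u v) = B u v" for u v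
  proof (rule lin_ext[where f = "\<lambda>u. T (tensor_vec u v)" and g = "\<lambda>u. B u v"])
    show "lin (\<lambda>u. T (tensor_vec u v))" by (rule lin_compose[OF lin_tensor_left T])
    show "lin (\<lambda>u. B u v)" by (rule Bl)
    fix i
    show "T (tensor_vec (bas i) v) = B (bas i) v"
      by (rule lin_ext[OF lin_compose[OF lin_tensor_right T] Br]) (simp add: tensor_bas T_def)
  qed
  then show thesis using T \<pi> \<rho> by (intro that[of T]) (auto simp: B_def)
qed

text \<open>The definite description in \<open>tlift\<close> denotes: existence comes from
  \<open>tensor_factorization\<close>, cut off outside the tensor space, and uniqueness from the
  spanning property of pure tensors. Later arguments about lifts rest on the three properties stated
  here.\<close>

lemma tlift_unique:
  assumes "vec.subspace V" "vec.subspace W" "bilinon V W \<beta>"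
  shows "tlift V W \<beta> \<in> extensional (tspace V W) \<and> linon (tspace V W) (tlift V W \<beta>) \<and>
    (\<forall>u\<in>V. \<forall>v\<in>W. tlift V W \<beta> (tensor_vec u v) = \<beta> u v)"
proof -
  obtain T0 where T0: "lin T0" "\<And>u v. u \<in> V \<Longrightarrow> v \<in> W \<Longrightarrow> T0 (tensor_vec u v) = \<beta> u v"
    using tensor_factorization[OF assms] by metis
  let ?P = "\<lambda>T. T \<in> extensional (tspace V W) \<and>
        (\<forall>s\<in>tspace V W. \<forall>t\<in>tspace V W. T (s + t) = T s + T t) \<and>
        (\<forall>c. \<forall>t\<in>tspace V W. T (vscale c t) = vscale c (T t)) \<and>
        (\<forall>u\<in>V. \<forall>v\<in>W. T (tensor_vec u v) = \<beta> u v)"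
  have "\<exists>!T. ?P T"
  proof (rule ex1I)
    have "linon (tspace V W) (restrict T0 (tspace V W))"
      by (intro linon_restrict lin_imp_linon T0 subspace_tspace)
    then show "?P (restrict T0 (tspace V W))"
      using T0(2) by (auto simp: linon_def tensor_in_tspace)
  next
    fix T assume T: "?P T"
    have T1: "linon (tspace V W) (restrict T0 (tspace V W))"
      by (intro linon_restrict lin_imp_linon T0 subspace_tspace)
    show "T = restrict T0 (tspace V W)"
    proof (rule extensionalityI[of _ "tspace V W"])
      fix t assume "t \<in> tspace V W"
      then show "T t = restrict T0 (tspace V W) t"
        using T T0(2) by (rule_tac tspace_ext[OF _ T1]) (auto simp: linon_def tensor_in_tspace)
    qed (use T in auto)
  qed
  from theI'[OF this] have "?P (tlift V W \<beta>)" unfolding tlift_def .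
  then show ?thesis by (auto simp: linon_def)
qed

lemmas tlift_ext = conjunct1[OF tlift_unique]
  and tlift_linon = conjunct1[OF conjunct2[OF tlift_unique]]

lemma tlift_tensor:
  "vec.subspace V \<Longrightarrow> vec.subspace W \<Longrightarrow> bilinon V W \<beta> \<Longrightarrow> u \<in> V \<Longrightarrow> v \<in> W \<Longrightarrow>
   tlift V W \<beta> (tensor_vec u v) = \<beta> u v"
  using tlift_unique by blast

lemma bilinon_tensor_maps:
  "linon V f \<Longrightarrow> linon W g \<Longrightarrow> bilinon V W (\<lambda>u v. tensor_vec (f u) (g v))"
  by (auto intro!: bilinonI linonI simp: linon_add linon_scale tensor_add_left tensor_add_right
      tensor_scale_left tensor_scale_right)

context
  fixes V W :: "vec set" and f g :: "vec \<Rightarrow> vec"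
  assumes *: "vec.subspace V" "vec.subspace W" "linon V f" "linon W g"
begin

lemma tmap_ext: "tmap V W f g \<in> extensional (tspace V W)"
  and tmap_linon: "linon (tspace V W) (tmap V W f g)"
  and tmap_tensor: "u \<in> V \<Longrightarrow> v \<in> W \<Longrightarrow> tmap V W f g (tensor_vec u v) = tensor_vec (f u) (g v)"
  unfolding tmap_def
  by (intro tlift_ext tlift_linon tlift_tensor bilinon_tensor_maps * | assumption)+

lemma tmap_into:
  assumes "\<And>v. v \<in> V \<Longrightarrow> f v \<in> V'" "\<And>v. v \<in> W \<Longrightarrow> g v \<in> W'" "t \<in> tspace V W"
  shows "tmap V W f g t \<in> tspace V' W'"
  by (rule tspace_into[OF tmap_linon subspace_tspace _ assms(3)])
    (use assms in \<open>auto simp: tmap_tensor intro: tensor_in_tspace\<close>)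

end

lemma tassoc_inner_bilinon:
  assumes "vec.subspace U" "vec.subspace V"
  shows "bilinon U V (\<lambda>u v. tensor_vec u (tensor_vec v w))"
  by (auto intro!: bilinonI linonI simp: tensor_add_left tensor_add_right
      tensor_scale_left tensor_scale_right)

text \<open>The vector \<open>w\<close> enters through the bilinear map that is lifted, so linearity
  in \<open>w\<close> is an instance of uniqueness: the two sides of each equation are linear in
  \<open>t\<close> and agree on pure tensors.\<close>

lemma tassoc_bilinon:
  assumes "vec.subspace U" "vec.subspace V" "vec.subspace W"
  shows "bilinon (tspace U V) W (\<lambda>t w. tlift U V (\<lambda>u v. tensor_vec u (tensor_vec v w)) t)"
proof (rule bilinonI)
  fix t assume t: "t \<in> tspace U V"
  note l = tlift_linon[OF assms(1,2) tassoc_inner_bilinon[OF assms(1,2)]]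
  note tt = tlift_tensor[OF assms(1,2) tassoc_inner_bilinon[OF assms(1,2)]]
  show "linon W (\<lambda>w. tlift U V (\<lambda>u v. tensor_vec u (tensor_vec v w)) t)"
  proof (rule linonI)
    fix w w' c
    show "tlift U V (\<lambda>u v. tensor_vec u (tensor_vec v (w + w'))) t =
        tlift U V (\<lambda>u v. tensor_vec u (tensor_vec v w)) t + tlift U V (\<lambda>u v. tensor_vec u (tensor_vec v w')) t"
      by (rule tspace_ext[OF l linon_plus[OF l l] _ t]) (simp only: tt, simp only: tensor_add_right)
    show "tlift U V (\<lambda>u v. tensor_vec u (tensor_vec v (vscale c w))) t =
        vscale c (tlift U V (\<lambda>u v. tensor_vec u (tensor_vec v w)) t)"
      by (rule tspace_ext[OF l linon_smult[OF l] _ t]) (simp only: tt, simp only: tensor_scale_right)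
  qed
qed (intro tlift_linon tassoc_inner_bilinon assms)

context
  fixes U V W :: "vec set"
  assumes *: "vec.subspace U" "vec.subspace V" "vec.subspace W"
begin

lemma tassoc_ext: "tassoc U V W \<in> extensional (tspace (tspace U V) W)"
  and tassoc_linon: "linon (tspace (tspace U V) W) (tassoc U V W)"
  unfolding tassoc_def by (intro tlift_ext tlift_linon tassoc_bilinon subspace_tspace *)+

lemma tassoc_tensor:
  "u \<in> U \<Longrightarrow> v \<in> V \<Longrightarrow> w \<in> W \<Longrightarrow>
     tassoc U V W (tensor_vec (tensor_vec u v) w) = tensor_vec u (tensor_vec v w)"
  unfolding tassoc_def
  by (simp add: tlift_tensor[OF subspace_tspace *(3) tassoc_bilinon[OF *]]
      tlift_tensor[OF *(1,2) tassoc_inner_bilinon[OF *(1,2)]] tensor_in_tspace)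

lemma tassoc_into: "t \<in> tspace (tspace U V) W \<Longrightarrow> tassoc U V W t \<in> tspace U (tspace V W)"
proof (rule tspace_into[OF tassoc_linon subspace_tspace])
  fix r w assume r: "r \<in> tspace U V" and w: "w \<in> W"
  show "tassoc U V W (tensor_vec r w) \<in> tspace U (tspace V W)"
    by (rule tspace_into[OF _ subspace_tspace _ r,
          OF linon_comp[OF lin_imp_linon[OF lin_tensor_left] _ tassoc_linon]])
      (use w in \<open>auto simp: tassoc_tensor intro: tensor_in_tspace\<close>)
qed

text \<open>The inverse \<open>J\<close> is the mirror-image nested lift. Both composites are linear
  and fix triple tensors, hence are identities.\<close>

lemma tassoc_bij: "bij_betw (tassoc U V W) (tspace (tspace U V) W) (tspace U (tspace V W))"
proof -
  let ?in = "\<lambda>u. tlift V W (\<lambda>v w. tensor_vec (tensor_vec u v) w)"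
  have ib: "bilinon V W (\<lambda>v w. tensor_vec (tensor_vec u v) w)" for u
    by (auto intro!: bilinonI linonI simp: tensor_add_left tensor_add_right
      tensor_scale_left tensor_scale_right)
  note il = tlift_linon[OF *(2,3) ib] and it = tlift_tensor[OF *(2,3) ib]
  have ob: "bilinon U (tspace V W) ?in"
  proof (rule bilinonI)
    fix t assume t: "t \<in> tspace V W"
    show "linon U (\<lambda>u. ?in u t)"
    proof (rule linonI)
      fix u u' c
      show "?in (u + u') t = ?in u t + ?in u' t"
        by (rule tspace_ext[OF il linon_plus[OF il il] _ t]) (simp only: it, simp only: tensor_add_left)
      show "?in (vscale c u) t = vscale c (?in u t)"
        by (rule tspace_ext[OF il linon_smult[OF il] _ t]) (simp only: it, simp only: tensor_scale_left)
    qed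
  qed (rule il)
  define J where "J = tlift U (tspace V W) ?in"
  have Jl: "linon (tspace U (tspace V W)) J" unfolding J_def by (intro tlift_linon * subspace_tspace ob)
  have Jt: "J (tensor_vec u (tensor_vec v w)) = tensor_vec (tensor_vec u v) w"
    if "u \<in> U" "v \<in> V" "w \<in> W" for u v w
    unfolding J_def using that by (simp add: tlift_tensor[OF *(1) subspace_tspace ob] it tensor_in_tspace)
  have Ji: "J t \<in> tspace (tspace U V) W" if t: "t \<in> tspace U (tspace V W)" for t
  proof (rule tspace_into[OF Jl subspace_tspace _ t])
    fix u r assume u: "u \<in> U" and r: "r \<in> tspace V W"
    show "J (tensor_vec u r) \<in> tspace (tspace U V) W"
      by (rule tspace_into[OF _ subspace_tspace _ r,
            OF linon_comp[OF lin_imp_linon[OF lin_tensor_right] _ Jl]])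
        (use u in \<open>auto simp: Jt intro: tensor_in_tspace\<close>)
  qed
  show ?thesis
  proof (rule bij_betwI[where g = J])
    fix t assume t: "t \<in> tspace (tspace U V) W"
    show "J (tassoc U V W t) = t"
      by (rule tspace_ext3_left[OF linon_comp[OF tassoc_linon tassoc_into Jl] linon_id _ t])
        (simp_all add: tassoc_tensor Jt)
  next
    fix t assume t: "t \<in> tspace U (tspace V W)"
    show "tassoc U V W (J t) = t"
      by (rule tspace_ext3_right[OF linon_comp[OF Jl Ji tassoc_linon] linon_id _ t])
        (simp_all add: tassoc_tensor Jt)
  qed (auto intro: Ji tassoc_into)
qed

end

section \<open>The unit space and the unit isomorphisms\<close>

lemma mem_unit_space: "s \<in> unit_space \<longleftrightarrow> s = vscale (lu s 0) (bas 0)"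
proof
  assume "s \<in> unit_space"
  then obtain k where "s = vscale k (bas 0)"
    by (auto simp: unit_space_def vec.span_singleton bas_def)
  then show "s = vscale (lu s 0) (bas 0)" by simp
next
  assume "s = vscale (lu s 0) (bas 0)"
  then show "s \<in> unit_space" unfolding unit_space_def bas_def
    by (metis vec.span_base vec.span_scale singletonI)
qed

lemma subspace_unit_space: "vec.subspace unit_space"
  by (simp add: unit_space_def vec.subspace_span)

lemma bas_in_unit_space: "bas 0 \<in> unit_space"
  by (simp add: mem_unit_space)

context
  fixes V :: "vec set"
  assumes V: "vec.subspace V"
begin

lemma unit_bilinon:
  "bilinon unit_space V (\<lambda>s v. vscale (lu s 0) v)" "bilinon V unit_space (\<lambda>v s. vscale (lu s 0) v)"
  by (auto intro!: bilinonI linonI simp: lookup_add vec.scale_left_distrib vec.scale_right_distrib mult.commute)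

lemma tlunit_ext: "tlunit V \<in> extensional (tspace unit_space V)"
  and tlunit_linon: "linon (tspace unit_space V) (tlunit V)"
  and trunit_ext: "trunit V \<in> extensional (tspace V unit_space)"
  and trunit_linon: "linon (tspace V unit_space) (trunit V)"
  unfolding tlunit_def trunit_def
  by (intro tlift_ext tlift_linon unit_bilinon subspace_unit_space V)+

lemma tlunit_tensor: "s \<in> unit_space \<Longrightarrow> v \<in> V \<Longrightarrow> tlunit V (tensor_vec s v) = vscale (lu s 0) v"
  and trunit_tensor: "s \<in> unit_space \<Longrightarrow> v \<in> V \<Longrightarrow> trunit V (tensor_vec v s) = vscale (lu s 0) v"
  unfolding tlunit_def trunit_def
  by (simp_all add: tlift_tensor unit_bilinon subspace_unit_space V)

lemma tlunit_into: "t \<in> tspace unit_space V \<Longrightarrow> tlunit V t \<in> V"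
  by (rule tspace_into[OF tlunit_linon V]) (auto simp: tlunit_tensor V vec.subspace_scale)

lemma trunit_into: "t \<in> tspace V unit_space \<Longrightarrow> trunit V t \<in> V"
  by (rule tspace_into[OF trunit_linon V]) (auto simp: trunit_tensor V vec.subspace_scale)

lemma tlunit_bij: "bij_betw (tlunit V) (tspace unit_space V) V"
proof (rule bij_betwI[where g = "tensor_vec (bas 0)"])
  fix t assume t: "t \<in> tspace unit_space V"
  have "tensor_vec (bas 0) (vscale (lu s 0) v) = tensor_vec s v" if "s \<in> unit_space" for s v
    using that by (metis mem_unit_space tensor_scale_left tensor_scale_right)
  note * = this
  show "tensor_vec (bas 0) (tlunit V t) = t"
    by (rule tspace_ext[OF linon_comp[OF tlunit_linon tlunit_into lin_imp_linon[OF lin_tensor_right]] linon_id _ t])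
      (simp_all add: tlunit_tensor *)
qed (auto simp: tlunit_tensor bas_in_unit_space intro: tlunit_into tensor_in_tspace)

lemma trunit_bij: "bij_betw (trunit V) (tspace V unit_space) V"
proof (rule bij_betwI[where g = "\<lambda>v. tensor_vec v (bas 0)"])
  fix t assume t: "t \<in> tspace V unit_space"
  have "tensor_vec (vscale (lu s 0) v) (bas 0) = tensor_vec v s" if "s \<in> unit_space" for s v
    using that by (metis mem_unit_space tensor_scale_left tensor_scale_right)
  note * = this
  show "tensor_vec (trunit V t) (bas 0) = t"
    by (rule tspace_ext[OF linon_comp[OF trunit_linon trunit_into lin_imp_linon[OF lin_tensor_left]] linon_id _ t])
      (simp_all add: trunit_tensor *)
qed (auto simp: trunit_tensor bas_in_unit_space intro: trunit_into tensor_in_tspace)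

end

section \<open>Functoriality and coherence of tensor products of spaces\<close>

lemma linon_compose:
  assumes "linon V f" "vec.subspace V" "\<And>v. v \<in> V \<Longrightarrow> f v \<in> W" "linon W g"
  shows "linon V (compose V g f)"
  unfolding compose_def using assms by (intro linon_restrict linon_comp[of V f W g]) auto

text \<open>A coherence axiom is an equation between arrows, hence between extensional functions.
  Extensionality and linearity reduce it to pure tensors, where both sides can be computed; the
  variants for three and four factors serve the associator, the triangle and the pentagon.\<close>

lemma tspace_eqI:
  assumes "S \<in> extensional (tspace V W)" "T \<in> extensional (tspace V W)"
    "linon (tspace V W) S" "linon (tspace V W) T"
    "\<And>u v. u \<in> V \<Longrightarrow> v \<in> W \<Longrightarrow> S (tensor_vec u v) = T (tensor_vec u v)"
  shows "S = T"
  by (rule extensionalityI[OF assms(1,2)]) (rule tspace_ext[OF assms(3-5)])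

lemma tspace_eqI3:
  assumes "S \<in> extensional (tspace (tspace U V) W)" "T \<in> extensional (tspace (tspace U V) W)"
    "linon (tspace (tspace U V) W) S" "linon (tspace (tspace U V) W) T"
    "\<And>u v w. u \<in> U \<Longrightarrow> v \<in> V \<Longrightarrow> w \<in> W \<Longrightarrow>
       S (tensor_vec (tensor_vec u v) w) = T (tensor_vec (tensor_vec u v) w)"
  shows "S = T"
  by (rule extensionalityI[OF assms(1,2)]) (rule tspace_ext3_left[OF assms(3-5)])

lemma tspace_eqI4:
  assumes "S \<in> extensional (tspace (tspace (tspace Z U) V) W)" "T \<in> extensional (tspace (tspace (tspace Z U) V) W)"
    "linon (tspace (tspace (tspace Z U) V) W) S" "linon (tspace (tspace (tspace Z U) V) W) T"
    "\<And>z u v w. z \<in> Z \<Longrightarrow> u \<in> U \<Longrightarrow> v \<in> V \<Longrightarrow> w \<in> W \<Longrightarrow>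
       S (tensor_vec (tensor_vec (tensor_vec z u) v) w) = T (tensor_vec (tensor_vec (tensor_vec z u) v) w)"
  shows "S = T"
  by (rule extensionalityI[OF assms(1,2)]) (rule tspace_ext4_left[OF assms(3-5)])

lemma tmap_id:
  assumes "vec.subspace V" "vec.subspace W"
  shows "tmap V W (\<lambda>v\<in>V. v) (\<lambda>v\<in>W. v) = (\<lambda>t\<in>tspace V W. t)"
  by (rule tspace_eqI[where V = V and W = W]) (simp_all add: assms tmap_ext tmap_linon tmap_tensor linon_restrict linon_id
      subspace_tspace tensor_in_tspace)

lemma tmap_compose:
  assumes "vec.subspace V" "vec.subspace W" "linon V f" "linon W g"
    "vec.subspace V'" "vec.subspace W'" "linon V' f'" "linon W' g'"
    "\<And>v. v \<in> V \<Longrightarrow> f v \<in> V'" "\<And>v. v \<in> W \<Longrightarrow> g v \<in> W'"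
  shows "tmap V W (compose V f' f) (compose W g' g) = compose (tspace V W) (tmap V' W' f' g') (tmap V W f g)"
proof -
  have l: "linon V (compose V f' f)" "linon W (compose W g' g)"
    using assms by (auto intro: linon_compose)
  have i: "tmap V W f g t \<in> tspace V' W'" if "t \<in> tspace V W" for t
    using assms that by (intro tmap_into) auto
  show ?thesis
    by (rule tspace_eqI[where V = V and W = W])
      (simp_all add: assms l tmap_ext tmap_linon tmap_tensor subspace_tspace tensor_in_tspace
        linon_compose[OF tmap_linon subspace_tspace i tmap_linon] compose_eq)
qed

context
  fixes V W :: "vec set"
  assumes *: "vec.subspace V" "vec.subspace W"
begin

lemma tmap_add_left:
  assumes "linon V f" "linon V f'" "linon W g"
  shows "tmap V W (\<lambda>v\<in>V. f v + f' v) g = (\<lambda>t\<in>tspace V W. tmap V W f g t + tmap V W f' g t)"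
proof -
  have l: "linon V (\<lambda>v\<in>V. f v + f' v)" using assms * by (intro linon_restrict linon_plus)
  show ?thesis
    by (rule tspace_eqI[where V = V and W = W]) (simp_all add: assms * l tmap_ext tmap_linon tmap_tensor subspace_tspace tensor_in_tspace
        linon_restrict linon_plus tensor_add_left)
qed

lemma tmap_add_right:
  assumes "linon V f" "linon W g" "linon W g'"
  shows "tmap V W f (\<lambda>v\<in>W. g v + g' v) = (\<lambda>t\<in>tspace V W. tmap V W f g t + tmap V W f g' t)"
proof -
  have l: "linon W (\<lambda>v\<in>W. g v + g' v)" using assms * by (intro linon_restrict linon_plus)
  show ?thesis
    by (rule tspace_eqI[where V = V and W = W]) (simp_all add: assms * l tmap_ext tmap_linon tmap_tensor subspace_tspace tensor_in_tspace
        linon_restrict linon_plus tensor_add_right)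
qed

lemma tmap_scale_left:
  assumes "linon V f" "linon W g"
  shows "tmap V W (\<lambda>v\<in>V. vscale c (f v)) g = (\<lambda>t\<in>tspace V W. vscale c (tmap V W f g t))"
proof -
  have l: "linon V (\<lambda>v\<in>V. vscale c (f v))" using assms * by (intro linon_restrict linon_smult)
  show ?thesis
    by (rule tspace_eqI[where V = V and W = W]) (simp_all add: assms * l tmap_ext tmap_linon tmap_tensor subspace_tspace tensor_in_tspace
        linon_restrict linon_smult tensor_scale_left)
qed

lemma tmap_scale_right:
  assumes "linon V f" "linon W g"
  shows "tmap V W f (\<lambda>v\<in>W. vscale c (g v)) = (\<lambda>t\<in>tspace V W. vscale c (tmap V W f g t))"
proof -
  have l: "linon W (\<lambda>v\<in>W. vscale c (g v))" using assms * by (intro linon_restrict linon_smult)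
  show ?thesis
    by (rule tspace_eqI[where V = V and W = W]) (simp_all add: assms * l tmap_ext tmap_linon tmap_tensor subspace_tspace tensor_in_tspace
        linon_restrict linon_smult tensor_scale_right)
qed

lemma tlunit_natural:
  assumes "vec.subspace W" "linon V f" "\<And>v. v \<in> V \<Longrightarrow> f v \<in> W"
  shows "compose (tspace unit_space V) (tlunit W) (tmap unit_space V (\<lambda>v\<in>unit_space. v) f) =
         compose (tspace unit_space V) f (tlunit V)"
proof -
  note s = subspace_unit_space
  have l: "linon unit_space (\<lambda>v\<in>unit_space. v)" by (intro linon_restrict linon_id s)
  have i: "tmap unit_space V (\<lambda>v\<in>unit_space. v) f t \<in> tspace unit_space W" if "t \<in> tspace unit_space V" for t
    using assms that * l s by (intro tmap_into) auto
  show ?thesis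
    by (rule tspace_eqI[where V = unit_space and W = V])
      (simp_all add: assms * l s tmap_tensor subspace_tspace tensor_in_tspace compose_eq tlunit_tensor linon_scale[OF assms(2)]
        linon_compose[OF tmap_linon subspace_tspace i tlunit_linon]
        linon_compose[OF tlunit_linon subspace_tspace tlunit_into])
qed

lemma trunit_natural:
  assumes "vec.subspace W" "linon V f" "\<And>v. v \<in> V \<Longrightarrow> f v \<in> W"
  shows "compose (tspace V unit_space) (trunit W) (tmap V unit_space f (\<lambda>v\<in>unit_space. v)) =
         compose (tspace V unit_space) f (trunit V)"
proof -
  note s = subspace_unit_space
  have l: "linon unit_space (\<lambda>v\<in>unit_space. v)" by (intro linon_restrict linon_id s)
  have i: "tmap V unit_space f (\<lambda>v\<in>unit_space. v) t \<in> tspace W unit_space" if "t \<in> tspace V unit_space" for t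
    using assms that * l s by (intro tmap_into) auto
  show ?thesis
    by (rule tspace_eqI[where V = V and W = unit_space])
      (simp_all add: assms * l s tmap_tensor subspace_tspace tensor_in_tspace compose_eq trunit_tensor linon_scale[OF assms(2)]
        linon_compose[OF tmap_linon subspace_tspace i trunit_linon]
        linon_compose[OF trunit_linon subspace_tspace trunit_into])
qed

lemma tensor_triangle:
  "compose (tspace (tspace V unit_space) W) (tmap V (tspace unit_space W) (\<lambda>v\<in>V. v) (tlunit W)) (tassoc V unit_space W) =
   tmap (tspace V unit_space) W (trunit V) (\<lambda>v\<in>W. v)"
proof -
  note s = subspace_unit_space
  have l: "linon V (\<lambda>v\<in>V. v)" "linon W (\<lambda>v\<in>W. v)" by (intro linon_restrict linon_id *)+
  show ?thesis
    by (rule tspace_eqI3[where U = V and V = unit_space and W = W])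
      (simp_all add: * l s tmap_tensor subspace_tspace tensor_in_tspace compose_eq trunit_tensor tlunit_tensor
        tassoc_tensor trunit_linon tlunit_linon tmap_linon tmap_ext tensor_scale_left tensor_scale_right
        linon_compose[OF tassoc_linon subspace_tspace tassoc_into tmap_linon])
qed

end

lemma tassoc_natural:
  assumes s: "vec.subspace U" "vec.subspace V" "vec.subspace W" "vec.subspace U'" "vec.subspace V'" "vec.subspace W'"
    and l: "linon U f" "linon V g" "linon W h"
    and i: "\<And>v. v \<in> U \<Longrightarrow> f v \<in> U'" "\<And>v. v \<in> V \<Longrightarrow> g v \<in> V'" "\<And>v. v \<in> W \<Longrightarrow> h v \<in> W'"
  shows "compose (tspace (tspace U V) W) (tassoc U' V' W') (tmap (tspace U V) W (tmap U V f g) h) =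
    compose (tspace (tspace U V) W) (tmap U (tspace V W) f (tmap V W g h)) (tassoc U V W)"
proof -
  have i2: "tmap (tspace U V) W (tmap U V f g) h t \<in> tspace (tspace U' V') W'" if "t \<in> tspace (tspace U V) W" for t
    using that s l i by (intro tmap_into[where W' = W'] subspace_tspace tmap_linon tmap_into[where V' = U' and W' = V']) auto
  show ?thesis
    by (rule tspace_eqI3[where U = U and V = V and W = W])
      (simp_all add: s l i subspace_tspace tmap_linon tmap_tensor tassoc_tensor tensor_in_tspace compose_eq
        linon_compose[OF tassoc_linon subspace_tspace tassoc_into tmap_linon]
        linon_compose[OF tmap_linon subspace_tspace i2 tassoc_linon])
qed

lemma tensor_pentagon:
  assumes s: "vec.subspace U" "vec.subspace V" "vec.subspace W" "vec.subspace Z"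
  defines "S \<equiv> tspace (tspace (tspace U V) W) Z"
  shows "compose S (tassoc U V (tspace W Z)) (tassoc (tspace U V) W Z) =
    compose S (tmap U (tspace (tspace V W) Z) (\<lambda>v\<in>U. v) (tassoc V W Z))
      (compose S (tassoc U (tspace V W) Z) (tmap (tspace (tspace U V) W) Z (tassoc U V W) (\<lambda>v\<in>Z. v)))"
proof -
  note st = s subspace_tspace
  have l: "linon U (\<lambda>v\<in>U. v)" "linon Z (\<lambda>v\<in>Z. v)" by (intro linon_restrict linon_id s)+
  have i1: "tmap (tspace (tspace U V) W) Z (tassoc U V W) (\<lambda>v\<in>Z. v) t \<in> tspace (tspace U (tspace V W)) Z"
    if "t \<in> S" for t
    using that l s unfolding S_def by (intro tmap_into st tassoc_linon tassoc_into) auto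
  have l1: "linon S (compose S (tassoc U (tspace V W) Z) (tmap (tspace (tspace U V) W) Z (tassoc U V W) (\<lambda>v\<in>Z. v)))"
    using l s i1 unfolding S_def
    by (intro linon_compose[where W = "tspace (tspace U (tspace V W)) Z"] tmap_linon tassoc_linon st) auto
  have i2: "compose S (tassoc U (tspace V W) Z) (tmap (tspace (tspace U V) W) Z (tassoc U V W) (\<lambda>v\<in>Z. v)) t
     \<in> tspace U (tspace (tspace V W) Z)" if "t \<in> S" for t
    using that i1[OF that] by (simp add: compose_eq tassoc_into st)
  show ?thesis
    unfolding S_def
    by (rule tspace_eqI4[where Z = U and U = V and V = W and W = Z])
      (simp_all add: st l tmap_tensor tassoc_linon tassoc_tensor tensor_in_tspace compose_eq
        linon_compose[OF tassoc_linon subspace_tspace tassoc_into tassoc_linon]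
        linon_compose[OF l1[unfolded S_def] subspace_tspace i2[unfolded S_def] tmap_linon])
qed

section \<open>Modules on sequence spaces\<close>

definition lc :: "('b \<Rightarrow> vec \<Rightarrow> vec) \<Rightarrow> 'b lincomb \<Rightarrow> vec \<Rightarrow> vec" where
  "lc a l v = (\<Sum>(c, b)\<leftarrow>l. vscale c (a b v))"

text \<open>Expresses \<open>X = vmod U a\<close> without quantifying over \<open>U\<close> and
  \<open>a\<close>, which are recovered as carrier and action in
  \<open>vops_eq_vmod\<close>.\<close>

definition vops :: "('b, vec) lmod \<Rightarrow> bool" where
  "vops X \<longleftrightarrow> vadd X = (+) \<and> vzero X = 0 \<and> vsmul X = vscale"

lemma vops_vmod [simp]: "vops (vmod U a)"
  by (simp add: vops_def vmod_def)

lemma vmod_simps [simp]: "carr (vmod U a) = U" "act (vmod U a) = a" "vadd (vmod U a) = (+)"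
  "vzero (vmod U a) = 0" "vsmul (vmod U a) = vscale"
  by (simp_all add: vmod_def)

lemma vops_eq_vmod: "vops X \<Longrightarrow> X = vmod (carr X) (act X)"
  by (cases X) (auto simp: vops_def vmod_def)

lemma lincomb_act_vops: "vops X \<Longrightarrow> lincomb_act X l v = lc (act X) l v"
  by (induction l) (auto simp: lincomb_act_def lc_def vops_def)

lemma cvspace_vops:
  assumes "vops X" shows "cvspace X \<longleftrightarrow> vec.subspace (carr X)"
proof
  assume "cvspace X"
  then show "vec.subspace (carr X)"
    using assms by (auto simp: cvspace_def vops_def intro!: vec.subspaceI)
next
  assume "vec.subspace (carr X)"
  moreover have "\<exists>w\<in>carr X. v + w = 0" if "v \<in> carr X" for v
    using that calculation by (intro bexI[of _ "- v"]) (auto intro: vec.subspace_neg)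
  ultimately show "cvspace X"
    using assms by (auto simp: cvspace_def vops_def vec.subspace_0 vec.subspace_add vec.subspace_scale
        add.assoc add.commute vec.scale_right_distrib vec.scale_left_distrib)
qed

lemma clinear_map_vops:
  "vops X \<Longrightarrow> vops Y \<Longrightarrow> clinear_map X Y f \<longleftrightarrow> (\<forall>v\<in>carr X. f v \<in> carr Y) \<and> linon (carr X) f"
  by (auto simp: clinear_map_def vops_def linon_def)

lemma lmod_hom_vops:
  "vops X \<Longrightarrow> vops Y \<Longrightarrow> lmod_hom X Y f \<longleftrightarrow>
     (\<forall>v\<in>carr X. f v \<in> carr Y) \<and> linon (carr X) f \<and> (\<forall>b. \<forall>v\<in>carr X. f (act X b v) = act Y b (f v))"
  by (auto simp: lmod_hom_def clinear_map_vops)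

lemma is_vmod_iff:
  "is_vmod br X \<longleftrightarrow> vops X \<and> vec.subspace (carr X) \<and>
     (\<forall>b. \<forall>v\<in>carr X. act X b v \<in> carr X) \<and> (\<forall>b. linon (carr X) (act X b)) \<and>
     (\<forall>x y. \<forall>v\<in>carr X. act X x (act X y v) = act X y (act X x v) + lc (act X) (br x y) v)"
proof -
  have e: "(\<exists>U a. X = vmod U a) \<longleftrightarrow> vops X" by (metis vops_eq_vmod vops_vmod)
  show ?thesis
  proof (cases "vops X")
    case True
    then have "vadd X = (+)" by (simp add: vops_def)
    with True show ?thesis
      unfolding is_vmod_def lie_module_def e
      by (simp add: cvspace_vops clinear_map_vops lincomb_act_vops all_conj_distrib)
  next
    case False then show ?thesis by (simp add: is_vmod_def e)
  qed
qed

lemma is_vmodI: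
  assumes "vec.subspace U" "\<And>b v. v \<in> U \<Longrightarrow> a b v \<in> U" "\<And>b. linon U (a b)"
    "\<And>x y v. v \<in> U \<Longrightarrow> a x (a y v) = a y (a x v) + lc a (br x y) v"
  shows "is_vmod br (vmod U a)"
  unfolding is_vmod_iff vmod_simps by (intro conjI vops_vmod allI ballI assms)

lemma vmod_vops: "is_vmod br X \<Longrightarrow> vops X"
  and vmod_subspace: "is_vmod br X \<Longrightarrow> vec.subspace (carr X)"
  and vmod_act: "is_vmod br X \<Longrightarrow> v \<in> carr X \<Longrightarrow> act X b v \<in> carr X"
  and vmod_linon: "is_vmod br X \<Longrightarrow> linon (carr X) (act X b)"
  and vmod_bracket: "is_vmod br X \<Longrightarrow> v \<in> carr X \<Longrightarrow>
    act X x (act X y v) = act X y (act X x v) + lc (act X) (br x y) v"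
  unfolding is_vmod_iff by blast+

lemma lc_linon: "(\<And>b. linon U (a b)) \<Longrightarrow> linon U (lc a l)"
proof (induction l)
  case Nil show ?case by (simp add: lc_def linon_def)
next
  case (Cons cb l)
  obtain c b where "cb = (c, b)" by (cases cb)
  then have "lc a (cb # l) = (\<lambda>v. vscale c (a b v) + lc a l v)" by (auto simp: lc_def)
  then show ?case using Cons by (auto intro!: linon_plus linon_smult)
qed

lemma lmod_homD:
  assumes "lmod_hom X Y f" "is_vmod br X" "is_vmod br' Y"
  shows "linon (carr X) f" "v \<in> carr X \<Longrightarrow> f v \<in> carr Y" "v \<in> carr X \<Longrightarrow> f (act X b v) = act Y b (f v)"
  using assms by (auto simp: lmod_hom_vops vmod_vops)

lemma lmod_homI:
  assumes "is_vmod br X" "is_vmod br' Y" "linon (carr X) f" "\<And>v. v \<in> carr X \<Longrightarrow> f v \<in> carr Y"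
    "\<And>b v. v \<in> carr X \<Longrightarrow> f (act X b v) = act Y b (f v)"
  shows "lmod_hom X Y f"
  using assms by (auto simp: lmod_hom_vops vmod_vops)

lemma lmod_hom_cong:
  assumes "lmod_hom X Y f" "is_vmod br X" "is_vmod br' Y" "\<And>v. v \<in> carr X \<Longrightarrow> f v = g v"
  shows "lmod_hom X Y g"
proof (rule lmod_homI[OF assms(2,3)])
  note h = lmod_homD[OF assms(1-3)]
  show "linon (carr X) g" using linon_cong[OF h(1) vmod_subspace[OF assms(2)] assms(4)] .
  show "g v \<in> carr Y" if "v \<in> carr X" for v using h(2)[OF that] assms(4)[OF that] by simp
  show "g (act X b v) = act Y b (g v)" if "v \<in> carr X" for b v
    using h(3)[OF that, of b] assms(4)[OF that] assms(4)[OF vmod_act[OF assms(2) that], of b] by simp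
qed

lemma lmod_hom_comp:
  assumes "lmod_hom X Y f" "lmod_hom Y Z g"
  shows "lmod_hom X Z (\<lambda>v. g (f v))"
  using assms unfolding lmod_hom_def clinear_map_def by (auto simp: Pi_iff)

text \<open>About \<open>Y\<close> nothing is known beyond the bijective homomorphism onto it. This
  generality is wanted for targets such as direct summands of \<open>dsum\<close>, which do not live
  on subspaces of \<open>vec\<close>.\<close>

lemma lmod_hom_inv:
  assumes f: "lmod_hom X Y f" and bij: "bij_betw f (carr X) (carr Y)" and X: "is_vmod br X"
  shows "lmod_hom Y X (inv_into (carr X) f)"
proof -
  let ?g = "inv_into (carr X) f"
  have inj: "inj_on f (carr X)" and im: "f ` carr X = carr Y" using bij by (auto simp: bij_betw_def)
  have g: "?g w \<in> carr X" "f (?g w) = w" if "w \<in> carr Y" for w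
    using that im by (auto intro: inv_into_into f_inv_into_f)
  note sx = vmod_subspace[OF X] vmod_vops[OF X, unfolded vops_def]
  have e: "?g w = v" if "v \<in> carr X" "f v = w" for v w using that inj by auto
  show ?thesis unfolding lmod_hom_def clinear_map_def
  proof (intro conjI ballI allI)
    show "?g \<in> carr Y \<rightarrow> carr X" using g by auto
  next
    fix u v assume "u \<in> carr Y" "v \<in> carr Y"
    then show "?g (vadd Y u v) = vadd X (?g u) (?g v)"
      using f g sx by (intro e) (auto simp: lmod_hom_def clinear_map_def vec.subspace_add)
  next
    fix c v assume "v \<in> carr Y"
    then show "?g (vsmul Y c v) = vsmul X c (?g v)"
      using f g sx by (intro e) (auto simp: lmod_hom_def clinear_map_def vec.subspace_scale)
  next
    fix b v assume "v \<in> carr Y"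
    then show "?g (act Y b v) = act X b (?g v)"
      using f g sx vmod_act[OF X] by (intro e) (auto simp: lmod_hom_def clinear_map_def)
  qed
qed

lemma submodule_vops:
  "vops X \<Longrightarrow> vec.subspace (carr X) \<Longrightarrow> submodule W X \<longleftrightarrow>
     vec.subspace W \<and> W \<subseteq> carr X \<and> (\<forall>b. \<forall>v\<in>W. act X b v \<in> W)"
  by (auto simp: submodule_def csubspace_def vops_def vec.subspace_0 vec.subspace_add vec.subspace_scale
      intro!: vec.subspaceI)

lemma submodule_iff:
  "is_vmod br X \<Longrightarrow> submodule W X \<longleftrightarrow>
     vec.subspace W \<and> W \<subseteq> carr X \<and> (\<forall>b. \<forall>v\<in>W. act X b v \<in> W)"
  by (simp add: submodule_vops vmod_vops vmod_subspace)

lemma is_vmod_submodule: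
  assumes X: "is_vmod br X" and W: "submodule W X"
  shows "is_vmod br (vmod W (act X))"
proof (rule is_vmodI)
  note W' = W[unfolded submodule_iff[OF X]]
  show "vec.subspace W" using W' by simp
  show "act X b v \<in> W" if "v \<in> W" for b v using W' that by simp
  show "linon W (act X b)" for b using linon_mono[OF vmod_linon[OF X]] W' by auto
  show "act X x (act X y v) = act X y (act X x v) + lc (act X) (br x y) v" if "v \<in> W" for x y v
    using vmod_bracket[OF X] that W' unfolding vmod_simps by blast
qed

lemma submodule_image:
  assumes "lmod_hom X Y f" and X: "is_vmod br X" and Y: "is_vmod br' Y"
  shows "submodule (f ` carr X) Y"
proof -
  note h = lmod_homD[OF assms]
  have "act Y b (f v) \<in> f ` carr X" if "v \<in> carr X" for b v
    using h(3)[OF that, of b] vmod_act[OF X that, of b] by (metis imageI)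
  then show ?thesis
    using h(2) linon_image_subspace[OF h(1) vmod_subspace[OF X] vmod_subspace[OF X]]
    by (auto simp: submodule_iff[OF Y])
qed

lemma submodule_vimage:
  assumes "lmod_hom X Y f" and X: "is_vmod br X" and Y: "is_vmod br' Y" and W: "submodule W Y"
  shows "submodule {v \<in> carr X. f v \<in> W} X"
proof -
  note h = lmod_homD[OF assms(1-3)] and s = vmod_subspace[OF X] and W' = W[unfolded submodule_iff[OF Y]]
  have "vec.subspace {v \<in> carr X. f v \<in> W}"
    using W' s linon_zero[OF h(1) vec.subspace_0[OF s]]
    by (intro vec.subspaceI)
      (auto simp: linon_add[OF h(1)] linon_scale[OF h(1)] vec.subspace_0 vec.subspace_add vec.subspace_scale)
  then show ?thesis using W' h(3) vmod_act[OF X] by (auto simp: submodule_iff[OF X])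
qed

lemma simple_module_iff:
  "is_vmod br X \<Longrightarrow> simple_module X \<longleftrightarrow> carr X \<noteq> {0} \<and> (\<forall>W. submodule W X \<longrightarrow> W = {0} \<or> W = carr X)"
  using vmod_vops[of br X] by (auto simp: simple_module_def vops_def)

lemma triv_mod_vmod: "is_vmod br triv_mod"
proof -
  have "lc (\<lambda>_ _. 0) l v = 0" for l :: "'a lincomb" and v by (induction l) (auto simp: lc_def)
  then show ?thesis unfolding triv_mod_def
    by (intro is_vmodI subspace_unit_space) (auto simp: vec.subspace_0 subspace_unit_space linon_def)
qed

lemma zero_mod_vmod: "is_vmod br (vmod {0} (\<lambda>_ _. 0))"
proof -
  have "lc (\<lambda>_ _. 0) l v = 0" for l :: "'a lincomb" and v by (induction l) (auto simp: lc_def)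
  then show ?thesis by (intro is_vmodI) (auto simp: linon_def vec.subspace_def)
qed

section \<open>Tensor products of modules\<close>

lemma carr_tensor_mod [simp]: "carr (tensor_mod A X) = tspace (carr A) (carr X)"
  by (simp add: tensor_mod_def)

lemma carr_triv_mod [simp]: "carr triv_mod = unit_space"
  by (simp add: triv_mod_def)

lemma act_triv_mod [simp]: "act triv_mod b v = 0"
  by (simp add: triv_mod_def)

context
  fixes br :: "'b \<Rightarrow> 'b \<Rightarrow> 'b lincomb" and A X :: "('b, vec) lmod"
  assumes A: "is_vmod br A" and X: "is_vmod br X"
begin

lemma act_tensor_mod:
  "a \<in> carr A \<Longrightarrow> x \<in> carr X \<Longrightarrow>
     act (tensor_mod A X) b (tensor_vec a x) = tensor_vec (act A b a) x + tensor_vec a (act X b x)"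
  using A X by (simp add: tensor_mod_def tmap_tensor vmod_subspace vmod_linon linon_id)

lemma linon_act_tensor_mod: "linon (tspace (carr A) (carr X)) (act (tensor_mod A X) b)"
  using A X by (auto simp: tensor_mod_def intro!: linon_plus tmap_linon vmod_subspace vmod_linon linon_id)

lemma act_tensor_mod_in: "t \<in> tspace (carr A) (carr X) \<Longrightarrow> act (tensor_mod A X) b t \<in> tspace (carr A) (carr X)"
  by (rule tspace_into[OF linon_act_tensor_mod subspace_tspace])
    (auto simp: act_tensor_mod intro!: vec.subspace_add subspace_tspace tensor_in_tspace vmod_act[OF A] vmod_act[OF X])

lemma lc_tensor_mod:
  "a \<in> carr A \<Longrightarrow> x \<in> carr X \<Longrightarrow>
     lc (act (tensor_mod A X)) l (tensor_vec a x) = tensor_vec (lc (act A) l a) x + tensor_vec a (lc (act X) l x)"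
  by (induction l) (auto simp: lc_def act_tensor_mod tensor_add_left tensor_add_right
      tensor_scale_left tensor_scale_right vec.scale_right_distrib algebra_simps)

lemma tensor_mod_vmod: "is_vmod br (tensor_mod A X)"
proof -
  let ?T = "tspace (carr A) (carr X)"
  let ?a = "act (tensor_mod A X)"
  have "is_vmod br (vmod ?T ?a)"
  proof (rule is_vmodI)
    fix x y t assume t: "t \<in> ?T"
    have c: "linon ?T (\<lambda>t. ?a x (?a y t))" for x y
      by (rule linon_comp[OF linon_act_tensor_mod act_tensor_mod_in linon_act_tensor_mod])
    have l: "linon ?T (lc ?a (br x y))" by (intro lc_linon linon_act_tensor_mod)
    show "?a x (?a y t) = ?a y (?a x t) + lc ?a (br x y) t"
    proof (rule tspace_ext[OF c linon_plus[OF c l] _ t])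
      fix u v assume u: "u \<in> carr A" and v: "v \<in> carr X"
      note ua = vmod_act[OF A u] and va = vmod_act[OF X v]
      show "?a x (?a y (tensor_vec u v)) = ?a y (?a x (tensor_vec u v)) + lc ?a (br x y) (tensor_vec u v)"
        using u v ua va
        by (simp add: act_tensor_mod lc_tensor_mod linon_add[OF linon_act_tensor_mod] tensor_in_tspace
            vmod_bracket[OF A u, of x y] vmod_bracket[OF X v, of x y] tensor_add_left tensor_add_right)
    qed
  qed (auto simp: subspace_tspace act_tensor_mod_in linon_act_tensor_mod)
  moreover have "tensor_mod A X = vmod ?T ?a" by (simp add: tensor_mod_def)
  ultimately show ?thesis by simp
qed

lemma lmod_hom_tensorI:
  assumes Y: "is_vmod br Y" and T: "linon (tspace (carr A) (carr X)) T"
    and i: "\<And>a x. a \<in> carr A \<Longrightarrow> x \<in> carr X \<Longrightarrow> T (tensor_vec a x) \<in> carr Y"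
    and h: "\<And>b a x. a \<in> carr A \<Longrightarrow> x \<in> carr X \<Longrightarrow>
      T (tensor_vec (act A b a) x) + T (tensor_vec a (act X b x)) = act Y b (T (tensor_vec a x))"
  shows "lmod_hom (tensor_mod A X) Y T"
proof (rule lmod_homI[OF tensor_mod_vmod Y])
  have i': "T t \<in> carr Y" if "t \<in> tspace (carr A) (carr X)" for t
    using tspace_into[OF T vmod_subspace[OF Y] i that] by simp
  then show "T t \<in> carr Y" if "t \<in> carr (tensor_mod A X)" for t using that by simp
  show "linon (carr (tensor_mod A X)) T" using T by simp
  fix b t assume "t \<in> carr (tensor_mod A X)"
  then have t: "t \<in> tspace (carr A) (carr X)" by simp
  show "T (act (tensor_mod A X) b t) = act Y b (T t)"
  proof (rule tspace_ext[OF linon_comp[OF linon_act_tensor_mod act_tensor_mod_in T] linon_comp[OF T i' vmod_linon[OF Y]] _ t])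
    fix u v assume u: "u \<in> carr A" and v: "v \<in> carr X"
    show "T (act (tensor_mod A X) b (tensor_vec u v)) = act Y b (T (tensor_vec u v))"
      using u v by (simp add: act_tensor_mod linon_add[OF T] tensor_in_tspace vmod_act[OF A] vmod_act[OF X] h)
  qed
qed

end

lemma lmod_hom_tmap:
  assumes A: "is_vmod br A" "is_vmod br A'" and X: "is_vmod br X" "is_vmod br X'"
    and f: "lmod_hom A A' f" and g: "lmod_hom X X' g"
  shows "lmod_hom (tensor_mod A X) (tensor_mod A' X') (tmap (carr A) (carr X) f g)"
proof -
  note fd = lmod_homD[OF f A] and gd = lmod_homD[OF g X]
  note t = tmap_linon[OF vmod_subspace[OF A(1)] vmod_subspace[OF X(1)] fd(1) gd(1)]
    tmap_tensor[OF vmod_subspace[OF A(1)] vmod_subspace[OF X(1)] fd(1) gd(1)]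
  show ?thesis
    by (rule lmod_hom_tensorI[OF A(1) X(1) tensor_mod_vmod[OF A(2) X(2)] t(1)])
      (simp_all add: t(2) fd gd tensor_in_tspace act_tensor_mod[OF A(2) X(2)] vmod_act[OF A(1)] vmod_act[OF X(1)])
qed

section \<open>Categories of modules\<close>

lemma lmod_hom_zero: "is_vmod br X \<Longrightarrow> is_vmod br' Y \<Longrightarrow> lmod_hom X Y (\<lambda>v. 0)"
proof (rule lmod_homI)
  assume Y: "is_vmod br' Y"
  show "0 = act Y b 0" for b
    using linon_zero[OF vmod_linon[OF Y] vec.subspace_0[OF vmod_subspace[OF Y]]] by simp
qed (auto simp: linon_def vmod_subspace vec.subspace_0)

lemma lmod_hom_add:
  assumes "lmod_hom X Y f" "lmod_hom X Y g" "is_vmod br X" "is_vmod br' Y"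
  shows "lmod_hom X Y (\<lambda>v. f v + g v)"
proof (rule lmod_homI[OF assms(3,4)])
  note f = lmod_homD[OF assms(1,3,4)] and g = lmod_homD[OF assms(2,3,4)]
  show "linon (carr X) (\<lambda>v. f v + g v)" by (intro linon_plus f g)
  show "f v + g v \<in> carr Y" if "v \<in> carr X" for v
    using f(2) g(2) that vmod_subspace[OF assms(4)] by (simp add: vec.subspace_add)
  show "f (act X b v) + g (act X b v) = act Y b (f v + g v)" if "v \<in> carr X" for b v
    using f(2,3) g(2,3) that by (simp add: linon_add[OF vmod_linon[OF assms(4)]])
qed

lemma lmod_hom_scale:
  assumes "lmod_hom X Y f" "is_vmod br X" "is_vmod br' Y"
  shows "lmod_hom X Y (\<lambda>v. vscale c (f v))"
proof (rule lmod_homI[OF assms(2,3)])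
  note f = lmod_homD[OF assms]
  show "linon (carr X) (\<lambda>v. vscale c (f v))" by (intro linon_smult f)
  show "vscale c (f v) \<in> carr Y" if "v \<in> carr X" for v
    using f(2) that vmod_subspace[OF assms(3)] by (simp add: vec.subspace_scale)
  show "vscale c (f (act X b v)) = act Y b (vscale c (f v))" if "v \<in> carr X" for b v
    using f(2,3) that by (simp add: linon_scale[OF vmod_linon[OF assms(3)]])
qed

lemma lmod_hom_id: "lmod_hom X X (\<lambda>v. v)"
  by (auto simp: lmod_hom_def clinear_map_def)

lemma lmod_hom_inclusion:
  "is_vmod br X \<Longrightarrow> submodule W X \<Longrightarrow> lmod_hom (vmod W (act X)) X (\<lambda>v. v)"
  by (rule lmod_homI[OF is_vmod_submodule]) (auto simp: submodule_iff linon_id)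

text \<open>The trivial intersection makes the two components of a vector unique (\<open>u\<close>,
  \<open>rI\<close>). The projections are therefore chosen pointwise, and additivity, homogeneity
  and equivariance all follow from uniqueness.\<close>

lemma direct_decomposition:
  assumes X: "is_vmod br X" and Y: "is_vmod br Y" and S: "is_vmod br S"
    and \<iota>: "lmod_hom X S \<iota>" "inj_on \<iota> (carr X)" and \<kappa>: "lmod_hom Y S \<kappa>" "inj_on \<kappa> (carr Y)"
    and disj: "\<iota> ` carr X \<inter> \<kappa> ` carr Y \<subseteq> {0}"
    and span: "\<And>v. v \<in> carr S \<Longrightarrow> \<exists>x\<in>carr X. \<exists>y\<in>carr Y. v = \<iota> x + \<kappa> y"
  obtains p q where "lmod_hom S X p" "lmod_hom S Y q"
    "\<And>x. x \<in> carr X \<Longrightarrow> p (\<iota> x) = x" "\<And>y. y \<in> carr Y \<Longrightarrow> q (\<kappa> y) = y"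
    "\<And>y. y \<in> carr Y \<Longrightarrow> p (\<kappa> y) = 0" "\<And>x. x \<in> carr X \<Longrightarrow> q (\<iota> x) = 0"
    "\<And>v. v \<in> carr S \<Longrightarrow> \<iota> (p v) + \<kappa> (q v) = v"
proof -
  note i = lmod_homD[OF \<iota>(1) X S] and k = lmod_homD[OF \<kappa>(1) Y S]
  note sX = vmod_subspace[OF X] and sY = vmod_subspace[OF Y] and sS = vmod_subspace[OF S]
  have "\<forall>v\<in>carr S. \<exists>z. fst z \<in> carr X \<and> snd z \<in> carr Y \<and> v = \<iota> (fst z) + \<kappa> (snd z)"
    using span by fastforce
  then obtain r where r: "\<And>v. v \<in> carr S \<Longrightarrow> fst (r v) \<in> carr X \<and> snd (r v) \<in> carr Y \<and> v = \<iota> (fst (r v)) + \<kappa> (snd (r v))"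
    by (metis bchoice)
  have u: "x = x' \<and> y = y'" if xy: "x \<in> carr X" "x' \<in> carr X" "y \<in> carr Y" "y' \<in> carr Y"
    and e: "\<iota> x + \<kappa> y = \<iota> x' + \<kappa> y'" for x x' y y'
  proof -
    have "\<iota> (x - x') = \<kappa> (y' - y)"
      using e xy sX sY by (simp add: linon_diff[OF i(1)] linon_diff[OF k(1)]) (simp add: algebra_simps)
    moreover have "x - x' \<in> carr X" "y' - y \<in> carr Y" using xy sX sY by (auto intro: vec.subspace_diff)
    ultimately have "\<iota> (x - x') = 0" "\<kappa> (y' - y) = 0" using disj by (metis (no_types, lifting) IntI imageI singletonD subsetD)+
    then have "\<iota> x = \<iota> x'" "\<kappa> y' = \<kappa> y"
      using xy sX sY by (simp_all add: linon_diff[OF i(1)] linon_diff[OF k(1)])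
    then show ?thesis using \<iota>(2) \<kappa>(2) xy by (auto dest: inj_onD)
  qed
  have rI: "fst (r v) = x \<and> snd (r v) = y" if "x \<in> carr X" "y \<in> carr Y" "v = \<iota> x + \<kappa> y" for v x y
  proof -
    have "v \<in> carr S" using that i(2) k(2) sS by (auto intro: vec.subspace_add)
    from r[OF this] that show ?thesis by (intro u) auto
  qed
  have add: "fst (r (v + w)) = fst (r v) + fst (r w) \<and> snd (r (v + w)) = snd (r v) + snd (r w)"
    if "v \<in> carr S" "w \<in> carr S" for v w
    using r[OF that(1)] r[OF that(2)] sX sY
    by (intro rI) (auto simp: linon_add[OF i(1)] linon_add[OF k(1)] vec.subspace_add algebra_simps)
  have scale: "fst (r (vscale c v)) = vscale c (fst (r v)) \<and> snd (r (vscale c v)) = vscale c (snd (r v))"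
    if "v \<in> carr S" for v c
    using r[OF that(1)] sX sY
    by (intro rI) (auto simp: linon_scale[OF i(1)] linon_scale[OF k(1)] vec.subspace_scale
        simp flip: vec.scale_right_distrib)
  have act: "fst (r (act S b v)) = act X b (fst (r v)) \<and> snd (r (act S b v)) = act Y b (snd (r v))"
    if v: "v \<in> carr S" for b v
  proof (rule rI)
    show "act X b (fst (r v)) \<in> carr X" "act Y b (snd (r v)) \<in> carr Y"
      using r[OF v] vmod_act[OF X] vmod_act[OF Y] by auto
    have "act S b v = act S b (\<iota> (fst (r v)) + \<kappa> (snd (r v)))" using r[OF v] by simp
    then show "act S b v = \<iota> (act X b (fst (r v))) + \<kappa> (act Y b (snd (r v)))"
      using conjunct1[OF r[OF v]] conjunct1[OF conjunct2[OF r[OF v]]]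
      by (simp only: linon_add[OF vmod_linon[OF S] i(2) k(2)] i k)
  qed
  have z: "\<iota> 0 = 0" "\<kappa> 0 = 0" "0 \<in> carr X" "0 \<in> carr Y"
    using linon_zero[OF i(1)] linon_zero[OF k(1)] sX sY by (auto simp: vec.subspace_0)
  show thesis
  proof (rule that[of "\<lambda>v. fst (r v)" "\<lambda>v. snd (r v)"])
    show "lmod_hom S X (\<lambda>v. fst (r v))" "lmod_hom S Y (\<lambda>v. snd (r v))"
      using r add scale act by (auto intro!: lmod_homI[OF S X] lmod_homI[OF S Y] linonI)
    fix x assume x: "x \<in> carr X"
    show "fst (r (\<iota> x)) = x" "snd (r (\<iota> x)) = 0" using rI[OF x z(4), of "\<iota> x"] z by auto
  next
    fix y assume y: "y \<in> carr Y"
    show "snd (r (\<kappa> y)) = y" "fst (r (\<kappa> y)) = 0" using rI[OF z(3) y, of "\<kappa> y"] z by auto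
  next
    fix v assume "v \<in> carr S"
    then show "\<iota> (fst (r v)) + \<kappa> (snd (r v)) = v" using r by simp
  qed
qed

text \<open>The direct sum is realised inside \<open>vec\<close> as sums of tensors with first
  factor \<open>bas 0\<close> (for \<open>X\<close>) and \<open>bas 1\<close> (for
  \<open>Y\<close>); \<open>pr i\<close> extracts the second factor of the part belonging to
  \<open>bas i\<close>.\<close>

lemma direct_sum_module:
  assumes X: "is_vmod br X" and Y: "is_vmod br Y"
  obtains S \<iota> \<kappa> where "is_vmod br S" "lmod_hom X S \<iota>" "inj_on \<iota> (carr X)" "lmod_hom Y S \<kappa>" "inj_on \<kappa> (carr Y)"
    "\<iota> ` carr X \<inter> \<kappa> ` carr Y \<subseteq> {0}" "\<And>v. v \<in> carr S \<Longrightarrow> \<exists>x\<in>carr X. \<exists>y\<in>carr Y. v = \<iota> x + \<kappa> y"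
proof -
  define j where "j i v = tensor_vec (bas i) v" for i v
  define pr where "pr i = lext (\<lambda>n. if fst (prod_decode n) = i then bas (snd (prod_decode n)) else 0)" for i
  have j: "lin (j i)" for i unfolding j_def by (rule lin_tensor_right)
  have pr: "lin (pr i)" for i unfolding pr_def by (rule lin_lext)
  have z: "lin (\<lambda>v. if i = k then v else 0)" for i k :: nat by (rule linI) auto
  have prj: "pr i (j k v) = (if i = k then v else 0)" for i k v
    by (rule lin_ext[OF lin_compose[OF j pr] z]) (auto simp: j_def pr_def tensor_bas)
  note sX = vmod_subspace[OF X] and sY = vmod_subspace[OF Y]
  define U where "U = {j 0 x + j 1 y | x y. x \<in> carr X \<and> y \<in> carr Y}"
  define a where "a b t = j 0 (act X b (pr 0 t)) + j 1 (act Y b (pr 1 t))" for b t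
  have a: "a b (j 0 x + j 1 y) = j 0 (act X b x) + j 1 (act Y b y)" for b x y
    by (simp add: a_def lin_add[OF pr] prj)
  have U: "vec.subspace U"
  proof (rule vec.subspaceI)
    show "0 \<in> U" unfolding U_def using lin_zero[OF j] sX sY vec.subspace_0
      by (metis (mono_tags, lifting) add.right_neutral mem_Collect_eq)
  next
    fix u v assume "u \<in> U" "v \<in> U"
    then obtain x y x' y' where "u = j 0 x + j 1 y" "v = j 0 x' + j 1 y'"
      "x \<in> carr X" "y \<in> carr Y" "x' \<in> carr X" "y' \<in> carr Y" by (auto simp: U_def)
    then have "u + v = j 0 (x + x') + j 1 (y + y')" "x + x' \<in> carr X" "y + y' \<in> carr Y"
      using sX sY by (simp_all add: lin_add[OF j] vec.subspace_add)
    then show "u + v \<in> U" unfolding U_def by blast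
  next
    fix c u assume "u \<in> U"
    then obtain x y where "u = j 0 x + j 1 y" "x \<in> carr X" "y \<in> carr Y" by (auto simp: U_def)
    then have "vscale c u = j 0 (vscale c x) + j 1 (vscale c y)" "vscale c x \<in> carr X" "vscale c y \<in> carr Y"
      using sX sY by (simp_all add: lin_scale[OF j] vec.scale_right_distrib vec.subspace_scale)
    then show "vscale c u \<in> U" unfolding U_def by blast
  qed
  have l: "linon U (a b)" for b
  proof (rule linonI)
    fix u v assume "u \<in> U" "v \<in> U"
    then obtain x y x' y' where uv: "u = j 0 x + j 1 y" "v = j 0 x' + j 1 y'"
      "x \<in> carr X" "y \<in> carr Y" "x' \<in> carr X" "y' \<in> carr Y" by (auto simp: U_def)
    then have "u + v = j 0 (x + x') + j 1 (y + y')" by (simp add: lin_add[OF j])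
    then show "a b (u + v) = a b u + a b v"
      using uv by (simp only: a) (simp add: lin_add[OF j] linon_add[OF vmod_linon[OF X]] linon_add[OF vmod_linon[OF Y]])
  next
    fix c u assume "u \<in> U"
    then obtain x y where u: "u = j 0 x + j 1 y" "x \<in> carr X" "y \<in> carr Y" by (auto simp: U_def)
    then have "vscale c u = j 0 (vscale c x) + j 1 (vscale c y)"
      by (simp add: lin_scale[OF j] vec.scale_right_distrib)
    then show "a b (vscale c u) = vscale c (a b u)"
      using u by (simp only: a) (simp add: lin_scale[OF j] linon_scale[OF vmod_linon[OF X]]
          linon_scale[OF vmod_linon[OF Y]] vec.scale_right_distrib)
  qed
  have lcU: "lc a l (j 0 x + j 1 y) = j 0 (lc (act X) l x) + j 1 (lc (act Y) l y)" for l x y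
    by (induction l) (auto simp: lc_def a[simplified] lin_zero[OF j] lin_add[OF j] lin_scale[OF j] vec.scale_right_distrib)
  have S: "is_vmod br (vmod U a)"
  proof (rule is_vmodI[OF U _ l])
    fix b v assume "v \<in> U"
    then obtain x y where u: "v = j 0 x + j 1 y" "x \<in> carr X" "y \<in> carr Y" by (auto simp: U_def)
    show "a b v \<in> U" unfolding u(1) a U_def using vmod_act[OF X u(2)] vmod_act[OF Y u(3)] by blast
  next
    fix b c v assume "v \<in> U"
    then obtain x y where u: "v = j 0 x + j 1 y" "x \<in> carr X" "y \<in> carr Y" by (auto simp: U_def)
    show "a b (a c v) = a c (a b v) + lc a (br b c) v"
      unfolding u(1) a lcU vmod_bracket[OF X u(2), of b c] vmod_bracket[OF Y u(3), of b c] lin_add[OF j]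
      by (simp add: algebra_simps)
  qed
  have z: "j i 0 = 0" for i by (rule lin_zero[OF j])
  have a0: "act X b 0 = 0" "act Y b 0 = 0" for b
    using linon_zero[OF vmod_linon[OF X]] linon_zero[OF vmod_linon[OF Y]] sX sY by (auto simp: vec.subspace_0)
  have j0: "j 0 x \<in> U" if "x \<in> carr X" for x
    using that vec.subspace_0[OF sY] z[of 1] unfolding U_def by (metis (mono_tags, lifting) add.right_neutral mem_Collect_eq)
  have j1: "j 1 y \<in> U" if "y \<in> carr Y" for y
    using that vec.subspace_0[OF sX] z[of 0] unfolding U_def by (metis (mono_tags, lifting) add.left_neutral mem_Collect_eq)
  show thesis
  proof (rule that[OF S, of "j 0" "j 1"])
    show "lmod_hom X (vmod U a) (j 0)"
      using a[of _ _ 0] by (intro lmod_homI[OF X S] lin_imp_linon j) (auto simp: j0 z a0)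
    show "lmod_hom Y (vmod U a) (j 1)"
      using a[of _ 0] by (intro lmod_homI[OF Y S] lin_imp_linon j) (auto simp: j1[simplified] z a0)
    show "inj_on (j 0) (carr X)" "inj_on (j 1) (carr Y)"
      by (metis inj_onI prj)+
    show "j 0 ` carr X \<inter> j 1 ` carr Y \<subseteq> {0}"
    proof
      fix v assume "v \<in> j 0 ` carr X \<inter> j 1 ` carr Y"
      then obtain x y where "v = j 0 x" "v = j 1 y" by (metis IntE imageE)
      then have "x = 0" using prj[of 0 0 x] prj[of 0 1 y] by simp
      then show "v \<in> {0}" using \<open>v = j 0 x\<close> z by simp
    qed
    show "\<exists>x\<in>carr X. \<exists>y\<in>carr Y. v = j 0 x + j 1 y" if "v \<in> carr (vmod U a)" for v
      using that by (auto simp: U_def)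
  qed
qed

text \<open>Only the linear part of \<open>C\<close> is prescribed, through
  \<open>lincat.truncate\<close>, so that plain, monoidal and module categories are covered at
  once.\<close>

locale vmodcat =
  fixes br :: "'b \<Rightarrow> 'b \<Rightarrow> 'b lincomb" and \<O> :: "'b vobj set" and C :: "('b vobj, 'b varr, 'm) lincat_scheme"
  assumes trunc: "lincat.truncate C = mod_lincat \<O>"
    and obj: "X \<in> \<O> \<Longrightarrow> is_vmod br X"
begin

definition arr :: "'b vobj \<Rightarrow> 'b vobj \<Rightarrow> (vec \<Rightarrow> vec) \<Rightarrow> bool" where
  "arr X Y f \<longleftrightarrow> X \<in> \<O> \<and> Y \<in> \<O> \<and> lmod_hom X Y f \<and> f \<in> extensional (carr X)"

lemma base [simp]:
  "Obj C = \<O>"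
  "Arr C = {(X, Y, f). arr X Y f}"
  "Dom C (X, Y, f) = X"
  "Cod C (X, Y, f) = Y"
  "Ide C X = (X, X, \<lambda>v\<in>carr X. v)"
  "Comp C (Y', Z, g) (X, Y, f) = (X, Z, compose (carr X) g f)"
  "Hadd C (X, Y, f) (X', Y', g) = (X, Y, \<lambda>v\<in>carr X. f v + g v)"
  "Hzero C X Y = (X, Y, \<lambda>v\<in>carr X. 0)"
  "Hsmul C c (X, Y, f) = (X, Y, \<lambda>v\<in>carr X. vscale c (f v))"
  for X Y Z X' Y' f g c
  using trunc by (auto simp: lincat.truncate_def mod_lincat_def arr_def)

lemma Hom_C: "\<phi> \<in> Hom C X Y \<longleftrightarrow> (\<exists>f. \<phi> = (X, Y, f) \<and> arr X Y f)"
  by (cases \<phi>) (auto simp: Hom_def)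

lemma arrD:
  assumes "arr X Y f"
  shows "X \<in> \<O>" "Y \<in> \<O>" "is_vmod br X" "is_vmod br Y" "vec.subspace (carr X)" "vec.subspace (carr Y)"
    "lmod_hom X Y f" "f \<in> extensional (carr X)" "linon (carr X) f" "v \<in> carr X \<Longrightarrow> f v \<in> carr Y"
proof -
  show 1: "X \<in> \<O>" "Y \<in> \<O>" "lmod_hom X Y f" "f \<in> extensional (carr X)" using assms by (auto simp: arr_def)
  then show 2: "is_vmod br X" "is_vmod br Y" by (auto intro: obj)
  then show "vec.subspace (carr X)" "vec.subspace (carr Y)" by (auto intro: vmod_subspace)
  show "linon (carr X) f" "v \<in> carr X \<Longrightarrow> f v \<in> carr Y" using lmod_homD[OF 1(3) 2] by auto
qed

lemma arrI: "X \<in> \<O> \<Longrightarrow> Y \<in> \<O> \<Longrightarrow> lmod_hom X Y f \<Longrightarrow> arr X Y (restrict f (carr X))"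
  unfolding arr_def using lmod_hom_cong[OF _ obj obj, of X Y f "restrict f (carr X)"] by auto

lemma arr_eqI: "arr X Y f \<Longrightarrow> arr X' Y' g \<Longrightarrow> X = X' \<Longrightarrow> (\<And>v. v \<in> carr X \<Longrightarrow> f v = g v) \<Longrightarrow> f = g"
  by (rule extensionalityI[of _ "carr X"]) (auto simp: arr_def)

lemma arr_comp: "arr X Y f \<Longrightarrow> arr Y Z g \<Longrightarrow> arr X Z (compose (carr X) g f)"
  unfolding compose_def by (rule arrI) (auto dest: arrD intro: lmod_hom_comp)

lemma arr_add: "arr X Y f \<Longrightarrow> arr X Y g \<Longrightarrow> arr X Y (\<lambda>v\<in>carr X. f v + g v)"
  by (rule arrI) (auto dest: arrD intro: lmod_hom_add)

lemma arr_scale: "arr X Y f \<Longrightarrow> arr X Y (\<lambda>v\<in>carr X. vscale c (f v))"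
  by (rule arrI) (auto dest: arrD intro: lmod_hom_scale)

lemma arr_zero: "X \<in> \<O> \<Longrightarrow> Y \<in> \<O> \<Longrightarrow> arr X Y (\<lambda>v\<in>carr X. 0)"
  by (rule arrI) (auto dest: obj intro: lmod_hom_zero)

lemma arr_ide: "X \<in> \<O> \<Longrightarrow> arr X X (\<lambda>v\<in>carr X. v)"
  by (rule arrI) (auto intro: lmod_hom_id)

lemma cvspace_hom: "X \<in> \<O> \<Longrightarrow> Y \<in> \<O> \<Longrightarrow> cvspace (homspace C X Y)"
proof -
  assume XY: "X \<in> \<O>" "Y \<in> \<O>"
  have neg: "\<exists>w\<in>Hom C X Y. Hadd C (X, Y, f) w = (X, Y, \<lambda>v\<in>carr X. 0)" if "arr X Y f" for f
    using arr_scale[OF that, of "-1"]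
    by (intro bexI[of _ "(X, Y, \<lambda>v\<in>carr X. vscale (-1) (f v))"]) (auto simp: Hom_C)
  have e: "(\<lambda>v\<in>carr X. 0 + f v) = f" "(\<lambda>v\<in>carr X. f v) = f" if "arr X Y f" for f
    using arrD(8)[OF that] by (auto simp: extensional_restrict)
  show ?thesis
    unfolding cvspace_def homspace_def
    using XY neg e
    by (auto simp: Hom_C arr_zero arr_add arr_scale add.assoc vec.scale_right_distrib vec.scale_left_distrib
        add.commute add.left_commute cong: restrict_cong)
qed

lemma linear_category: "linear_category C"
proof
  show "f \<in> Arr C \<Longrightarrow> Dom C f \<in> Obj C" "f \<in> Arr C \<Longrightarrow> Cod C f \<in> Obj C" for f
    by (auto dest: arrD)
  show "X \<in> Obj C \<Longrightarrow> Ide C X \<in> Hom C X X" for X by (auto simp: Hom_C arr_ide)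
  show "X \<in> Obj C \<Longrightarrow> Y \<in> Obj C \<Longrightarrow> cvspace (homspace C X Y)" for X Y by (simp add: cvspace_hom)
next
  fix f g X Y Z assume "f \<in> Hom C X Y" "g \<in> Hom C Y Z"
  then show "Comp C g f \<in> Hom C X Z" by (auto simp: Hom_C arr_comp)
next
  fix f g h W X Y Z assume "f \<in> Hom C W X" "g \<in> Hom C X Y" "h \<in> Hom C Y Z"
  then show "Comp C (Comp C h g) f = Comp C h (Comp C g f)"
    by (auto simp: Hom_C compose_def arrD intro!: restrict_ext)
next
  fix f X Y assume "f \<in> Hom C X Y"
  then obtain f' where f: "f = (X, Y, f')" "arr X Y f'" by (auto simp: Hom_C)
  show "Comp C f (Ide C X) = f" "Comp C (Ide C Y) f = f"
    using f arrD(8,10)[OF f(2)] by (auto simp: compose_def extensional_def restrict_def)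
next
  fix f f' g X Y Z assume "f \<in> Hom C X Y" "f' \<in> Hom C X Y" "g \<in> Hom C Y Z"
  then obtain f1 f1' g1 where f: "f = (X, Y, f1)" "arr X Y f1" "f' = (X, Y, f1')" "arr X Y f1'" "g = (Y, Z, g1)" "arr Y Z g1"
    by (auto simp: Hom_C)
  show "Comp C g (Hadd C f f') = Hadd C (Comp C g f) (Comp C g f')"
    using f arrD(10)[OF f(2)] arrD(10)[OF f(4)] by (auto simp: compose_def linon_add[OF arrD(9)[OF f(6)]] intro!: restrict_ext)
next
  fix f g g' X Y Z assume "f \<in> Hom C X Y" "g \<in> Hom C Y Z" "g' \<in> Hom C Y Z"
  then show "Comp C (Hadd C g g') f = Hadd C (Comp C g f) (Comp C g' f)"
    by (auto simp: Hom_C compose_def arrD intro!: restrict_ext)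
next
  fix f g c X Y Z assume "f \<in> Hom C X Y" "g \<in> Hom C Y Z"
  then obtain f1 g1 where f: "f = (X, Y, f1)" "arr X Y f1" "g = (Y, Z, g1)" "arr Y Z g1"
    by (auto simp: Hom_C)
  show "Comp C g (Hsmul C c f) = Hsmul C c (Comp C g f)"
    using f arrD(10)[OF f(2)] by (auto simp: compose_def linon_scale[OF arrD(9)[OF f(4)]] intro!: restrict_ext)
  show "Comp C (Hsmul C c g) f = Hsmul C c (Comp C g f)"
    using f arrD(10)[OF f(2)] by (auto simp: compose_def intro!: restrict_ext)
qed

lemma iso_arrI:
  assumes f: "arr X Y f" and bij: "bij_betw f (carr X) (carr Y)"
  shows "iso_arr C (X, Y, f)"
proof -
  let ?g = "restrict (inv_into (carr X) f) (carr Y)"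
  have g: "arr Y X ?g" using lmod_hom_inv[OF arrD(7)[OF f] bij arrD(3)[OF f]] arrD(1,2)[OF f] by (rule_tac arrI)
  have "compose (carr X) ?g f = (\<lambda>v\<in>carr X. v)" "compose (carr Y) f ?g = (\<lambda>v\<in>carr Y. v)"
    using bij by (auto simp: compose_def bij_betw_def inv_into_f_f f_inv_into_f intro!: restrict_ext)
  then show ?thesis unfolding iso_arr_def
    by (auto simp: f Hom_C intro!: bexI[of _ "(Y, X, ?g)"] exI[of _ ?g] g)
qed

lemma biproductI:
  assumes O: "X \<in> \<O>" "Y \<in> \<O>" "S \<in> \<O>"
    and \<iota>: "lmod_hom X S \<iota>" "inj_on \<iota> (carr X)" and \<kappa>: "lmod_hom Y S \<kappa>" "inj_on \<kappa> (carr Y)"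
    and disj: "\<iota> ` carr X \<inter> \<kappa> ` carr Y \<subseteq> {0}"
    and span: "\<And>v. v \<in> carr S \<Longrightarrow> \<exists>x\<in>carr X. \<exists>y\<in>carr Y. v = \<iota> x + \<kappa> y"
  shows "biproduct C X Y S"
proof -
  obtain p q where pq: "lmod_hom S X p" "lmod_hom S Y q"
    "\<And>x. x \<in> carr X \<Longrightarrow> p (\<iota> x) = x" "\<And>y. y \<in> carr Y \<Longrightarrow> q (\<kappa> y) = y"
    "\<And>y. y \<in> carr Y \<Longrightarrow> p (\<kappa> y) = 0" "\<And>x. x \<in> carr X \<Longrightarrow> q (\<iota> x) = 0"
    "\<And>v. v \<in> carr S \<Longrightarrow> \<iota> (p v) + \<kappa> (q v) = v"
    using direct_decomposition[OF obj[OF O(1)] obj[OF O(2)] obj[OF O(3)] assms(4-9)] by metis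
  note m = obj[OF O(1)] obj[OF O(2)] obj[OF O(3)]
  note i = lmod_homD(2)[OF \<iota>(1) m(1,3)] lmod_homD(2)[OF \<kappa>(1) m(2,3)]
    lmod_homD(2)[OF pq(1) m(3,1)] lmod_homD(2)[OF pq(2) m(3,2)]
  let ?i = "restrict \<iota> (carr X)" and ?j = "restrict \<kappa> (carr Y)"
    and ?p = "restrict p (carr S)" and ?q = "restrict q (carr S)"
  have a: "arr X S ?i" "arr Y S ?j" "arr S X ?p" "arr S Y ?q"
    using O \<iota> \<kappa> pq by (auto intro: arrI)
  show ?thesis unfolding biproduct_def
    apply (intro conjI)
    subgoal using O by simp
    subgoal using O by simp
    subgoal using O by simp
    apply (rule bexI[of _ "(X, S, ?i)"], rule bexI[of _ "(Y, S, ?j)"], rule bexI[of _ "(S, X, ?p)"], rule bexI[of _ "(S, Y, ?q)"])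
    using a pq i by (auto simp: Hom_C compose_def intro!: restrict_ext)
qed

lemma zero_objI:
  assumes Z: "Z \<in> \<O>" "carr Z = {0}"
  shows "zero_obj C Z"
  unfolding zero_obj_def
proof (intro conjI ballI)
  show "Z \<in> Obj C" using Z by simp
  fix X assume "X \<in> Obj C"
  then have X: "X \<in> \<O>" by simp
  show "\<exists>!f. f \<in> Hom C X Z"
  proof (rule ex1I[of _ "(X, Z, \<lambda>v\<in>carr X. 0)"])
    show "(X, Z, \<lambda>v\<in>carr X. 0) \<in> Hom C X Z" using X Z by (simp add: Hom_C arr_zero)
    fix f assume "f \<in> Hom C X Z"
    then show "f = (X, Z, \<lambda>v\<in>carr X. 0)"
      using arrD(10)[of X Z] Z(2) arr_zero[OF X Z(1)] by (auto simp: Hom_C intro!: arr_eqI)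
  qed
  show "\<exists>!f. f \<in> Hom C Z X"
  proof (rule ex1I[of _ "(Z, X, \<lambda>v\<in>carr Z. 0)"])
    show "(Z, X, \<lambda>v\<in>carr Z. 0) \<in> Hom C Z X" using arr_zero[OF Z(1) X] by (simp add: Hom_C)
    fix f assume "f \<in> Hom C Z X"
    then obtain f' where f: "f = (Z, X, f')" "arr Z X f'" by (auto simp: Hom_C)
    have "f' 0 = 0" using linon_zero[OF arrD(9)[OF f(2)]] Z by simp
    then show "f = (Z, X, \<lambda>v\<in>carr Z. 0)"
      using arr_eqI[OF f(2) arr_zero[OF Z(1) X] refl] Z(2) f by auto
  qed
qed

text \<open>An idempotent splits through its image, which is a homomorphic image of the object;
  hence the closure hypothesis on \<open>\<O>\<close>.\<close>

lemma idempotent_splitI: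
  assumes im: "\<And>X Y f. X \<in> \<O> \<Longrightarrow> is_vmod br Y \<Longrightarrow> lmod_hom X Y f \<Longrightarrow> f ` carr X = carr Y \<Longrightarrow> Y \<in> \<O>"
  shows "idempotent_split C"
  unfolding idempotent_split_def
proof (intro ballI impI)
  fix X e assume "X \<in> Obj C" "e \<in> Hom C X X" and id: "Comp C e e = e"
  then obtain e' where e: "e = (X, X, e')" "arr X X e'" by (auto simp: Hom_C)
  note m = arrD[OF e(2)]
  have ee: "e' (e' v) = e' v" if "v \<in> carr X" for v
    using id e that by (auto simp: compose_def dest: fun_cong[of _ _ v])
  have sub: "submodule (e' ` carr X) X" by (rule submodule_image[OF m(7,3,4)])
  let ?Y = "vmod (e' ` carr X) (act X)"
  have Y: "is_vmod br ?Y" by (rule is_vmod_submodule[OF m(3) sub])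
  have r: "lmod_hom X ?Y e'"
    by (rule lmod_homI[OF m(3) Y m(9)]) (auto simp: lmod_homD(3)[OF m(7) m(3,4)])
  have YO: "?Y \<in> \<O>" by (rule im[OF m(1) Y r]) simp
  have s: "lmod_hom ?Y X (\<lambda>v. v)" by (rule lmod_hom_inclusion[OF m(3) sub])
  let ?r = "restrict e' (carr X)" and ?s = "restrict (\<lambda>v. v) (carr ?Y)"
  have rs: "compose (carr ?Y) ?r ?s = (\<lambda>v\<in>carr ?Y. v)" "compose (carr X) ?s ?r = e'"
    using m(8,10) ee by (auto simp: compose_def extensional_def fun_eq_iff)
  show "\<exists>Y\<in>Obj C. \<exists>r\<in>Hom C X Y. \<exists>s\<in>Hom C Y X. Comp C r s = Ide C Y \<and> Comp C s r = e"
  proof (intro bexI conjI)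
    show "Comp C (X, ?Y, ?r) (?Y, X, ?s) = Ide C ?Y" "Comp C (?Y, X, ?s) (X, ?Y, ?r) = e"
      using rs by (simp_all add: e)
    show "(?Y, X, ?s) \<in> Hom C ?Y X" "(X, ?Y, ?r) \<in> Hom C X ?Y" "?Y \<in> Obj C"
      using arrI[OF m(1) YO r] arrI[OF YO m(1) s] YO by (simp_all add: Hom_C)
  qed
qed

end

lemma mod_moncat_simps:
  "lincat.truncate (mod_moncat \<O>) = mod_lincat \<O>"
  "tob (mod_moncat \<O>) = tensor_mod"
  "tarr (mod_moncat \<O>) (A, A', f) (B, B', g) = (tensor_mod A B, tensor_mod A' B', tmap (carr A) (carr B) f g)"
  "tunit (mod_moncat \<O>) = triv_mod"
  "assoc (mod_moncat \<O>) A B D = (tensor_mod (tensor_mod A B) D, tensor_mod A (tensor_mod B D),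
                tassoc (carr A) (carr B) (carr D))"
  "lunit (mod_moncat \<O>) A = (tensor_mod triv_mod A, A, tlunit (carr A))"
  "runit (mod_moncat \<O>) A = (tensor_mod A triv_mod, A, trunit (carr A))"
  by (simp_all add: mod_moncat_def moncat.defs lincat.defs mod_lincat_def)

lemma mod_modcat_simps:
  "lincat.truncate (mod_modcat r \<O>) = mod_lincat \<O>"
  "aob (mod_modcat r \<O>) A X = tensor_mod (r A) X"
  "aarr (mod_modcat r \<O>) (A, A', f) (X, X', g) =
     (tensor_mod (r A) X, tensor_mod (r A') X', tmap (carr A) (carr X) f g)"
  "massoc (mod_modcat r \<O>) A B X = (tensor_mod (r (tensor_mod A B)) X, tensor_mod (r A) (tensor_mod (r B) X),
                tassoc (carr A) (carr B) (carr X))"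
  "munit (mod_modcat r \<O>) X = (tensor_mod (r triv_mod) X, X, tlunit (carr X))"
  by (simp_all add: mod_modcat_def modcat.defs lincat.defs mod_lincat_def)

text \<open>Pulling back modules along a Lie algebra homomorphism, as far as the module structure on
  tensor products is concerned.\<close>

locale restriction =
  fixes cbr :: "'c \<Rightarrow> 'c \<Rightarrow> 'c lincomb" and br :: "'b \<Rightarrow> 'b \<Rightarrow> 'b lincomb" and r :: "'c vobj \<Rightarrow> 'b vobj"
  assumes r_vmod: "is_vmod cbr A \<Longrightarrow> is_vmod br (r A)"
    and r_carr [simp]: "carr (r A) = carr A"
    and r_hom: "is_vmod cbr A \<Longrightarrow> is_vmod cbr B \<Longrightarrow> lmod_hom A B f \<Longrightarrow> lmod_hom (r A) (r B) f"
    and r_tensor: "is_vmod cbr A \<Longrightarrow> is_vmod cbr B \<Longrightarrow> t \<in> tspace (carr A) (carr B) \<Longrightarrow>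
      act (r (tensor_mod A B)) b t = act (tensor_mod (r A) (r B)) b t"
    and r_triv: "v \<in> unit_space \<Longrightarrow> act (r triv_mod) b v = 0"
begin

text \<open>Leaving \<open>r\<close> general yields the associator of the monoidal category
  (\<open>r\<close> the identity) and that of a module category from one computation on triple
  tensors.\<close>

lemma hom_tassoc:
  assumes A: "is_vmod cbr A" and B: "is_vmod cbr B" and X: "is_vmod br X"
  shows "lmod_hom (tensor_mod (r (tensor_mod A B)) X) (tensor_mod (r A) (tensor_mod (r B) X)) (tassoc (carr A) (carr B) (carr X))"
proof (rule lmod_hom_tensorI)
  note s = vmod_subspace[OF A] vmod_subspace[OF B] vmod_subspace[OF X]
  note tl = tassoc_linon[OF s] and tt = tassoc_tensor[OF s] and ti = tassoc_into[OF s]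
  note rA = r_vmod[OF A] and rB = r_vmod[OF B]
  show AB: "is_vmod br (r (tensor_mod A B))" using A B by (intro r_vmod tensor_mod_vmod)
  show "is_vmod br X" by (rule X)
  show Y: "is_vmod br (tensor_mod (r A) (tensor_mod (r B) X))" using rA rB X by (intro tensor_mod_vmod)
  show "linon (tspace (carr (r (tensor_mod A B))) (carr X)) (tassoc (carr A) (carr B) (carr X))" using tl by simp
  show "tassoc (carr A) (carr B) (carr X) (tensor_vec a x) \<in> carr (tensor_mod (r A) (tensor_mod (r B) X))"
    if "a \<in> carr (r (tensor_mod A B))" "x \<in> carr X" for a x
    using that by (simp add: ti tensor_in_tspace)
  fix b t x assume "t \<in> carr (r (tensor_mod A B))" and x: "x \<in> carr X"
  then have t: "t \<in> tspace (carr A) (carr B)" by simp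
  note xx = vmod_act[OF X x, of b]
  note l = lin_imp_linon[OF lin_tensor_left]
  let ?T = "tassoc (carr A) (carr B) (carr X)"
  have i1: "act (r (tensor_mod A B)) b t \<in> tspace (carr A) (carr B)" if "t \<in> tspace (carr A) (carr B)" for t
    using vmod_act[OF AB, of t b] that by simp
  have l1: "linon (tspace (carr A) (carr B)) (act (r (tensor_mod A B)) b)" using vmod_linon[OF AB] by simp
  have l2: "linon (tspace (carr A) (carr B)) (\<lambda>t. ?T (tensor_vec (act (r (tensor_mod A B)) b t) x))"
    using i1 x by (intro linon_comp[OF linon_comp[OF l1 i1 l] _ tl]) (auto intro: tensor_in_tspace)
  have l3: "linon (tspace (carr A) (carr B)) (\<lambda>t. ?T (tensor_vec t x))" if "x \<in> carr X" for x
    using that by (intro linon_comp[OF l _ tl]) (auto intro: tensor_in_tspace)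
  have l4: "linon (tspace (carr A) (carr B)) (\<lambda>t. act (tensor_mod (r A) (tensor_mod (r B) X)) b (?T (tensor_vec t x)))"
    using x by (intro linon_comp[OF l3[OF x] _ vmod_linon[OF Y]]) (auto intro: tensor_in_tspace ti)
  show "?T (tensor_vec (act (r (tensor_mod A B)) b t) x) + ?T (tensor_vec t (act X b x)) =
     act (tensor_mod (r A) (tensor_mod (r B) X)) b (?T (tensor_vec t x))"
  proof (rule tspace_ext[OF linon_plus[OF l2 l3[OF xx]] l4 _ t])
    fix u v assume u: "u \<in> carr A" and v: "v \<in> carr B"
    have u': "act (r A) b u \<in> carr A" using vmod_act[OF rA, of u] u by simp
    have v': "act (r B) b v \<in> carr B" using vmod_act[OF rB, of v] v by simp
    show "?T (tensor_vec (act (r (tensor_mod A B)) b (tensor_vec u v)) x) + ?T (tensor_vec (tensor_vec u v) (act X b x)) =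
       act (tensor_mod (r A) (tensor_mod (r B) X)) b (?T (tensor_vec (tensor_vec u v) x))"
      using u v x u' v' xx
      by (simp add: r_tensor[OF A B] act_tensor_mod[OF rA rB] act_tensor_mod[OF rA tensor_mod_vmod[OF rB X]]
          act_tensor_mod[OF rB X] tt tensor_in_tspace tensor_add_left tensor_add_right linon_add[OF tl] add.assoc)
  qed
qed

lemma hom_tlunit:
  assumes X: "is_vmod br X"
  shows "lmod_hom (tensor_mod (r triv_mod) X) X (tlunit (carr X))"
  by (rule lmod_hom_tensorI[OF r_vmod[OF triv_mod_vmod] X X])
    (use vmod_subspace[OF X] vmod_act[OF X] linon_scale[OF vmod_linon[OF X]] in \<open>auto simp: tlunit_tensor tlunit_linon r_triv
      vec.subspace_scale linon_zero[OF tlunit_linon] vec.subspace_0 subspace_tspace\<close>)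

lemma hom_trunit:
  assumes A: "is_vmod cbr A"
  shows "lmod_hom (tensor_mod (r A) (r triv_mod)) (r A) (trunit (carr A))"
  by (rule lmod_hom_tensorI[OF r_vmod[OF A] r_vmod[OF triv_mod_vmod] r_vmod[OF A]])
    (use vmod_subspace[OF A] vmod_act[OF r_vmod[OF A]] linon_scale[OF vmod_linon[OF r_vmod[OF A]]] in \<open>auto simp: trunit_tensor trunit_linon r_triv
      vec.subspace_scale linon_zero[OF trunit_linon] vec.subspace_0 subspace_tspace\<close>)

end

lemma restriction_id: "restriction br br (\<lambda>A. A)"
  by standard auto

section \<open>Monoidal and module categories of modules\<close>

locale vmoncat =
  fixes cbr :: "'c \<Rightarrow> 'c \<Rightarrow> 'c lincomb" and \<P> :: "'c vobj set"
  assumes P_vmod: "A \<in> \<P> \<Longrightarrow> is_vmod cbr A"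
    and P_tensor: "A \<in> \<P> \<Longrightarrow> B \<in> \<P> \<Longrightarrow> tensor_mod A B \<in> \<P>"
    and P_triv: "triv_mod \<in> \<P>"
begin

sublocale P: vmodcat cbr \<P> "mod_moncat \<P>"
  by standard (auto simp: mod_moncat_simps P_vmod)

lemma P_sub: "A \<in> \<P> \<Longrightarrow> vec.subspace (carr A)"
  by (rule vmod_subspace[OF P_vmod])

lemma arr_tarr:
  assumes "P.arr A A' f" "P.arr B B' g"
  shows "P.arr (tensor_mod A B) (tensor_mod A' B') (tmap (carr A) (carr B) f g)"
  unfolding P.arr_def
  using P.arrD[OF assms(1)] P.arrD[OF assms(2)] by (simp add: P_tensor lmod_hom_tmap tmap_ext)

lemma arr_assoc:
  assumes "A \<in> \<P>" "B \<in> \<P>" "D \<in> \<P>"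
  shows "P.arr (tensor_mod (tensor_mod A B) D) (tensor_mod A (tensor_mod B D)) (tassoc (carr A) (carr B) (carr D))"
  unfolding P.arr_def
  using restriction.hom_tassoc[OF restriction_id, of cbr A B D] assms by (simp add: P_tensor P_vmod P_sub tassoc_ext)

lemma arr_lunit: "A \<in> \<P> \<Longrightarrow> P.arr (tensor_mod triv_mod A) A (tlunit (carr A))"
  unfolding P.arr_def using restriction.hom_tlunit[OF restriction_id, of cbr A]
  by (simp add: P_tensor P_triv P_vmod P_sub tlunit_ext)

lemma arr_runit: "A \<in> \<P> \<Longrightarrow> P.arr (tensor_mod A triv_mod) A (trunit (carr A))"
  unfolding P.arr_def using restriction.hom_trunit[OF restriction_id, of cbr A]
  by (simp add: P_tensor P_triv P_vmod P_sub trunit_ext)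

sublocale P: linear_category "mod_moncat \<P>"
  by (rule P.linear_category)

lemma monoidal_linear_category: "monoidal_linear_category (mod_moncat \<P>)"
proof
  let ?C = "mod_moncat \<P>"
  note [simp] = mod_moncat_simps P.Hom_C
  show "A \<in> Obj ?C \<Longrightarrow> B \<in> Obj ?C \<Longrightarrow> tob ?C A B \<in> Obj ?C" for A B by (simp add: P_tensor)
  show "f \<in> Hom ?C A A' \<Longrightarrow> g \<in> Hom ?C B B' \<Longrightarrow> tarr ?C f g \<in> Hom ?C (tob ?C A B) (tob ?C A' B')" for f g A A' B B'
    by (auto intro: arr_tarr)
  show "A \<in> Obj ?C \<Longrightarrow> B \<in> Obj ?C \<Longrightarrow> tarr ?C (Ide ?C A) (Ide ?C B) = Ide ?C (tob ?C A B)" for A B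
    by (simp add: tmap_id P_sub)
  show "f \<in> Hom ?C A A' \<Longrightarrow> f' \<in> Hom ?C A' A'' \<Longrightarrow> g \<in> Hom ?C B B' \<Longrightarrow> g' \<in> Hom ?C B' B'' \<Longrightarrow>
          tarr ?C (Comp ?C f' f) (Comp ?C g' g) = Comp ?C (tarr ?C f' g') (tarr ?C f g)" for f f' g g' A A' A'' B B' B''
    by (auto simp: P.arrD tmap_compose)
  show "f \<in> Hom ?C A A' \<Longrightarrow> f' \<in> Hom ?C A A' \<Longrightarrow> g \<in> Hom ?C B B' \<Longrightarrow>
          tarr ?C (Hadd ?C f f') g = Hadd ?C (tarr ?C f g) (tarr ?C f' g)" for f f' g A A' B B'
    by (auto simp: P.arrD tmap_add_left)
  show "f \<in> Hom ?C A A' \<Longrightarrow> g \<in> Hom ?C B B' \<Longrightarrow> g' \<in> Hom ?C B B' \<Longrightarrow>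
          tarr ?C f (Hadd ?C g g') = Hadd ?C (tarr ?C f g) (tarr ?C f g')" for f g g' A A' B B'
    by (auto simp: P.arrD tmap_add_right)
  show "f \<in> Hom ?C A A' \<Longrightarrow> g \<in> Hom ?C B B' \<Longrightarrow> tarr ?C (Hsmul ?C c f) g = Hsmul ?C c (tarr ?C f g)" for f g c A A' B B'
    by (auto simp: P.arrD tmap_scale_left)
  show "f \<in> Hom ?C A A' \<Longrightarrow> g \<in> Hom ?C B B' \<Longrightarrow> tarr ?C f (Hsmul ?C c g) = Hsmul ?C c (tarr ?C f g)" for f g c A A' B B'
    by (auto simp: P.arrD tmap_scale_right)
  show "tunit ?C \<in> Obj ?C" by (simp add: P_triv)
  show "A \<in> Obj ?C \<Longrightarrow> B \<in> Obj ?C \<Longrightarrow> D \<in> Obj ?C \<Longrightarrow> assoc ?C A B D \<in> Hom ?C (tob ?C (tob ?C A B) D) (tob ?C A (tob ?C B D))" for A B D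
    by (simp add: arr_assoc)
  show "A \<in> Obj ?C \<Longrightarrow> B \<in> Obj ?C \<Longrightarrow> D \<in> Obj ?C \<Longrightarrow> iso_arr ?C (assoc ?C A B D)" for A B D
    using arr_assoc[of A B D] by (auto intro!: P.iso_arrI simp: tassoc_bij P_sub)
  show "f \<in> Hom ?C A A' \<Longrightarrow> g \<in> Hom ?C B B' \<Longrightarrow> h \<in> Hom ?C D D' \<Longrightarrow>
          Comp ?C (assoc ?C A' B' D') (tarr ?C (tarr ?C f g) h) =
          Comp ?C (tarr ?C f (tarr ?C g h)) (assoc ?C A B D)" for f g h A A' B B' D D'
    by (auto simp: P.arrD tassoc_natural)
  show "A \<in> Obj ?C \<Longrightarrow> lunit ?C A \<in> Hom ?C (tob ?C (tunit ?C) A) A" for A by (simp add: arr_lunit)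
  show "A \<in> Obj ?C \<Longrightarrow> iso_arr ?C (lunit ?C A)" for A
    using arr_lunit[of A] by (auto intro!: P.iso_arrI simp: tlunit_bij P_sub)
  show "f \<in> Hom ?C A A' \<Longrightarrow> Comp ?C (lunit ?C A') (tarr ?C (Ide ?C (tunit ?C)) f) = Comp ?C f (lunit ?C A)" for f A A'
    by (auto simp: P.arrD tlunit_natural)
  show "A \<in> Obj ?C \<Longrightarrow> runit ?C A \<in> Hom ?C (tob ?C A (tunit ?C)) A" for A by (simp add: arr_runit)
  show "A \<in> Obj ?C \<Longrightarrow> iso_arr ?C (runit ?C A)" for A
    using arr_runit[of A] by (auto intro!: P.iso_arrI simp: trunit_bij P_sub)
  show "f \<in> Hom ?C A A' \<Longrightarrow> Comp ?C (runit ?C A') (tarr ?C f (Ide ?C (tunit ?C))) = Comp ?C f (runit ?C A)" for f A A'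
    by (auto simp: P.arrD trunit_natural)
  show "A \<in> Obj ?C \<Longrightarrow> B \<in> Obj ?C \<Longrightarrow> D \<in> Obj ?C \<Longrightarrow> G \<in> Obj ?C \<Longrightarrow>
          Comp ?C (assoc ?C A B (tob ?C D G)) (assoc ?C (tob ?C A B) D G) =
          Comp ?C (tarr ?C (Ide ?C A) (assoc ?C B D G))
            (Comp ?C (assoc ?C A (tob ?C B D) G) (tarr ?C (assoc ?C A B D) (Ide ?C G)))" for A B D G
    by (simp add: tensor_pentagon P_sub)
  show "A \<in> Obj ?C \<Longrightarrow> B \<in> Obj ?C \<Longrightarrow>
          Comp ?C (tarr ?C (Ide ?C A) (lunit ?C B)) (assoc ?C A (tunit ?C) B) = tarr ?C (runit ?C A) (Ide ?C B)" for A B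
    by (simp add: tensor_triangle P_sub)
qed

end

locale vactcat = vmoncat cbr \<P> + restriction cbr br r + M: vmodcat br \<O> "mod_modcat r \<O>"
  for cbr :: "'c \<Rightarrow> 'c \<Rightarrow> 'c lincomb" and \<P> and br :: "'b \<Rightarrow> 'b \<Rightarrow> 'b lincomb" and r and \<O> +
  assumes O_tensor: "A \<in> \<P> \<Longrightarrow> X \<in> \<O> \<Longrightarrow> tensor_mod (r A) X \<in> \<O>"
begin

lemma O_sub: "X \<in> \<O> \<Longrightarrow> vec.subspace (carr X)"
  by (rule vmod_subspace[OF M.obj])

lemma arr_aarr:
  assumes "P.arr A A' f" "M.arr X X' g"
  shows "M.arr (tensor_mod (r A) X) (tensor_mod (r A') X') (tmap (carr A) (carr X) f g)"
  unfolding M.arr_def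
  using P.arrD[OF assms(1)] M.arrD[OF assms(2)] lmod_hom_tmap[of br "r A" "r A'" X X' f g]
  by (simp add: O_tensor r_vmod r_hom tmap_ext)

lemma arr_massoc:
  assumes "A \<in> \<P>" "B \<in> \<P>" "X \<in> \<O>"
  shows "M.arr (tensor_mod (r (tensor_mod A B)) X) (tensor_mod (r A) (tensor_mod (r B) X)) (tassoc (carr A) (carr B) (carr X))"
  unfolding M.arr_def using assms by (simp add: P_tensor O_tensor hom_tassoc P_vmod M.obj P_sub O_sub tassoc_ext)

lemma arr_munit: "X \<in> \<O> \<Longrightarrow> M.arr (tensor_mod (r triv_mod) X) X (tlunit (carr X))"
  unfolding M.arr_def by (simp add: O_tensor P_triv hom_tlunit M.obj O_sub tlunit_ext)

lemma module_category: "module_category (mod_moncat \<P>) (mod_modcat r \<O>)"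
proof -
  interpret C: monoidal_linear_category "mod_moncat \<P>" by (rule monoidal_linear_category)
  interpret L: linear_category "mod_modcat r \<O>" by (rule M.linear_category)
  show ?thesis
  proof
    let ?C = "mod_moncat \<P>" and ?M = "mod_modcat r \<O>"
    note [simp] = mod_moncat_simps mod_modcat_simps P.Hom_C M.Hom_C
    show "A \<in> Obj ?C \<Longrightarrow> X \<in> Obj ?M \<Longrightarrow> aob ?M A X \<in> Obj ?M" for A X by (simp add: O_tensor)
    show "f \<in> Hom ?C A A' \<Longrightarrow> g \<in> Hom ?M X X' \<Longrightarrow> aarr ?M f g \<in> Hom ?M (aob ?M A X) (aob ?M A' X')" for f g A A' X X'
      by (auto intro: arr_aarr)
    show "A \<in> Obj ?C \<Longrightarrow> X \<in> Obj ?M \<Longrightarrow> aarr ?M (Ide ?C A) (Ide ?M X) = Ide ?M (aob ?M A X)" for A X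
      by (simp add: tmap_id P_sub O_sub)
    show "f \<in> Hom ?C A A' \<Longrightarrow> f' \<in> Hom ?C A' A'' \<Longrightarrow> g \<in> Hom ?M X X' \<Longrightarrow> g' \<in> Hom ?M X' X'' \<Longrightarrow>
            aarr ?M (Comp ?C f' f) (Comp ?M g' g) = Comp ?M (aarr ?M f' g') (aarr ?M f g)" for f f' g g' A A' A'' X X' X''
      by (auto simp: P.arrD M.arrD tmap_compose)
    show "f \<in> Hom ?C A A' \<Longrightarrow> f' \<in> Hom ?C A A' \<Longrightarrow> g \<in> Hom ?M X X' \<Longrightarrow>
            aarr ?M (Hadd ?C f f') g = Hadd ?M (aarr ?M f g) (aarr ?M f' g)" for f f' g A A' X X'
      by (auto simp: P.arrD M.arrD tmap_add_left)
    show "f \<in> Hom ?C A A' \<Longrightarrow> g \<in> Hom ?M X X' \<Longrightarrow> g' \<in> Hom ?M X X' \<Longrightarrow>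
            aarr ?M f (Hadd ?M g g') = Hadd ?M (aarr ?M f g) (aarr ?M f g')" for f g g' A A' X X'
      by (auto simp: P.arrD M.arrD tmap_add_right)
    show "f \<in> Hom ?C A A' \<Longrightarrow> g \<in> Hom ?M X X' \<Longrightarrow> aarr ?M (Hsmul ?C c f) g = Hsmul ?M c (aarr ?M f g)" for f g c A A' X X'
      by (auto simp: P.arrD M.arrD tmap_scale_left)
    show "f \<in> Hom ?C A A' \<Longrightarrow> g \<in> Hom ?M X X' \<Longrightarrow> aarr ?M f (Hsmul ?M c g) = Hsmul ?M c (aarr ?M f g)" for f g c A A' X X'
      by (auto simp: P.arrD M.arrD tmap_scale_right)
    show "A \<in> Obj ?C \<Longrightarrow> B \<in> Obj ?C \<Longrightarrow> X \<in> Obj ?M \<Longrightarrow>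
            massoc ?M A B X \<in> Hom ?M (aob ?M (tob ?C A B) X) (aob ?M A (aob ?M B X))" for A B X
      by (simp add: arr_massoc)
    show "A \<in> Obj ?C \<Longrightarrow> B \<in> Obj ?C \<Longrightarrow> X \<in> Obj ?M \<Longrightarrow> iso_arr ?M (massoc ?M A B X)" for A B X
      using arr_massoc[of A B X] by (auto intro!: M.iso_arrI simp: tassoc_bij P_sub O_sub)
    show "f \<in> Hom ?C A A' \<Longrightarrow> k \<in> Hom ?C B B' \<Longrightarrow> g \<in> Hom ?M X X' \<Longrightarrow>
            Comp ?M (massoc ?M A' B' X') (aarr ?M (tarr ?C f k) g) =
            Comp ?M (aarr ?M f (aarr ?M k g)) (massoc ?M A B X)" for f k g A A' B B' X X'
      by (auto simp: P.arrD M.arrD tassoc_natural)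
    show "X \<in> Obj ?M \<Longrightarrow> munit ?M X \<in> Hom ?M (aob ?M (tunit ?C) X) X" for X by (simp add: arr_munit)
    show "X \<in> Obj ?M \<Longrightarrow> iso_arr ?M (munit ?M X)" for X
      using arr_munit[of X] by (auto intro!: M.iso_arrI simp: tlunit_bij O_sub)
    show "g \<in> Hom ?M X X' \<Longrightarrow> Comp ?M (munit ?M X') (aarr ?M (Ide ?C (tunit ?C)) g) = Comp ?M g (munit ?M X)" for g X X'
      by (auto simp: M.arrD tlunit_natural)
    show "A \<in> Obj ?C \<Longrightarrow> B \<in> Obj ?C \<Longrightarrow> D \<in> Obj ?C \<Longrightarrow> X \<in> Obj ?M \<Longrightarrow>
            Comp ?M (massoc ?M A B (aob ?M D X)) (massoc ?M (tob ?C A B) D X) =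
            Comp ?M (aarr ?M (Ide ?C A) (massoc ?M B D X))
              (Comp ?M (massoc ?M A (tob ?C B D) X) (aarr ?M (assoc ?C A B D) (Ide ?M X)))" for A B D X
      by (simp add: tensor_pentagon P_sub O_sub)
    show "A \<in> Obj ?C \<Longrightarrow> X \<in> Obj ?M \<Longrightarrow>
            Comp ?M (aarr ?M (Ide ?C A) (munit ?M X)) (massoc ?M A (tunit ?C) X) = aarr ?M (runit ?C A) (Ide ?M X)" for A X
      by (simp add: tensor_triangle P_sub O_sub)
  qed
qed

end

section \<open>Semisimple linear categories\<close>

lemma cvspace_smul_0:
  assumes V: "cvspace V" and v: "v \<in> carr V" shows "vsmul V 0 v = vzero V"
proof -
  let ?z = "vsmul V 0 v"
  have z: "?z \<in> carr V" using V v by (simp add: cvspace_def)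
  have zz: "vadd V ?z ?z = ?z" using V v unfolding cvspace_def by (metis add_0)
  obtain w where w: "w \<in> carr V" "vadd V ?z w = vzero V"
  proof -
    have "\<forall>v\<in>carr V. \<exists>w\<in>carr V. vadd V v w = vzero V" using V unfolding cvspace_def by (elim conjE)
    then show thesis using z that by blast
  qed
  have "vadd V ?z (vadd V ?z w) = vadd V ?z w" using V z w zz unfolding cvspace_def by metis
  then have "vadd V ?z (vzero V) = vzero V" using w by simp
  then show ?thesis using V z unfolding cvspace_def by metis
qed

context linear_category
begin

lemma hom_obj: "f \<in> Hom C X Y \<Longrightarrow> X \<in> Obj C \<and> Y \<in> Obj C"
  using Dom_in Cod_in by (auto simp: Hom_def)

lemma zero_in: "X \<in> Obj C \<Longrightarrow> Y \<in> Obj C \<Longrightarrow> Hzero C X Y \<in> Hom C X Y"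
  using Hom_cvspace[of X Y] by (simp add: cvspace_def homspace_def)

lemma add_in: "f \<in> Hom C X Y \<Longrightarrow> g \<in> Hom C X Y \<Longrightarrow> Hadd C f g \<in> Hom C X Y"
  using hom_obj[of f X Y] Hom_cvspace[of X Y] by (simp add: cvspace_def homspace_def)

lemma smul_in: "f \<in> Hom C X Y \<Longrightarrow> Hsmul C c f \<in> Hom C X Y"
  using hom_obj[of f X Y] Hom_cvspace[of X Y] by (simp add: cvspace_def homspace_def)

lemma zero_add:
  assumes "f \<in> Hom C X Y" shows "Hadd C (Hzero C X Y) f = f"
proof -
  let ?V = "homspace C X Y"
  have "cvspace ?V" using hom_obj[OF assms] Hom_cvspace by blast
  then have "\<forall>v\<in>carr ?V. vadd ?V (vzero ?V) v = v" unfolding cvspace_def by (elim conjE)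
  then show ?thesis using assms by (simp add: homspace_def)
qed

lemma add_commute: "f \<in> Hom C X Y \<Longrightarrow> g \<in> Hom C X Y \<Longrightarrow> Hadd C f g = Hadd C g f"
  using hom_obj[of f X Y] Hom_cvspace[of X Y] by (simp add: cvspace_def homspace_def)

lemma add_zero:
  assumes f: "f \<in> Hom C X Y" shows "Hadd C f (Hzero C X Y) = f"
proof -
  have "Hzero C X Y \<in> Hom C X Y" using zero_in hom_obj[OF f] by blast
  from add_commute[OF f this] zero_add[OF f] show ?thesis by (rule trans)
qed

lemma smul_smul: "f \<in> Hom C X Y \<Longrightarrow> Hsmul C c (Hsmul C d f) = Hsmul C (c * d) f"
  using hom_obj[of f X Y] Hom_cvspace[of X Y] by (simp add: cvspace_def homspace_def)

lemma smul_one: "f \<in> Hom C X Y \<Longrightarrow> Hsmul C 1 f = f"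
  using hom_obj[of f X Y] Hom_cvspace[of X Y] by (simp add: cvspace_def homspace_def)

lemma smul_0: "f \<in> Hom C X Y \<Longrightarrow> Hsmul C 0 f = Hzero C X Y"
  using hom_obj[of f X Y] cvspace_smul_0[OF Hom_cvspace[of X Y], of f] by (simp add: homspace_def)

lemma smul_zero: "X \<in> Obj C \<Longrightarrow> Y \<in> Obj C \<Longrightarrow> Hsmul C c (Hzero C X Y) = Hzero C X Y"
  using smul_smul[of "Hzero C X Y" X Y c 0] smul_0[of "Hzero C X Y" X Y] zero_in by simp

lemma Comp_zero:
  assumes g: "g \<in> Hom C Y Z" and X: "X \<in> Obj C"
  shows "Comp C g (Hzero C X Y) = Hzero C X Z"
proof -
  have z: "Hzero C X Y \<in> Hom C X Y" using zero_in X hom_obj[OF g] by blast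
  have "Comp C g (Hsmul C 0 (Hzero C X Y)) = Hsmul C 0 (Comp C g (Hzero C X Y))"
    by (rule Comp_smul_right[OF z g])
  then show ?thesis unfolding smul_0[OF z] smul_0[OF Comp_in[OF z g]] .
qed

lemma zero_Comp:
  assumes f: "f \<in> Hom C X Y" and Z: "Z \<in> Obj C"
  shows "Comp C (Hzero C Y Z) f = Hzero C X Z"
proof -
  have z: "Hzero C Y Z \<in> Hom C Y Z" using zero_in Z hom_obj[OF f] by blast
  have "Comp C (Hsmul C 0 (Hzero C Y Z)) f = Hsmul C 0 (Comp C (Hzero C Y Z) f)"
    by (rule Comp_smul_left[OF f z])
  then show ?thesis unfolding smul_0[OF z] smul_0[OF Comp_in[OF f z]] .
qed

lemma zero_obj_iff: "Z \<in> Obj C \<Longrightarrow> zero_obj C Z \<longleftrightarrow> Ide C Z = Hzero C Z Z"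
proof
  assume Z: "Z \<in> Obj C" and "zero_obj C Z"
  then show "Ide C Z = Hzero C Z Z" using Ide_in zero_in unfolding zero_obj_def by blast
next
  assume Z: "Z \<in> Obj C" and e: "Ide C Z = Hzero C Z Z"
  show "zero_obj C Z" unfolding zero_obj_def
  proof (intro conjI ballI Z)
    fix X assume X: "X \<in> Obj C"
    show "\<exists>!f. f \<in> Hom C X Z"
    proof (rule ex1I)
      show "Hzero C X Z \<in> Hom C X Z" by (rule zero_in[OF X Z])
    next
      fix f assume "f \<in> Hom C X Z"
      then show "f = Hzero C X Z" using Ide_Comp zero_Comp e Z by metis
    qed
    show "\<exists>!f. f \<in> Hom C Z X"
    proof (rule ex1I)
      show "Hzero C Z X \<in> Hom C Z X" by (rule zero_in[OF Z X])
    next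
      fix f assume "f \<in> Hom C Z X"
      then show "f = Hzero C Z X" using Comp_Ide Comp_zero e Z by metis
    qed
  qed
qed

lemma hom_zero_obj_left:
  assumes Z: "zero_obj C Z" and f: "f \<in> Hom C Z X" shows "f = Hzero C Z X"
proof -
  have o: "Z \<in> Obj C" using hom_obj[OF f] by simp
  show ?thesis using Comp_Ide[OF f] Comp_zero[OF f o] Z zero_obj_iff[OF o] by simp
qed

lemma hom_zero_obj_right:
  assumes Z: "zero_obj C Z" and f: "f \<in> Hom C X Z" shows "f = Hzero C X Z"
proof -
  have o: "Z \<in> Obj C" using hom_obj[OF f] by simp
  show ?thesis using Ide_Comp[OF f] zero_Comp[OF f o] Z zero_obj_iff[OF o] by simp
qed

lemma biproductE:
  assumes "biproduct C X Y S"
  obtains i j p q where "i \<in> Hom C X S" "j \<in> Hom C Y S" "p \<in> Hom C S X" "q \<in> Hom C S Y"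
    "Comp C p i = Ide C X" "Comp C q j = Ide C Y" "Comp C p j = Hzero C Y X" "Comp C q i = Hzero C X Y"
    "Hadd C (Comp C i p) (Comp C j q) = Ide C S"
  using assms unfolding biproduct_def by (elim conjE bexE) (rule that)

lemma split_source:
  assumes "i \<in> Hom C X S" "j \<in> Hom C Y S" "p \<in> Hom C S X" "q \<in> Hom C S Y"
    "Hadd C (Comp C i p) (Comp C j q) = Ide C S" "f \<in> Hom C S Z"
  shows "f = Hadd C (Comp C (Comp C f i) p) (Comp C (Comp C f j) q)"
proof -
  note m = assms(1-4) and f = assms(6)
  have "f = Comp C f (Hadd C (Comp C i p) (Comp C j q))" using Comp_Ide[OF f] assms(5) by simp
  also have "\<dots> = Hadd C (Comp C f (Comp C i p)) (Comp C f (Comp C j q))"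
    by (rule Comp_add_right[OF Comp_in[OF m(3,1)] Comp_in[OF m(4,2)] f])
  finally show ?thesis using Comp_assoc[OF m(3,1) f] Comp_assoc[OF m(4,2) f] by simp
qed

lemma split_target:
  assumes "i \<in> Hom C X S" "j \<in> Hom C Y S" "p \<in> Hom C S X" "q \<in> Hom C S Y"
    "Hadd C (Comp C i p) (Comp C j q) = Ide C S" "f \<in> Hom C Z S"
  shows "f = Hadd C (Comp C i (Comp C p f)) (Comp C j (Comp C q f))"
proof -
  note m = assms(1-4) and f = assms(6)
  have "f = Comp C (Hadd C (Comp C i p) (Comp C j q)) f" using Ide_Comp[OF f] assms(5) by simp
  also have "\<dots> = Hadd C (Comp C (Comp C i p) f) (Comp C (Comp C j q) f)"
    by (rule Comp_add_left[OF f Comp_in[OF m(3,1)] Comp_in[OF m(4,2)]])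
  finally show ?thesis using Comp_assoc[OF f m(3,1)] Comp_assoc[OF f m(4,2)] by simp
qed

lemma csubspace_hom_iff:
  "csubspace W (homspace C X Y) \<longleftrightarrow> W \<subseteq> Hom C X Y \<and> Hzero C X Y \<in> W \<and>
     (\<forall>f\<in>W. \<forall>g\<in>W. Hadd C f g \<in> W) \<and> (\<forall>c. \<forall>f\<in>W. Hsmul C c f \<in> W)"
  by (simp add: csubspace_def homspace_def)

lemma fin_dim_hom_iff:
  "fin_dim (homspace C X Y) \<longleftrightarrow> (\<exists>B. finite B \<and> B \<subseteq> Hom C X Y \<and>
     (\<forall>W. csubspace W (homspace C X Y) \<and> B \<subseteq> W \<longrightarrow> W = Hom C X Y))"
  by (simp add: fin_dim_def homspace_def)

lemma fin_dim_homE: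
  assumes "fin_dim (homspace C X Y)"
  obtains B where "finite B" "B \<subseteq> Hom C X Y"
    "\<And>W. csubspace W (homspace C X Y) \<Longrightarrow> B \<subseteq> W \<Longrightarrow> W = Hom C X Y"
proof -
  from assms obtain B where B: "finite B \<and> B \<subseteq> Hom C X Y \<and>
     (\<forall>W. csubspace W (homspace C X Y) \<and> B \<subseteq> W \<longrightarrow> W = Hom C X Y)"
    unfolding fin_dim_hom_iff by (elim exE)
  show thesis by (rule that[of B]) (use B in simp_all)
qed

text \<open>Arrows out of \<open>S\<close> are sums of arrows through \<open>p\<close> and through
  \<open>q\<close>. As \<open>fin_dim\<close> speaks of subspaces containing a finite set, a
  subspace \<open>W\<close> containing \<open>?B\<close> is pulled back along composition with
  \<open>p\<close> and with \<open>q\<close>, and both pullbacks turn out to be everything.\<close>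

lemma fin_dim_source:
  assumes b: "biproduct C X Y S" and "fin_dim (homspace C X Z)" "fin_dim (homspace C Y Z)" and Z: "Z \<in> Obj C"
  shows "fin_dim (homspace C S Z)"
proof -
  obtain i j p q where m: "i \<in> Hom C X S" "j \<in> Hom C Y S" "p \<in> Hom C S X" "q \<in> Hom C S Y"
    "Hadd C (Comp C i p) (Comp C j q) = Ide C S" by (rule biproductE[OF b]) (rule that, assumption+)
  obtain B where B: "finite B" "B \<subseteq> Hom C X Z" "\<And>W. csubspace W (homspace C X Z) \<Longrightarrow> B \<subseteq> W \<Longrightarrow> W = Hom C X Z"
    by (rule fin_dim_homE[OF assms(2)]) (rule that)
  obtain D where D: "finite D" "D \<subseteq> Hom C Y Z" "\<And>W. csubspace W (homspace C Y Z) \<Longrightarrow> D \<subseteq> W \<Longrightarrow> W = Hom C Y Z"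
    by (rule fin_dim_homE[OF assms(3)]) (rule that)
  let ?B = "(\<lambda>f. Comp C f p) ` B \<union> (\<lambda>f. Comp C f q) ` D"
  have o: "X \<in> Obj C" "Y \<in> Obj C" "S \<in> Obj C" using m hom_obj by blast+
  have pre: "csubspace {f \<in> Hom C T Z. Comp C f u \<in> W} (homspace C T Z)"
    if W: "csubspace W (homspace C S Z)" and u: "u \<in> Hom C S T" for W u T
    using W u Z hom_obj[OF u] unfolding csubspace_hom_iff
    by (auto simp: zero_in add_in smul_in zero_Comp Comp_add_left Comp_smul_left)
  have "W = Hom C S Z" if W: "csubspace W (homspace C S Z)" and BW: "?B \<subseteq> W" for W
  proof -
    have 1: "{f \<in> Hom C X Z. Comp C f p \<in> W} = Hom C X Z"
      by (rule B(3)[OF pre[OF W m(3)]]) (use B(2) BW in auto)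
    have 2: "{f \<in> Hom C Y Z. Comp C f q \<in> W} = Hom C Y Z"
      by (rule D(3)[OF pre[OF W m(4)]]) (use D(2) BW in auto)
    have "f \<in> W" if f: "f \<in> Hom C S Z" for f
    proof -
      have "Comp C (Comp C f i) p \<in> W" "Comp C (Comp C f j) q \<in> W"
        using 1 2 Comp_in[OF m(1) f] Comp_in[OF m(2) f] by auto
      then show ?thesis using split_source[OF m f] W unfolding csubspace_hom_iff by metis
    qed
    then show ?thesis using W unfolding csubspace_hom_iff by blast
  qed
  moreover have "?B \<subseteq> Hom C S Z" using B(2) D(2) Comp_in[OF m(3)] Comp_in[OF m(4)] by auto
  moreover have "finite ?B" using B(1) D(1) by simp
  ultimately show ?thesis unfolding fin_dim_hom_iff by (intro exI[of _ ?B] conjI allI impI) (elim conjE | assumption)+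
qed

lemma fin_dim_target:
  assumes b: "biproduct C X Y S" and "fin_dim (homspace C Z X)" "fin_dim (homspace C Z Y)" and Z: "Z \<in> Obj C"
  shows "fin_dim (homspace C Z S)"
proof -
  obtain i j p q where m: "i \<in> Hom C X S" "j \<in> Hom C Y S" "p \<in> Hom C S X" "q \<in> Hom C S Y"
    "Hadd C (Comp C i p) (Comp C j q) = Ide C S" by (rule biproductE[OF b]) (rule that, assumption+)
  obtain B where B: "finite B" "B \<subseteq> Hom C Z X" "\<And>W. csubspace W (homspace C Z X) \<Longrightarrow> B \<subseteq> W \<Longrightarrow> W = Hom C Z X"
    by (rule fin_dim_homE[OF assms(2)]) (rule that)
  obtain D where D: "finite D" "D \<subseteq> Hom C Z Y" "\<And>W. csubspace W (homspace C Z Y) \<Longrightarrow> D \<subseteq> W \<Longrightarrow> W = Hom C Z Y"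
    by (rule fin_dim_homE[OF assms(3)]) (rule that)
  let ?B = "(\<lambda>f. Comp C i f) ` B \<union> (\<lambda>f. Comp C j f) ` D"
  have o: "X \<in> Obj C" "Y \<in> Obj C" "S \<in> Obj C" using m hom_obj by blast+
  have pre: "csubspace {f \<in> Hom C Z T. Comp C u f \<in> W} (homspace C Z T)"
    if W: "csubspace W (homspace C Z S)" and u: "u \<in> Hom C T S" for W u T
    using W u Z hom_obj[OF u] unfolding csubspace_hom_iff
    by (auto simp: zero_in add_in smul_in Comp_zero Comp_add_right Comp_smul_right)
  have "W = Hom C Z S" if W: "csubspace W (homspace C Z S)" and BW: "?B \<subseteq> W" for W
  proof -
    have 1: "{f \<in> Hom C Z X. Comp C i f \<in> W} = Hom C Z X"
      by (rule B(3)[OF pre[OF W m(1)]]) (use B(2) BW in auto)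
    have 2: "{f \<in> Hom C Z Y. Comp C j f \<in> W} = Hom C Z Y"
      by (rule D(3)[OF pre[OF W m(2)]]) (use D(2) BW in auto)
    have "f \<in> W" if f: "f \<in> Hom C Z S" for f
    proof -
      have "Comp C i (Comp C p f) \<in> W" "Comp C j (Comp C q f) \<in> W"
        using 1 2 Comp_in[OF f m(3)] Comp_in[OF f m(4)] by auto
      then show ?thesis using split_target[OF m f] W unfolding csubspace_hom_iff by metis
    qed
    then show ?thesis using W unfolding csubspace_hom_iff by blast
  qed
  moreover have "?B \<subseteq> Hom C Z S" using B(2) D(2) Comp_in[OF _ m(1)] Comp_in[OF _ m(2)] by auto
  moreover have "finite ?B" using B(1) D(1) by simp
  ultimately show ?thesis unfolding fin_dim_hom_iff by (intro exI[of _ ?B] conjI allI impI) (elim conjE | assumption)+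
qed

lemma fin_dim_hom_singleton:
  assumes "\<And>f. f \<in> Hom C X Y \<Longrightarrow> \<exists>c. f = Hsmul C c g" "g \<in> Hom C X Y"
  shows "fin_dim (homspace C X Y)"
proof -
  have "W = Hom C X Y" if "csubspace W (homspace C X Y)" "{g} \<subseteq> W" for W
    using that assms(1) unfolding csubspace_hom_iff by blast
  then show ?thesis unfolding fin_dim_hom_iff using assms(2) by (intro exI[of _ "{g}"]) blast
qed

lemma fin_dim_zero_hom:
  assumes "X \<in> Obj C" "Y \<in> Obj C" "\<And>f. f \<in> Hom C X Y \<Longrightarrow> f = Hzero C X Y"
  shows "fin_dim (homspace C X Y)"
  by (rule fin_dim_hom_singleton[OF _ zero_in[OF assms(1,2)]]) (simp add: smul_zero assms)

end

text \<open>Schur's lemma for a list of objects, together with the existence of decompositions.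
  Krull-Schmidt, finite dimensionality of the hom-spaces and the classification of indecomposables
  are derived in this abstract setting.\<close>

locale semisimple_category = linear_category C for C :: "('o, 'a, 'm) lincat_scheme" +
  fixes X :: "nat \<Rightarrow> 'o"
  assumes X_obj: "X i \<in> Obj C"
    and X_end: "f \<in> Hom C (X i) (X i) \<Longrightarrow> \<exists>c. f = Hsmul C c (Ide C (X i))"
    and X_nonzero: "Ide C (X i) \<noteq> Hzero C (X i) (X i)"
    and X_hom: "i \<noteq> j \<Longrightarrow> f \<in> Hom C (X i) (X j) \<Longrightarrow> f = Hzero C (X i) (X j)"
    and decomp: "Y \<in> Obj C \<Longrightarrow> \<exists>is. direct_sum C (map X is) Y"
begin

lemma object_induct [consumes 1, case_names zero biproduct]:
  assumes "Y \<in> Obj C" and zero: "\<And>Z. zero_obj C Z \<Longrightarrow> P Z"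
    and step: "\<And>i S T. biproduct C (X i) S T \<Longrightarrow> P S \<Longrightarrow> P T"
  shows "P Y"
proof -
  obtain "is" where "direct_sum C (map X is) Y" using decomp[OF assms(1)] by blast
  then show ?thesis
  proof (induction "map X is" Y arbitrary: "is")
    case (2 Xs S A T)
    then obtain i js where "A = X i" "Xs = map X js" by auto
    then show ?case using 2 step by blast
  qed (rule zero)
qed

lemma smul_Ide_iso: "c \<noteq> 0 \<Longrightarrow> iso_arr C (Hsmul C c (Ide C (X i)))"
proof -
  assume c: "c \<noteq> 0"
  let ?I = "Ide C (X i)"
  have I: "?I \<in> Hom C (X i) (X i)" using Ide_in X_obj by blast
  have "Comp C (Hsmul C a ?I) (Hsmul C b ?I) = Hsmul C (a * b) ?I" for a b
    using Comp_smul_left[OF smul_in[OF I] I] Comp_smul_right[OF I I] Ide_Comp[OF I] smul_smul[OF I] by simp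
  then have "Comp C (Hsmul C (1/c) ?I) (Hsmul C c ?I) = ?I" "Comp C (Hsmul C c ?I) (Hsmul C (1/c) ?I) = ?I"
    using c smul_one[OF I] by simp_all
  then show ?thesis unfolding iso_arr_def using smul_in[OF I] by (auto simp: Hom_def)
qed

text \<open>Endomorphisms of \<open>X i\<close> are scalars, so a non-isomorphism is zero, and so is
  a sum of two of them.\<close>

lemma local_end_X: "local_end C (X i)"
  unfolding local_end_def
proof (intro conjI ballI impI)
  show "Ide C (X i) \<noteq> Hzero C (X i) (X i)" by (rule X_nonzero)
  fix f g assume f: "f \<in> Hom C (X i) (X i)" "\<not> iso_arr C f" and g: "g \<in> Hom C (X i) (X i)" "\<not> iso_arr C g"
  have I: "Ide C (X i) \<in> Hom C (X i) (X i)" using Ide_in X_obj by blast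
  have z: "f = Hzero C (X i) (X i)" if "f \<in> Hom C (X i) (X i)" "\<not> iso_arr C f" for f
    using X_end[OF that(1)] that(2) smul_Ide_iso smul_0[OF I] by metis
  have "Hadd C f g = Hzero C (X i) (X i)"
    using z[OF f] z[OF g] zero_add[OF zero_in[OF X_obj X_obj]] by simp
  moreover have "\<not> iso_arr C (Hzero C (X i) (X i))"
  proof
    have d: "Dom C (Hzero C (X i) (X i)) = X i" "Cod C (Hzero C (X i) (X i)) = X i"
      using zero_in[OF X_obj X_obj] by (auto simp: Hom_def)
    assume "iso_arr C (Hzero C (X i) (X i))"
    then obtain g where "g \<in> Hom C (X i) (X i)" "Comp C g (Hzero C (X i) (X i)) = Ide C (X i)"
      unfolding iso_arr_def d by blast
    then show False using Comp_zero[of g "X i" "X i" "X i"] X_obj X_nonzero by metis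
  qed
  ultimately show "\<not> iso_arr C (Hadd C f g)" by simp
qed

lemma krull_schmidt: "krull_schmidt C"
  unfolding krull_schmidt_def
proof
  fix Y assume "Y \<in> Obj C"
  then obtain "is" where "direct_sum C (map X is) Y" using decomp by blast
  then show "\<exists>Xs. (\<forall>Y\<in>set Xs. Y \<in> Obj C \<and> local_end C Y) \<and> direct_sum C Xs Y"
    using X_obj local_end_X by (intro exI[of _ "map X is"]) auto
qed

text \<open>The endomorphism \<open>a p\<close> of \<open>X i\<close> is a scalar \<open>c\<close>.
  If \<open>c = 0\<close>, the identity of \<open>Y\<close> vanishes because its square factors
  through \<open>a p\<close>. Otherwise \<open>q (a p) = 0\<close> forces \<open>q = 0\<close>, and
  the identity of \<open>Z\<close> vanishes.\<close>

lemma indecomposable_X: "indecomposable C (X i)"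
  unfolding indecomposable_def
proof (intro conjI allI impI)
  show "X i \<in> Obj C" by (rule X_obj)
  show "\<not> zero_obj C (X i)" using zero_obj_iff X_obj X_nonzero by blast
  fix Y Z assume b: "biproduct C Y Z (X i)"
  then have YZ: "Y \<in> Obj C" "Z \<in> Obj C" by (auto simp: biproduct_def)
  obtain a j p q where m: "a \<in> Hom C Y (X i)" "j \<in> Hom C Z (X i)" "p \<in> Hom C (X i) Y" "q \<in> Hom C (X i) Z"
    "Comp C p a = Ide C Y" "Comp C q j = Ide C Z" "Comp C p j = Hzero C Z Y" "Comp C q a = Hzero C Y Z"
    by (rule biproductE[OF b]) (rule that)
  have I: "Ide C (X i) \<in> Hom C (X i) (X i)" using Ide_in X_obj by blast
  obtain c where c: "Comp C a p = Hsmul C c (Ide C (X i))" using X_end[OF Comp_in[OF m(3,1)]] by blast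
  have q: "Comp C q (Comp C a p) = Hsmul C c q"
    unfolding c using Comp_smul_right[OF I m(4)] Comp_Ide[OF m(4)] by simp
  have q0: "Comp C q (Comp C a p) = Hzero C (X i) Z"
    using Comp_assoc[OF m(3,1,4)] m(8) zero_Comp[OF m(3) YZ(2)] by simp
  show "zero_obj C Y \<or> zero_obj C Z"
  proof (cases "c = 0")
    case True
    then have ap: "Comp C a p = Hzero C (X i) (X i)" using c smul_0[OF I] by simp
    have "Comp C (Comp C p a) (Comp C p a) = Comp C p (Comp C (Comp C a p) a)"
      using Comp_assoc[OF Comp_in[OF m(1,3)] m(1,3)] Comp_assoc[OF m(1,3,1)] by simp
    then have "Ide C Y = Hzero C Y Y"
      using m(5) ap zero_Comp[OF m(1) X_obj] Comp_zero[OF m(3) YZ(1)] Comp_Ide[OF Ide_in[OF YZ(1)]] by simp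
    then show ?thesis using zero_obj_iff YZ by blast
  next
    case False
    have "q = Hsmul C (1/c) (Hsmul C c q)" using False smul_smul[OF m(4)] smul_one[OF m(4)] by simp
    also have "\<dots> = Hzero C (X i) Z" using q q0 smul_zero X_obj YZ by metis
    finally have "Ide C Z = Hzero C Z Z" using m(6) zero_Comp[OF m(2) YZ(2)] by simp
    then show ?thesis using zero_obj_iff YZ by blast
  qed
qed

lemma isomorphic_X: "isomorphic C (X i) (X j) \<Longrightarrow> i = j"
proof (rule ccontr)
  assume ij: "i \<noteq> j" and "isomorphic C (X i) (X j)"
  then obtain f where f: "f \<in> Hom C (X i) (X j)" "iso_arr C f" by (auto simp: isomorphic_def)
  then have d: "Dom C f = X i" "Cod C f = X j" by (auto simp: Hom_def)
  obtain g where "g \<in> Hom C (X j) (X i)" "Comp C g f = Ide C (X i)"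
    using f(2) unfolding iso_arr_def d by blast
  then show False using X_hom[OF ij f(1)] Comp_zero[of g "X j" "X i" "X i"] X_obj X_nonzero by metis
qed

text \<open>A nonempty decomposition begins with a nonzero \<open>X a\<close>. Indecomposability
  makes the rest \<open>S\<close> zero, and then the projection to \<open>X a\<close> is
  invertible.\<close>

lemma indecomposable_iso_X:
  assumes "indecomposable C Y" shows "\<exists>i. isomorphic C Y (X i)"
proof -
  have Y: "Y \<in> Obj C" "\<not> zero_obj C Y" using assms by (auto simp: indecomposable_def)
  obtain "is" where "direct_sum C (map X is) Y" using decomp[OF Y(1)] by blast
  then show ?thesis
  proof cases
    case 1 then show ?thesis using Y by simp
  next
    case (2 Xs S A)
    then obtain a where a: "biproduct C (X a) S Y" by auto
    then have S: "S \<in> Obj C" by (simp add: biproduct_def)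
    have "\<not> zero_obj C (X a)" using zero_obj_iff X_obj X_nonzero by blast
    then have zS: "zero_obj C S" using assms a by (auto simp: indecomposable_def)
    obtain i j p q where m: "i \<in> Hom C (X a) Y" "j \<in> Hom C S Y" "p \<in> Hom C Y (X a)" "q \<in> Hom C Y S"
      "Comp C p i = Ide C (X a)" "Hadd C (Comp C i p) (Comp C j q) = Ide C Y" by (rule biproductE[OF a]) (rule that)
    have "Comp C j q = Hzero C Y Y"
      using hom_zero_obj_left[OF zS m(2)] zero_Comp[OF m(4) Y(1)] by simp
    then have "Comp C i p = Ide C Y" using m(6) add_zero[OF Comp_in[OF m(3,1)]] by simp
    then have "iso_arr C p" using m unfolding iso_arr_def by (auto simp: Hom_def)
    then show ?thesis using m(3) unfolding isomorphic_def by blast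
  qed
qed

lemma fin_dim_hom: "Y \<in> Obj C \<Longrightarrow> Z \<in> Obj C \<Longrightarrow> fin_dim (homspace C Y Z)"
proof (induction Y rule: object_induct)
  case (zero Y)
  then have "Y \<in> Obj C" by (simp add: zero_obj_def)
  then show ?case using zero(2) hom_zero_obj_left[OF zero(1)] by (rule fin_dim_zero_hom)
next
  case (biproduct i S T)
  have "fin_dim (homspace C (X i) Z)" using biproduct(3)
  proof (induction Z rule: object_induct)
    case (zero Z)
    then have "Z \<in> Obj C" by (simp add: zero_obj_def)
    then show ?case using hom_zero_obj_right[OF zero(1)] by (rule fin_dim_zero_hom[OF X_obj])
  next
    case (biproduct j S T)
    have "fin_dim (homspace C (X i) (X j))"
    proof (cases "i = j")
      case True
      show ?thesis unfolding True[symmetric] by (rule fin_dim_hom_singleton[OF X_end Ide_in[OF X_obj]])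
    next
      case False
      show ?thesis by (rule fin_dim_zero_hom[OF X_obj X_obj X_hom[OF False]])
    qed
    then show ?case using fin_dim_target[OF biproduct(1) _ biproduct(2) X_obj] by blast
  qed
  then show ?case using fin_dim_source[OF biproduct(1) _ biproduct(2)[OF biproduct(3)] biproduct(3)] by blast
qed

lemma locally_finitaryI: "additive_cat C \<Longrightarrow> idempotent_split C \<Longrightarrow> locally_finitary C"
  unfolding locally_finitary_def countably_many_indecomposables_def
  using linear_category_axioms krull_schmidt fin_dim_hom indecomposable_iso_X
  by (auto intro!: exI[of _ "range X"])

text \<open>The \<open>X i\<close> detect nonzero arrows. The contrapositive is proved by splitting
  off one summand of the source at a time.\<close>

lemma hom_nonzero_source:
  assumes "f \<in> Hom C Y Z" "f \<noteq> Hzero C Y Z"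
  obtains i g where "g \<in> Hom C (X i) Y" "Comp C f g \<noteq> Hzero C (X i) Z"
proof -
  have Z: "Z \<in> Obj C" and Y: "Y \<in> Obj C" using hom_obj[OF assms(1)] by auto
  have "(\<forall>i. \<forall>g\<in>Hom C (X i) Y. Comp C f g = Hzero C (X i) Z) \<longrightarrow> f = Hzero C Y Z"
    if "f \<in> Hom C Y Z" for f using Y that
  proof (induction Y arbitrary: f rule: object_induct)
    case (zero Y) then show ?case using hom_zero_obj_left by blast
  next
    case (biproduct i S T)
    obtain a j p q where m: "a \<in> Hom C (X i) T" "j \<in> Hom C S T" "p \<in> Hom C T (X i)" "q \<in> Hom C T S"
      "Hadd C (Comp C a p) (Comp C j q) = Ide C T" by (rule biproductE[OF biproduct(1)]) (rule that)
    have T: "T \<in> Obj C" using m hom_obj by blast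
    show ?case
    proof
      assume *: "\<forall>i. \<forall>g\<in>Hom C (X i) T. Comp C f g = Hzero C (X i) Z"
      have "Comp C (Comp C f j) g = Hzero C (X k) Z" if "g \<in> Hom C (X k) S" for k g
        using * Comp_assoc[OF that m(2) biproduct(3)] Comp_in[OF that m(2)] by simp
      then have "Comp C f j = Hzero C S Z" using biproduct(2)[OF Comp_in[OF m(2) biproduct(3)]] by blast
      moreover have "Comp C f a = Hzero C (X i) Z" using * m(1) by blast
      ultimately have "f = Hadd C (Comp C (Hzero C (X i) Z) p) (Comp C (Hzero C S Z) q)"
        using split_source[OF m biproduct(3)] by simp
      then show "f = Hzero C T Z"
        using zero_Comp[OF m(3) Z] zero_Comp[OF m(4) Z] zero_add[OF zero_in[OF T Z]] by simp
    qed
  qed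
  then show thesis using assms that by blast
qed

lemma hom_nonzero_target:
  assumes "f \<in> Hom C Z Y" "f \<noteq> Hzero C Z Y"
  obtains i g where "g \<in> Hom C Y (X i)" "Comp C g f \<noteq> Hzero C Z (X i)"
proof -
  have Z: "Z \<in> Obj C" and Y: "Y \<in> Obj C" using hom_obj[OF assms(1)] by auto
  have "(\<forall>i. \<forall>g\<in>Hom C Y (X i). Comp C g f = Hzero C Z (X i)) \<longrightarrow> f = Hzero C Z Y"
    if "f \<in> Hom C Z Y" for f using Y that
  proof (induction Y arbitrary: f rule: object_induct)
    case (zero Y) then show ?case using hom_zero_obj_right by blast
  next
    case (biproduct i S T)
    obtain a j p q where m: "a \<in> Hom C (X i) T" "j \<in> Hom C S T" "p \<in> Hom C T (X i)" "q \<in> Hom C T S"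
      "Hadd C (Comp C a p) (Comp C j q) = Ide C T" by (rule biproductE[OF biproduct(1)]) (rule that)
    have T: "T \<in> Obj C" using m hom_obj by blast
    show ?case
    proof
      assume *: "\<forall>i. \<forall>g\<in>Hom C T (X i). Comp C g f = Hzero C Z (X i)"
      have "Comp C g (Comp C q f) = Hzero C Z (X k)" if "g \<in> Hom C S (X k)" for k g
        using * Comp_assoc[OF biproduct(3) m(4) that] Comp_in[OF m(4) that] by simp
      then have "Comp C q f = Hzero C Z S" using biproduct(2)[OF Comp_in[OF biproduct(3) m(4)]] by blast
      moreover have "Comp C p f = Hzero C Z (X i)" using * m(3) by blast
      ultimately have "f = Hadd C (Comp C a (Hzero C Z (X i))) (Comp C j (Hzero C Z S))"
        using split_target[OF m biproduct(3)] by simp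
      then show "f = Hzero C Z T"
        using Comp_zero[OF m(1) Z] Comp_zero[OF m(2) Z] zero_add[OF zero_in[OF Z T]] by simp
    qed
  qed
  then show thesis using assms that by blast
qed

end

lemma simple_transitiveI:
  assumes M: "module_category P M" and "semisimple_category M X" and A: "A \<in> Obj P"
    and b0: "biproduct M (X 0) (X 1) (aob M A (X 0))"
    and bS: "\<And>i. i \<ge> 1 \<Longrightarrow> biproduct M (X (i - 1)) (X (i + 1)) (aob M A (X i))"
  shows "simple_transitive P M"
  unfolding simple_transitive_def
proof (intro conjI M allI impI)
  interpret S: semisimple_category M X by fact
  interpret M: module_category P M by (rule M)
  fix I assume inv: "invariant_ideal P M I"
  let ?Z = "{Hzero M X Y | X Y. X \<in> Obj M \<and> Y \<in> Obj M}"
  have sub: "I \<subseteq> Arr M" and cs: "\<And>X Y. X \<in> Obj M \<Longrightarrow> Y \<in> Obj M \<Longrightarrow> csubspace (I \<inter> Hom M X Y) (homspace M X Y)"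
    and post: "\<And>f g X Y Z. f \<in> I \<Longrightarrow> f \<in> Hom M X Y \<Longrightarrow> g \<in> Hom M Y Z \<Longrightarrow> Comp M g f \<in> I"
    and pre: "\<And>f g X Y Z. f \<in> I \<Longrightarrow> f \<in> Hom M Y Z \<Longrightarrow> g \<in> Hom M X Y \<Longrightarrow> Comp M f g \<in> I"
    and act: "\<And>f. f \<in> I \<Longrightarrow> aarr M (Ide P A) f \<in> I"
    using inv A unfolding invariant_ideal_def by (auto simp: Hom_def)
  have zI: "?Z \<subseteq> I" using cs S.csubspace_hom_iff by blast
  show "I = ?Z \<or> I = Arr M"
  proof (cases "I \<subseteq> ?Z")
    case True then show ?thesis using zI by blast
  next
    case False
    then obtain f where f: "f \<in> I" "f \<notin> ?Z" by blast
    define Y Z where "Y = Dom M f" and "Z = Cod M f"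
    have fh: "f \<in> Hom M Y Z" using f(1) sub by (auto simp: Hom_def Y_def Z_def)
    have "f \<noteq> Hzero M Y Z" using f(2) S.hom_obj[OF fh] by blast
    then obtain i g where g: "g \<in> Hom M (X i) Y" "Comp M f g \<noteq> Hzero M (X i) Z"
      using S.hom_nonzero_source[OF fh] by blast
    have fg: "Comp M f g \<in> Hom M (X i) Z" "Comp M f g \<in> I" using S.Comp_in[OF g(1) fh] pre[OF f(1) fh g(1)] by auto
    obtain j h where h: "h \<in> Hom M Z (X j)" "Comp M h (Comp M f g) \<noteq> Hzero M (X i) (X j)"
      using S.hom_nonzero_target[OF fg(1) g(2)] by blast
    \<comment> \<open>Composition with arrows from \<open>X i\<close> and to \<open>X j\<close>
      keeps the element of the ideal nonzero. By Schur's lemma \<open>j = i\<close> and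
      \<open>?k\<close> is a nonzero multiple of an identity.\<close>
    let ?k = "Comp M h (Comp M f g)"
    have k: "?k \<in> Hom M (X i) (X j)" "?k \<in> I" using S.Comp_in[OF fg(1) h(1)] post[OF fg(2,1) h(1)] by auto
    have "j = i" using S.X_hom[OF _ k(1)] h(2) by blast
    then obtain c where c: "?k = Hsmul M c (Ide M (X i))" using S.X_end k(1) by blast
    have Ii: "Ide M (X i) \<in> Hom M (X i) (X i)" using S.Ide_in S.X_obj by blast
    have "c \<noteq> 0" using c h(2) \<open>j = i\<close> S.smul_0[OF Ii] by auto
    then have "Ide M (X i) = Hsmul M (1/c) ?k" unfolding c using S.smul_smul[OF Ii] S.smul_one[OF Ii] by simp
    then have Xi: "Ide M (X i) \<in> I"
      using cs[OF S.X_obj S.X_obj, of i i] k \<open>j = i\<close> unfolding S.csubspace_hom_iff by (metis IntE IntI)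
    have tens: "Ide M (aob M A (X i)) \<in> I" if "Ide M (X i) \<in> I" for i
      using act[OF that] M.aarr_Ide[OF A S.X_obj] by simp
    \<comment> \<open>The identity of a summand is the projection after the identity of
      \<open>T\<close> after the inclusion, so it lies in the ideal together with the
      latter.\<close>
    have part: "Ide M U \<in> I \<and> Ide M V \<in> I" if b: "biproduct M U V T" and T: "Ide M T \<in> I" for U V T
    proof -
      obtain a j p q where m: "a \<in> Hom M U T" "j \<in> Hom M V T" "p \<in> Hom M T U" "q \<in> Hom M T V"
        "Comp M p a = Ide M U" "Comp M q j = Ide M V" by (rule S.biproductE[OF b]) (rule that)
      have Th: "Ide M T \<in> Hom M T T" using S.Ide_in S.hom_obj[OF m(1)] by blast
      have "Comp M p (Ide M T) = p" "Comp M q (Ide M T) = q" using S.Comp_Ide m by auto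
      then have "p \<in> I" "q \<in> I" using post[OF T Th m(3)] post[OF T Th m(4)] by auto
      then show ?thesis using pre[OF _ m(3,1)] pre[OF _ m(4,2)] m by auto
    qed
    have up: "Ide M (X (Suc n)) \<in> I" if "Ide M (X n) \<in> I" for n
      using part[OF b0 tens] part[OF bS tens, of n] that by (cases n) auto
    have down: "Ide M (X n) \<in> I" if "Ide M (X (Suc n)) \<in> I" for n
      using part[OF bS tens, of "Suc n"] that by simp
    \<comment> \<open>The neighbours of \<open>X (Suc n)\<close> include \<open>X n\<close>: from
      the index found first, the ideal is followed down to \<open>X 0\<close> and from there up to
      every \<open>X n\<close>.\<close>
    have "Ide M (X 0) \<in> I" using Xi by (induction i) (auto intro: down)
    then have all: "Ide M (X n) \<in> I" for n by (induction n) (auto intro: up)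
    have ide: "Ide M Y \<in> I" if "Y \<in> Obj M" for Y using that
    proof (induction Y rule: S.object_induct)
      case (zero Z)
      then have "Z \<in> Obj M" by (simp add: zero_obj_def)
      then show ?case using zero zI S.zero_obj_iff by auto
    next
      case (biproduct i S T)
      obtain a j p q where m: "a \<in> Hom M (X i) T" "j \<in> Hom M S T" "p \<in> Hom M T (X i)" "q \<in> Hom M T S"
        "Hadd M (Comp M a p) (Comp M j q) = Ide M T" by (rule S.biproductE[OF biproduct(1)]) (rule that)
      have T: "T \<in> Obj M" and So: "S \<in> Obj M" using m S.hom_obj by blast+
      have "Comp M a (Ide M (X i)) = a" "Comp M j (Ide M S) = j" using S.Comp_Ide m by auto
      then have "a \<in> I" "j \<in> I"
        using post[OF all S.Ide_in[OF S.X_obj] m(1)] post[OF biproduct(2) S.Ide_in[OF So] m(2)] by auto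
      then have "Comp M a p \<in> I \<inter> Hom M T T" "Comp M j q \<in> I \<inter> Hom M T T"
        using pre m S.Comp_in by blast+
      then show ?case using cs[OF T T] m(5) unfolding S.csubspace_hom_iff by (metis IntE)
    qed
    have "f \<in> I" if "f \<in> Arr M" for f
    proof -
      have fh: "f \<in> Hom M (Dom M f) (Cod M f)" using that by (simp add: Hom_def)
      have D: "Dom M f \<in> Obj M" using S.hom_obj[OF fh] by simp
      show ?thesis using post[OF ide[OF D] S.Ide_in[OF D] fh] S.Comp_Ide[OF fh] by simp
    qed
    then show ?thesis using sub by blast
  qed
qed

section \<open>Modules generated by a family of simple modules\<close>

lemma submodule_span:
  assumes N: "is_vmod br N" and sub: "\<And>B. B \<in> \<B> \<Longrightarrow> submodule B N"
  shows "submodule (vec.span (\<Union>\<B>)) N"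
proof -
  note s = vmod_subspace[OF N]
  have sub': "B \<subseteq> carr N" "v \<in> B \<Longrightarrow> act N b v \<in> B" if "B \<in> \<B>" for B b v
    using sub[OF that] unfolding submodule_iff[OF N] by blast+
  have U: "\<Union>\<B> \<subseteq> carr N" using sub'(1) by blast
  have "act N b ` vec.span (\<Union>\<B>) \<subseteq> vec.span (\<Union>\<B>)" for b
  proof -
    have "act N b ` \<Union>\<B> \<subseteq> \<Union>\<B>" using sub'(2) by blast
    then show ?thesis unfolding linon_image_span[OF vmod_linon[OF N] s U] by (rule vec.span_mono)
  qed
  then show ?thesis unfolding submodule_iff[OF N] using vec.span_minimal[OF U s] vec.subspace_span by blast
qed

text \<open>Both claims come from one fact: the preimage of \<open>W\<close> is a proper submodule
  of a simple module, hence zero.\<close>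

lemma simple_hom_inj:
  assumes X: "is_vmod br X" "simple_module X" and N: "is_vmod br' N" and f: "lmod_hom X N f"
    and W: "submodule W N" and nz: "v \<in> carr X" "f v \<notin> W"
  shows "inj_on f (carr X)" "f ` carr X \<inter> W \<subseteq> {0}"
proof -
  note sm = submodule_vimage[OF f X(1) N W] and s = vmod_subspace[OF X(1)]
  note fl = lmod_homD(1)[OF f X(1) N]
  have "{v \<in> carr X. f v \<in> W} \<noteq> carr X" using nz by blast
  then have z: "{v \<in> carr X. f v \<in> W} = {0}" using X(2) sm unfolding simple_module_iff[OF X(1)] by blast
  have f0: "f 0 = 0" by (rule linon_zero[OF fl vec.subspace_0[OF s]])
  have W0: "0 \<in> W" using W unfolding submodule_iff[OF N] by (simp add: vec.subspace_0)
  show "inj_on f (carr X)"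
  proof (rule inj_onI)
    fix u v assume uv: "u \<in> carr X" "v \<in> carr X" "f u = f v"
    then have "f (u - v) = 0" using linon_diff[OF fl uv(1,2) s] by simp
    then have "u - v \<in> {v \<in> carr X. f v \<in> W}" using uv s W0 by (simp add: vec.subspace_diff)
    then show "u = v" unfolding z by simp
  qed
  show "f ` carr X \<inter> W \<subseteq> {0}"
  proof
    fix y assume "y \<in> f ` carr X \<inter> W"
    then obtain x where x: "y = f x" "x \<in> {v \<in> carr X. f v \<in> W}" by blast
    then show "y \<in> {0}" unfolding z using f0 by simp
  qed
qed

text \<open>\<open>M\<close> may live on any type, which admits modules of cosets, and is not
  assumed to satisfy the vector space axioms. Preservation of zero therefore has to be
  demanded.\<close>

definition base_iso :: "('b, vec) lmod \<Rightarrow> ('b, 'w) lmod \<Rightarrow> (vec \<Rightarrow> 'w) \<Rightarrow> bool" where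
  "base_iso X M f \<longleftrightarrow> lmod_hom X M f \<and> bij_betw f (carr X) (carr M) \<and> f 0 = vzero M"

lemma dsum_simps:
  "carr (dsum K M) = {f \<in> Pi\<^sub>E K (\<lambda>k. carr (M k)). finite {k \<in> K. f k \<noteq> vzero (M k)}}"
  "vadd (dsum K M) f g = (\<lambda>k\<in>K. vadd (M k) (f k) (g k))"
  "vzero (dsum K M) = (\<lambda>k\<in>K. vzero (M k))"
  "vsmul (dsum K M) c f = (\<lambda>k\<in>K. vsmul (M k) c (f k))"
  "act (dsum K M) b f = (\<lambda>k\<in>K. act (M k) b (f k))"
  by (simp_all add: dsum_def)

lemma base_iso_submodule:
  assumes Q: "is_vmod br Q" and h: "base_iso Q M h" and D: "submodule D M"
  shows "submodule {v \<in> carr Q. h v \<in> D} Q"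
proof -
  have hh: "h (u + v) = vadd M (h u) (h v)" "h (vscale c u) = vsmul M c (h u)" "h (act Q b u) = act M b (h u)"
    if "u \<in> carr Q" "v \<in> carr Q" for u v c b
    using h that vmod_vops[OF Q] by (auto simp: base_iso_def lmod_hom_def clinear_map_def vops_def)
  have h0: "h 0 = vzero M" using h by (simp add: base_iso_def)
  have D': "vzero M \<in> D" "u \<in> D \<Longrightarrow> v \<in> D \<Longrightarrow> vadd M u v \<in> D" "u \<in> D \<Longrightarrow> vsmul M c u \<in> D" "u \<in> D \<Longrightarrow> act M b u \<in> D"
    for u v c b using D by (auto simp: submodule_def csubspace_def)
  note s = vmod_subspace[OF Q]
  show ?thesis unfolding submodule_iff[OF Q]
    using s D' h0 hh vmod_act[OF Q]
    by (auto intro!: vec.subspaceI simp: vec.subspace_0 vec.subspace_add vec.subspace_scale)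
qed

locale simple_family =
  fixes br :: "'b \<Rightarrow> 'b \<Rightarrow> 'b lincomb" and X :: "nat \<Rightarrow> 'b vobj"
  assumes X_vmod: "is_vmod br (X i)"
    and X_simple: "simple_module (X i)"
    and X_schur: "lmod_hom (X i) (X i) f \<Longrightarrow> \<exists>c. \<forall>v\<in>carr (X i). f v = vscale c v"
    and X_distinct: "i \<noteq> j \<Longrightarrow> lmod_hom (X i) (X j) f \<Longrightarrow> v \<in> carr (X i) \<Longrightarrow> f v = 0"
begin

text \<open>The images may overlap. Pairs \<open>(i, \<phi>)\<close> are collected so that one
  \<open>X i\<close> can occur with several maps.\<close>

definition gen :: "'b vobj \<Rightarrow> bool" where
  "gen N \<longleftrightarrow> (\<exists>L. finite L \<and> (\<forall>(i, \<phi>)\<in>L. lmod_hom (X i) N \<phi>) \<and>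
     carr N = vec.span (\<Union>(i, \<phi>)\<in>L. \<phi> ` carr (X i)))"

text \<open>The maps witnessing \<open>gen\<close> for the pieces are composed with the maps into
  \<open>N\<close>. Closure under images and sums, and later stability under tensor products, are
  obtained from this lemma.\<close>

lemma gen_cover:
  assumes N: "is_vmod br N" and fin: "finite \<K>"
    and K: "\<And>M f. (M, f) \<in> \<K> \<Longrightarrow> is_vmod br M \<and> gen M \<and> lmod_hom M N f"
    and span: "carr N = vec.span (\<Union>(M, f)\<in>\<K>. f ` carr M)"
  shows "gen N"
proof -
  have "\<forall>k\<in>\<K>. \<exists>L. finite L \<and> (\<forall>(i, \<phi>)\<in>L. lmod_hom (X i) (fst k) \<phi>) \<and>
     carr (fst k) = vec.span (\<Union>(i, \<phi>)\<in>L. \<phi> ` carr (X i))"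
    using K unfolding gen_def by fastforce
  then obtain L where L: "\<And>k. k \<in> \<K> \<Longrightarrow> finite (L k) \<and> (\<forall>(i, \<phi>)\<in>L k. lmod_hom (X i) (fst k) \<phi>) \<and>
     carr (fst k) = vec.span (\<Union>(i, \<phi>)\<in>L k. \<phi> ` carr (X i))"
    by (metis bchoice)
  let ?L = "\<Union>k\<in>\<K>. (\<lambda>(i, \<phi>). (i, \<lambda>v. snd k (\<phi> v))) ` L k"
  let ?B = "\<Union>(i, \<phi>)\<in>?L. \<phi> ` carr (X i)"
  have fL: "finite ?L" using fin L by auto
  have hL: "lmod_hom (X i) N \<phi>" if "(i, \<phi>) \<in> ?L" for i \<phi>
  proof -
    from that obtain k \<psi> where k: "k \<in> \<K>" "(i, \<psi>) \<in> L k" "\<phi> = (\<lambda>v. snd k (\<psi> v))" by auto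
    have "lmod_hom (X i) (fst k) \<psi>" using L[OF k(1)] k(2) by auto
    moreover have "lmod_hom (fst k) N (snd k)" using K[of "fst k" "snd k"] k(1) by simp
    ultimately show ?thesis unfolding k(3) by (rule lmod_hom_comp)
  qed
  have "\<phi> ` carr (X i) \<subseteq> carr N" if "(i, \<phi>) \<in> ?L" for i \<phi>
    using lmod_homD(2)[OF hL[OF that] X_vmod N] by auto
  then have "?B \<subseteq> carr N" by (intro UN_least) (auto simp only: split_paired_all prod.case)
  then have 1: "vec.span ?B \<subseteq> carr N" by (rule vec.span_minimal[OF _ vmod_subspace[OF N]])
  have "f ` carr M \<subseteq> vec.span ?B" if k: "(M, f) \<in> \<K>" for M f
  proof -
    let ?A = "\<Union>(i, \<phi>)\<in>L (M, f). \<phi> ` carr (X i)"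
    have M: "is_vmod br M" and h: "lmod_hom M N f" using K[OF k] by auto
    have c: "carr M = vec.span ?A" using L[OF k] by simp
    have A: "?A \<subseteq> carr M" unfolding c using vec.span_superset .
    have "f ` ?A \<subseteq> ?B" using k by fastforce
    then have "vec.span (f ` ?A) \<subseteq> vec.span ?B" by (rule vec.span_mono)
    then show ?thesis using linon_image_span[OF lmod_homD(1)[OF h M N] vmod_subspace[OF M] A] c by simp
  qed
  then have "(\<Union>(M, f)\<in>\<K>. f ` carr M) \<subseteq> vec.span ?B" by auto
  then have 2: "carr N \<subseteq> vec.span ?B" unfolding span by (rule vec.span_minimal[OF _ vec.subspace_span])
  show ?thesis unfolding gen_def using fL hL 1 2 by (intro exI[of _ ?L]) blast
qed

lemma gen_image:
  assumes "gen M" "is_vmod br M" "is_vmod br N" "lmod_hom M N f" "f ` carr M = carr N"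
  shows "gen N"
  by (rule gen_cover[of _ "{(M, f)}"])
    (use assms in \<open>auto simp: vec.span_eq_iff[THEN iffD2, OF vmod_subspace[OF assms(3)]]\<close>)

lemma gen_zero: "carr N = {0} \<Longrightarrow> gen N"
  unfolding gen_def by (intro exI[of _ "{}"]) simp

lemma gen_X: "gen (X i)"
  unfolding gen_def
  by (intro exI[of _ "{(i, \<lambda>v. v)}"]) (auto simp: lmod_hom_id vec.span_eq_iff[THEN iffD2, OF vmod_subspace[OF X_vmod]])

lemma gen_sum:
  assumes "is_vmod br S" "gen M" "is_vmod br M" "gen N" "is_vmod br N" "lmod_hom M S f" "lmod_hom N S g"
    "\<And>v. v \<in> carr S \<Longrightarrow> \<exists>x\<in>carr M. \<exists>y\<in>carr N. v = f x + g y"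
  shows "gen S"
proof (rule gen_cover[of _ "{(M, f), (N, g)}"])
  have s: "carr S \<subseteq> vec.span (f ` carr M \<union> g ` carr N)"
  proof
    fix v assume "v \<in> carr S"
    then obtain x y where "x \<in> carr M" "y \<in> carr N" "v = f x + g y" using assms(8) by blast
    then show "v \<in> vec.span (f ` carr M \<union> g ` carr N)" by (auto intro!: vec.span_add intro: vec.span_base)
  qed
  have "f ` carr M \<union> g ` carr N \<subseteq> carr S"
    using lmod_homD(2)[OF assms(6,3,1)] lmod_homD(2)[OF assms(7,5,1)] by auto
  then have "vec.span (f ` carr M \<union> g ` carr N) \<subseteq> carr S" by (rule vec.span_minimal[OF _ vmod_subspace[OF assms(1)]])
  then show "carr S = vec.span (\<Union>(M, f)\<in>{(M, f), (N, g)}. f ` carr M)" using s by simp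
qed (use assms in auto)

end

locale generated_category = simple_family br X + vmodcat br \<O> C
  for br :: "'b \<Rightarrow> 'b \<Rightarrow> 'b lincomb" and X and \<O> and C :: "('b vobj, 'b varr, 'm) lincat_scheme" +
  assumes O_def: "N \<in> \<O> \<longleftrightarrow> is_vmod br N \<and> gen N"
begin

lemma X_in: "X i \<in> \<O>"
  by (simp add: O_def X_vmod gen_X)

lemma ex_biproduct: "M \<in> \<O> \<Longrightarrow> N \<in> \<O> \<Longrightarrow> \<exists>S. biproduct C M N S"
proof -
  assume "M \<in> \<O>" "N \<in> \<O>"
  then have M: "is_vmod br M" "gen M" and N: "is_vmod br N" "gen N" by (auto simp: O_def)
  obtain S f g where S: "is_vmod br S" "lmod_hom M S f" "inj_on f (carr M)" "lmod_hom N S g" "inj_on g (carr N)"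
    "f ` carr M \<inter> g ` carr N \<subseteq> {0}" "\<And>v. v \<in> carr S \<Longrightarrow> \<exists>x\<in>carr M. \<exists>y\<in>carr N. v = f x + g y"
    by (rule direct_sum_module[OF M(1) N(1)]) (rule that)
  have "gen S" by (rule gen_sum[OF S(1) M(2,1) N(2,1) S(2,4,7)])
  then have "S \<in> \<O>" using S(1) by (simp add: O_def)
  then show ?thesis using biproductI[OF \<open>M \<in> \<O>\<close> \<open>N \<in> \<O>\<close> _ S(2-7)] by blast
qed

lemma ex_zero: "\<exists>Z. zero_obj C Z"
  by (rule exI[of _ "vmod {0} (\<lambda>_ _. 0)"], rule zero_objI) (auto simp: O_def zero_mod_vmod gen_zero)

lemma additive_cat: "additive_cat C"
  unfolding additive_cat_def using ex_zero ex_biproduct by simp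

lemma idempotent_split: "idempotent_split C"
  by (rule idempotent_splitI) (auto simp: O_def intro: gen_image)

text \<open>The maps are inserted one at a time. By simplicity a new image either lies in the span
  \<open>?B\<close> of the others, and is dropped, or meets it in zero, and splits off as a direct
  summand.\<close>

lemma direct_sum_decomposition:
  assumes "N \<in> \<O>" shows "\<exists>is. direct_sum C (map X is) N"
proof -
  obtain L where L: "finite L" "\<forall>(i, \<phi>)\<in>L. lmod_hom (X i) N \<phi>"
     "carr N = vec.span (\<Union>(i, \<phi>)\<in>L. \<phi> ` carr (X i))" using assms unfolding O_def gen_def by blast
  have "is_vmod br N" using assms by (simp add: O_def)
  with L show ?thesis
  proof (induction L arbitrary: N rule: finite_induct)
    case empty
    then have "zero_obj C N" by (intro zero_objI) (auto simp: O_def gen_zero)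
    then have "direct_sum C (map X []) N" by (simp add: direct_sum.intros)
    then show ?case by blast
  next
    case (insert x L)
    obtain i \<phi> where x: "x = (i, \<phi>)" by (cases x)
    note N = \<open>is_vmod br N\<close>
    have \<phi>: "lmod_hom (X i) N \<phi>" using insert.prems(1) x by auto
    have hL: "lmod_hom (X j) N \<psi>" if "(j, \<psi>) \<in> L" for j \<psi> using insert.prems(1) that by auto
    let ?B = "\<Union>(i, \<phi>)\<in>L. \<phi> ` carr (X i)"
    have B: "submodule (vec.span ?B) N"
      by (rule submodule_span[OF N]) (auto intro: submodule_image[OF hL X_vmod N])
    let ?M = "vmod (vec.span ?B) (act N)"
    have M: "is_vmod br ?M" by (rule is_vmod_submodule[OF N B])
    have hM: "lmod_hom (X j) ?M \<psi>" if "(j, \<psi>) \<in> L" for j \<psi>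
    proof (rule lmod_homI[OF X_vmod M])
      note h = lmod_homD[OF hL[OF that] X_vmod N]
      show "linon (carr (X j)) \<psi>" by (rule h(1))
      show "\<psi> v \<in> carr ?M" if "v \<in> carr (X j)" for v
        using that \<open>(j, \<psi>) \<in> L\<close> by (auto intro!: vec.span_base)
      show "\<psi> (act (X j) b v) = act ?M b (\<psi> v)" if "v \<in> carr (X j)" for b v using h(3)[OF that] by simp
    qed
    obtain js where js: "direct_sum C (map X js) ?M"
      using insert.IH[of ?M] hM M by (auto simp del: vmod_simps(2))
    have MO: "?M \<in> \<O>" using M hM insert.hyps(1) unfolding O_def gen_def by (auto intro!: exI[of _ L])
    have NO: "N \<in> \<O>" using N insert.prems insert.hyps(1) unfolding O_def gen_def by (auto intro!: exI[of _ "insert x L"])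
    have cN: "carr N = vec.span (\<phi> ` carr (X i) \<union> ?B)" using insert.prems(2) by (simp add: x)
    show ?case
    proof (cases "\<phi> ` carr (X i) \<subseteq> vec.span ?B")
      case True
      have "carr N = vec.span ?B"
        unfolding cN using True vec.span_mono[of ?B "\<phi> ` carr (X i) \<union> ?B"]
        by (intro antisym vec.span_minimal) (auto intro: vec.span_base)
      then have "N = ?M" using vops_eq_vmod[OF vmod_vops[OF N]] by simp
      then show ?thesis using js by metis
    next
      case False
      then obtain v where v: "v \<in> carr (X i)" "\<phi> v \<notin> vec.span ?B" by blast
      note sh = simple_hom_inj[OF X_vmod X_simple N \<phi> B v]
      have im: "vec.span (\<phi> ` carr (X i)) = \<phi> ` carr (X i)"
        using submodule_image[OF \<phi> X_vmod N] unfolding submodule_iff[OF N] by (simp add: vec.span_eq_iff)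
      have "biproduct C (X i) ?M N"
      proof (rule biproductI[OF X_in MO NO \<phi> sh(1) lmod_hom_inclusion[OF N B]])
        show "inj_on (\<lambda>v. v) (carr ?M)" by simp
        show "\<phi> ` carr (X i) \<inter> (\<lambda>v. v) ` carr ?M \<subseteq> {0}" using sh(2) by simp
        fix u assume "u \<in> carr N"
        then show "\<exists>x\<in>carr (X i). \<exists>y\<in>carr ?M. u = \<phi> x + y"
          unfolding cN vec.span_Un im by auto
      qed
      then have "direct_sum C (map X (i # js)) N" using js by (simp add: direct_sum.intros(2))
      then show ?thesis by blast
    qed
  qed
qed

lemma semisimple_category: "semisimple_category C X"
proof -
  interpret linear_category C by (rule linear_category)
  show ?thesis
  proof
    show "X i \<in> Obj C" for i by (simp add: X_in)
    show "\<exists>c. f = Hsmul C c (Ide C (X i))" if f0: "f \<in> Hom C (X i) (X i)" for f i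
    proof -
      obtain f' where f: "f = (X i, X i, f')" "arr (X i) (X i) f'" using f0 by (auto simp: Hom_C)
      obtain c where c: "\<forall>v\<in>carr (X i). f' v = vscale c v" using X_schur[OF arrD(7)[OF f(2)]] by blast
      have "f' = (\<lambda>v\<in>carr (X i). vscale c ((\<lambda>v\<in>carr (X i). v) v))"
        using c by (intro arr_eqI[OF f(2) arr_scale[OF arr_ide[OF X_in]] refl]) simp
      then show ?thesis using f by auto
    qed
    show "Ide C (X i) \<noteq> Hzero C (X i) (X i)" for i
    proof
      assume "Ide C (X i) = Hzero C (X i) (X i)"
      then have "(\<lambda>v\<in>carr (X i). v) = (\<lambda>v\<in>carr (X i). 0)" by simp
      then have "\<forall>v\<in>carr (X i). v = 0" by (metis restrict_apply')
      moreover have "carr (X i) \<noteq> {0}" "0 \<in> carr (X i)"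
        using X_simple[of i] vec.subspace_0[OF vmod_subspace[OF X_vmod[of i]]] by (auto simp: simple_module_iff[OF X_vmod])
      ultimately show False by blast
    qed
    show "f = Hzero C (X i) (X j)" if ij: "i \<noteq> j" and f0: "f \<in> Hom C (X i) (X j)" for f i j
    proof -
      obtain f' where f: "f = (X i, X j, f')" "arr (X i) (X j) f'" using f0 by (auto simp: Hom_C)
      have "f' = (\<lambda>v\<in>carr (X i). 0)"
        using X_distinct[OF ij arrD(7)[OF f(2)]] by (intro arr_eqI[OF f(2) arr_zero[OF X_in X_in] refl]) simp
      then show ?thesis using f by simp
    qed
    show "\<exists>is. direct_sum C (map X is) Y" if "Y \<in> Obj C" for Y using direct_sum_decomposition that by simp
  qed
qed

text \<open>If the images met nontrivially, simplicity would put the first inside the second;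
  followed by the inverse of \<psi> this would give a nonzero map from \<open>X i\<close> to
  \<open>X j\<close>, which \<open>X_distinct\<close> excludes.\<close>

lemma biproduct_pairI:
  assumes N: "is_vmod br N" and \<phi>: "lmod_hom (X i) N \<phi>" "u \<in> carr (X i)" "\<phi> u \<noteq> 0"
    and \<psi>: "lmod_hom (X j) N \<psi>" "v \<in> carr (X j)" "\<psi> v \<noteq> 0"
    and ij: "i \<noteq> j" and span: "carr N = vec.span (\<phi> ` carr (X i) \<union> \<psi> ` carr (X j))"
  shows "biproduct C (X i) (X j) N"
proof -
  have z: "submodule {0} N"
    using vmod_subspace[OF N] linon_zero[OF vmod_linon[OF N]] by (auto simp: submodule_iff[OF N] vec.subspace_0)
  have i1: "inj_on \<phi> (carr (X i))" using simple_hom_inj(1)[OF X_vmod X_simple N \<phi>(1) z \<phi>(2)] \<phi>(3) by simp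
  have i2: "inj_on \<psi> (carr (X j))" using simple_hom_inj(1)[OF X_vmod X_simple N \<psi>(1) z \<psi>(2)] \<psi>(3) by simp
  note im1 = submodule_image[OF \<phi>(1) X_vmod N] and im2 = submodule_image[OF \<psi>(1) X_vmod N]
  note h1 = lmod_homD[OF \<phi>(1) X_vmod N] and h2 = lmod_homD[OF \<psi>(1) X_vmod N]
  have disj: "\<phi> ` carr (X i) \<inter> \<psi> ` carr (X j) \<subseteq> {0}"
  proof (cases "\<phi> ` carr (X i) \<subseteq> \<psi> ` carr (X j)")
    case False
    then obtain w where "w \<in> carr (X i)" "\<phi> w \<notin> \<psi> ` carr (X j)" by blast
    then show ?thesis by (rule simple_hom_inj(2)[OF X_vmod X_simple N \<phi>(1) im2])
  next
    case True
    let ?M = "vmod (\<psi> ` carr (X j)) (act N)"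
    have M: "is_vmod br ?M" by (rule is_vmod_submodule[OF N im2])
    have \<psi>': "lmod_hom (X j) ?M \<psi>" by (rule lmod_homI[OF X_vmod M h2(1)]) (auto simp: h2)
    have \<phi>': "lmod_hom (X i) ?M \<phi>" by (rule lmod_homI[OF X_vmod M h1(1)]) (use True in \<open>auto simp: h1\<close>)
    have b: "bij_betw \<psi> (carr (X j)) (carr ?M)" using i2 by (simp add: bij_betw_def)
    note inv = lmod_hom_inv[OF \<psi>' b X_vmod]
    have "inv_into (carr (X j)) \<psi> (\<phi> u) = 0" by (rule X_distinct[OF ij lmod_hom_comp[OF \<phi>' inv] \<phi>(2)])
    moreover have "\<phi> u \<in> \<psi> ` carr (X j)" using True \<phi>(2) by blast
    ultimately have "\<phi> u = \<psi> 0" using f_inv_into_f by metis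
    then show ?thesis using \<phi>(3) linon_zero[OF h2(1) vec.subspace_0[OF vmod_subspace[OF X_vmod]]] by simp
  qed
  have sp: "\<exists>x\<in>carr (X i). \<exists>y\<in>carr (X j). w = \<phi> x + \<psi> y" if "w \<in> carr N" for w
  proof -
    have spi: "vec.span (\<phi> ` carr (X i)) = \<phi> ` carr (X i)" "vec.span (\<psi> ` carr (X j)) = \<psi> ` carr (X j)"
      using im1 im2 unfolding submodule_iff[OF N] by (simp_all add: vec.span_eq_iff)
    have "w \<in> {x + y | x y. x \<in> \<phi> ` carr (X i) \<and> y \<in> \<psi> ` carr (X j)}"
      using that span vec.span_Un[of "\<phi> ` carr (X i)" "\<psi> ` carr (X j)"] unfolding spi by blast
    then show ?thesis by blast
  qed
  have NO: "N \<in> \<O>" using gen_sum[OF N gen_X X_vmod gen_X X_vmod \<phi>(1) \<psi>(1) sp] N by (simp add: O_def)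
  show ?thesis by (rule biproductI[OF X_in X_in NO \<phi>(1) i1 \<psi>(1) i2 disj sp])
qed

lemma zero_obj_carr: "zero_obj C Z \<Longrightarrow> carr Z = {0}"
proof -
  interpret linear_category C by (rule linear_category)
  assume z: "zero_obj C Z"
  then have Z: "Z \<in> Obj C" by (simp add: zero_obj_def)
  then have "(\<lambda>v\<in>carr Z. v) = (\<lambda>v\<in>carr Z. 0)" using zero_obj_iff[OF Z] z by simp
  then have "\<forall>v\<in>carr Z. v = 0" by (metis restrict_apply')
  moreover have "0 \<in> carr Z" using Z obj vmod_subspace vec.subspace_0 by auto
  ultimately show ?thesis by blast
qed

text \<open>Connects the categorical \<open>direct_sum\<close> with the concrete \<open>dsum\<close>
  occurring in \<open>in_add_closure\<close>. The induction removes the head of the list, which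
  takes index 0, while the other indices are shifted by one.\<close>

lemma direct_sum_dsum:
  fixes M :: "nat \<Rightarrow> ('b, 'w) lmod"
  assumes "direct_sum C (map X is) N" "\<And>k. k < length is \<Longrightarrow> \<exists>f. base_iso (X (is ! k)) (M k) f"
  shows "\<exists>F. base_iso N (dsum {..<length is} M) F"
  using assms
proof (induction "map X is" N arbitrary: "is" M)
  case (1 Z)
  \<comment> \<open>Over the empty index set the only element of \<open>dsum\<close> is the
    everywhere undefined function.\<close>
  let ?F = "\<lambda>v. \<lambda>k\<in>{..<0::nat}. undefined"
  note 2 = zero_obj_carr[OF 1(1)]
  have "base_iso Z (dsum {..<length is} M) ?F"
    unfolding base_iso_def lmod_hom_def clinear_map_def
    using 1 2 by (auto simp: dsum_simps bij_betw_def)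
  then show ?case by blast
next
  case (2 Xs S A T)
  interpret linear_category C by (rule linear_category)
  obtain i js where "is": "is = i # js" "A = X i" "Xs = map X js" using 2(4) by auto
  have "\<exists>f. base_iso (X (js ! k)) (M (Suc k)) f" if "k < length js" for k
    using 2(5)[of "Suc k"] that by (simp add: "is")
  then obtain G where G: "base_iso S (dsum {..<length js} (\<lambda>k. M (Suc k))) G" using 2(2)[OF "is"(3), of "\<lambda>k. M (Suc k)"] by blast
  obtain g where g: "base_iso (X i) (M 0) g" using 2(5)[of 0] by (auto simp: "is")
  obtain a j p q where m: "a \<in> Hom C (X i) T" "j \<in> Hom C S T" "p \<in> Hom C T (X i)" "q \<in> Hom C T S"
    "Comp C p a = Ide C (X i)" "Comp C q j = Ide C S" "Comp C p j = Hzero C S (X i)" "Comp C q a = Hzero C (X i) S"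
    "Hadd C (Comp C a p) (Comp C j q) = Ide C T"
    by (rule biproductE[OF 2(3)[unfolded "is"]]) (rule that)
  obtain a' j' p' q' where e: "a = (X i, T, a')" "j = (S, T, j')" "p = (T, X i, p')" "q = (T, S, q')"
    and ar: "arr (X i) T a'" "arr S T j'" "arr T (X i) p'" "arr T S q'" using m(1-4) by (auto simp: Hom_C)
  have pa: "p' (a' x) = x" "q' (a' x) = 0" if "x \<in> carr (X i)" for x
    using m(5,8) that unfolding e by (auto simp: compose_def dest!: fun_cong[of _ _ x])
  have qj: "q' (j' y) = y" "p' (j' y) = 0" if "y \<in> carr S" for y
    using m(6,7) that unfolding e by (auto simp: compose_def dest!: fun_cong[of _ _ y])
  have split: "a' (p' v) + j' (q' v) = v" if "v \<in> carr T" for v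
    using m(9) that unfolding e by (auto simp: compose_def dest!: fun_cong[of _ _ v])
  note ap = arrD(10)[OF ar(1)] arrD(10)[OF ar(2)] arrD(10)[OF ar(3)] arrD(10)[OF ar(4)]
  note li = arrD(9)[OF ar(3)] arrD(9)[OF ar(4)]
  note mX = arrD(3)[OF ar(1)] and mS = arrD(3)[OF ar(2)] and mT = arrD(4)[OF ar(1)]
  note vo = vmod_vops[OF mX, unfolded vops_def] vmod_vops[OF mS, unfolded vops_def] vmod_vops[OF mT, unfolded vops_def]
  let ?n = "length js"
  \<comment> \<open>Component 0 comes from the projection to \<open>X i\<close>, the later ones from
    the map already obtained for the remaining summand \<open>S\<close>.\<close>
  define F where "F v = (\<lambda>k\<in>{..<Suc ?n}. case k of 0 \<Rightarrow> g (p' v) | Suc l \<Rightarrow> G (q' v) l)" for v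
  have gh: "g \<in> carr (X i) \<rightarrow> carr (M 0)" "bij_betw g (carr (X i)) (carr (M 0))" "g 0 = vzero (M 0)"
    "\<And>u v. u \<in> carr (X i) \<Longrightarrow> v \<in> carr (X i) \<Longrightarrow> g (u + v) = vadd (M 0) (g u) (g v)"
    "\<And>c v. v \<in> carr (X i) \<Longrightarrow> g (vscale c v) = vsmul (M 0) c (g v)"
    "\<And>b v. v \<in> carr (X i) \<Longrightarrow> g (act (X i) b v) = act (M 0) b (g v)"
    using g vo by (auto simp: base_iso_def lmod_hom_def clinear_map_def)
  have Gh: "bij_betw G (carr S) (carr (dsum {..<?n} (\<lambda>k. M (Suc k))))"
    "\<And>l. l < ?n \<Longrightarrow> G 0 l = vzero (M (Suc l))"
    "\<And>v. v \<in> carr S \<Longrightarrow> G v \<in> Pi\<^sub>E {..<?n} (\<lambda>k. carr (M (Suc k)))"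
    "\<And>u v l. u \<in> carr S \<Longrightarrow> v \<in> carr S \<Longrightarrow> l < ?n \<Longrightarrow> G (u + v) l = vadd (M (Suc l)) (G u l) (G v l)"
    "\<And>c v l. v \<in> carr S \<Longrightarrow> l < ?n \<Longrightarrow> G (vscale c v) l = vsmul (M (Suc l)) c (G v l)"
    "\<And>b v l. v \<in> carr S \<Longrightarrow> l < ?n \<Longrightarrow> G (act S b v) l = act (M (Suc l)) b (G v l)"
    using G vo unfolding base_iso_def lmod_hom_def clinear_map_def by (auto simp: dsum_simps)
  have FP: "F v \<in> Pi\<^sub>E {..<Suc ?n} (\<lambda>k. carr (M k))" if "v \<in> carr T" for v
    using gh(1) Gh(3)[OF ap(4)[OF that]] ap(3)[OF that] unfolding F_def by (auto split: nat.split)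
  have hom: "lmod_hom T (dsum {..<length is} M) F"
    unfolding lmod_hom_def clinear_map_def
  proof (intro conjI ballI allI)
    show "F \<in> carr T \<rightarrow> carr (dsum {..<length is} M)" using FP by (auto simp: dsum_simps "is")
  next
    fix u v assume uv: "u \<in> carr T" "v \<in> carr T"
    show "F (vadd T u v) = vadd (dsum {..<length is} M) (F u) (F v)"
      unfolding dsum_simps "is" using uv ap vo
      by (auto simp: F_def linon_add[OF li(1)] linon_add[OF li(2)] gh Gh split: nat.split intro!: restrict_ext)
  next
    fix c v assume v: "v \<in> carr T"
    show "F (vsmul T c v) = vsmul (dsum {..<length is} M) c (F v)"
      unfolding dsum_simps "is" using v ap vo
      by (auto simp: F_def linon_scale[OF li(1)] linon_scale[OF li(2)] gh Gh split: nat.split intro!: restrict_ext)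
  next
    fix b v assume v: "v \<in> carr T"
    note h = lmod_homD(3)[OF arrD(7)[OF ar(3)] mT mX v] lmod_homD(3)[OF arrD(7)[OF ar(4)] mT mS v]
    show "F (act T b v) = act (dsum {..<length is} M) b (F v)"
      unfolding dsum_simps "is" using v ap vo
      by (auto simp: F_def h gh Gh split: nat.split intro!: restrict_ext)
  qed
  have inj: "inj_on F (carr T)"
  proof (rule inj_onI)
    fix u v assume uv: "u \<in> carr T" "v \<in> carr T" "F u = F v"
    have "g (p' u) = g (p' v)" using fun_cong[OF uv(3), of 0] by (simp add: F_def)
    then have 1: "p' u = p' v" using gh(2) ap(3) uv by (auto simp: bij_betw_def dest: inj_onD)
    have "G (q' u) l = G (q' v) l" if "l < ?n" for l using fun_cong[OF uv(3), of "Suc l"] that by (simp add: F_def)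
    then have "G (q' u) = G (q' v)" using Gh(3)[OF ap(4)[OF uv(1)]] Gh(3)[OF ap(4)[OF uv(2)]] by (intro PiE_ext) auto
    then have 2: "q' u = q' v" using Gh(1) ap(4) uv by (auto simp: bij_betw_def dest: inj_onD)
    show "u = v" using split[OF uv(1)] split[OF uv(2)] 1 2 by metis
  qed
  have surj: "f \<in> F ` carr T" if f: "f \<in> carr (dsum {..<length is} M)" for f
  proof -
    have fP: "f \<in> Pi\<^sub>E {..<Suc ?n} (\<lambda>k. carr (M k))" using f by (simp add: dsum_simps "is")
    then have "f 0 \<in> carr (M 0)" by auto
    then obtain x where x: "x \<in> carr (X i)" "g x = f 0" using gh(2) by (metis bij_betw_def imageE)
    have "(\<lambda>l\<in>{..<?n}. f (Suc l)) \<in> carr (dsum {..<?n} (\<lambda>k. M (Suc k)))" using fP by (auto simp: dsum_simps)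
    then obtain y where y: "y \<in> carr S" "G y = (\<lambda>l\<in>{..<?n}. f (Suc l))" using Gh(1) by (metis bij_betw_def imageE)
    have v: "a' x + j' y \<in> carr T" using ap x y arrD(6)[OF ar(1)] by (simp add: vec.subspace_add)
    have "p' (a' x + j' y) = x" "q' (a' x + j' y) = y"
      using x y ap by (simp_all add: linon_add[OF li(1)] linon_add[OF li(2)] pa qj)
    then have "F (a' x + j' y) = f"
      using x y fP by (intro PiE_ext[OF FP[OF v] fP]) (auto simp: F_def split: nat.split)
    then show ?thesis using v by blast
  qed
  have F0: "F 0 = vzero (dsum {..<length is} M)"
  proof -
    have "0 \<in> carr T" using arrD(6)[OF ar(1)] vec.subspace_0 by blast
    then have "p' 0 = 0" "q' 0 = 0" using linon_zero[OF li(1)] linon_zero[OF li(2)] by auto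
    then show ?thesis unfolding dsum_simps "is" by (auto simp: F_def gh Gh split: nat.split intro!: restrict_ext)
  qed
  have "F ` carr T \<subseteq> carr (dsum {..<length is} M)" using hom by (auto simp: lmod_hom_def clinear_map_def)
  then have "bij_betw F (carr T) (carr (dsum {..<length is} M))" using inj surj by (auto simp: bij_betw_def)
  then show ?case using hom F0 unfolding base_iso_def by blast
qed

lemma ex_direct_sum: "\<exists>Q. direct_sum C (map X is) Q"
proof (induction "is")
  case Nil then show ?case using ex_zero by (auto intro: direct_sum.intros(1))
next
  case (Cons i js)
  then obtain Q where Q: "direct_sum C (map X js) Q" by blast
  then have "Q \<in> \<O>" by cases (auto simp: zero_obj_def biproduct_def)
  then obtain S where "biproduct C (X i) Q S" using ex_biproduct X_in by blast
  then show ?case using Q by (auto intro!: exI[of _ S] direct_sum.intros(2))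
qed

lemma direct_sum_in: "direct_sum C Xs Q \<Longrightarrow> Q \<in> \<O>"
  by (erule direct_sum.cases) (auto simp: zero_obj_def biproduct_def)

end

context simple_family
begin

text \<open>A direct summand is the image of the whole sum under a projection, so it is generated.
  Conversely a generated module is isomorphic to a finite \<open>dsum\<close> of members of
  \<open>S\<close>, which is a summand of itself with complement zero.\<close>

lemma in_add_closure_iff:
  fixes S :: "('b, 'w) lmod set"
  assumes SX: "\<And>M. M \<in> S \<Longrightarrow> \<exists>i f. base_iso (X i) M f" and XS: "\<And>i. \<exists>M\<in>S. \<exists>f. base_iso (X i) M f"
    and N: "is_vmod br N"
  shows "in_add_closure S N \<longleftrightarrow> gen N"
proof -
  let ?O = "{N. is_vmod br N \<and> gen N}"
  interpret generated_category br X ?O "mod_lincat ?O"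
    by standard (auto simp: lincat.truncate_def mod_lincat_def)
  show ?thesis
  proof
    assume "in_add_closure S N"
    then obtain n M D where M: "\<forall>k<n. M k \<in> S" and D: "direct_summand D (dsum {..<n} M)"
      and iso: "lmod_iso N ((dsum {..<n} M)\<lparr>carr := D\<rparr>)" unfolding in_add_closure_def by blast
    have "\<forall>k. \<exists>i. k < n \<longrightarrow> (\<exists>f. base_iso (X i) (M k) f)" using SX M by blast
    then obtain i where i: "\<And>k. k < n \<Longrightarrow> \<exists>f. base_iso (X (i k)) (M k) f" by metis
    obtain Q where Q: "direct_sum (mod_lincat ?O) (map X (map i [0..<n])) Q" using ex_direct_sum by blast
    obtain F where F: "base_iso Q (dsum {..<n} M) F" using direct_sum_dsum[OF Q, of M] i by auto
    have Q': "is_vmod br Q" "gen Q" using direct_sum_in[OF Q] by auto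
    have Fb: "bij_betw F (carr Q) (carr (dsum {..<n} M))" and F0: "F 0 = vzero (dsum {..<n} M)"
      and Fh: "lmod_hom Q (dsum {..<n} M) F" using F by (auto simp: base_iso_def)
    have Fadd: "F (u + v) = vadd (dsum {..<n} M) (F u) (F v)" if "u \<in> carr Q" "v \<in> carr Q" for u v
      using Fh vmod_vops[OF Q'(1)] that by (auto simp: lmod_hom_def clinear_map_def vops_def)
    obtain D' where D': "submodule D (dsum {..<n} M)" "submodule D' (dsum {..<n} M)" "D \<inter> D' = {vzero (dsum {..<n} M)}"
      "\<forall>v\<in>carr (dsum {..<n} M). \<exists>d\<in>D. \<exists>d'\<in>D'. v = vadd (dsum {..<n} M) d d'"
      using D unfolding direct_summand_def by blast
    \<comment> \<open>\<open>D\<close> and its complement are transported along \<open>F\<close> to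
      submodules of \<open>Q\<close>, where \<open>direct_decomposition\<close> supplies the
      projection onto \<open>A\<close>.\<close>
    define A B where "A = {v \<in> carr Q. F v \<in> D}" and "B = {v \<in> carr Q. F v \<in> D'}"
    have A: "submodule A Q" and B: "submodule B Q"
      unfolding A_def B_def by (rule base_iso_submodule[OF Q'(1) F] D')+
    note mA = is_vmod_submodule[OF Q'(1) A] and mB = is_vmod_submodule[OF Q'(1) B]
    have DC: "D \<subseteq> carr (dsum {..<n} M)" "D' \<subseteq> carr (dsum {..<n} M)"
      using D' by (auto simp: submodule_def csubspace_def)
    have pre: "\<exists>a\<in>carr Q. F a = d" if "d \<in> carr (dsum {..<n} M)" for d using Fb that by (metis bij_betw_def imageE)
    have "0 \<in> carr Q" using vmod_subspace[OF Q'(1)] vec.subspace_0 by blast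
    moreover have "x = 0" if "x \<in> A" "x \<in> B" "0 \<in> carr Q" for x
    proof -
      have "F x \<in> D \<inter> D'" using that by (simp add: A_def B_def)
      then have "F x = F 0" using D'(3) F0 by simp
      then show ?thesis using that Fb by (auto simp: A_def bij_betw_def dest: inj_onD)
    qed
    ultimately have AB0: "(\<lambda>v. v) ` carr (vmod A (act Q)) \<inter> (\<lambda>v. v) ` carr (vmod B (act Q)) \<subseteq> {0}"
      by auto
    have ABs: "\<exists>x\<in>carr (vmod A (act Q)). \<exists>y\<in>carr (vmod B (act Q)). v = x + y" if v: "v \<in> carr Q" for v
    proof -
      have "F v \<in> carr (dsum {..<n} M)" using Fb v by (auto simp: bij_betw_def)
      then obtain d d' where d: "d \<in> D" "d' \<in> D'" "F v = vadd (dsum {..<n} M) d d'" using D'(4) by blast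
      obtain a where a: "a \<in> carr Q" "F a = d" using pre d DC by blast
      obtain b where b: "b \<in> carr Q" "F b = d'" using pre d DC by blast
      have "F v = F (a + b)" using d a b Fadd by simp
      moreover have "a + b \<in> carr Q" using a b vmod_subspace[OF Q'(1)] by (simp add: vec.subspace_add)
      ultimately have "v = a + b" using Fb v by (auto simp: bij_betw_def dest: inj_onD)
      then show ?thesis using a b d by (auto simp: A_def B_def)
    qed
    obtain p where p: "lmod_hom Q (vmod A (act Q)) p" "\<And>x. x \<in> carr (vmod A (act Q)) \<Longrightarrow> p x = x"
      using direct_decomposition[OF mA mB Q'(1) lmod_hom_inclusion[OF Q'(1) A] _ lmod_hom_inclusion[OF Q'(1) B] _ AB0 ABs]
      by (metis inj_on_id2)
    obtain g where g: "lmod_hom N ((dsum {..<n} M)\<lparr>carr := D\<rparr>) g" "bij_betw g (carr N) D"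
      using iso by (auto simp: lmod_iso_def)
    note g' = lmod_hom_inv[OF g(1) _ N, simplified, OF g(2)]
    have FA: "lmod_hom (vmod A (act Q)) ((dsum {..<n} M)\<lparr>carr := D\<rparr>) F"
      using Fh vmod_vops[OF Q'(1)] unfolding lmod_hom_def clinear_map_def
      by (auto simp: A_def vops_def)
    define h where "h v = inv_into (carr N) g (F (p v))" for v
    have h: "lmod_hom Q N h" unfolding h_def by (rule lmod_hom_comp[OF lmod_hom_comp[OF p(1) FA] g'])
    have "carr N \<subseteq> h ` carr Q"
    proof
      fix v assume v: "v \<in> carr N"
      then have "g v \<in> D" using g(2) by (auto simp: bij_betw_def)
      then obtain a where a: "a \<in> carr Q" "F a = g v" using pre DC by blast
      then have "a \<in> A" using \<open>g v \<in> D\<close> by (simp add: A_def)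
      then have "h a = v" unfolding h_def using p(2)[of a] a g(2) v by (simp add: bij_betw_def)
      then show "v \<in> h ` carr Q" using a by blast
    qed
    then have "h ` carr Q = carr N" using lmod_homD(2)[OF h Q'(1) N] by blast
    then show "gen N" by (rule gen_image[OF Q'(2,1) N h])
  next
    assume "gen N"
    then obtain "is" where "is": "direct_sum (mod_lincat ?O) (map X is) N" using direct_sum_decomposition N by blast
    have "\<forall>k. \<exists>M. M \<in> S \<and> (\<exists>f. base_iso (X (is ! k)) M f)" using XS by blast
    then obtain M where M: "\<And>k. M k \<in> S" "\<And>k. \<exists>f. base_iso (X (is ! k)) (M k) f" by metis
    let ?n = "length is"
    let ?V = "dsum {..<?n} M"
    obtain F where F: "base_iso N ?V F" using direct_sum_dsum[OF "is", of M] M(2) by blast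
    have Fb: "F ` carr N = carr ?V" and F0: "F 0 = vzero ?V" and Fh: "lmod_hom N ?V F"
      using F by (auto simp: base_iso_def bij_betw_def)
    note s = vmod_subspace[OF N]
    have h: "vadd ?V (F u) (F v) = F (u + v)" "vsmul ?V c (F u) = F (vscale c u)" "act ?V b (F u) = F (act N b u)"
      if "u \<in> carr N" "v \<in> carr N" for u v c b
      using Fh vmod_vops[OF N] that by (auto simp: lmod_hom_def clinear_map_def vops_def)
    have n0: "0 \<in> carr N" using s vec.subspace_0 by blast
    have a0: "act N b 0 = 0" for b using linon_zero[OF vmod_linon[OF N] n0] .
    have 1: "submodule (carr ?V) ?V"
      unfolding submodule_def csubspace_def Fb[symmetric] F0[symmetric]
      using n0 vmod_act[OF N] s by (auto simp: h vec.subspace_add vec.subspace_scale)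
    have 2: "submodule {vzero ?V} ?V"
      unfolding submodule_def csubspace_def Fb[symmetric] F0[symmetric]
      using n0 by (auto simp: h[OF n0 n0] a0)
    have 3: "\<exists>d\<in>carr ?V. \<exists>d'\<in>{vzero ?V}. v = vadd ?V d d'" if v: "v \<in> carr ?V" for v
    proof -
      obtain u where u: "u \<in> carr N" "v = F u" using v unfolding Fb[symmetric] by blast
      then have "v = vadd ?V v (vzero ?V)" using h(1)[OF u(1) n0] F0 by simp
      then show ?thesis using v by blast
    qed
    have "direct_summand (carr ?V) ?V"
      unfolding direct_summand_def using 1 2 3 by (intro conjI exI[of _ "{vzero ?V}"]) (auto simp: submodule_def csubspace_def)
    moreover have "lmod_iso N (?V\<lparr>carr := carr ?V\<rparr>)"
      using F unfolding lmod_iso_def base_iso_def lmod_hom_def clinear_map_def by (intro exI[of _ F]) simp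
    ultimately show "in_add_closure S N" unfolding in_add_closure_def using M(1) by blast
  qed
qed

end

section \<open>Finite-dimensional modules over \<open>sl\<^sub>2\<close>\<close>

text \<open>Composing the action with a projection onto the carrier makes it linear everywhere, and the
  bracket relations then hold everywhere.\<close>

lemma total_action:
  assumes N: "is_vmod br N"
  obtains T where "\<And>b. lin (T b)" "\<And>b v. T b v \<in> carr N" "\<And>b v. v \<in> carr N \<Longrightarrow> T b v = act N b v"
    "\<And>x y v. T x (T y v) = T y (T x v) + lc T (br x y) v"
proof -
  obtain \<pi> where \<pi>: "lin \<pi>" "\<And>v. \<pi> v \<in> carr N" "\<And>v. v \<in> carr N \<Longrightarrow> \<pi> v = v"
    using subspace_projection[OF vmod_subspace[OF N]] by metis
  define T where "T b v = act N b (\<pi> v)" for b v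
  have TN: "T b v \<in> carr N" for b v unfolding T_def by (rule vmod_act[OF N \<pi>(2)])
  have lc: "lc T l v = lc (act N) l (\<pi> v)" for l v by (simp add: lc_def T_def)
  show thesis
  proof (rule that[of T])
    show "lin (T b)" for b
      unfolding T_def
      by (rule linI) (simp_all add: lin_add[OF \<pi>(1)] lin_scale[OF \<pi>(1)] linon_add[OF vmod_linon[OF N]]
          linon_scale[OF vmod_linon[OF N]] \<pi>(2))
    show "T b v \<in> carr N" for b v by (rule TN)
    show "T b v = act N b v" if "v \<in> carr N" for b v using that by (simp add: T_def \<pi>(3))
    show "T x (T y v) = T y (T x v) + lc T (br x y) v" for x y v
    proof -
      have "T x (T y v) = act N x (act N y (\<pi> v))" "T y (T x v) = act N y (act N x (\<pi> v))"
        by (simp_all add: T_def \<pi>(3) vmod_act[OF N \<pi>(2)])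
      then show ?thesis unfolding lc using vmod_bracket[OF N \<pi>(2)] by metis
    qed
  qed
qed

section \<open>Operators annihilated by products of linear factors\<close>

lemma lin_funpow: "lin f \<Longrightarrow> lin (f ^^ n)"
  by (induction n) (auto intro: linI simp: lin_add lin_scale)

lemma funpow_in: "(\<And>v. v \<in> V \<Longrightarrow> f v \<in> V) \<Longrightarrow> v \<in> V \<Longrightarrow> (f ^^ n) v \<in> V"
  by (induction n) auto

text \<open>The product of the commuting operators \<open>T - \<mu>\<close> over a list of scalars,
  applied to \<open>v\<close>; the list acts as an annihilating polynomial given by its
  roots.\<close>

fun lp :: "(vec \<Rightarrow> vec) \<Rightarrow> complex list \<Rightarrow> vec \<Rightarrow> vec" where
  "lp T [] v = v"
| "lp T (\<mu> # ms) v = lp T ms (T v - vscale \<mu> v)"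

definition sh :: "(vec \<Rightarrow> vec) \<Rightarrow> complex \<Rightarrow> vec \<Rightarrow> vec" where
  "sh T \<mu> v = T v - vscale \<mu> v"

lemma lin_sh: "lin T \<Longrightarrow> lin (sh T \<mu>)"
  by (rule linI) (simp_all add: sh_def lin_add lin_scale algebra_simps vec.scale_right_distrib vec.scale_right_diff_distrib)

lemma sh_commute: "lin T \<Longrightarrow> sh T \<mu> (sh T \<nu> v) = sh T \<nu> (sh T \<mu> v)"
  by (simp add: sh_def lin_diff lin_scale vec.scale_right_diff_distrib algebra_simps)

lemma lp_Cons: "lp T (\<mu> # ms) v = lp T ms (sh T \<mu> v)"
  by (simp add: sh_def)

declare lp.simps(2) [simp del]

lemma lin_lp: "lin T \<Longrightarrow> lin (lp T ms)"
proof (induction ms)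
  case Nil show ?case by (rule linI) auto
next
  case (Cons \<mu> ms)
  have "lin (\<lambda>v. lp T ms (sh T \<mu> v))" using Cons by (intro lin_compose[OF lin_sh])
  then show ?case by (simp add: lp_Cons)
qed

lemma lp_sh: "lin T \<Longrightarrow> lp T ms (sh T \<mu> v) = sh T \<mu> (lp T ms v)"
proof (induction ms arbitrary: v)
  case (Cons \<nu> ms)
  then show ?case using sh_commute[OF Cons.prems, of \<nu> \<mu> v] by (simp add: lp_Cons)
qed simp

lemma lp_append: "lp T (xs @ ys) v = lp T ys (lp T xs v)"
  by (induction xs arbitrary: v) (simp_all add: lp_Cons)

text \<open>Products of shifts of \<open>T\<close> commute, so the factor that kills
  \<open>v\<close> can be applied first.\<close>

lemma lp_append_zero:
  assumes T: "lin T" and "lp T xs v = 0 \<or> lp T ys v = 0"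
  shows "lp T (xs @ ys) v = 0"
proof -
  have "lp T ys (lp T xs v) = lp T xs (lp T ys v)"
    by (induction ys arbitrary: v) (simp_all add: lp_Cons lp_sh[OF T])
  then show ?thesis using assms lin_zero[OF lin_lp[OF T]] by (metis lp_append)
qed

lemma lp_eigen: "lin T \<Longrightarrow> T v = vscale \<mu> v \<Longrightarrow> lp T ms v = vscale (\<Prod>\<nu>\<leftarrow>ms. \<mu> - \<nu>) v"
proof (induction ms)
  case (Cons \<nu> ms)
  have "sh T \<nu> v = vscale (\<mu> - \<nu>) v" using Cons.prems by (simp add: sh_def vec.scale_left_diff_distrib)
  then show ?case using Cons by (simp add: lp_Cons lin_scale[OF lin_lp] mult.commute)
qed simp

text \<open>Removing factors from \<open>ys\<close> leads to a vector with
  \<open>T v = \<mu> v\<close> for some \<mu> in \<open>ys\<close>. On it the product over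
  \<open>xs\<close> is multiplication by a scalar, nonzero because \<mu> is not in
  \<open>xs\<close>.\<close>

lemma lp_coprime:
  assumes T: "lin T" and "lp T xs v = 0" "lp T ys v = 0" "set xs \<inter> set ys = {}"
  shows "v = 0"
  using assms(2-4)
proof (induction ys arbitrary: v)
  case (Cons \<mu> ys)
  have "lp T xs (sh T \<mu> v) = 0" unfolding lp_sh[OF T] Cons.prems(1) by (simp add: sh_def lin_zero[OF T])
  then have "sh T \<mu> v = 0" using Cons.prems by (rule_tac Cons.IH) (auto simp: lp_Cons)
  then have "lp T xs v = vscale (\<Prod>\<nu>\<leftarrow>xs. \<mu> - \<nu>) v" by (intro lp_eigen[OF T]) (simp add: sh_def)
  moreover have "(\<Prod>\<nu>\<leftarrow>xs. \<mu> - \<nu>) \<noteq> 0" using Cons.prems(3) by (auto simp: prod_list_zero_iff)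
  ultimately show ?case using Cons.prems(1) by simp
qed simp

text \<open>The vector \<open>p(T) v\<close>.\<close>

definition ev :: "(vec \<Rightarrow> vec) \<Rightarrow> complex poly \<Rightarrow> vec \<Rightarrow> vec" where
  "ev T p v = (\<Sum>i\<le>degree p. vscale (coeff p i) ((T ^^ i) v))"

lemma ev_superset:
  assumes "degree p \<le> n" shows "ev T p v = (\<Sum>i\<le>n. vscale (coeff p i) ((T ^^ i) v))"
  unfolding ev_def using assms by (intro sum.mono_neutral_left) (auto simp: coeff_eq_0)

lemma ev_pCons:
  assumes T: "lin T" shows "ev T (pCons c p) v = vscale c v + T (ev T p v)"
proof -
  have "ev T (pCons c p) v = (\<Sum>i\<le>Suc (degree p). vscale (coeff (pCons c p) i) ((T ^^ i) v))"
    by (rule ev_superset) (simp add: degree_pCons_le)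
  also have "\<dots> = vscale c v + (\<Sum>i\<le>degree p. vscale (coeff p i) (T ((T ^^ i) v)))"
    by (subst sum.atMost_Suc_shift) simp
  finally show ?thesis by (simp add: ev_def lin_sum[OF T] lin_scale[OF T])
qed

lemma ev_zero [simp]: "ev T 0 v = 0"
  by (simp add: ev_def)

lemma ev_add:
  assumes T: "lin T" shows "ev T (p + q) v = ev T p v + ev T q v"
proof (induction p arbitrary: q)
  case (pCons c p)
  obtain d r where "q = pCons d r" by (cases q)
  then show ?case
    by (simp add: ev_pCons[OF T] pCons.IH lin_add[OF T] vec.scale_left_distrib algebra_simps)
qed simp

lemma ev_smult: "lin T \<Longrightarrow> ev T (smult c p) v = vscale c (ev T p v)"
  by (induction p) (simp_all add: ev_pCons lin_scale vec.scale_right_distrib)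

lemma ev_mult: "lin T \<Longrightarrow> ev T (p * q) v = ev T p (ev T q v)"
  by (induction p) (simp_all add: ev_pCons ev_add ev_smult mult_pCons_left)

text \<open>The fundamental theorem of algebra splits off one root at a time, and the roots found
  form the list for \<open>lp\<close>.\<close>

lemma ev_imp_lp:
  assumes T: "lin T" and "p \<noteq> 0" "ev T p v = 0"
  shows "\<exists>ms. lp T ms v = 0"
  using assms(2,3)
proof (induction "degree p" arbitrary: p v)
  case 0
  then obtain c where "p = [:c:]" "c \<noteq> 0" by (metis degree_eq_zeroE pCons_0_0)
  then have "v = 0" using 0 by (simp add: ev_pCons[OF T] lin_zero[OF T])
  then show ?case by (intro exI[of _ "[]"]) simp
next
  case (Suc n)
  have "\<not> constant (poly p)" using Suc(2) by (simp add: constant_degree)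
  then obtain z where "poly p z = 0" using fundamental_theorem_of_algebra by blast
  then obtain q where q: "p = [:- z, 1:] * q" by (auto simp: poly_eq_0_iff_dvd dvd_def)
  have q0: "q \<noteq> 0" using q Suc.prems by auto
  have "degree p = degree [:- z, 1:] + degree q" unfolding q using q0 by (intro degree_mult_eq) auto
  then have "n = degree q" using Suc(2) by simp
  moreover have "ev T q (sh T z v) = 0"
  proof -
    have "p = q * [:- z, 1:]" using q by (simp only: mult.commute)
    then have "ev T p v = ev T q (ev T [:- z, 1:] v)" by (simp only: ev_mult[OF T])
    also have "ev T [:- z, 1:] v = sh T z v" by (simp add: ev_pCons[OF T] sh_def lin_zero[OF T])
    finally show ?thesis using Suc.prems by simp
  qed
  ultimately obtain ms where "lp T ms (sh T z v) = 0" using Suc.hyps(1) q0 by blast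
  then show ?case by (intro exI[of _ "z # ms"]) (simp add: lp_Cons)
qed

lemma findim_annihilated:
  assumes T: "lin T" and inv: "\<And>v. v \<in> V \<Longrightarrow> T v \<in> V" and B: "finite B" "V = vec.span B" and v: "v \<in> V"
  shows "\<exists>ms. lp T ms v = 0"
proof -
  let ?n = "card B"
  let ?t = "\<lambda>i. (T ^^ i) v"
  have tV: "?t i \<in> V" for i using inv v by (rule funpow_in)
  obtain p where p: "p \<noteq> 0" "ev T p v = 0"
  \<comment> \<open>If two powers of \<open>T\<close> agree on \<open>v\<close>, these vectors form
    too small a set for the dimension count, but then a difference of two monomials is the required
    polynomial.\<close>
  proof (cases "inj_on ?t {..?n}")
    case False
    then obtain i j where ij: "i \<noteq> j" "?t i = ?t j" unfolding inj_on_def by blast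
    let ?p = "monom 1 i - monom (1::complex) j"
    have "ev T (monom 1 k) v = ?t k" for k
      by (simp add: ev_def degree_monom_eq when_def if_distrib[of "\<lambda>c. vscale c _"] cong: if_cong)
    moreover have "ev T (- p) v = - ev T p v" for p using ev_smult[OF T, of "-1" p v] by simp
    ultimately have "ev T ?p v = 0" using ij(2) ev_add[OF T, of "monom 1 i" "- monom 1 j" v] by simp
    moreover have "coeff ?p i = 1" using ij(1) by simp
    then have "?p \<noteq> 0" by (metis coeff_0 zero_neq_one)
    ultimately show thesis using that by blast
  next
    case True
    have "\<not> vec.independent (?t ` {..?n})"
    proof
      assume ind: "vec.independent (?t ` {..?n})"
      have "?t ` {..?n} \<subseteq> vec.span B" using tV B(2) by auto
      from vec.independent_span_bound[OF B(1) ind this] True show False by (simp add: card_image)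
    qed
    then obtain t u where t: "finite t" "t \<subseteq> ?t ` {..?n}" "(\<Sum>w\<in>t. vscale (u w) w) = 0" "\<exists>w\<in>t. u w \<noteq> 0"
      unfolding vec.dependent_explicit by blast
    \<comment> \<open>The scalars of the linear relation, with 0 for the powers whose vector does
      not occur in \<open>t\<close>.\<close>
    define c where "c i = (if i \<le> ?n \<and> ?t i \<in> t then u (?t i) else 0)" for i
    define p where "p = (\<Sum>i\<le>?n. monom (c i) i)"
    have cf: "coeff p i = c i" for i by (simp add: p_def coeff_sum c_def)
    have "degree p \<le> ?n" by (rule degree_le) (auto simp: cf c_def)
    then have "ev T p v = (\<Sum>i\<le>?n. vscale (c i) (?t i))" by (simp add: ev_superset cf)
    also have "\<dots> = (\<Sum>w\<in>?t ` {..?n}. if w \<in> t then vscale (u w) w else 0)"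
      by (subst sum.reindex[OF True]) (auto simp: c_def intro!: sum.cong)
    also have "\<dots> = (\<Sum>w\<in>t. vscale (u w) w)" using t(2) by (subst sum.inter_restrict[symmetric]) (auto simp: Int_absorb1)
    finally have "ev T p v = 0" using t(3) by simp
    moreover have "p \<noteq> 0"
    proof -
      obtain w where "w \<in> t" "u w \<noteq> 0" using t(4) by blast
      moreover then obtain i where "i \<le> ?n" "w = ?t i" using t(2) by auto
      ultimately have "coeff p i \<noteq> 0" by (simp add: cf c_def)
      then show ?thesis by auto
    qed
    ultimately show thesis using that by blast
  qed
  then show ?thesis using ev_imp_lp[OF T] by blast
qed

text \<open>Concatenating annihilating lists of the finitely many spanning vectors gives a common
  one.\<close>

lemma findim_annihilated_uniform:
  assumes T: "lin T" and inv: "\<And>v. v \<in> V \<Longrightarrow> T v \<in> V" and B: "finite B" "V = vec.span B"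
  obtains ms where "\<And>v. v \<in> V \<Longrightarrow> lp T ms v = 0"
proof -
  have "\<exists>ms. \<forall>v\<in>S. lp T ms v = 0" if "finite S" "S \<subseteq> V" for S using that
  proof (induction rule: finite_induct)
    case (insert x S)
    then obtain xs ys where "\<forall>v\<in>S. lp T xs v = 0" "lp T ys x = 0"
      using findim_annihilated[OF T inv B, of x] by auto
    then have "\<forall>v\<in>insert x S. lp T (xs @ ys) v = 0" using lp_append_zero[OF T] by blast
    then show ?case by blast
  qed simp
  from this[OF B(1)] B(2) vec.span_superset obtain ms where ms: "\<forall>v\<in>B. lp T ms v = 0" by blast
  have "lp T ms v = 0" if "v \<in> V" for v using that unfolding B(2)
  proof (induction rule: vec.span_induct_alt)
    case (step c x y) then show ?case using ms by (simp add: lin_add[OF lin_lp[OF T]] lin_scale[OF lin_lp[OF T]])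
  qed (simp add: lin_zero[OF lin_lp[OF T]])
  then show thesis using that by blast
qed

text \<open>The operator \<open>e\<close> raises generalised eigenvalues of \<open>T\<close> by
  \<open>c\<close>. For a suitable \<open>k\<close> the list \<open>ms\<close> shifted by
  \<open>k c\<close> is disjoint from \<open>ms\<close>; as \<open>(e ^^ k) v\<close> is killed by
  the products over both lists, it vanishes by \<open>lp_coprime\<close>.\<close>

lemma findim_nilpotent:
  assumes T: "lin T" and e: "lin e" and c: "c \<noteq> 0" and comm: "\<And>v. T (e v) = e (T v) + vscale c (e v)"
    and inv: "\<And>v. v \<in> V \<Longrightarrow> T v \<in> V" "\<And>v. v \<in> V \<Longrightarrow> e v \<in> V" and B: "finite B" "V = vec.span B"
  obtains k where "\<And>v. v \<in> V \<Longrightarrow> (e ^^ k) v = 0"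
proof -
  obtain ms where ms: "\<And>v. v \<in> V \<Longrightarrow> lp T ms v = 0" using findim_annihilated_uniform[OF T inv(1) B] by metis
  have Te: "T ((e ^^ k) v) = (e ^^ k) (T v) + vscale (of_nat k * c) ((e ^^ k) v)" for k v
    by (induction k arbitrary: v) (simp_all add: comm lin_add[OF e] lin_scale[OF e] algebra_simps vec.scale_left_distrib)
  have she: "sh T (\<mu> + of_nat k * c) ((e ^^ k) v) = (e ^^ k) (sh T \<mu> v)" for \<mu> k v
    by (simp add: sh_def Te lin_diff[OF lin_funpow[OF e]] lin_scale[OF lin_funpow[OF e]] vec.scale_left_distrib)
  have lpe: "lp T (map (\<lambda>\<mu>. \<mu> + of_nat k * c) xs) ((e ^^ k) v) = (e ^^ k) (lp T xs v)" for k xs v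
    by (induction xs arbitrary: v) (simp_all add: lp_Cons she)
  \<comment> \<open>Each pair \<mu>, \<nu> excludes at most one \<open>k\<close>, so some
    \<open>k\<close> keeps the two lists apart.\<close>
  have "finite {k :: nat. \<exists>\<mu>\<in>set ms. \<exists>\<nu>\<in>set ms. \<mu> + of_nat k * c = \<nu>}"
  proof (rule finite_subset)
    show "{k :: nat. \<exists>\<mu>\<in>set ms. \<exists>\<nu>\<in>set ms. \<mu> + of_nat k * c = \<nu>} \<subseteq>
        (\<Union>\<mu>\<in>set ms. \<Union>\<nu>\<in>set ms. {k. of_nat k = (\<nu> - \<mu>) / c})"
      using c by (auto simp: field_simps)
    have "finite {k :: nat. of_nat k = z}" for z :: complex
    proof -
      have "{k :: nat. of_nat k = z} \<subseteq> {THE k. of_nat k = z}" by auto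
      then show ?thesis by (rule finite_subset) simp
    qed
    then show "finite (\<Union>\<mu>\<in>set ms. \<Union>\<nu>\<in>set ms. {k :: nat. of_nat k = (\<nu> - \<mu>) / c})" by auto
  qed
  then obtain k :: nat where k: "\<not> (\<exists>\<mu>\<in>set ms. \<exists>\<nu>\<in>set ms. \<mu> + of_nat k * c = \<nu>)"
    using ex_new_if_finite[OF infinite_UNIV_nat] by blast
  have "(e ^^ k) v = 0" if "v \<in> V" for v
  proof (rule lp_coprime[OF T])
    show "lp T ms ((e ^^ k) v) = 0" using inv(2) that by (intro ms funpow_in)
    show "lp T (map (\<lambda>\<mu>. \<mu> + of_nat k * c) ms) ((e ^^ k) v) = 0"
      using ms[OF that] by (simp add: lpe lin_zero[OF lin_funpow[OF e]])
    show "set ms \<inter> set (map (\<lambda>\<mu>. \<mu> + of_nat k * c) ms) = {}" using k by auto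
  qed
  then show thesis using that by blast
qed

definition gen_eigen :: "(vec \<Rightarrow> vec) \<Rightarrow> complex \<Rightarrow> vec set" where
  "gen_eigen T \<mu> = {v. \<exists>k. (sh T \<mu> ^^ k) v = 0}"

lemma gen_eigen_mono: "lin T \<Longrightarrow> (sh T \<mu> ^^ k) v = 0 \<Longrightarrow> k \<le> l \<Longrightarrow> (sh T \<mu> ^^ l) v = 0"
proof -
  assume T: "lin T" and "(sh T \<mu> ^^ k) v = 0" "k \<le> l"
  then have "(sh T \<mu> ^^ (l - k + k)) v = 0"
    unfolding funpow_add by (simp add: lin_zero[OF lin_funpow[OF lin_sh[OF T]]])
  then show ?thesis using \<open>k \<le> l\<close> by simp
qed

lemma subspace_gen_eigen: "lin T \<Longrightarrow> vec.subspace (gen_eigen T \<mu>)"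
proof (rule vec.subspaceI)
  assume T: "lin T"
  note l = lin_funpow[OF lin_sh[OF T]]
  show "0 \<in> gen_eigen T \<mu>" unfolding gen_eigen_def using lin_zero[OF l] by blast
  fix u v c assume "u \<in> gen_eigen T \<mu>"
  then obtain k where k: "(sh T \<mu> ^^ k) u = 0" unfolding gen_eigen_def by blast
  then show "vscale c u \<in> gen_eigen T \<mu>" unfolding gen_eigen_def using lin_scale[OF l] by fastforce
  assume "v \<in> gen_eigen T \<mu>"
  then obtain l' where k': "(sh T \<mu> ^^ l') v = 0" unfolding gen_eigen_def by blast
  have "(sh T \<mu> ^^ (max k l')) (u + v) = 0"
    using gen_eigen_mono[OF T k, of "max k l'"] gen_eigen_mono[OF T k', of "max k l'"] by (simp add: lin_add[OF l])
  then show "u + v \<in> gen_eigen T \<mu>" unfolding gen_eigen_def by blast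
qed

text \<open>\<open>T - \<mu>\<close> is invertible on generalised \<nu>-eigenvectors: since
  \<open>(T - \<mu>) s = (T - \<nu>) s + (\<nu> - \<mu>) s\<close>, a solution for
  \<open>(T - \<nu>) s\<close>, which has smaller order, yields one for \<open>s\<close>.\<close>

lemma gen_eigen_solve:
  assumes T: "lin T" and V: "vec.subspace V" "\<And>v. v \<in> V \<Longrightarrow> T v \<in> V" and ne: "\<nu> \<noteq> \<mu>"
  shows "s \<in> V \<Longrightarrow> (sh T \<nu> ^^ k) s = 0 \<Longrightarrow> \<exists>t\<in>V \<inter> gen_eigen T \<nu>. sh T \<mu> t = s"
proof (induction k arbitrary: s)
  case 0
  then show ?case using V lin_zero[OF lin_sh[OF T]] vec.subspace_0[OF subspace_gen_eigen[OF T]]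
    by (intro bexI[of _ 0]) (auto simp: vec.subspace_0)
next
  case (Suc k)
  let ?s' = "sh T \<nu> s"
  have s'V: "?s' \<in> V" using Suc.prems(1) V by (simp add: sh_def vec.subspace_diff vec.subspace_scale)
  have "(sh T \<nu> ^^ k) ?s' = 0" using Suc.prems(2) by (simp only: funpow_Suc_right o_apply)
  then obtain t where t: "t \<in> V" "t \<in> gen_eigen T \<nu>" "sh T \<mu> t = ?s'" using Suc.IH s'V by blast
  have e: "sh T \<mu> s = ?s' + vscale (\<nu> - \<mu>) s" by (simp add: sh_def vec.scale_left_diff_distrib)
  let ?t = "vscale (1 / (\<nu> - \<mu>)) (s - t)"
  have "sh T \<mu> ?t = s"
    using t(3) e ne by (simp add: lin_scale[OF lin_sh[OF T]] lin_diff[OF lin_sh[OF T]])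
  moreover have "s \<in> gen_eigen T \<nu>" using Suc.prems(2) unfolding gen_eigen_def by blast
  ultimately show ?case
    using t(1,2) Suc.prems(1) V(1) subspace_gen_eigen[OF T, of \<nu>]
    by (intro bexI[of _ ?t]) (auto intro!: vec.subspace_scale vec.subspace_diff)
qed

text \<open>By \<open>gen_eigen_solve\<close>, every \<open>s\<close> in the sum of the generalised
  eigenspaces is \<open>(T - \<mu>) t\<close> up to a generalised \<mu>-eigenvector, with
  \<open>t\<close> in the sum. For \<open>s = (T - \<mu>) v\<close>, which lies in the sum by
  induction, this makes \<open>t - v\<close> a generalised \<mu>-eigenvector.\<close>

lemma gen_eigen_decomposition:
  assumes T: "lin T" and V: "vec.subspace V" "\<And>v. v \<in> V \<Longrightarrow> T v \<in> V"
  shows "v \<in> V \<Longrightarrow> lp T ms v = 0 \<Longrightarrow> v \<in> vec.span (\<Union>\<mu>. V \<inter> gen_eigen T \<mu>)"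
proof (induction ms arbitrary: v)
  case Nil then show ?case by (simp add: vec.span_zero)
next
  case (Cons \<mu> ms)
  let ?S = "\<Union>\<mu>. V \<inter> gen_eigen T \<mu>"
  have sV: "sh T \<mu> w \<in> V" if "w \<in> V" for w using that V by (simp add: sh_def vec.subspace_diff vec.subspace_scale)
  have SV: "vec.span ?S \<subseteq> V" by (rule vec.span_minimal[OF _ V(1)]) auto
  let ?P = "\<lambda>s. \<exists>t\<in>vec.span ?S. sh T \<mu> t - s \<in> gen_eigen T \<mu>"
  note l = lin_sh[OF T, of \<mu>] and g = subspace_gen_eigen[OF T, of \<mu>]
  have "?P s" if "s \<in> vec.span ?S" for s using that
  proof (induction rule: vec.span_induct_alt)
    case base then show ?case
      using vec.subspace_0[OF g] lin_zero[OF l] by (intro bexI[of _ 0]) (auto simp: vec.span_zero)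
  next
    case (step c x y)
    obtain t where t: "t \<in> vec.span ?S" "sh T \<mu> t - y \<in> gen_eigen T \<mu>" using step by blast
    obtain \<nu> where \<nu>: "x \<in> V" "x \<in> gen_eigen T \<nu>" using step by blast
    obtain r where r: "r \<in> vec.span ?S" "sh T \<mu> r - x \<in> gen_eigen T \<mu>"
    proof (cases "\<nu> = \<mu>")
      case True
      then show thesis using that[of 0] \<nu> lin_zero[OF l] vec.subspace_neg[OF g] by (auto simp: vec.span_zero)
    next
      case False
      then obtain r where "r \<in> V \<inter> gen_eigen T \<nu>" "sh T \<mu> r = x"
        using gen_eigen_solve[OF T V False] \<nu> unfolding gen_eigen_def by blast
      then show thesis using that[of r] vec.subspace_0[OF g] by (auto intro: vec.span_base)
    qed
    have "sh T \<mu> (vscale c r + t) - (vscale c x + y) = vscale c (sh T \<mu> r - x) + (sh T \<mu> t - y)"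
      by (simp add: lin_add[OF l] lin_scale[OF l] vec.scale_right_diff_distrib)
    also have "\<dots> \<in> gen_eigen T \<mu>" using r t g by (auto intro: vec.subspace_add vec.subspace_scale)
    finally show ?case using r t by (auto intro!: bexI[of _ "vscale c r + t"] vec.span_add vec.span_scale)
  qed
  moreover have "sh T \<mu> v \<in> vec.span ?S" using Cons sV by (simp add: lp_Cons)
  ultimately obtain t where t: "t \<in> vec.span ?S" "sh T \<mu> t - sh T \<mu> v \<in> gen_eigen T \<mu>" by blast
  then have "sh T \<mu> (t - v) \<in> gen_eigen T \<mu>" by (simp add: lin_diff[OF l])
  then obtain k where "(sh T \<mu> ^^ k) (sh T \<mu> (t - v)) = 0" unfolding gen_eigen_def by blast
  then have "(sh T \<mu> ^^ Suc k) (t - v) = 0" by (simp only: funpow_Suc_right o_apply)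
  then have "t - v \<in> gen_eigen T \<mu>" unfolding gen_eigen_def by blast
  moreover have "t - v \<in> V" using t SV Cons.prems(1) V(1) by (auto intro: vec.subspace_diff)
  ultimately have "t - v \<in> vec.span ?S" by (intro vec.span_base) blast
  then have "t - (t - v) \<in> vec.span ?S" using t(1) by (rule_tac vec.span_diff)
  then show ?case by simp
qed

section \<open>Operators satisfying the relations of sl2: highest weight vectors and Weyl's
  theorem\<close>

locale sl2_ops =
  fixes e f h :: "vec \<Rightarrow> vec"
  assumes lin_e: "lin e" and lin_f: "lin f" and lin_h: "lin h"
    and ef: "e (f v) = f (e v) + h v"
    and he: "h (e v) = e (h v) + vscale 2 (e v)"
    and hf: "h (f v) = f (h v) - vscale 2 (f v)"
begin

lemmas lins = lin_add[OF lin_e] lin_add[OF lin_f] lin_add[OF lin_h] lin_scale[OF lin_e] lin_scale[OF lin_f] lin_scale[OF lin_h]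
  lin_diff[OF lin_e] lin_diff[OF lin_f] lin_diff[OF lin_h] lin_zero[OF lin_e] lin_zero[OF lin_f] lin_zero[OF lin_h]

lemma h_f_pow: "h ((f ^^ j) v) = (f ^^ j) (h v) - vscale (2 * of_nat j) ((f ^^ j) v)"
  by (induction j arbitrary: v) (simp_all add: hf lins vec.scale_left_distrib distrib_left)

lemma h_e_pow: "h ((e ^^ j) v) = (e ^^ j) (h v) + vscale (2 * of_nat j) ((e ^^ j) v)"
  by (induction j arbitrary: v) (simp_all add: he lins vec.scale_left_distrib distrib_left)

text \<open>The usual string formula with \<open>h\<close> kept as an operator: \<open>v\<close> is
  not assumed to be an eigenvector, and the formula serves to prove that generalised eigenvectors of
  this kind are eigenvectors.\<close>

lemma e_f_pow: "e v = 0 \<Longrightarrow> e ((f ^^ Suc j) v) = vscale (of_nat (Suc j)) ((f ^^ j) (sh h (of_nat j) v))"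
proof (induction j)
  case 0 then show ?case by (simp add: ef lins sh_def)
next
  case (Suc j)
  note l = lin_funpow[OF lin_f]
  have "e ((f ^^ Suc (Suc j)) v) = f (e ((f ^^ Suc j) v)) + h ((f ^^ Suc j) v)" by (simp add: ef)
  also have "\<dots> = vscale (of_nat (Suc j)) ((f ^^ Suc j) (sh h (of_nat j) v)) +
      ((f ^^ Suc j) (h v) - vscale (2 * of_nat (Suc j)) ((f ^^ Suc j) v))"
    unfolding Suc.IH[OF Suc.prems] h_f_pow by (simp add: lins)
  also have "\<dots> = vscale (of_nat (Suc (Suc j))) ((f ^^ Suc j) (sh h (of_nat (Suc j)) v))"
    unfolding sh_def lin_diff[OF l] lin_scale[OF l]
    by (rule poly_mapping_eqI, simp only: lookup_add lookup_minus lookup_vscale) (simp add: algebra_simps)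
  finally show ?case .
qed

lemma ker_e_h: "e v = 0 \<Longrightarrow> e (h v) = 0"
  using he[of v] by (simp add: lins)

lemma ker_e_sh: "e v = 0 \<Longrightarrow> e (sh h \<mu> v) = 0"
  by (simp add: sh_def lins ker_e_h)

text \<open>Iterating \<open>e_f_pow\<close> produces \<open>j! h (h - 1) ... (h - j + 1) v\<close>.
  Combined with nilpotency of \<open>f\<close>, this confines the weights of highest weight vectors
  to natural numbers.\<close>

lemma e_pow_f_pow: "e v = 0 \<Longrightarrow> (e ^^ j) ((f ^^ j) v) = vscale (fact j) (lp h (map of_nat [0..<j]) v)"
proof (induction j arbitrary: v)
  case (Suc j)
  have "(e ^^ Suc j) ((f ^^ Suc j) v) = (e ^^ j) (e ((f ^^ Suc j) v))" by (simp only: funpow_Suc_right o_apply)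
  also have "\<dots> = vscale (of_nat (Suc j)) ((e ^^ j) ((f ^^ j) (sh h (of_nat j) v)))"
    unfolding e_f_pow[OF Suc.prems] by (rule lin_scale[OF lin_funpow[OF lin_e]])
  also have "\<dots> = vscale (fact (Suc j)) (lp h (map of_nat [0..<j]) (sh h (of_nat j) v))"
    using Suc.IH[OF ker_e_sh[OF Suc.prems]] by (simp add: algebra_simps)
  finally show ?case by (simp add: lp_append lp_Cons lp_sh[OF lin_h])
qed simp

lemma f_pow_sh: "(f ^^ k) v = 0 \<Longrightarrow> (f ^^ k) (sh h \<mu> v) = 0"
proof -
  assume z: "(f ^^ k) v = 0"
  then have "(f ^^ k) (h v) = 0" using h_f_pow[of k v] by (simp add: lins)
  then show ?thesis using z by (simp add: sh_def lin_diff[OF lin_funpow[OF lin_f]] lin_scale[OF lin_funpow[OF lin_f]])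
qed

lemma ker_e_lp:
  assumes "e v = 0" "(f ^^ k) v = 0" shows "lp h (map of_nat [0..<k]) v = 0"
  using e_pow_f_pow[OF assms(1), of k] assms(2) by (simp add: lin_zero[OF lin_funpow[OF lin_e]])

lemma highest_weight_nat:
  assumes "e v = 0" "(f ^^ k) v = 0" "h v = vscale \<mu> v" "v \<noteq> 0"
  shows "\<exists>m<k. \<mu> = of_nat m"
proof -
  have "vscale (\<Prod>\<nu>\<leftarrow>map of_nat [0..<k]. \<mu> - \<nu>) v = 0"
    using ker_e_lp[OF assms(1,2)] lp_eigen[OF lin_h assms(3)] by metis
  then have "(\<Prod>\<nu>\<leftarrow>map of_nat [0..<k]. \<mu> - \<nu>) = 0" using assms(4) by simp
  then show ?thesis by (auto simp: prod_list_zero_iff)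
qed

text \<open>On the highest weight vectors \<open>h\<close> is killed by a product of distinct linear factors, so
  generalised eigenvectors are eigenvectors.\<close>

lemma ker_e_eigen:
  "e v = 0 \<Longrightarrow> (f ^^ k) v = 0 \<Longrightarrow> (sh h \<mu> ^^ n) v = 0 \<Longrightarrow> h v = vscale \<mu> v"
proof (induction n arbitrary: v)
  case 0 then show ?case by (simp add: lins)
next
  case (Suc n)
  let ?c = "sh h \<mu> v"
  have c: "e ?c = 0" "(f ^^ k) ?c = 0" "(sh h \<mu> ^^ n) ?c = 0"
    using ker_e_sh f_pow_sh Suc.prems by (simp_all only: funpow_Suc_right o_apply)
  then have hc: "h ?c = vscale \<mu> ?c" by (rule Suc.IH)
  have "?c = 0"
  proof (rule ccontr)
    assume c0: "?c \<noteq> 0"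
    then obtain m where m: "m < k" "\<mu> = of_nat m" using highest_weight_nat[OF c(1,2) hc] by blast
    \<comment> \<open>\<mu> is itself one of the numbers below \<open>k\<close>. The factor
      \<open>h - \<mu>\<close> that turned \<open>v\<close> into \<open>?c\<close> is taken out of
      the product, and the remaining factors act on \<open>?c\<close> by nonzero scalars.\<close>
    let ?xs = "[0..<m]" and ?ys = "[Suc m..<k]"
    have s: "[0..<k] = ?xs @ m # ?ys" using m(1)
      by (metis append_Cons append_Nil le0 less_imp_le_nat upt_add_eq_append upt_conv_Cons le_add_diff_inverse add_0)
    have "lp h (map of_nat (?xs @ ?ys)) ?c = lp h (map of_nat [0..<k]) v"
      unfolding s by (simp add: lp_append lp_Cons m(2) lp_sh[OF lin_h])
    also have "\<dots> = 0" by (rule ker_e_lp[OF Suc.prems(1,2)])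
    finally have "vscale (\<Prod>\<nu>\<leftarrow>map of_nat (?xs @ ?ys). \<mu> - \<nu>) ?c = 0" using lp_eigen[OF lin_h hc] by metis
    then have "(\<Prod>\<nu>\<leftarrow>map of_nat (?xs @ ?ys). \<mu> - \<nu>) = 0" using c0 by simp
    then show False by (auto simp: prod_list_zero_iff m(2))
  qed
  then show ?case by (simp add: sh_def)
qed

lemma e_f_pow_eigen:
  assumes "e v = 0" "h v = vscale \<mu> v"
  shows "e ((f ^^ Suc j) v) = vscale (of_nat (Suc j) * (\<mu> - of_nat j)) ((f ^^ j) v)"
proof -
  have "sh h (of_nat j) v = vscale (\<mu> - of_nat j) v" by (simp add: sh_def assms vec.scale_left_diff_distrib)
  then show ?thesis using e_f_pow[OF assms(1), of j] by (simp add: lin_scale[OF lin_funpow[OF lin_f]])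
qed

lemma h_f_pow_eigen: "h v = vscale \<mu> v \<Longrightarrow> h ((f ^^ j) v) = vscale (\<mu> - 2 * of_nat j) ((f ^^ j) v)"
  by (simp add: h_f_pow lin_scale[OF lin_funpow[OF lin_f]] vec.scale_left_diff_distrib)

text \<open>At the least \<open>n\<close> with \<open>(f ^^ n) v = 0\<close>, writing
  \<open>n = j + 1\<close> and applying \<open>e\<close> gives
  \<open>(j + 1) (m - j) (f ^^ j) v = 0\<close>, so \<open>j\<close> cannot exceed
  \<open>m\<close>.\<close>

lemma f_pow_highest:
  assumes "e v = 0" "h v = vscale (of_nat m) v" "(f ^^ k) v = 0"
  shows "(f ^^ Suc m) v = 0"
proof (rule ccontr)
  assume ne: "(f ^^ Suc m) v \<noteq> 0"
  define n where "n = (LEAST n. (f ^^ n) v = 0)"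
  have n: "(f ^^ n) v = 0" unfolding n_def using assms(3) by (rule LeastI)
  have least: "(f ^^ i) v \<noteq> 0" if "i < n" for i using that not_less_Least unfolding n_def by blast
  have "\<not> n \<le> Suc m"
  proof
    assume "n \<le> Suc m"
    then obtain d where "Suc m = d + n" by (metis add.commute le_Suc_ex)
    then have "(f ^^ Suc m) v = (f ^^ d) ((f ^^ n) v)" by (simp only: funpow_add o_apply)
    then show False using n ne by (simp add: lin_zero[OF lin_funpow[OF lin_f]])
  qed
  then obtain j where j: "n = Suc j" "m < j" by (metis Suc_lessE not_le)
  have "vscale (of_nat (Suc j) * (of_nat m - of_nat j)) ((f ^^ j) v) = 0"
    using e_f_pow_eigen[OF assms(1,2), of j] n by (simp only: j lins)
  moreover have "(of_nat (Suc j) :: complex) * (of_nat m - of_nat j) \<noteq> 0"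
    using j(2) by (metis eq_iff_diff_eq_0 mult_eq_0_iff of_nat_eq_iff less_irrefl nat.distinct(1) of_nat_eq_0_iff)
  ultimately show False using least[of j] j(1) by simp
qed

definition hw_span :: "vec set \<Rightarrow> vec set" where
  "hw_span V = vec.span {(f ^^ j) v | j v m. v \<in> V \<and> e v = 0 \<and> h v = vscale (of_nat m) v}"

lemma hw_spanI: "v \<in> V \<Longrightarrow> e v = 0 \<Longrightarrow> h v = vscale (of_nat m) v \<Longrightarrow> (f ^^ j) v \<in> hw_span V"
  unfolding hw_span_def by (intro vec.span_base) blast

lemma subspace_hw_span: "vec.subspace (hw_span V)"
  by (simp add: hw_span_def vec.subspace_span)

text \<open>Induction on the order of nilpotency of \<open>e\<close> at \<open>a\<close>. The top
  \<open>b = (e ^^ r) a\<close> is a genuine highest weight vector of weight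
  \<open>m = i + 2 r\<close>, and subtracting a multiple of \<open>(f ^^ r) b\<close> from
  \<open>a\<close> lowers the order. The multiple exists because
  \<open>(e ^^ r) ((f ^^ r) b)\<close> is \<open>r! m (m - 1) ... (m - r + 1) b\<close> and the
  bound on \<open>i\<close> gives \<open>m \<ge> r\<close>.\<close>

lemma upper_weights:
  assumes V: "vec.subspace V" "\<And>v. v \<in> V \<Longrightarrow> e v \<in> V" "\<And>v. v \<in> V \<Longrightarrow> f v \<in> V" "\<And>v. v \<in> V \<Longrightarrow> h v \<in> V"
    and fk: "\<And>v. v \<in> V \<Longrightarrow> (f ^^ k) v = 0" and i: "i \<ge> -1"
  shows "a \<in> V \<Longrightarrow> (e ^^ r) a = 0 \<Longrightarrow> (sh h (of_int i) ^^ n) a = 0 \<Longrightarrow> a \<in> hw_span V"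
proof (induction r arbitrary: a n)
  case 0 then show ?case using vec.subspace_0[OF subspace_hw_span] by simp
next
  case (Suc r)
  let ?b = "(e ^^ r) a"
  have bV: "?b \<in> V" using V(2) Suc.prems(1) by (rule funpow_in)
  have eb: "e ?b = 0" using Suc.prems(2) by simp
  have "sh h (\<mu> + 2 * of_nat r) ((e ^^ r) w) = (e ^^ r) (sh h \<mu> w)" for \<mu> w
    by (simp add: sh_def h_e_pow lin_diff[OF lin_funpow[OF lin_e]] lin_scale[OF lin_funpow[OF lin_e]] vec.scale_left_distrib)
  then have "(sh h (\<mu> + 2 * of_nat r) ^^ n) ((e ^^ r) w) = (e ^^ r) ((sh h \<mu> ^^ n) w)" for \<mu> w n
    by (induction n) simp_all
  then have "(sh h (of_int i + 2 * of_nat r) ^^ n) ?b = 0" using Suc.prems(3) by (simp add: lin_zero[OF lin_funpow[OF lin_e]])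
  then have hb: "h ?b = vscale (of_int i + 2 * of_nat r) ?b" by (rule ker_e_eigen[OF eb fk[OF bV]])
  show ?case
  proof (cases "?b = 0")
    case True then show ?thesis using Suc by blast
  next
    case False
    obtain m where m: "of_int i + 2 * of_nat r = (of_nat m :: complex)" using highest_weight_nat[OF eb fk[OF bV] hb False] by blast
    then have "(of_int (i + 2 * int r) :: complex) = of_int (int m)" by simp
    then have im: "i + 2 * int r = int m" by (simp only: of_int_eq_iff)
    let ?P = "\<Prod>\<nu>\<leftarrow>map of_nat [0..<r]. (of_nat m - \<nu> :: complex)"
    have P: "?P \<noteq> 0" using im i by (auto simp: prod_list_zero_iff)
    let ?c = "fact r * ?P"
    have c: "?c \<noteq> 0" using P by simp
    have ef: "(e ^^ r) ((f ^^ r) ?b) = vscale ?c ?b"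
      using e_pow_f_pow[OF eb, of r] lp_eigen[OF lin_h hb[unfolded m]] by simp
    let ?a = "a - vscale (1 / ?c) ((f ^^ r) ?b)"
    have f1: "(f ^^ r) ?b \<in> hw_span V" using hb m by (intro hw_spanI[OF bV eb, of m]) simp
    have fV: "(f ^^ r) ?b \<in> V" using V(3) bV by (rule funpow_in)
    have 1: "?a \<in> V" using Suc.prems(1) fV V(1) by (intro vec.subspace_diff vec.subspace_scale)
    have 2: "(e ^^ r) ?a = 0"
      using c by (simp add: lin_diff[OF lin_funpow[OF lin_e]] lin_scale[OF lin_funpow[OF lin_e]] ef)
    have "h ((f ^^ r) ?b) = vscale (of_int i) ((f ^^ r) ?b)" using h_f_pow_eigen[OF hb, of r] by simp
    then have "sh h (of_int i) ((f ^^ r) ?b) = 0" by (simp add: sh_def)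
    then have "(f ^^ r) ?b \<in> gen_eigen h (of_int i)" unfolding gen_eigen_def by (intro CollectI exI[of _ 1]) simp
    moreover have "a \<in> gen_eigen h (of_int i)" using Suc.prems(3) unfolding gen_eigen_def by blast
    ultimately have "?a \<in> gen_eigen h (of_int i)"
      using subspace_gen_eigen[OF lin_h] by (intro vec.subspace_diff vec.subspace_scale) auto
    then obtain n' where "(sh h (of_int i) ^^ n') ?a = 0" unfolding gen_eigen_def by blast
    then have "?a \<in> hw_span V" using Suc.IH 1 2 by blast
    then have "?a + vscale (1 / ?c) ((f ^^ r) ?b) \<in> hw_span V"
      using f1 subspace_hw_span by (intro vec.subspace_add vec.subspace_scale)
    then show ?thesis by simp
  qed
qed

end

text \<open>The symmetry exchanging raising and lowering; through it lowest weight vectors are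
  handled as highest weight vectors of the new triple.\<close>

lemma sl2_ops_dual: "sl2_ops e f h \<Longrightarrow> sl2_ops f e (\<lambda>v. - h v)"
proof -
  assume "sl2_ops e f h"
  then interpret sl2_ops e f h .
  show ?thesis
    by standard (auto intro!: linI simp: lins lin_e lin_f ef he hf lin_uminus[OF lin_e] lin_uminus[OF lin_f])
qed

context sl2_ops
begin

text \<open>Generalised weight spaces of weight \<open>\<ge> -1\<close> are handled from above,
  those of weight \<open>\<le> 1\<close> from below.\<close>

theorem weyl:
  assumes V: "\<And>v. v \<in> V \<Longrightarrow> e v \<in> V" "\<And>v. v \<in> V \<Longrightarrow> f v \<in> V" "\<And>v. v \<in> V \<Longrightarrow> h v \<in> V"
    and B: "finite B" "V = vec.span B"
  shows "V \<subseteq> hw_span V"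
proof
  interpret D: sl2_ops f e "\<lambda>v. - h v" by (rule sl2_ops_dual) (rule sl2_ops_axioms)
  have sV: "vec.subspace V" unfolding B(2) by (rule vec.subspace_span)
  have hV: "- h v \<in> V" if "v \<in> V" for v using V(3)[OF that] sV by (rule_tac vec.subspace_neg)
  obtain k where k: "\<And>v. v \<in> V \<Longrightarrow> (e ^^ k) v = 0"
    by (rule findim_nilpotent[where c = 2, OF lin_h lin_e _ he V(3,1) B]) auto
  obtain l where l: "\<And>v. v \<in> V \<Longrightarrow> (f ^^ l) v = 0"
    by (rule findim_nilpotent[where c = "-2", OF lin_h lin_f _ _ V(3,2) B]) (auto simp: hf)
  \<comment> \<open>The string climbing from a lowest weight vector \<open>v\<close> of weight
    \<open>-m\<close> is, up to nonzero factors, the string descending from its top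
    \<open>?u\<close>.\<close>
  have DA: "D.hw_span V \<subseteq> hw_span V"
    unfolding D.hw_span_def
  proof (rule vec.span_minimal[OF _ subspace_hw_span], clarify)
    fix j v m assume v: "v \<in> V" "f v = 0" "- h v = vscale (of_nat m) v"
    have z: "(e ^^ Suc m) v = 0" by (rule D.f_pow_highest[OF v(2,3) k[OF v(1)]])
    let ?u = "(e ^^ m) v"
    have uV: "?u \<in> V" using V(1) v(1) by (rule funpow_in)
    have eu: "e ?u = 0" using z by simp
    have hv: "h v = vscale (- of_nat m) v" using v(3) by (metis minus_minus vec.scale_minus_left)
    have hu: "h ?u = vscale (of_nat m) ?u"
    proof -
      have "h ?u = vscale (- of_nat m + 2 * of_nat m) ?u"
        unfolding h_e_pow hv lin_scale[OF lin_funpow[OF lin_e]] vec.scale_left_distrib ..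
      then show ?thesis by simp
    qed
    have "\<exists>c. c \<noteq> 0 \<and> (f ^^ i) ?u = vscale c ((e ^^ (m - i)) v)" if "i \<le> m" for i using that
    proof (induction i)
      case 0 then show ?case by (intro exI[of _ 1]) simp
    next
      case (Suc i)
      then obtain c where c: "c \<noteq> 0" "(f ^^ i) ?u = vscale c ((e ^^ (m - i)) v)" by auto
      have mi: "m - i = Suc (m - Suc i)" using Suc.prems by simp
      have "(f ^^ Suc i) ?u = vscale c (f ((e ^^ Suc (m - Suc i)) v))" using c(2) by (simp add: lins mi)
      also have "\<dots> = vscale (c * (of_nat (Suc (m - Suc i)) * (of_nat m - of_nat (m - Suc i)))) ((e ^^ (m - Suc i)) v)"
        unfolding D.e_f_pow_eigen[OF v(2,3)] by simp
      finally have s: "(f ^^ Suc i) ?u = vscale (c * (of_nat (Suc (m - Suc i)) * (of_nat m - of_nat (m - Suc i)))) ((e ^^ (m - Suc i)) v)" .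
      have "m - Suc i \<noteq> m" using Suc.prems by simp
      then have "(of_nat m :: complex) \<noteq> of_nat (m - Suc i)" by (metis of_nat_eq_iff)
      then show ?case using s c(1) by (intro exI conjI, rule_tac[2] s) (simp del: of_nat_Suc)
    qed
    then have st: "\<exists>c. c \<noteq> 0 \<and> (f ^^ (m - j)) ?u = vscale c ((e ^^ j) v)" if "j \<le> m"
      using that by (metis diff_diff_cancel diff_le_self)
    show "(e ^^ j) v \<in> hw_span V"
    proof (cases "j \<le> m")
      case True
      then obtain c where c: "c \<noteq> 0" "(f ^^ (m - j)) ?u = vscale c ((e ^^ j) v)" using st by blast
      then have "(e ^^ j) v = vscale (1 / c) ((f ^^ (m - j)) ?u)" by simp
      also have "\<dots> \<in> hw_span V" using hw_spanI[OF uV eu hu] subspace_hw_span by (rule_tac vec.subspace_scale)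
      finally show ?thesis .
    next
      case False
      then obtain d where "j = d + Suc m" by (metis add.commute le_Suc_ex not_less_eq_eq)
      then have "(e ^^ j) v = (e ^^ d) ((e ^^ Suc m) v)" by (simp only: funpow_add o_apply)
      then show ?thesis using z vec.subspace_0[OF subspace_hw_span] by (simp add: lin_zero[OF lin_funpow[OF lin_e]])
    qed
  qed
  have gen: "a \<in> hw_span V" if a: "a \<in> V" "(sh h \<mu> ^^ n) a = 0" for a \<mu> n
  proof (cases "a = 0")
    case True then show ?thesis using vec.subspace_0[OF subspace_hw_span] by simp
  next
    case False
    \<comment> \<open>The top of the \<open>e\<close>-string through \<open>a\<close> is a highest
      weight vector, so its weight is a natural number. Hence \<mu> is an integer and one of the two
      ranges applies.\<close>
    define r where "r = (LEAST r. (e ^^ r) a = 0)"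
    have r: "(e ^^ r) a = 0" unfolding r_def using k[OF a(1)] by (rule LeastI)
    have "r \<noteq> 0" using r False by (metis funpow_0)
    then obtain q where q: "r = Suc q" by (cases r) auto
    have b0: "(e ^^ q) a \<noteq> 0" using not_less_Least[of q "\<lambda>r. (e ^^ r) a = 0"] q unfolding r_def by simp
    have bV: "(e ^^ q) a \<in> V" using V(1) a(1) by (rule funpow_in)
    have eb: "e ((e ^^ q) a) = 0" using r q by simp
    have "sh h (\<mu> + 2 * of_nat q) ((e ^^ q) w) = (e ^^ q) (sh h \<mu> w)" for w
      by (simp add: sh_def h_e_pow lin_diff[OF lin_funpow[OF lin_e]] lin_scale[OF lin_funpow[OF lin_e]] vec.scale_left_distrib)
    then have "(sh h (\<mu> + 2 * of_nat q) ^^ n) ((e ^^ q) w) = (e ^^ q) ((sh h \<mu> ^^ n) w)" for w n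
      by (induction n) simp_all
    then have "(sh h (\<mu> + 2 * of_nat q) ^^ n) ((e ^^ q) a) = 0" using a(2) by (simp add: lin_zero[OF lin_funpow[OF lin_e]])
    then have hb: "h ((e ^^ q) a) = vscale (\<mu> + 2 * of_nat q) ((e ^^ q) a)" by (rule ker_e_eigen[OF eb l[OF bV]])
    obtain m where "\<mu> + 2 * of_nat q = (of_nat m :: complex)" using highest_weight_nat[OF eb l[OF bV] hb b0] by blast
    then have i: "\<mu> = of_int (int m - 2 * int q)" by (simp add: algebra_simps)
    let ?i = "int m - 2 * int q"
    show ?thesis
    proof (cases "?i \<ge> -1")
      case True
      show ?thesis by (rule upper_weights[OF sV V l True a(1) k[OF a(1)] a(2)[unfolded i]])
    next
      case False
      have "sh (\<lambda>v. - h v) (- \<nu>) w = - sh h \<nu> w" for \<nu> w by (simp add: sh_def)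
      then have "(sh (\<lambda>v. - h v) (- \<nu>) ^^ n) w = vscale ((-1) ^ n) ((sh h \<nu> ^^ n) w)" for \<nu> w n
        by (induction n) (simp_all add: lin_scale[OF lin_sh[OF lin_h]])
      then have "(sh (\<lambda>v. - h v) (of_int (- ?i)) ^^ n) a = vscale ((-1) ^ n) ((sh h (of_int ?i) ^^ n) a)"
        by (simp only: of_int_minus)
      also have "\<dots> = 0" using a(2)[unfolded i] by (simp only: vec.scale_zero_right)
      finally have "(sh (\<lambda>v. - h v) (of_int (- ?i)) ^^ n) a = 0" .
      then have "a \<in> D.hw_span V"
        using False by (intro D.upper_weights[OF sV V(2,1) hV k _ a(1) l[OF a(1)], of "- ?i"]) auto
      then show ?thesis using DA by blast
    qed
  qed
  fix a assume a: "a \<in> V"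
  obtain ms where ms: "lp h ms a = 0" using findim_annihilated[OF lin_h V(3) B a] by blast
  have "a \<in> vec.span (\<Union>\<mu>. V \<inter> gen_eigen h \<mu>)"
    by (rule gen_eigen_decomposition[where T = h and V = V]) (use lin_h sV V(3) a ms in blast)+
  moreover have "vec.span (\<Union>\<mu>. V \<inter> gen_eigen h \<mu>) \<subseteq> hw_span V"
    by (rule vec.span_minimal[OF _ subspace_hw_span]) (auto simp: gen_eigen_def intro: gen)
  ultimately show "a \<in> hw_span V" by blast
qed

end

text \<open>The basis vector \<open>mon a b\<close> stands for the monomial \<open>x\<^sup>a y\<^sup>b\<close>, on which \<open>e = x \<partial>\<^sub>y\<close>,
  \<open>f = y \<partial>\<^sub>x\<close> and \<open>h = x \<partial>\<^sub>x - y \<partial>\<^sub>y\<close> act.\<close>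

definition mon :: "nat \<Rightarrow> nat \<Rightarrow> vec" where
  "mon a b = bas (prod_encode (a, b))"

definition cf :: "vec \<Rightarrow> nat \<Rightarrow> nat \<Rightarrow> complex" where
  "cf v a b = lu v (prod_encode (a, b))"

definition lext2 :: "(nat \<Rightarrow> nat \<Rightarrow> vec) \<Rightarrow> vec \<Rightarrow> vec" where
  "lext2 g = lext (\<lambda>n. g (fst (prod_decode n)) (snd (prod_decode n)))"

lemma lin_lext2: "lin (lext2 g)"
  by (simp add: lext2_def lin_lext)

lemma lext2_mon [simp]: "lext2 g (mon a b) = g a b"
  by (simp add: lext2_def mon_def)

lemma bas_eq_mon: "bas n = mon (fst (prod_decode n)) (snd (prod_decode n))"
  by (simp add: mon_def)

lemma lin_ext2: "lin f \<Longrightarrow> lin g \<Longrightarrow> (\<And>a b. f (mon a b) = g (mon a b)) \<Longrightarrow> f v = g v"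
  by (rule lin_ext) (auto simp: bas_eq_mon)

lemma cf_simps [simp]:
  "cf (u + v) a b = cf u a b + cf v a b" "cf (u - v) a b = cf u a b - cf v a b"
  "cf (vscale c v) a b = c * cf v a b" "cf 0 a b = 0" "cf (- v) a b = - cf v a b"
  by (simp_all add: cf_def lookup_add lookup_minus)

lemma cf_mon [simp]: "cf (mon a b) a' b' = (if a = a' \<and> b = b' then 1 else 0)"
  by (simp add: cf_def mon_def prod_encode_eq)

lemma cf_eqI: "(\<And>a b. cf u a b = cf v a b) \<Longrightarrow> u = v"
  by (rule poly_mapping_eqI) (metis cf_def prod.collapse prod_decode_inverse)

text \<open>Multiplying with \<open>bas 0\<close> makes a functional vector-valued, so
  \<open>lin_ext2\<close> applies. Coefficient formulas such as \<open>cf_sE\<close> are thereby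
  checked on monomials.\<close>

lemma functional_ext2:
  assumes "\<And>u v. f (u + v) = f u + f v" "\<And>c v. f (vscale c v) = c * f v"
    "\<And>u v. g (u + v) = g u + g v" "\<And>c v. g (vscale c v) = c * g v"
    "\<And>a b. f (mon a b) = g (mon a b)"
  shows "f v = (g v :: complex)"
proof -
  have "vscale (f v) (bas 0) = vscale (g v) (bas 0)"
    by (rule lin_ext2[where f = "\<lambda>v. vscale (f v) (bas 0)" and g = "\<lambda>v. vscale (g v) (bas 0)"])
      (auto intro!: linI simp: assms vec.scale_left_distrib)
  then have "lu (vscale (f v) (bas 0)) 0 = lu (vscale (g v) (bas 0)) 0" by (rule arg_cong)
  then show ?thesis by simp
qed

definition sE :: "vec \<Rightarrow> vec" where
  "sE = lext2 (\<lambda>a b. vscale (of_nat b) (mon (a + 1) (b - 1)))"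

definition sF :: "vec \<Rightarrow> vec" where
  "sF = lext2 (\<lambda>a b. vscale (of_nat a) (mon (a - 1) (b + 1)))"

definition sH :: "vec \<Rightarrow> vec" where
  "sH = lext2 (\<lambda>a b. vscale (of_nat a - of_nat b) (mon a b))"

lemma lin_sE: "lin sE" and lin_sF: "lin sF" and lin_sH: "lin sH"
  by (simp_all add: sE_def sF_def sH_def lin_lext2)

lemma s_mon: "sE (mon a b) = vscale (of_nat b) (mon (a + 1) (b - 1))"
  "sF (mon a b) = vscale (of_nat a) (mon (a - 1) (b + 1))"
  "sH (mon a b) = vscale (of_nat a - of_nat b) (mon a b)"
  by (simp_all add: sE_def sF_def sH_def)

lemmas s_lins = lin_add[OF lin_sE] lin_add[OF lin_sF] lin_add[OF lin_sH] lin_scale[OF lin_sE] lin_scale[OF lin_sF]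
  lin_scale[OF lin_sH] lin_diff[OF lin_sE] lin_diff[OF lin_sF] lin_diff[OF lin_sH] lin_zero[OF lin_sE]
  lin_zero[OF lin_sF] lin_zero[OF lin_sH]

lemma cf_sE: "cf (sE v) a b = (if a = 0 then 0 else of_nat (b + 1) * cf v (a - 1) (b + 1))"
  by (rule functional_ext2[where f = "\<lambda>v. cf (sE v) a b"]) (auto simp: s_lins s_mon algebra_simps)

lemma cf_sF: "cf (sF v) a b = (if b = 0 then 0 else of_nat (a + 1) * cf v (a + 1) (b - 1))"
  by (rule functional_ext2[where f = "\<lambda>v. cf (sF v) a b"]) (auto simp: s_lins s_mon algebra_simps)

lemma cf_sH: "cf (sH v) a b = (of_nat a - of_nat b) * cf v a b"
  by (rule functional_ext2[where f = "\<lambda>v. cf (sH v) a b"]) (auto simp: s_lins s_mon algebra_simps)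

lemma sl2_ops_s: "sl2_ops sE sF sH"
proof (rule sl2_ops.intro)
  show "lin sE" "lin sF" "lin sH" by (fact lin_sE lin_sF lin_sH)+
  fix v
  show "sE (sF v) = sF (sE v) + sH v"
    by (rule cf_eqI) (auto simp: cf_sE cf_sF cf_sH algebra_simps of_nat_diff)
  show "sH (sE v) = sE (sH v) + vscale 2 (sE v)"
    by (rule cf_eqI) (auto simp: cf_sE cf_sH algebra_simps of_nat_diff)
  show "sH (sF v) = sF (sH v) - vscale 2 (sF v)"
    by (rule cf_eqI) (auto simp: cf_sF cf_sH algebra_simps of_nat_diff)
qed

text \<open>The polynomials all of whose terms have degree in \<open>K\<close>: \<open>{m}\<close>
  gives the space of L(m), and \<open>{n..}\<close> that of V(n,\<theta>).\<close>

definition HK :: "nat set \<Rightarrow> vec set" where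
  "HK K = {v. \<forall>a b. a + b \<notin> K \<longrightarrow> cf v a b = 0}"

lemma subspace_HK: "vec.subspace (HK K)"
  by (rule vec.subspaceI) (auto simp: HK_def)

lemma mon_in_HK [simp]: "mon a b \<in> HK K \<longleftrightarrow> a + b \<in> K"
  by (auto simp: HK_def)

lemma HK_span: "HK K = vec.span {mon a b | a b. a + b \<in> K}"
proof
  show "vec.span {mon a b | a b. a + b \<in> K} \<subseteq> HK K"
    by (rule vec.span_minimal[OF _ subspace_HK]) auto
  show "HK K \<subseteq> vec.span {mon a b | a b. a + b \<in> K}"
  proof
    fix v assume v: "v \<in> HK K"
    have "v = (\<Sum>k\<in>Poly_Mapping.keys v. vscale (lu v k) (bas k))"
      using vec_eq_lext[of v] by (simp add: lext_def)
    also have "\<dots> \<in> vec.span {mon a b | a b. a + b \<in> K}"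
    proof (intro vec.span_sum vec.span_scale vec.span_base)
      fix k assume k: "k \<in> Poly_Mapping.keys v"
      obtain a b where ab: "k = prod_encode (a, b)" by (metis prod.collapse prod_decode_inverse)
      then have "a + b \<in> K" using v k by (auto simp: HK_def cf_def in_keys_iff)
      then show "bas k \<in> {mon a b | a b. a + b \<in> K}" using ab by (auto simp: mon_def)
    qed
    finally show "v \<in> vec.span {mon a b | a b. a + b \<in> K}" .
  qed
qed

lemma HK_ext:
  assumes "linon (HK K) S" "linon (HK K) T" "\<And>a b. a + b \<in> K \<Longrightarrow> S (mon a b) = T (mon a b)" "v \<in> HK K"
  shows "S v = T v"
proof -
  have "v \<in> vec.span {mon a b | a b. a + b \<in> K}" using assms(4) HK_span by simp
  then have "v \<in> HK K \<and> S v = T v"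
  proof (induction rule: vec.span_induct_alt)
    case base then show ?case
      using linon_zero[OF assms(1)] linon_zero[OF assms(2)] vec.subspace_0[OF subspace_HK[of K]] by simp
  next
    case (step c x y)
    then obtain a b where x: "x = mon a b" "a + b \<in> K" by auto
    then have xK: "x \<in> HK K" by simp
    then have "vscale c x \<in> HK K" by (rule vec.subspace_scale[OF subspace_HK])
    then show ?case using step x assms(3) xK
      by (simp add: linon_add[OF assms(1)] linon_add[OF assms(2)] linon_scale[OF assms(1)] linon_scale[OF assms(2)]
          vec.subspace_add[OF subspace_HK])
  qed
  then show ?thesis by simp
qed

lemma HK_closed: "v \<in> HK K \<Longrightarrow> sE v \<in> HK K" "v \<in> HK K \<Longrightarrow> sF v \<in> HK K" "v \<in> HK K \<Longrightarrow> sH v \<in> HK K"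
  by (auto simp: HK_def cf_sE cf_sF cf_sH)

lemma cf_eventually_zero:
  obtains B where "\<And>a b. b \<ge> B \<Longrightarrow> cf v a b = 0"
proof -
  obtain m where m: "\<forall>n\<in>Poly_Mapping.keys v. n \<le> m" using finite_nat_set_iff_bounded_le finite_keys by blast
  have "cf v a b = 0" if "b \<ge> Suc m" for a b
  proof (rule ccontr)
    assume "cf v a b \<noteq> 0"
    then have "prod_encode (a, b) \<le> m" using m by (auto simp: cf_def in_keys_iff)
    then show False using le_prod_encode_2[of b a] that by simp
  qed
  then show thesis by (rule that)
qed

text \<open>\<open>sE\<close> lowers the degree in y, which is bounded on \<open>v\<close>, so the
  last nonzero vector among its iterates is killed by \<open>sE\<close>.\<close>

lemma sE_kernel_vector:
  assumes "v \<in> W" "v \<noteq> 0" and W: "\<And>v. v \<in> W \<Longrightarrow> sE v \<in> W"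
  shows "\<exists>w\<in>W. w \<noteq> 0 \<and> sE w = 0"
proof -
  obtain B where "\<And>a b. b \<ge> B \<Longrightarrow> cf v a b = 0" by (rule cf_eventually_zero[of v]) (rule that)
  then show ?thesis using assms(1,2)
  proof (induction B arbitrary: v)
    case 0
    then have "v = 0" by (intro cf_eqI) simp
    then show ?case using 0 by simp
  next
    case (Suc B)
    show ?case
    proof (cases "sE v = 0")
      case True then show ?thesis using Suc.prems by blast
    next
      case False
      then show ?thesis using Suc.prems W by (intro Suc.IH[of "sE v"]) (auto simp: cf_sE)
    qed
  qed
qed

text \<open>Up to the factor \<open>b\<close>, \<open>cf v a b\<close> is a coefficient of
  \<open>sE v\<close>; thus the kernel consists of polynomials in x alone.\<close>

lemma ker_sE: "sE v = 0 \<Longrightarrow> b > 0 \<Longrightarrow> cf v a b = 0"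
  using cf_sE[of v "Suc a" "b - 1"] by simp

section \<open>The simple modules L(m) as spaces of forms, and covers by them\<close>

fun sl2act :: "sl2 \<Rightarrow> vec \<Rightarrow> vec" where
  "sl2act E = sE"
| "sl2act F = sF"
| "sl2act H = sH"

lemma sl2_vmodI:
  assumes "vec.subspace U" "\<And>b v. v \<in> U \<Longrightarrow> a b v \<in> U" "\<And>b. linon U (a b)"
    and "\<And>v. v \<in> U \<Longrightarrow> a E (a F v) = a F (a E v) + a H v"
    and "\<And>v. v \<in> U \<Longrightarrow> a H (a E v) = a E (a H v) + vscale 2 (a E v)"
    and "\<And>v. v \<in> U \<Longrightarrow> a H (a F v) = a F (a H v) - vscale 2 (a F v)"
  shows "is_vmod sl2_br (vmod U a)"
proof (rule is_vmodI[OF assms(1-3)])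
  fix x y v assume v: "v \<in> U"
  show "a x (a y v) = a y (a x v) + lc a (sl2_br x y) v"
    by (cases x; cases y) (simp_all add: lc_def assms(4-6)[OF v])
qed

lemma sl2_ops_total:
  assumes T: "\<And>b. lin (T b)" "\<And>x y v. T x (T y v) = T y (T x v) + lc T (sl2_br x y) v"
  shows "sl2_ops (T E) (T F) (T H)"
proof (rule sl2_ops.intro)
  show "lin (T E)" "lin (T F)" "lin (T H)" by (rule T(1))+
  fix v
  show "T E (T F v) = T F (T E v) + T H v" "T H (T E v) = T E (T H v) + vscale 2 (T E v)"
    "T H (T F v) = T F (T H v) - vscale 2 (T F v)"
    using T(2)[of E F v] T(2)[of H E v] T(2)[of H F v] by (simp_all add: lc_def)
qed

definition Lc :: "nat \<Rightarrow> sl2 vobj" where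
  "Lc m = vmod (HK {m}) sl2act"

lemma lin_sl2act: "lin (sl2act b)"
  by (cases b) (simp_all add: lin_sE lin_sF lin_sH)

lemma HK_sl2act: "v \<in> HK K \<Longrightarrow> sl2act b v \<in> HK K"
  by (cases b) (simp_all add: HK_closed)

lemma Lc_vmod: "is_vmod sl2_br (Lc m)"
proof -
  interpret sl2_ops sE sF sH by (rule sl2_ops_s)
  show ?thesis unfolding Lc_def
    by (rule sl2_vmodI) (simp_all add: subspace_HK HK_sl2act lin_imp_linon lin_sl2act ef he hf)
qed

lemma Lc_simps [simp]: "carr (Lc m) = HK {m}" "act (Lc m) = sl2act"
  by (simp_all add: Lc_def)

lemma Lc_highest:
  assumes "v \<in> HK {m}" "sE v = 0" shows "v = vscale (cf v m 0) (mon m 0)"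
proof (rule cf_eqI)
  fix a b
  show "cf v a b = cf (vscale (cf v m 0) (mon m 0)) a b"
  proof (cases "b = 0 \<and> a = m")
    case False
    then have "cf v a b = 0" using assms ker_sE[of v b a] by (cases "b = 0") (auto simp: HK_def)
    then show ?thesis using False by auto
  qed simp
qed

text \<open>A nonzero submodule contains a nonzero vector killed by \<open>sE\<close>, which is a
  multiple of x^m; applying \<open>sF\<close> repeatedly reaches every monomial of degree
  \<open>m\<close>.\<close>

lemma Lc_simple: "simple_module (Lc m)"
  unfolding simple_module_iff[OF Lc_vmod]
proof (intro conjI allI impI)
  show "carr (Lc m) \<noteq> {0}"
  proof
    assume "carr (Lc m) = {0}"
    then have "mon m 0 = 0" using mon_in_HK[of m 0 "{m}"] by auto
    then show False using cf_mon[of m 0 m 0] by simp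
  qed
  fix W assume "submodule W (Lc m)"
  then have W: "vec.subspace W" "W \<subseteq> HK {m}" "\<And>b v. v \<in> W \<Longrightarrow> sl2act b v \<in> W"
    by (auto simp: submodule_iff[OF Lc_vmod])
  show "W = {0} \<or> W = carr (Lc m)"
  proof (cases "W = {0}")
    case False
    then obtain v where "v \<in> W" "v \<noteq> 0" using vec.subspace_0[OF W(1)] by auto
    then obtain w where w: "w \<in> W" "w \<noteq> 0" "sE w = 0" using sE_kernel_vector[of v W] W(3)[of _ E] by auto
    then have e: "w = vscale (cf w m 0) (mon m 0)" using Lc_highest W(2) by blast
    then have "cf w m 0 \<noteq> 0" using w(2) by auto
    then have "mon m 0 = vscale (1 / cf w m 0) w" by (subst e) simp
    then have m0: "mon m 0 \<in> W" using w(1) W(1) by (simp add: vec.subspace_scale)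
    have mW: "mon a b \<in> W" if "a + b = m" for a b using that
    proof (induction b arbitrary: a)
      case (Suc b)
      then have "mon (Suc a) b \<in> W" by simp
      then have "vscale (1 / of_nat (Suc a)) (sF (mon (Suc a) b)) \<in> W"
        using W(3)[of _ F] W(1) by (auto intro: vec.subspace_scale)
      then show ?case by (simp add: s_mon del: of_nat_Suc)
    qed (use m0 in simp)
    have "HK {m} \<subseteq> W" unfolding HK_span by (rule vec.span_minimal[OF _ W(1)]) (use mW in auto)
    then show ?thesis using W(2) by auto
  qed simp
qed

lemma Lc_basis:
  "vec.independent ((\<lambda>b. mon (m - b) b) ` {..m})" "HK {m} = vec.span ((\<lambda>b. mon (m - b) b) ` {..m})"
  "card ((\<lambda>b. mon (m - b) b) ` {..m}) = m + 1"
proof -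
  have inj: "inj_on (\<lambda>b. mon (m - b) b) {..m}"
    by (rule inj_onI) (metis cf_mon zero_neq_one)
  show "card ((\<lambda>b. mon (m - b) b) ` {..m}) = m + 1" using inj by (simp add: card_image)
  have "{mon a b | a b. a + b \<in> {m}} = (\<lambda>b. mon (m - b) b) ` {..m}"
  proof (intro subset_antisym subsetI)
    fix x assume "x \<in> {mon a b | a b. a + b \<in> {m}}"
    then obtain a b where "x = mon a b" "a + b = m" by auto
    then show "x \<in> (\<lambda>b. mon (m - b) b) ` {..m}" by (intro image_eqI[of _ _ b]) auto
  next
    fix x assume "x \<in> (\<lambda>b. mon (m - b) b) ` {..m}"
    then obtain b where "x = mon (m - b) b" "b \<le> m" by auto
    then show "x \<in> {mon a b | a b. a + b \<in> {m}}" by (intro CollectI exI[of _ "m - b"] exI[of _ b]) simp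
  qed
  then show "HK {m} = vec.span ((\<lambda>b. mon (m - b) b) ` {..m})" by (simp add: HK_span)
  show "vec.independent ((\<lambda>b. mon (m - b) b) ` {..m})"
  proof (rule vec.independent_if_scalars_zero)
    fix g x assume s: "(\<Sum>x\<in>(\<lambda>b. mon (m - b) b) ` {..m}. vscale (g x) x) = 0" and "x \<in> (\<lambda>b. mon (m - b) b) ` {..m}"
    then obtain b where b: "b \<le> m" "x = mon (m - b) b" by auto
    have "0 = cf (\<Sum>i\<le>m. vscale (g (mon (m - i) i)) (mon (m - i) i)) (m - b) b"
      using s by (simp add: sum.reindex[OF inj])
    also have "\<dots> = (\<Sum>i\<le>m. cf (vscale (g (mon (m - i) i)) (mon (m - i) i)) (m - b) b)"
      by (simp add: cf_def lookup_sum)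
    also have "\<dots> = (\<Sum>i\<le>m. if i = b then g (mon (m - b) b) else 0)" by (intro sum.cong) auto
    also have "\<dots> = g x" using b by simp
    finally show "g x = 0" by simp
  qed simp
qed

lemma dim_Lc: "vec.dim (carr (Lc m)) = m + 1"
  using Lc_basis[of m] vec.dim_span_eq_card_independent by simp

lemma fin_dim_iff:
  assumes "vops V" "vec.subspace (carr V)"
  shows "fin_dim V \<longleftrightarrow> (\<exists>B. finite B \<and> carr V = vec.span B)"
proof -
  have cs: "csubspace W V \<longleftrightarrow> vec.subspace W \<and> W \<subseteq> carr V" for W
  proof -
    have v: "vadd V = (+)" "vzero V = 0" "vsmul V = vscale" using assms(1) by (auto simp: vops_def)
    show ?thesis unfolding csubspace_def vec.subspace_def v by blast
  qed
  show ?thesis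
  proof
    assume "fin_dim V"
    then obtain B where B': "finite B \<and> B \<subseteq> carr V \<and> (\<forall>W. csubspace W V \<and> B \<subseteq> W \<longrightarrow> W = carr V)"
      unfolding fin_dim_def by (elim exE)
    then have B: "finite B" "B \<subseteq> carr V" "\<And>W. csubspace W V \<Longrightarrow> B \<subseteq> W \<Longrightarrow> W = carr V" by simp_all
    have "vec.span B = carr V"
      by (rule B(3)) (simp_all add: cs vec.span_minimal[OF B(2) assms(2)] vec.span_superset)
    then show "\<exists>B. finite B \<and> carr V = vec.span B" using B(1) by blast
  next
    assume "\<exists>B. finite B \<and> carr V = vec.span B"
    then obtain B where B: "finite B" "carr V = vec.span B" by blast
    have "W = carr V" if "csubspace W V" "B \<subseteq> W" for W
      using that vec.span_minimal[of B W] unfolding cs B(2) by blast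
    moreover have "B \<subseteq> carr V" unfolding B(2) by (rule vec.span_superset)
    ultimately show "fin_dim V" unfolding fin_dim_def using B(1) by (intro exI[of _ B]) simp
  qed
qed

text \<open>The formula comes from \<open>f\<^sup>b x\<^sup>a\<^sup>+\<^sup>b = ((a + b)! / a!) x\<^sup>a y\<^sup>b\<close>.\<close>

definition hw_map :: "(vec \<Rightarrow> vec) \<Rightarrow> vec \<Rightarrow> vec \<Rightarrow> vec" where
  "hw_map f v = lext2 (\<lambda>a b. vscale (fact a / fact (a + b)) ((f ^^ b) v))"

lemma lin_hw_map: "lin (hw_map f v)"
  by (simp add: hw_map_def lin_lext2)

lemma hw_map_mon: "hw_map f v (mon a b) = vscale (fact a / fact (a + b)) ((f ^^ b) v)"
  by (simp add: hw_map_def)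

context sl2_ops
begin

text \<open>On monomials these are the string formulas. The boundary cases use the hypotheses on
  \<open>v\<close>: \<open>e v = 0\<close> for \<open>b = 0\<close>, and
  \<open>(f ^^ Suc k) v = 0\<close> for \<open>a = 0\<close>.\<close>

lemma hw_map_intertwines:
  assumes v: "e v = 0" "h v = vscale (of_nat k) v" "(f ^^ Suc k) v = 0" and u: "u \<in> HK {k}"
  shows "hw_map f v (sE u) = e (hw_map f v u)" "hw_map f v (sF u) = f (hw_map f v u)"
    "hw_map f v (sH u) = h (hw_map f v u)"
proof -
  note l = lin_imp_linon[OF lin_compose[OF lin_sE lin_hw_map]] lin_imp_linon[OF lin_compose[OF lin_hw_map lin_e]]
    lin_imp_linon[OF lin_compose[OF lin_sF lin_hw_map]] lin_imp_linon[OF lin_compose[OF lin_hw_map lin_f]]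
    lin_imp_linon[OF lin_compose[OF lin_sH lin_hw_map]] lin_imp_linon[OF lin_compose[OF lin_hw_map lin_h]]
  note s = lin_scale[OF lin_hw_map]
  show "hw_map f v (sE u) = e (hw_map f v u)"
  proof (rule HK_ext[OF l(1,2) _ u])
    fix a b :: nat assume "a + b \<in> {k}"
    then have k: "k = a + b" by simp
    show "hw_map f v (sE (mon a b)) = e (hw_map f v (mon a b))"
    proof (cases b)
      case 0 then show ?thesis by (simp add: s_mon hw_map_mon lins v lin_zero[OF lin_hw_map])
    next
      case (Suc j)
      have "of_nat k - of_nat j = (of_nat (Suc a) :: complex)" using k Suc by simp
      then have "e ((f ^^ b) v) = vscale (of_nat b * of_nat (Suc a)) ((f ^^ j) v)"
        using e_f_pow_eigen[OF v(1,2), of j] Suc by simp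
      then show ?thesis by (simp add: s_mon hw_map_mon lins s Suc del: of_nat_Suc funpow.simps)
    qed
  qed
  show "hw_map f v (sF u) = f (hw_map f v u)"
  proof (rule HK_ext[OF l(3,4) _ u])
    fix a b :: nat assume "a + b \<in> {k}"
    then have k: "k = a + b" by simp
    show "hw_map f v (sF (mon a b)) = f (hw_map f v (mon a b))"
    proof (cases a)
      case 0 then show ?thesis using v(3) k by (simp add: s_mon hw_map_mon lins lin_zero[OF lin_hw_map])
    next
      case (Suc j)
      then show ?thesis by (simp add: s_mon hw_map_mon lins s del: of_nat_Suc)
    qed
  qed
  show "hw_map f v (sH u) = h (hw_map f v u)"
  proof (rule HK_ext[OF l(5,6) _ u])
    fix a b :: nat assume "a + b \<in> {k}"
    then have "of_nat k - 2 * of_nat b = (of_nat a - of_nat b :: complex)" by auto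
    then show "hw_map f v (sH (mon a b)) = h (hw_map f v (mon a b))"
      by (simp add: s_mon hw_map_mon lins s h_f_pow_eigen[OF v(2)] mult.commute)
  qed
qed

end

text \<open>Weyl's theorem in the form used for tensor products. Each of finitely many spanning
  vectors is a combination of finitely many string vectors, and a string vector lies in the image of
  the \<open>hw_map\<close> of its highest weight vector.\<close>

theorem weyl_cover:
  assumes A: "is_vmod sl2_br A" and B: "finite B" "carr A = vec.span B"
  obtains L where "finite L" "\<And>k \<phi>. (k, \<phi>) \<in> L \<Longrightarrow> lin \<phi> \<and> lmod_hom (Lc k) A \<phi>"
    "carr A = vec.span (\<Union>(k, \<phi>)\<in>L. \<phi> ` HK {k})"
proof -
  obtain T where T: "\<And>b. lin (T b)" "\<And>b v. T b v \<in> carr A" "\<And>b v. v \<in> carr A \<Longrightarrow> T b v = act A b v"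
    "\<And>x y v. T x (T y v) = T y (T x v) + lc T (sl2_br x y) v" by (rule total_action[OF A]) (rule that)
  interpret sl2_ops "T E" "T F" "T H" by (rule sl2_ops_total[OF T(1,4)])
  note s = vmod_subspace[OF A]
  let ?S = "{(T F ^^ j) v | j v m. v \<in> carr A \<and> T E v = 0 \<and> T H v = vscale (of_nat m) v}"
  obtain l where l: "\<And>v. v \<in> carr A \<Longrightarrow> (T F ^^ l) v = 0"
    by (rule findim_nilpotent[where c = "-2", OF lin_h lin_f _ _ T(2,2) B]) (auto simp: hf)
  have "carr A \<subseteq> vec.span ?S" using weyl[OF T(2,2,2) B] by (simp add: hw_span_def)
  then have ex: "\<forall>b\<in>B. \<exists>t. finite t \<and> t \<subseteq> ?S \<and> b \<in> vec.span t"
  proof (intro ballI)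
    fix b assume "b \<in> B" and AS: "carr A \<subseteq> vec.span ?S"
    then have "b \<in> vec.span ?S" using B(2) vec.span_base by blast
    then obtain t r where t: "finite t" "t \<subseteq> ?S" "b = (\<Sum>a\<in>t. vscale (r a) a)"
      unfolding vec.span_explicit by blast
    have "b \<in> vec.span t" unfolding t(3) by (intro vec.span_sum vec.span_scale vec.span_base)
    then show "\<exists>t. finite t \<and> t \<subseteq> ?S \<and> b \<in> vec.span t" using t by blast
  qed
  from bchoice[OF ex] obtain t where t: "\<forall>b\<in>B. finite (t b) \<and> t b \<subseteq> ?S \<and> b \<in> vec.span (t b)" by (elim exE)
  let ?t = "\<Union>b\<in>B. t b"
  have ft: "finite ?t" using B(1) t by blast
  have tS: "?t \<subseteq> ?S" using t by blast
  have Bt: "B \<subseteq> vec.span ?t"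
  proof
    fix b assume b: "b \<in> B"
    then have "vec.span (t b) \<subseteq> vec.span ?t" by (intro vec.span_mono) blast
    then show "b \<in> vec.span ?t" using t b by blast
  qed
  have wit: "\<forall>w\<in>?t. \<exists>p. lin (snd p) \<and> lmod_hom (Lc (fst p)) A (snd p) \<and> w \<in> snd p ` HK {fst p}"
  proof
    fix w assume "w \<in> ?t"
    then obtain j v m where w: "w = (T F ^^ j) v" "v \<in> carr A" "T E v = 0" "T H v = vscale (of_nat m) v"
      using tS by blast
    have z: "(T F ^^ Suc m) v = 0" by (rule f_pow_highest[OF w(3,4) l[OF w(2)]])
    let ?\<phi> = "hw_map (T F) v"
    have in_A: "?\<phi> u \<in> carr A" for u
    proof -
      have "(T F ^^ b) v \<in> carr A" for b using T(2) w(2) by (rule funpow_in)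
      then show ?thesis unfolding hw_map_def lext2_def lext_def
        using s by (intro vec.subspace_sum vec.subspace_scale)
    qed
    have "lmod_hom (Lc m) A ?\<phi>"
    proof (rule lmod_homI[OF Lc_vmod A lin_imp_linon[OF lin_hw_map] in_A])
      fix b u assume "u \<in> carr (Lc m)"
      then show "?\<phi> (act (Lc m) b u) = act A b (?\<phi> u)"
        using hw_map_intertwines[OF w(3,4) z, of u] T(3)[OF in_A] by (cases b) auto
    qed
    moreover have "w \<in> ?\<phi> ` HK {m}"
    proof (cases "j \<le> m")
      case True
      let ?c = "fact (m - j) / fact m :: complex"
      have "?\<phi> (vscale (1 / ?c) (mon (m - j) j)) = w"
        using True w(1) by (simp add: lin_scale[OF lin_hw_map] hw_map_mon)
      moreover have "vscale (1 / ?c) (mon (m - j) j) \<in> HK {m}"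
        using True by (intro vec.subspace_scale subspace_HK) simp
      ultimately show ?thesis by (metis imageI)
    next
      case False
      then obtain d where "j = d + Suc m" by (metis add.commute le_Suc_ex not_less_eq_eq)
      then have "w = (T F ^^ d) ((T F ^^ Suc m) v)" unfolding w(1) by (simp only: funpow_add o_apply)
      then have "w = ?\<phi> 0" using z by (simp add: lin_zero[OF lin_funpow[OF lin_f]] lin_zero[OF lin_hw_map])
      then show ?thesis using vec.subspace_0[OF subspace_HK] by blast
    qed
    ultimately show "\<exists>p. lin (snd p) \<and> lmod_hom (Lc (fst p)) A (snd p) \<and> w \<in> snd p ` HK {fst p}"
      using lin_hw_map by (intro exI[of _ "(m, ?\<phi>)"]) simp
  qed
  from bchoice[OF wit] obtain p where p: "\<forall>w\<in>?t. lin (snd (p w)) \<and> lmod_hom (Lc (fst (p w))) A (snd (p w)) \<and>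
    w \<in> snd (p w) ` HK {fst (p w)}" by (elim exE)
  define k \<phi> where "k w = fst (p w)" and "\<phi> w = snd (p w)" for w
  have k: "lin (\<phi> w) \<and> lmod_hom (Lc (k w)) A (\<phi> w) \<and> w \<in> \<phi> w ` HK {k w}" if "w \<in> ?t" for w
    using p that unfolding k_def \<phi>_def by blast
  let ?L = "(\<lambda>w. (k w, \<phi> w)) ` ?t"
  show thesis
  proof (rule that[of ?L])
    show "finite ?L" using ft by simp
    show "lin \<psi> \<and> lmod_hom (Lc j) A \<psi>" if "(j, \<psi>) \<in> ?L" for j \<psi> using that k by auto
    let ?U = "\<Union>(k, \<phi>)\<in>?L. \<phi> ` HK {k}"
    have "?t \<subseteq> ?U"
    proof
      fix w assume w: "w \<in> ?t"
      then have "(k w, \<phi> w) \<in> ?L" by (rule imageI)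
      then show "w \<in> ?U" by (rule UN_I) (use k[OF w] in simp)
    qed
    then have "B \<subseteq> vec.span ?U" using Bt vec.span_mono by blast
    then have 1: "carr A \<subseteq> vec.span ?U" unfolding B(2) by (rule vec.span_minimal[OF _ vec.subspace_span])
    have "?U \<subseteq> carr A"
    proof -
      have "\<phi> w ` HK {k w} \<subseteq> carr A" if "w \<in> ?t" for w
        using lmod_homD(2)[OF _ Lc_vmod A, of "k w" "\<phi> w"] k[OF that] by auto
      then show ?thesis by fastforce
    qed
    then have "vec.span ?U \<subseteq> carr A" by (rule vec.span_minimal[OF _ s])
    then show "carr A = vec.span ?U" using 1 by blast
  qed
qed

text \<open>Some map of a cover is nonzero, hence an isomorphism from a simple \<open>Lc k\<close>,
  and the dimension identifies \<open>k\<close> with \<open>m\<close>. This settles what the choice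
  in \<open>L_mod\<close> can be.\<close>

lemma simple_Lc_iso:
  assumes V: "is_vmod sl2_br V" "simple_module V" "vec.dim (carr V) = m + 1"
  obtains \<phi> where "lin \<phi>" "base_iso (Lc m) V \<phi>"
proof -
  obtain B where B: "B \<subseteq> carr V" "vec.independent B" "carr V \<subseteq> vec.span B" "card B = vec.dim (carr V)"
    by (rule vec.basis_exists)
  have fB: "finite B" using B(4) V(3) by (simp add: card_ge_0_finite)
  have "carr V = vec.span B" using B(1,3) vec.span_minimal[OF B(1) vmod_subspace[OF V(1)]] by blast
  from weyl_cover[OF V(1) fB this] obtain L where L: "finite L"
    "\<And>k \<phi>. (k, \<phi>) \<in> L \<Longrightarrow> lin \<phi> \<and> lmod_hom (Lc k) V \<phi>" "carr V = vec.span (\<Union>(k, \<phi>)\<in>L. \<phi> ` HK {k})" by metis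
  have nz: "carr V \<noteq> {0}" using V(2) by (simp add: simple_module_iff[OF V(1)])
  have "\<exists>k \<phi> u. (k, \<phi>) \<in> L \<and> u \<in> HK {k} \<and> \<phi> u \<noteq> 0"
  proof (rule ccontr)
    assume "\<not> ?thesis"
    then have "(\<Union>(k, \<phi>)\<in>L. \<phi> ` HK {k}) \<subseteq> {0}" by auto
    then have "vec.span (\<Union>(k, \<phi>)\<in>L. \<phi> ` HK {k}) \<subseteq> {0}" by (rule vec.span_minimal) (simp add: vec.subspace_def)
    then have "carr V \<subseteq> {0}" using L(3) by simp
    then show False using nz vec.subspace_0[OF vmod_subspace[OF V(1)]] by blast
  qed
  then obtain k \<phi> u where k: "(k, \<phi>) \<in> L" "u \<in> HK {k}" "\<phi> u \<noteq> 0" by blast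
  then have \<phi>: "lin \<phi>" "lmod_hom (Lc k) V \<phi>" using L(2) by auto
  have z: "submodule {0} V"
    using vmod_subspace[OF V(1)] linon_zero[OF vmod_linon[OF V(1)]] by (auto simp: submodule_iff[OF V(1)] vec.subspace_0)
  have inj: "inj_on \<phi> (HK {k})" using simple_hom_inj(1)[OF Lc_vmod Lc_simple V(1) \<phi>(2) z, of u] k by simp
  have im: "\<phi> ` HK {k} = carr V"
    using submodule_image[OF \<phi>(2) Lc_vmod V(1)] V(2) k(2,3) unfolding simple_module_iff[OF V(1)] by (metis Lc_simps(1) imageI singletonD)
  let ?B = "(\<lambda>b. mon (k - b) b) ` {..k}"
  have 1: "vec.independent (\<phi> ` ?B)"
    using inj by (intro vp.linear_independent_injective_image[OF \<phi>(1) Lc_basis(1)]) (simp add: Lc_basis(2))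
  have "vec.span (\<phi> ` ?B) = \<phi> ` HK {k}" unfolding Lc_basis(2) by (rule vp.linear_span_image[OF \<phi>(1)])
  then have "vec.dim (carr V) = card (\<phi> ` ?B)" using vec.dim_span_eq_card_independent[OF 1] im by simp
  also have "\<dots> = card ?B"
  proof (rule card_image)
    have "?B \<subseteq> HK {k}" unfolding Lc_basis(2) by (rule vec.span_superset)
    then show "inj_on \<phi> ?B" using inj inj_on_subset by blast
  qed
  finally have "k = m" using Lc_basis(3)[of k] V(3) by simp
  then have "base_iso (Lc m) V \<phi>"
    using \<phi>(2) inj im lin_zero[OF \<phi>(1)] vmod_vops[OF V(1)] by (auto simp: base_iso_def bij_betw_def vops_def)
  then show thesis using that \<phi>(1) by blast
qed

lemma L_mod_spec: "is_vmod sl2_br (L_mod m)" "simple_module (L_mod m)" "vec.dim (carr (L_mod m)) = m + 1"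
proof -
  have "\<exists>V. is_vmod sl2_br V \<and> simple_module V \<and> vec.dim (carr V) = m + 1"
    using Lc_vmod Lc_simple dim_Lc by blast
  from someI_ex[OF this] show "is_vmod sl2_br (L_mod m)" "simple_module (L_mod m)" "vec.dim (carr (L_mod m)) = m + 1"
    unfolding L_mod_def by auto
qed

lemma L_mod_iso: obtains \<phi> where "lin \<phi>" "base_iso (Lc m) (L_mod m) \<phi>"
  by (rule simple_Lc_iso[OF L_mod_spec]) (rule that)

section \<open>Closure under tensor products\<close>

text \<open>L(1) with a weight basis singled out. Tensor computations are done for any such module,
  because they are applied to \<open>Lc 1\<close> as well as to \<open>L_mod 1\<close>.\<close>

definition std2 :: "sl2 vobj \<Rightarrow> vec \<Rightarrow> vec \<Rightarrow> bool" where
  "std2 A x y \<longleftrightarrow> is_vmod sl2_br A \<and> x \<in> carr A \<and> y \<in> carr A \<and> carr A = vec.span {x, y} \<and>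
     (\<forall>a b. vscale a x + vscale b y = 0 \<longrightarrow> a = 0 \<and> b = 0) \<and>
     act A E x = 0 \<and> act A E y = x \<and> act A F x = y \<and> act A F y = 0 \<and> act A H x = x \<and> act A H y = - y"

lemma std2_iso:
  assumes \<phi>: "lin \<phi>" "base_iso (Lc 1) V \<phi>" and V: "is_vmod sl2_br V"
  shows "std2 V (\<phi> (mon 1 0)) (\<phi> (mon 0 1))"
proof -
  have h: "lmod_hom (Lc 1) V \<phi>" and inj: "inj_on \<phi> (HK {1})" and im: "\<phi> ` HK {1} = carr V"
    using \<phi>(2) by (auto simp: base_iso_def bij_betw_def)
  have m: "mon 1 0 \<in> HK {1}" "mon 0 1 \<in> HK {1}" by simp_all
  have "{mon a b | a b. a + b \<in> {1}} = {mon 1 0, mon 0 1}" by (auto simp: add_is_1)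
  then have "HK {1} = vec.span {mon 1 0, mon 0 1}" using HK_span[of "{1}"] by simp
  then have sp: "carr V = vec.span {\<phi> (mon 1 0), \<phi> (mon 0 1)}"
    using im vp.linear_span_image[OF \<phi>(1), of "{mon 1 0, mon 0 1}"] by simp
  have a: "act V b (\<phi> u) = \<phi> (sl2act b u)" if "u \<in> HK {1}" for b u
    using lmod_homD(3)[OF h Lc_vmod V, of u b] that by simp
  have ind: "c = 0 \<and> d = 0" if "vscale c (\<phi> (mon 1 0)) + vscale d (\<phi> (mon 0 1)) = 0" for c d
  proof -
    let ?u = "vscale c (mon 1 0) + vscale d (mon 0 1)"
    have "\<phi> ?u = \<phi> 0" using that by (simp add: lin_add[OF \<phi>(1)] lin_scale[OF \<phi>(1)] lin_zero[OF \<phi>(1)])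
    moreover have "?u \<in> HK {1}" "0 \<in> HK {1}"
      using subspace_HK[of "{1}"] m by (auto intro!: vec.subspace_add vec.subspace_scale vec.subspace_0)
    ultimately have "?u = 0" using inj by (metis inj_onD)
    then have "cf ?u 1 0 = 0" "cf ?u 0 1 = 0" by simp_all
    then show ?thesis by simp
  qed
  show ?thesis unfolding std2_def
    using V im m sp ind by (auto simp: a s_mon lin_zero[OF \<phi>(1)] lin_uminus[OF \<phi>(1)])
qed

lemma std2_Lc1: "std2 (Lc 1) (mon 1 0) (mon 0 1)"
proof (rule std2_iso[of "\<lambda>v. v"])
  show "lin (\<lambda>v. v)" by (rule linI) auto
  show "base_iso (Lc 1) (Lc 1) (\<lambda>v. v)" by (auto simp: base_iso_def lmod_hom_id bij_betw_def Lc_def)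
  show "is_vmod sl2_br (Lc 1)" by (rule Lc_vmod)
qed

lemma std2_L_mod1: "\<exists>x y. std2 (L_mod 1) x y"
  using L_mod_iso[of 1] std2_iso[OF _ _ L_mod_spec(1)] by metis

lemma tensor_span_right:
  assumes N: "vec.subspace N" and NB: "N = vec.span B" and S: "vec.subspace S"
    and *: "\<And>a n. a \<in> A \<Longrightarrow> n \<in> B \<Longrightarrow> tensor_vec a n \<in> S"
  shows "tspace A N \<subseteq> S"
proof (rule tspace_minimal[OF S])
  fix a n assume a: "a \<in> A" and "n \<in> N"
  then have "n \<in> vec.span B" using NB by simp
  then show "tensor_vec a n \<in> S"
    by (induction rule: vec.span_induct_alt)
      (use * a S in \<open>auto simp: tensor_add_right tensor_scale_right vec.subspace_0 vec.subspace_add vec.subspace_scale\<close>)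
qed

lemma tensor_span_left:
  assumes N: "vec.subspace A" and NB: "A = vec.span B" and S: "vec.subspace S"
    and *: "\<And>a n. a \<in> B \<Longrightarrow> n \<in> N \<Longrightarrow> tensor_vec a n \<in> S"
  shows "tspace A N \<subseteq> S"
proof (rule tspace_minimal[OF S])
  fix a n assume n: "n \<in> N" and "a \<in> A"
  then have "a \<in> vec.span B" using NB by simp
  then show "tensor_vec a n \<in> S"
    by (induction rule: vec.span_induct_alt)
      (use * n S in \<open>auto simp: tensor_add_left tensor_scale_left vec.subspace_0 vec.subspace_add vec.subspace_scale\<close>)
qed

text \<open>Follows from \<open>a \<otimes> (b n) = b (a \<otimes> n) - (b a) \<otimes> n\<close>.
  For cyclic \<open>N\<close> it is therefore enough to find the generator in this
  submodule.\<close>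

lemma tensor_submodule_slice:
  assumes A: "is_vmod br A" and N: "is_vmod br N" and S: "submodule S (tensor_mod A N)"
  shows "submodule {n \<in> carr N. \<forall>a\<in>carr A. tensor_vec a n \<in> S} N"
proof -
  note T = tensor_mod_vmod[OF A N]
  have S': "vec.subspace S" "\<And>b t. t \<in> S \<Longrightarrow> act (tensor_mod A N) b t \<in> S"
    using S by (auto simp: submodule_iff[OF T])
  note s = vmod_subspace[OF N]
  have "tensor_vec a (act N b n) \<in> S" if n: "n \<in> carr N" "\<forall>a\<in>carr A. tensor_vec a n \<in> S" and a: "a \<in> carr A" for a b n
  proof -
    have "act (tensor_mod A N) b (tensor_vec a n) \<in> S" using n(2) a S'(2) by blast
    then have "tensor_vec (act A b a) n + tensor_vec a (act N b n) \<in> S" by (simp add: act_tensor_mod[OF A N a n(1)])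
    moreover have "tensor_vec (act A b a) n \<in> S" using n(2) vmod_act[OF A a] by blast
    ultimately have "tensor_vec (act A b a) n + tensor_vec a (act N b n) - tensor_vec (act A b a) n \<in> S"
      using S'(1) by (rule_tac vec.subspace_diff)
    then show ?thesis by simp
  qed
  then show ?thesis unfolding submodule_iff[OF N] using s S'(1) vmod_act[OF N]
    by (auto intro!: vec.subspaceI simp: vec.subspace_0 vec.subspace_add vec.subspace_scale
        tensor_add_right tensor_scale_right)
qed

definition mX :: "vec \<Rightarrow> vec" where "mX = lext2 (\<lambda>a b. mon (a + 1) b)"
definition mY :: "vec \<Rightarrow> vec" where "mY = lext2 (\<lambda>a b. mon a (b + 1))"

lemma lin_mX: "lin mX" and lin_mY: "lin mY"
  by (simp_all add: mX_def mY_def lin_lext2)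

lemma m_mon: "mX (mon a b) = mon (a + 1) b" "mY (mon a b) = mon a (b + 1)"
  by (simp_all add: mX_def mY_def)

lemmas m_lins = lin_add[OF lin_mX] lin_add[OF lin_mY] lin_scale[OF lin_mX] lin_scale[OF lin_mY]

lemma cf_mX: "cf (mX v) a b = (if a = 0 then 0 else cf v (a - 1) b)"
  by (rule functional_ext2[where f = "\<lambda>v. cf (mX v) a b"]) (auto simp: m_lins m_mon)

lemma cf_mY: "cf (mY v) a b = (if b = 0 then 0 else cf v a (b - 1))"
  by (rule functional_ext2[where f = "\<lambda>v. cf (mY v) a b"]) (auto simp: m_lins m_mon)

lemma s_m_commute:
  "sE (mX v) = mX (sE v)" "sE (mY v) = mY (sE v) + mX v" "sF (mX v) = mX (sF v) + mY v" "sF (mY v) = mY (sF v)"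
  "sH (mX v) = mX (sH v) + mX v" "sH (mY v) = mY (sH v) - mY v"
  by (rule cf_eqI, auto simp: cf_sE cf_sF cf_sH cf_mX cf_mY algebra_simps of_nat_diff)+

text \<open>The map is multiplication of polynomials: x and y times the forms of degree
  \<open>k\<close> span the forms of degree \<open>k + 1\<close>. A surjection is what
  \<open>good_cover\<close> asks for.\<close>

lemma Lc_multiplication:
  obtains T where "lmod_hom (tensor_mod (Lc 1) (Lc k)) (Lc (Suc k)) T"
    "carr (Lc (Suc k)) = vec.span (T ` carr (tensor_mod (Lc 1) (Lc k)))"
proof -
  define \<beta> where "\<beta> u g = vscale (cf u 1 0) (mX g) + vscale (cf u 0 1) (mY g)" for u g
  have b: "bilinon (HK {1}) (HK {k}) \<beta>"
    by (auto intro!: bilinonI linonI simp: \<beta>_def m_lins vec.scale_left_distrib vec.scale_right_distrib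
        algebra_simps)
  define T where "T = tlift (HK {1}) (HK {k}) \<beta>"
  note l = tlift_linon[OF subspace_HK subspace_HK b, folded T_def]
    and t = tlift_tensor[OF subspace_HK subspace_HK b, folded T_def]
  have \<beta>i: "\<beta> u g \<in> HK {Suc k}" if "g \<in> HK {k}" for u g
    using that by (auto simp: \<beta>_def HK_def cf_mX cf_mY)
  have h: "lmod_hom (tensor_mod (Lc 1) (Lc k)) (Lc (Suc k)) T"
  proof (rule lmod_hom_tensorI[OF Lc_vmod Lc_vmod Lc_vmod])
    show "linon (tspace (carr (Lc 1)) (carr (Lc k))) T" using l by simp
    fix u g assume u: "u \<in> carr (Lc 1)" and g: "g \<in> carr (Lc k)"
    then show "T (tensor_vec u g) \<in> carr (Lc (Suc k))" by (simp add: t \<beta>i)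
    fix b
    have "\<beta> (sl2act b u) g + \<beta> u (sl2act b g) = sl2act b (\<beta> u g)"
      by (cases b) (simp_all add: \<beta>_def cf_sE cf_sF cf_sH s_lins s_m_commute vec.scale_right_distrib
          vec.scale_right_diff_distrib)
    then show "T (tensor_vec (act (Lc 1) b u) g) + T (tensor_vec u (act (Lc k) b g)) = act (Lc (Suc k)) b (T (tensor_vec u g))"
      using u g by (simp add: t HK_sl2act)
  qed
  have "mon a b \<in> T ` tspace (HK {1}) (HK {k})" if ab: "a + b = Suc k" for a b
  proof (cases a)
    case 0
    then have "T (tensor_vec (mon 0 1) (mon 0 k)) = mon a b" using ab by (simp add: t \<beta>_def m_mon)
    moreover have "tensor_vec (mon 0 1) (mon 0 k) \<in> tspace (HK {1}) (HK {k})" by (intro tensor_in_tspace) auto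
    ultimately show ?thesis by (metis imageI)
  next
    case (Suc c)
    then have "T (tensor_vec (mon 1 0) (mon c b)) = mon a b" using ab by (simp add: t \<beta>_def m_mon)
    moreover have "tensor_vec (mon 1 0) (mon c b) \<in> tspace (HK {1}) (HK {k})" using ab Suc by (intro tensor_in_tspace) auto
    ultimately show ?thesis by (metis imageI)
  qed
  then have "{mon a b | a b. a + b \<in> {Suc k}} \<subseteq> T ` tspace (HK {1}) (HK {k})" by auto
  then have 1: "HK {Suc k} \<subseteq> vec.span (T ` tspace (HK {1}) (HK {k}))" unfolding HK_span by (rule vec.span_mono)
  have "T ` tspace (HK {1}) (HK {k}) \<subseteq> HK {Suc k}" using lmod_homD(2)[OF h tensor_mod_vmod[OF Lc_vmod Lc_vmod] Lc_vmod] by auto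
  then have "vec.span (T ` tspace (HK {1}) (HK {k})) \<subseteq> HK {Suc k}" by (rule vec.span_minimal[OF _ subspace_HK])
  then show thesis using that[OF h] 1 by simp
qed

text \<open>For \<open>i = 0\<close> the truncated \<open>i - 1\<close> is 0, so
  \<open>tensor_std2\<close> then describes the loop at \<open>X 0\<close>. It asks for nonzero maps
  with jointly spanning images; \<open>biproduct_pairI\<close> supplies directness.\<close>

locale tensor_family = simple_family br X + restriction sl2_br br r
  for br :: "'b \<Rightarrow> 'b \<Rightarrow> 'b lincomb" and X and r +
  assumes tensor_std2: "std2 A x y \<Longrightarrow> \<exists>\<phi> \<psi> u v. lmod_hom (X (i - 1)) (tensor_mod (r A) (X i)) \<phi> \<and>
      u \<in> carr (X (i - 1)) \<and> \<phi> u \<noteq> 0 \<and> lmod_hom (X (i + 1)) (tensor_mod (r A) (X i)) \<psi> \<and>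
      v \<in> carr (X (i + 1)) \<and> \<psi> v \<noteq> 0 \<and>
      carr (tensor_mod (r A) (X i)) = vec.span (\<phi> ` carr (X (i - 1)) \<union> \<psi> ` carr (X (i + 1)))"
begin

text \<open>Stability of the category under tensoring with \<open>A\<close>, taken as a property of
  \<open>A\<close>: it passes to images, finite sums and tensor products, so that Weyl's theorem
  reduces it to L(1).\<close>

definition good :: "sl2 vobj \<Rightarrow> bool" where
  "good A \<longleftrightarrow> is_vmod sl2_br A \<and> (\<forall>N. is_vmod br N \<longrightarrow> gen N \<longrightarrow> gen (tensor_mod (r A) N))"

text \<open>Tensoring the maps from the \<open>X i\<close> to \<open>N\<close> with \<open>A\<close>
  covers the product of \<open>A\<close> with \<open>N\<close> by the products of \<open>A\<close>
  with the \<open>X i\<close>.\<close>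

lemma goodI:
  assumes A: "is_vmod sl2_br A" and X: "\<And>i. gen (tensor_mod (r A) (X i))"
  shows "good A"
  unfolding good_def
proof (intro conjI A allI impI)
  fix N assume N: "is_vmod br N" "gen N"
  note rA = r_vmod[OF A]
  obtain L where L: "finite L" "\<forall>(i, \<phi>)\<in>L. lmod_hom (X i) N \<phi>" "carr N = vec.span (\<Union>(i, \<phi>)\<in>L. \<phi> ` carr (X i))"
    using N(2) unfolding gen_def by blast
  let ?t = "\<lambda>(i, \<phi>). (tensor_mod (r A) (X i), tmap (carr A) (carr (X i)) (\<lambda>a. a) \<phi>)"
  have hom: "lmod_hom (tensor_mod (r A) (X i)) (tensor_mod (r A) N) (tmap (carr A) (carr (X i)) (\<lambda>a. a) \<phi>)"
    if "(i, \<phi>) \<in> L" for i \<phi>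
    using lmod_hom_tmap[OF rA rA X_vmod N(1) lmod_hom_id, of i \<phi>] L(2) that by auto
  let ?B = "\<Union>(M, f)\<in>?t ` L. f ` carr M"
  show "gen (tensor_mod (r A) N)"
  proof (rule gen_cover[of _ "?t ` L"])
    show T: "is_vmod br (tensor_mod (r A) N)" by (rule tensor_mod_vmod[OF rA N(1)])
    show "finite (?t ` L)" using L(1) by simp
    show "is_vmod br M \<and> gen M \<and> lmod_hom M (tensor_mod (r A) N) f" if "(M, f) \<in> ?t ` L" for M f
      using that X hom tensor_mod_vmod[OF rA X_vmod] by auto
    have "f ` carr M \<subseteq> carr (tensor_mod (r A) N)" if "(M, f) \<in> ?t ` L" for M f
      using lmod_homD(2)[OF hom tensor_mod_vmod[OF rA X_vmod] T] that by auto
    then have "?B \<subseteq> carr (tensor_mod (r A) N)" by fast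
    then have 1: "vec.span ?B \<subseteq> carr (tensor_mod (r A) N)" by (rule vec.span_minimal[OF _ vmod_subspace[OF T]])
    have "tspace (carr A) (carr N) \<subseteq> vec.span ?B"
    proof (rule tensor_span_right[OF vmod_subspace[OF N(1)] L(3) vec.subspace_span])
      fix a n assume a: "a \<in> carr A" and "n \<in> (\<Union>(i, \<phi>)\<in>L. \<phi> ` carr (X i))"
      then obtain i \<phi> x where n: "(i, \<phi>) \<in> L" "x \<in> carr (X i)" "n = \<phi> x" by auto
      have "linon (carr (X i)) \<phi>" using L(2) n(1) lmod_homD(1)[OF _ X_vmod N(1)] by auto
      then have "tensor_vec a n = tmap (carr A) (carr (X i)) (\<lambda>a. a) \<phi> (tensor_vec a x)"
        using a n by (simp add: tmap_tensor vmod_subspace[OF A] vmod_subspace[OF X_vmod] linon_id)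
      moreover have "tensor_vec a x \<in> carr (tensor_mod (r A) (X i))" using a n by (simp add: tensor_in_tspace)
      ultimately have "tensor_vec a n \<in> ?B" using n(1) by fastforce
      then show "tensor_vec a n \<in> vec.span ?B" by (rule vec.span_base)
    qed
    then show "carr (tensor_mod (r A) N) = vec.span ?B" using 1 by auto
  qed
qed

lemma good_cover:
  assumes A: "is_vmod sl2_br A" and fin: "finite \<K>"
    and K: "\<And>B \<psi>. (B, \<psi>) \<in> \<K> \<Longrightarrow> good B \<and> lmod_hom B A \<psi>"
    and span: "carr A = vec.span (\<Union>(B, \<psi>)\<in>\<K>. \<psi> ` carr B)"
  shows "good A"
proof (rule goodI[OF A])
  fix i
  note rA = r_vmod[OF A]
  let ?t = "\<lambda>(B, \<psi>). (tensor_mod (r B) (X i), tmap (carr B) (carr (X i)) \<psi> (\<lambda>x. x))"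
  have mB: "is_vmod sl2_br B" if "(B, \<psi>) \<in> \<K>" for B \<psi> using K[OF that] by (simp add: good_def)
  have hom: "lmod_hom (tensor_mod (r B) (X i)) (tensor_mod (r A) (X i)) (tmap (carr B) (carr (X i)) \<psi> (\<lambda>x. x))"
    if "(B, \<psi>) \<in> \<K>" for B \<psi>
    using lmod_hom_tmap[OF r_vmod[OF mB[OF that]] rA X_vmod[of i] X_vmod[of i] r_hom[OF mB[OF that] A] lmod_hom_id] K[OF that] by simp
  let ?B = "\<Union>(M, f)\<in>?t ` \<K>. f ` carr M"
  show "gen (tensor_mod (r A) (X i))"
  proof (rule gen_cover[of _ "?t ` \<K>"])
    show T: "is_vmod br (tensor_mod (r A) (X i))" by (rule tensor_mod_vmod[OF rA X_vmod])
    show "finite (?t ` \<K>)" using fin by simp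
    show KK: "is_vmod br M \<and> gen M \<and> lmod_hom M (tensor_mod (r A) (X i)) f" if "(M, f) \<in> ?t ` \<K>" for M f
    proof -
      from that obtain B \<psi> where B: "(B, \<psi>) \<in> \<K>" "M = tensor_mod (r B) (X i)" "f = tmap (carr B) (carr (X i)) \<psi> (\<lambda>x. x)" by auto
      then show ?thesis using K[OF B(1)] hom[OF B(1)] tensor_mod_vmod[OF r_vmod[OF mB[OF B(1)]] X_vmod] X_vmod gen_X
        by (simp add: good_def)
    qed
    have "f ` carr M \<subseteq> carr (tensor_mod (r A) (X i))" if "(M, f) \<in> ?t ` \<K>" for M f
      using lmod_homD(2)[of M _ f br br] KK[OF that] T by blast
    then have "?B \<subseteq> carr (tensor_mod (r A) (X i))" by fast
    then have 1: "vec.span ?B \<subseteq> carr (tensor_mod (r A) (X i))" by (rule vec.span_minimal[OF _ vmod_subspace[OF T]])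
    have "tspace (carr A) (carr (X i)) \<subseteq> vec.span ?B"
    proof (rule tensor_span_left[OF vmod_subspace[OF A] span vec.subspace_span])
      fix a n assume n: "n \<in> carr (X i)" and "a \<in> (\<Union>(B, \<psi>)\<in>\<K>. \<psi> ` carr B)"
      then obtain B \<psi> b where b: "(B, \<psi>) \<in> \<K>" "b \<in> carr B" "a = \<psi> b" by auto
      have "linon (carr B) \<psi>" using K[OF b(1)] lmod_homD(1)[OF _ mB[OF b(1)] A] by auto
      then have "tensor_vec a n = tmap (carr B) (carr (X i)) \<psi> (\<lambda>x. x) (tensor_vec b n)"
        using b n by (simp add: tmap_tensor vmod_subspace[OF mB[OF b(1)]] vmod_subspace[OF X_vmod] linon_id)
      moreover have "tensor_vec b n \<in> carr (tensor_mod (r B) (X i))" using b n by (simp add: tensor_in_tspace)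
      ultimately have "tensor_vec a n \<in> ?B" using b(1) by fastforce
      then show "tensor_vec a n \<in> vec.span ?B" by (rule vec.span_base)
    qed
    then show "carr (tensor_mod (r A) (X i)) = vec.span ?B" using 1 by auto
  qed
qed

lemma good_std2:
  assumes "std2 A x y" shows "good A"
proof (rule goodI)
  show A: "is_vmod sl2_br A" using assms by (simp add: std2_def)
  fix i
  note T = tensor_mod_vmod[OF r_vmod[OF A] X_vmod]
  obtain \<phi> \<psi> where "lmod_hom (X (i - 1)) (tensor_mod (r A) (X i)) \<phi>" "lmod_hom (X (i + 1)) (tensor_mod (r A) (X i)) \<psi>"
    "carr (tensor_mod (r A) (X i)) = vec.span (\<phi> ` carr (X (i - 1)) \<union> \<psi> ` carr (X (i + 1)))"
    using tensor_std2[OF assms] by blast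
  then show "gen (tensor_mod (r A) (X i))"
    by (intro gen_cover[OF T, of "{(X (i - 1), \<phi>), (X (i + 1), \<psi>)}"]) (auto simp: X_vmod gen_X)
qed

text \<open>Up to the associator, tensoring with the product is tensoring twice.\<close>

lemma good_tensor:
  assumes A: "good A" and B: "good B" shows "good (tensor_mod A B)"
proof (rule goodI)
  have mA: "is_vmod sl2_br A" and mB: "is_vmod sl2_br B" using A B by (auto simp: good_def)
  note rA = r_vmod[OF mA] and rB = r_vmod[OF mB]
  show AB: "is_vmod sl2_br (tensor_mod A B)" by (rule tensor_mod_vmod[OF mA mB])
  fix i
  note M = tensor_mod_vmod[OF r_vmod[OF AB] X_vmod, of i] and N = tensor_mod_vmod[OF rA tensor_mod_vmod[OF rB X_vmod], of i]
  note s = vmod_subspace[OF mA] vmod_subspace[OF mB] vmod_subspace[OF X_vmod]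
  have b: "bij_betw (tassoc (carr A) (carr B) (carr (X i))) (carr (tensor_mod (r (tensor_mod A B)) (X i)))
      (carr (tensor_mod (r A) (tensor_mod (r B) (X i))))" using tassoc_bij[OF s] by simp
  note inv = lmod_hom_inv[OF hom_tassoc[OF mA mB X_vmod] b M]
  have "gen (tensor_mod (r B) (X i))" using B X_vmod gen_X by (simp add: good_def)
  then have g: "gen (tensor_mod (r A) (tensor_mod (r B) (X i)))"
    using A tensor_mod_vmod[OF rB X_vmod] by (simp add: good_def)
  have "inv_into (carr (tensor_mod (r (tensor_mod A B)) (X i))) (tassoc (carr A) (carr B) (carr (X i)))
     ` carr (tensor_mod (r A) (tensor_mod (r B) (X i))) = carr (tensor_mod (r (tensor_mod A B)) (X i))"
    using bij_betw_inv_into[OF b] by (simp add: bij_betw_def)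
  then show "gen (tensor_mod (r (tensor_mod A B)) (X i))" by (rule gen_image[OF g N M inv])
qed

lemma good_triv: "good triv_mod"
proof (rule goodI[OF triv_mod_vmod])
  fix i
  note M = tensor_mod_vmod[OF r_vmod[OF triv_mod_vmod] X_vmod, of i]
  have b: "bij_betw (tlunit (carr (X i))) (carr (tensor_mod (r triv_mod) (X i))) (carr (X i))"
    using tlunit_bij[OF vmod_subspace[OF X_vmod]] by simp
  note inv = lmod_hom_inv[OF hom_tlunit[OF X_vmod] b M]
  show "gen (tensor_mod (r triv_mod) (X i))"
    using bij_betw_inv_into[OF b] by (intro gen_image[OF gen_X X_vmod M inv]) (simp add: bij_betw_def)
qed

lemma good_Lc: "good (Lc k)"
proof (induction k)
  case 0
  \<comment> \<open>As the pair of zeros is encoded by 0, \<open>bas 0\<close> is the constant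
    monomial, and the unit space is literally the space of L(0).\<close>
  have e: "prod_encode (0, 0) = 0" by (simp add: prod_encode_def)
  have "HK {0} = vec.span {mon 0 0}" by (simp add: HK_span)
  then have u: "unit_space = HK {0}" by (simp add: unit_space_def mon_def bas_def e)
  have z: "sl2act b v = 0" if "v \<in> HK {0}" for b v
  proof (rule cf_eqI)
    fix a' b'
    have "cf v a b = 0" if "a \<noteq> 0 \<or> b \<noteq> 0" for a b using that \<open>v \<in> HK {0}\<close> by (auto simp: HK_def)
    then show "cf (sl2act b v) a' b' = cf 0 a' b'"
      by (cases b; cases "a' = 0 \<and> b' = 0") (auto simp: cf_sE cf_sF cf_sH)
  qed
  have "lmod_hom triv_mod (Lc 0) (\<lambda>v. v)"
    by (rule lmod_homI[OF triv_mod_vmod Lc_vmod]) (auto simp: u linon_id z)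
  then show ?case using good_triv
    by (intro good_cover[OF Lc_vmod, of "{(triv_mod, \<lambda>v. v)}"])
      (auto simp: u vec.span_eq_iff[THEN iffD2, OF subspace_HK])
next
  case (Suc k)
  obtain T where "lmod_hom (tensor_mod (Lc 1) (Lc k)) (Lc (Suc k)) T"
    "carr (Lc (Suc k)) = vec.span (T ` carr (tensor_mod (Lc 1) (Lc k)))" by (rule Lc_multiplication)
  then show ?case using good_tensor[OF good_std2[OF std2_Lc1] Suc]
    by (intro good_cover[OF Lc_vmod, of "{(tensor_mod (Lc 1) (Lc k), T)}"]) auto
qed

text \<open>\<open>weyl_cover\<close> writes \<open>A\<close> as a finite sum of images of modules
  \<open>Lc k\<close>, which are good by induction on \<open>k\<close>.\<close>

theorem good_findim:
  assumes A: "is_vmod sl2_br A" "fin_dim A" shows "good A"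
proof -
  obtain B where B: "finite B" "carr A = vec.span B"
    using A fin_dim_iff[OF vmod_vops[OF A(1)] vmod_subspace[OF A(1)]] by blast
  obtain L where L: "finite L" "\<And>k \<phi>. (k, \<phi>) \<in> L \<Longrightarrow> lin \<phi> \<and> lmod_hom (Lc k) A \<phi>"
    "carr A = vec.span (\<Union>(k, \<phi>)\<in>L. \<phi> ` HK {k})" using weyl_cover[OF A(1) B] by metis
  let ?K = "(\<lambda>(k, \<phi>). (Lc k, \<phi>)) ` L"
  have "(\<Union>(B, \<psi>)\<in>?K. \<psi> ` carr B) = (\<Union>(k, \<phi>)\<in>L. \<phi> ` HK {k})" by fastforce
  then show ?thesis using L good_Lc by (intro good_cover[OF A(1), of ?K]) auto
qed

end

section \<open>The acting category, and the theorem for an abstract tensor family\<close>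

lemma vmoncat_sl2: "vmoncat sl2_br {V. is_vmod sl2_br V \<and> fin_dim V}"
proof
  let ?P = "{V. is_vmod sl2_br V \<and> fin_dim V}"
  have fd: "fin_dim V \<longleftrightarrow> (\<exists>B. finite B \<and> carr V = vec.span B)" if "is_vmod sl2_br V" for V
    by (rule fin_dim_iff[OF vmod_vops[OF that] vmod_subspace[OF that]])
  show "is_vmod sl2_br A" if "A \<in> ?P" for A using that by simp
  show "triv_mod \<in> ?P" using triv_mod_vmod[of sl2_br] by (auto simp: fd unit_space_def)
  fix A B assume "A \<in> ?P" "B \<in> ?P"
  then have m: "is_vmod sl2_br A" "is_vmod sl2_br B" "fin_dim A" "fin_dim B" by auto
  then obtain S T where S: "finite S" "carr A = vec.span S" and T: "finite T" "carr B = vec.span T" by (auto simp: fd)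
  note AB = tensor_mod_vmod[OF m(1,2)]
  let ?U = "(\<lambda>(s, t). tensor_vec s t) ` (S \<times> T)"
  have "?U \<subseteq> tspace (carr A) (carr B)" using S T by (auto intro!: tensor_in_tspace vec.span_base)
  then have 1: "vec.span ?U \<subseteq> tspace (carr A) (carr B)" by (rule vec.span_minimal[OF _ subspace_tspace])
  have "tensor_vec a t \<in> vec.span ?U" if "a \<in> carr A" "t \<in> T" for a t
  proof -
    have "a \<in> vec.span S" using that S by simp
    then show ?thesis
    proof (induction rule: vec.span_induct_alt)
      case (step c x y)
      moreover have "tensor_vec x t \<in> vec.span ?U" using step(1) that(2) by (intro vec.span_base) auto
      ultimately show ?case by (simp add: tensor_add_left tensor_scale_left vec.span_add vec.span_scale)
    qed (simp add: vec.span_zero)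
  qed
  then have "tspace (carr A) (carr B) \<subseteq> vec.span ?U"
    by (intro tensor_span_right[OF vmod_subspace[OF m(2)] T(2) vec.subspace_span])
  then have "carr (tensor_mod A B) = vec.span ?U" using 1 by auto
  moreover have "finite ?U" using S T by simp
  ultimately show "tensor_mod A B \<in> ?P" using AB fd[OF AB] by blast
qed

context tensor_family
begin

theorem simple_transitive_type_T_infinity:
  fixes S :: "('b, 'w) lmod set"
  assumes SX: "\<And>M. M \<in> S \<Longrightarrow> \<exists>i f. base_iso (X i) M f" and XS: "\<And>i. \<exists>M\<in>S. \<exists>f. base_iso (X i) M f"
  defines "M \<equiv> mod_modcat r {N. is_vmod br N \<and> in_add_closure S N}"
  shows "simple_transitive sl2_fin M \<and> type_T_infinity M"
proof -
  let ?P = "{V. is_vmod sl2_br V \<and> fin_dim V}"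
  let ?O = "{N. is_vmod br N \<and> gen N}"
  \<comment> \<open>From here on the additive closure is handled as the class of generated
    modules.\<close>
  have "{N. is_vmod br N \<and> in_add_closure S N} = ?O" using in_add_closure_iff[OF SX XS] by blast
  then have M: "M = mod_modcat r ?O" by (simp add: M_def)
  interpret P: vmoncat sl2_br ?P by (rule vmoncat_sl2)
  interpret G: generated_category br X ?O "mod_modcat r ?O"
    by standard (auto simp: mod_modcat_simps)
  interpret A: vactcat sl2_br ?P br r ?O
  proof
    fix A Y assume "A \<in> ?P" "Y \<in> ?O"
    then show "tensor_mod (r A) Y \<in> ?O"
      using good_findim[of A] tensor_mod_vmod[OF r_vmod, of A Y] by (auto simp: good_def)
  qed
  interpret S: semisimple_category "mod_modcat r ?O" X by (rule G.semisimple_category)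
  have mc: "module_category sl2_fin M" unfolding M sl2_fin_def by (rule A.module_category)
  have lf: "locally_finitary M" unfolding M by (rule S.locally_finitaryI[OF G.additive_cat G.idempotent_split])
  have L1: "is_vmod sl2_br (L_mod 1)" by (rule L_mod_spec(1))
  obtain x y where xy: "std2 (L_mod 1) x y" using std2_L_mod1 by blast
  have b: "biproduct M (X (i - 1)) (X (i + 1)) (aob M (L_mod 1) (X i))" for i
  proof -
    obtain \<phi> \<psi> u v where h: "lmod_hom (X (i - 1)) (tensor_mod (r (L_mod 1)) (X i)) \<phi>"
      "u \<in> carr (X (i - 1))" "\<phi> u \<noteq> 0" "lmod_hom (X (i + 1)) (tensor_mod (r (L_mod 1)) (X i)) \<psi>"
      "v \<in> carr (X (i + 1))" "\<psi> v \<noteq> 0"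
      "carr (tensor_mod (r (L_mod 1)) (X i)) = vec.span (\<phi> ` carr (X (i - 1)) \<union> \<psi> ` carr (X (i + 1)))"
      using tensor_std2[OF xy] by blast
    show ?thesis unfolding M mod_modcat_simps
      by (rule G.biproduct_pairI[OF tensor_mod_vmod[OF r_vmod[OF L1] X_vmod] h(1-6) _ h(7)]) simp
  qed
  have b0: "biproduct M (X 0) (X 1) (aob M (L_mod 1) (X 0))" using b[of 0] by simp
  have "\<exists>B. finite B \<and> carr (L_mod 1) = vec.span B"
    using xy by (intro exI[of _ "{x, y}"]) (simp add: std2_def)
  then have "fin_dim (L_mod 1)" using fin_dim_iff[OF vmod_vops[OF L1] vmod_subspace[OF L1]] by blast
  then have LP: "L_mod 1 \<in> Obj sl2_fin" using L1 unfolding sl2_fin_def by simp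
  have st: "simple_transitive sl2_fin M"
    by (rule simple_transitiveI[OF mc _ LP b0 b]) (unfold M, rule G.semisimple_category)
  have "type_T_infinity M"
    unfolding type_T_infinity_def
  proof (intro conjI exI[of _ X] allI impI)
    show "indecomposable M (X i)" for i unfolding M by (rule S.indecomposable_X)
    show "isomorphic M (X i) (X j) \<Longrightarrow> i = j" for i j unfolding M by (rule S.isomorphic_X)
    show "indecomposable M Y \<Longrightarrow> \<exists>i. isomorphic M Y (X i)" for Y unfolding M by (rule S.indecomposable_iso_X)
  qed (use mc lf b0 b in auto)
  then show ?thesis using st by blast
qed

end

text \<open>\<open>Q i N v\<close> is meant as the condition on \<open>v\<close> for the existence of a homomorphism \<open>X i \<rightarrow> N\<close> with
  \<open>w i \<mapsto> v\<close>.\<close>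

lemma simple_familyI:
  fixes X :: "nat \<Rightarrow> 'b vobj" and Q :: "nat \<Rightarrow> 'b vobj \<Rightarrow> vec \<Rightarrow> bool"
  assumes vm: "\<And>i. is_vmod br (X i)" and w: "\<And>i. w i \<in> carr (X i)" "\<And>i. w i \<noteq> 0"
    and cyc: "\<And>i W. submodule W (X i) \<Longrightarrow> w i \<in> W \<Longrightarrow> W = carr (X i)"
    and sim: "\<And>i W. submodule W (X i) \<Longrightarrow> W \<noteq> {0} \<Longrightarrow> w i \<in> W"
    and Qw: "\<And>i. Q i (X i) (w i)"
    and Qh: "\<And>i j k f v. lmod_hom (X i) (X j) f \<Longrightarrow> v \<in> carr (X i) \<Longrightarrow> Q k (X i) v \<Longrightarrow> Q k (X j) (f v)"
    and Qu: "\<And>i j v. v \<in> carr (X j) \<Longrightarrow> Q i (X j) v \<Longrightarrow> \<exists>c. v = vscale c (w j)"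
    and Qz: "\<And>i j v. i \<noteq> j \<Longrightarrow> v \<in> carr (X j) \<Longrightarrow> Q i (X j) v \<Longrightarrow> v = 0"
  shows "simple_family br X"
proof
  fix i j :: nat and f v
  show "is_vmod br (X i)" by (rule vm)
  show "simple_module (X i)" unfolding simple_module_iff[OF vm] using w cyc sim by blast
  \<comment> \<open>Homomorphisms that agree on \<open>w i\<close> agree everywhere, since their
    equaliser is a submodule containing the generator.\<close>
  have eq: "\<forall>v\<in>carr (X i). f v = g v" if f: "lmod_hom (X i) (X j) f" and g: "lmod_hom (X i) (X j) g" and fg: "f (w i) = g (w i)"
    for i j f g
  proof -
    note fh = lmod_homD[OF f vm vm] and gh = lmod_homD[OF g vm vm] and s = vmod_subspace[OF vm[of i]]
    have "submodule {v \<in> carr (X i). f v = g v} (X i)"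
      unfolding submodule_iff[OF vm]
      using s fh gh vmod_act[OF vm] linon_zero[OF fh(1) vec.subspace_0[OF s]] linon_zero[OF gh(1) vec.subspace_0[OF s]]
      by (auto intro!: vec.subspaceI simp: vec.subspace_0 vec.subspace_add vec.subspace_scale linon_add[OF fh(1)]
          linon_add[OF gh(1)] linon_scale[OF fh(1)] linon_scale[OF gh(1)])
    from cyc[OF this] w(1) fg show ?thesis by blast
  qed
  show "\<exists>c. \<forall>v\<in>carr (X i). f v = vscale c v" if f: "lmod_hom (X i) (X i) f"
  proof -
    obtain c where "f (w i) = vscale c (w i)" using Qu[OF _ Qh[OF f w(1) Qw]] lmod_homD(2)[OF f vm vm w(1)] by blast
    then show ?thesis using eq[OF f lmod_hom_scale[OF lmod_hom_id vm vm]] by blast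
  qed
  show "f v = 0" if ij: "i \<noteq> j" and f: "lmod_hom (X i) (X j) f" and v: "v \<in> carr (X i)"
  proof -
    have "f (w i) = 0" by (rule Qz[OF ij lmod_homD(2)[OF f vm vm w(1)] Qh[OF f w(1) Qw]])
    then show ?thesis using eq[OF f lmod_hom_zero[OF vm vm]] v by blast
  qed
qed

lemma simple_hom_bij:
  assumes M: "is_vmod br M" "simple_module M" and N: "is_vmod br N" "simple_module N"
    and f: "lmod_hom M N f" and u: "u \<in> carr M" "f u \<noteq> 0"
  shows "bij_betw f (carr M) (carr N)"
proof -
  have z: "submodule {0} N"
    using vmod_subspace[OF N(1)] linon_zero[OF vmod_linon[OF N(1)]] by (auto simp: submodule_iff[OF N(1)] vec.subspace_0)
  have "inj_on f (carr M)" using simple_hom_inj(1)[OF M N(1) f z u(1)] u(2) by simp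
  moreover have "f ` carr M = carr N"
    using submodule_image[OF f M(1) N(1)] N(2) u unfolding simple_module_iff[OF N(1)] by (metis imageI singletonD)
  ultimately show ?thesis by (simp add: bij_betw_def)
qed

section \<open>The Schroedinger Lie algebra\<close>

text \<open>The relation \<open>pq\<close> is imposed on \<open>V\<close> only: after an action has
  been made total, the central element is known to act as \<theta> on the carrier, but not on all of
  \<open>vec\<close>.\<close>

locale schr_ops = sl2_ops e f h for e f h +
  fixes p q :: "vec \<Rightarrow> vec" and V :: "vec set" and \<theta> :: complex
  assumes lin_p: "lin p" and lin_q: "lin q"
    and eq: "e (q v) = q (e v) + p v" and ep: "e (p v) = p (e v)"
    and hp: "h (p v) = p (h v) + p v" and hq: "h (q v) = q (h v) - q v"
    and fp: "f (p v) = p (f v) + q v" and fq: "f (q v) = q (f v)"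
    and subV: "vec.subspace V" and pV: "v \<in> V \<Longrightarrow> p v \<in> V" and fV: "v \<in> V \<Longrightarrow> f v \<in> V"
    and pq: "v \<in> V \<Longrightarrow> p (q v) = q (p v) + vscale \<theta> v"
begin

lemmas pqlins = lin_add[OF lin_p] lin_add[OF lin_q] lin_scale[OF lin_p] lin_scale[OF lin_q]
  lin_diff[OF lin_p] lin_diff[OF lin_q] lin_zero[OF lin_p] lin_zero[OF lin_q]

lemma fq_pow: "(f ^^ b) (q v) = q ((f ^^ b) v)"
  by (induction b) (simp_all add: fq)

lemma fp_pow: "(f ^^ b) (p v) = p ((f ^^ b) v) + vscale (of_nat b) (q ((f ^^ (b - 1)) v))"
proof (induction b)
  case (Suc b)
  have *: "vscale (of_nat b) (f (q ((f ^^ (b - 1)) v))) = vscale (of_nat b) (q ((f ^^ b) v))"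
    by (cases b) (simp_all add: fq)
  have "(f ^^ Suc b) (p v) = f (p ((f ^^ b) v)) + vscale (of_nat b) (f (q ((f ^^ (b - 1)) v)))"
    using Suc by (simp add: lins)
  also have "\<dots> = p ((f ^^ Suc b) v) + q ((f ^^ b) v) + vscale (of_nat b) (q ((f ^^ b) v))"
    unfolding * fp by simp
  finally show ?case by (simp add: vec.scale_left_distrib)
qed simp

end

text \<open>The solution of the recursion below. Multiplied by \<open>k + 1\<close> it telescopes:
  \<open>k (k + 1) \<gamma>_k\<close> grows by \<open>\<theta> (k + 1)\<close> at each step, and the
  value 0 at \<open>k = n\<close> leaves \<open>\<theta>/2 (k (k + 1) - n (n + 1))\<close>.\<close>

definition \<gamma> :: "complex \<Rightarrow> nat \<Rightarrow> nat \<Rightarrow> complex" where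
  "\<gamma> \<theta> n k = \<theta> / 2 * (1 - of_nat (n * (n + 1)) / of_nat (k * (k + 1)))"

text \<open>In degree \<open>k\<close>, \<open>p\<close> and \<open>q\<close> will act as \<open>x + \<gamma>\<^sub>k \<partial>\<^sub>y\<close> and \<open>y - \<gamma>\<^sub>k \<partial>\<^sub>x\<close>; then \<open>[p, q] = \<theta>\<close> amounts to the
  recursion \<open>\<gamma>_rec\<close>, and \<open>\<gamma>\<^sub>n = 0\<close> makes the polynomials of degree \<open>\<ge> n\<close> a submodule.
  For \<open>k = 0\<close> the junk value \<open>x / 0 = 0\<close> does no harm: \<open>\<gamma> \<theta> n 0\<close> only ever occurs with coefficient \<open>0\<close>.\<close>

lemma \<gamma>_rec: "k \<ge> n \<Longrightarrow> of_nat (k + 2) * \<gamma> \<theta> n (k + 1) - of_nat k * \<gamma> \<theta> n k = \<theta>"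
proof (cases "k = 0")
  case False
  define x where "x = (of_nat k :: complex)"
  have "x + 1 = of_nat (k + 1)" "x + 2 = of_nat (k + 2)" by (simp_all add: x_def)
  then have nz: "x \<noteq> 0" "x + 1 \<noteq> 0" "x + 2 \<noteq> 0"
    unfolding x_def using False by (simp_all only: of_nat_eq_0_iff) simp_all
  define N where "N = (of_nat (n * (n + 1)) :: complex)"
  define s t where "s = N / ((x + 1) * (x + 2))" and "t = N / (x * (x + 1))"
  have st: "(x + 2) * s = N / (x + 1)" "x * t = N / (x + 1)" using nz by (simp_all add: s_def t_def)
  have "of_nat (k + 2) * \<gamma> \<theta> n (k + 1) - of_nat k * \<gamma> \<theta> n k =
    (x + 2) * (\<theta> / 2 * (1 - s)) - x * (\<theta> / 2 * (1 - t))"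
    by (simp add: \<gamma>_def x_def N_def s_def t_def algebra_simps)
  also have "\<dots> = \<theta> / 2 * ((x + 2) - (x + 2) * s - x + x * t)" by (simp add: field_simps)
  also have "\<dots> = \<theta>" unfolding st by simp
  finally show ?thesis .
qed (simp add: \<gamma>_def)

text \<open>Kept with the factor \<open>n\<close> because division by zero makes
  \<open>\<gamma> \<theta> 0 0\<close> equal to \<open>\<theta> / 2\<close>.\<close>

lemma \<gamma>_n: "of_nat n * \<gamma> \<theta> n n = 0"
proof (cases "n = 0")
  case False
  then have nz: "(of_nat (n * (n + 1)) :: complex) \<noteq> 0" unfolding of_nat_eq_0_iff by simp
  show ?thesis unfolding \<gamma>_def divide_self[OF nz] by simp
qed simp

lemma \<gamma>_self: "n > 0 \<Longrightarrow> \<gamma> \<theta> n n = 0"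
  using \<gamma>_n[of n \<theta>] by simp

text \<open>In degrees above \<open>n\<close> vectors can therefore be lowered; this gives
  simplicity and separates the modules for different \<open>n\<close>.\<close>

lemma \<gamma>_nonzero: "\<theta> \<noteq> 0 \<Longrightarrow> k > n \<Longrightarrow> \<gamma> \<theta> n k \<noteq> 0"
proof
  assume "\<theta> \<noteq> 0" "k > n" "\<gamma> \<theta> n k = 0"
  have "(of_nat (k * (k + 1)) :: complex) \<noteq> 0" using \<open>k > n\<close> unfolding of_nat_eq_0_iff by simp
  moreover have "of_nat (n * (n + 1)) / of_nat (k * (k + 1)) = (1 :: complex)"
    using \<open>\<theta> \<noteq> 0\<close> \<open>\<gamma> \<theta> n k = 0\<close> unfolding \<gamma>_def by (simp only: mult_eq_0_iff right_minus_eq) simp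
  ultimately have "(of_nat (n * (n + 1)) :: complex) = of_nat (k * (k + 1))" by (simp only: divide_eq_1_iff)
  then have "n * (n + 1) = k * (k + 1)" by (simp only: of_nat_eq_iff)
  moreover have "n * (n + 1) < k * (k + 1)" using \<open>k > n\<close> by (intro mult_strict_mono) auto
  ultimately show False by simp
qed

lemma \<gamma>_next: "of_nat (n + 2) * \<gamma> \<theta> n (n + 1) = \<theta>"
  using \<gamma>_rec[of n n \<theta>] \<gamma>_n[of n \<theta>] by simp

text \<open>Two steps of the recursion starting at \<open>n\<close>; the number
  \<open>2 n + 3\<close> reappears in the coefficients of \<open>u_plus\<close>.\<close>

lemma \<gamma>_next2: "of_nat (n + 2) * of_nat (n + 3) * \<gamma> \<theta> n (n + 2) = \<theta> * of_nat (2 * n + 3)"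
proof -
  have "of_nat (n + 3) * \<gamma> \<theta> n (n + 2) = \<theta> + of_nat (n + 1) * \<gamma> \<theta> n (n + 1)"
    using \<gamma>_rec[of n "n + 1" \<theta>] by (simp add: algebra_simps numeral_3_eq_3)
  then have "of_nat (n + 2) * (of_nat (n + 3) * \<gamma> \<theta> n (n + 2)) = of_nat (n + 2) * \<theta> + of_nat (n + 1) * (of_nat (n + 2) * \<gamma> \<theta> n (n + 1))"
    by (simp only:) (simp add: algebra_simps)
  then show ?thesis unfolding \<gamma>_next by (simp add: algebra_simps)
qed

definition sP :: "complex \<Rightarrow> nat \<Rightarrow> vec \<Rightarrow> vec" where
  "sP \<theta> n = lext2 (\<lambda>a b. mon (a + 1) b + vscale (\<gamma> \<theta> n (a + b) * of_nat b) (mon a (b - 1)))"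

definition sQ :: "complex \<Rightarrow> nat \<Rightarrow> vec \<Rightarrow> vec" where
  "sQ \<theta> n = lext2 (\<lambda>a b. mon a (b + 1) - vscale (\<gamma> \<theta> n (a + b) * of_nat a) (mon (a - 1) b))"

lemma lin_sP: "lin (sP \<theta> n)" and lin_sQ: "lin (sQ \<theta> n)"
  by (simp_all add: sP_def sQ_def lin_lext2)

lemma sP_mon: "sP \<theta> n (mon a b) = mon (a + 1) b + vscale (\<gamma> \<theta> n (a + b) * of_nat b) (mon a (b - 1))"
  by (simp add: sP_def)

lemma sQ_mon: "sQ \<theta> n (mon a b) = mon a (b + 1) - vscale (\<gamma> \<theta> n (a + b) * of_nat a) (mon (a - 1) b)"
  by (simp add: sQ_def)

lemma cf_sP: "cf (sP \<theta> n v) a b = (if a = 0 then 0 else cf v (a - 1) b) + \<gamma> \<theta> n (a + b + 1) * of_nat (b + 1) * cf v a (b + 1)"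
  by (rule functional_ext2[where f = "\<lambda>v. cf (sP \<theta> n v) a b"])
    (auto simp: lin_add[OF lin_sP] lin_scale[OF lin_sP] sP_mon algebra_simps)

lemma cf_sQ: "cf (sQ \<theta> n v) a b = (if b = 0 then 0 else cf v a (b - 1)) - \<gamma> \<theta> n (a + b + 1) * of_nat (a + 1) * cf v (a + 1) b"
  by (rule functional_ext2[where f = "\<lambda>v. cf (sQ \<theta> n v) a b"])
    (auto simp: lin_add[OF lin_sQ] lin_scale[OF lin_sQ] sQ_mon algebra_simps)

text \<open>Terms of degree \<open>n - 1\<close> arise only by lowering degree \<open>n\<close>, and
  carry the factor \<open>\<gamma> \<theta> n n = 0\<close>.\<close>

lemma sPQ_closed:
  assumes v: "v \<in> HK {n..}" shows "sP \<theta> n v \<in> HK {n..}" "sQ \<theta> n v \<in> HK {n..}"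
proof -
  have z: "cf v a b = 0" if "a + b < n" for a b using v that by (auto simp: HK_def)
  have g: "\<gamma> \<theta> n (a + b + 1) * cf v a' b' = 0" if "a + b < n" "a' + b' = a + b + 1" for a b a' b'
    using that z[of a' b'] \<gamma>_self[of n \<theta>] by (cases "a + b + 1 = n") auto
  have "cf (sP \<theta> n v) a b = 0 \<and> cf (sQ \<theta> n v) a b = 0" if lt: "a + b < n" for a b
    using g[OF lt, of a "b + 1"] g[OF lt, of "a + 1" b] z[of "a - 1" b] z[of a "b - 1"] lt
    by (auto simp: cf_sP cf_sQ)
  then show "sP \<theta> n v \<in> HK {n..}" "sQ \<theta> n v \<in> HK {n..}" by (auto simp: HK_def)
qed

lemma schr_ops_s: "schr_ops sE sF sH (sP \<theta> n) (sQ \<theta> n) (HK {n..}) \<theta>"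
proof (intro schr_ops.intro sl2_ops_s schr_ops_axioms.intro)
  fix v
  show "sE (sQ \<theta> n v) = sQ \<theta> n (sE v) + sP \<theta> n v"
  proof (rule cf_eqI)
    fix a b show "cf (sE (sQ \<theta> n v)) a b = cf (sQ \<theta> n (sE v) + sP \<theta> n v) a b"
      by (cases a; cases b) (simp_all add: cf_sE cf_sP cf_sQ algebra_simps)
  qed
  show "sE (sP \<theta> n v) = sP \<theta> n (sE v)"
  proof (rule cf_eqI)
    fix a b show "cf (sE (sP \<theta> n v)) a b = cf (sP \<theta> n (sE v)) a b"
      by (cases a; cases b) (simp_all add: cf_sE cf_sP algebra_simps)
  qed
  show "sH (sP \<theta> n v) = sP \<theta> n (sH v) + sP \<theta> n v"
  proof (rule cf_eqI)
    fix a b show "cf (sH (sP \<theta> n v)) a b = cf (sP \<theta> n (sH v) + sP \<theta> n v) a b"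
      by (cases a; cases b) (simp_all add: cf_sH cf_sP algebra_simps)
  qed
  show "sH (sQ \<theta> n v) = sQ \<theta> n (sH v) - sQ \<theta> n v"
  proof (rule cf_eqI)
    fix a b show "cf (sH (sQ \<theta> n v)) a b = cf (sQ \<theta> n (sH v) - sQ \<theta> n v) a b"
      by (cases a; cases b) (simp_all add: cf_sH cf_sQ algebra_simps)
  qed
  show "sF (sP \<theta> n v) = sP \<theta> n (sF v) + sQ \<theta> n v"
  proof (rule cf_eqI)
    fix a b show "cf (sF (sP \<theta> n v)) a b = cf (sP \<theta> n (sF v) + sQ \<theta> n v) a b"
      by (cases a; cases b) (simp_all add: cf_sF cf_sP cf_sQ algebra_simps)
  qed
  show "sF (sQ \<theta> n v) = sQ \<theta> n (sF v)"
  proof (rule cf_eqI)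
    fix a b show "cf (sF (sQ \<theta> n v)) a b = cf (sQ \<theta> n (sF v)) a b"
      by (cases a; cases b) (simp_all add: cf_sF cf_sQ algebra_simps)
  qed
  assume v: "v \<in> HK {n..}"
  show "sP \<theta> n (sQ \<theta> n v) = sQ \<theta> n (sP \<theta> n v) + vscale \<theta> v"
  proof (rule cf_eqI)
    fix a b
    show "cf (sP \<theta> n (sQ \<theta> n v)) a b = cf (sQ \<theta> n (sP \<theta> n v) + vscale \<theta> v) a b"
    proof (cases "a + b < n")
      case True
      have "sP \<theta> n (sQ \<theta> n v) \<in> HK {n..}" "sQ \<theta> n (sP \<theta> n v) + vscale \<theta> v \<in> HK {n..}"
        using v by (auto intro!: sPQ_closed vec.subspace_add vec.subspace_scale subspace_HK)
      then show ?thesis using True by (auto simp: HK_def)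
    next
      case False
      \<comment> \<open>In degree \<open>k = a + b\<close> the commutator multiplies by
        \<open>(k + 2) \<gamma>_(k+1) - k \<gamma>_k\<close>, which the recursion evaluates to
        \<theta>.\<close>
      then have "(of_nat (a + b + 2) * \<gamma> \<theta> n (a + b + 1) - of_nat (a + b) * \<gamma> \<theta> n (a + b)) * cf v a b = \<theta> * cf v a b"
        using \<gamma>_rec[of n "a + b" \<theta>] by simp
      then show ?thesis by (cases a; cases b) (simp_all add: cf_sP cf_sQ algebra_simps)
    qed
  qed
qed (auto simp: lin_sP lin_sQ subspace_HK sPQ_closed HK_closed)

fun schract :: "complex \<Rightarrow> nat \<Rightarrow> schr \<Rightarrow> vec \<Rightarrow> vec" where
  "schract \<theta> n SE = sE" | "schract \<theta> n SF = sF" | "schract \<theta> n SH = sH"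
| "schract \<theta> n SP = sP \<theta> n" | "schract \<theta> n SQ = sQ \<theta> n" | "schract \<theta> n SZ = vscale \<theta>"

definition Vc :: "complex \<Rightarrow> nat \<Rightarrow> schr vobj" where
  "Vc \<theta> n = vmod (HK {n..}) (schract \<theta> n)"

lemma Vc_simps [simp]: "carr (Vc \<theta> n) = HK {n..}" "act (Vc \<theta> n) = schract \<theta> n"
  by (simp_all add: Vc_def)

lemma lin_schract: "lin (schract \<theta> n b)"
  by (cases b) (auto simp: lin_sE lin_sF lin_sH lin_sP lin_sQ vec.scale_right_distrib mult.commute intro!: linI)

lemma HK_schract: "v \<in> HK {n..} \<Longrightarrow> schract \<theta> n b v \<in> HK {n..}"
  by (cases b) (auto simp: HK_closed sPQ_closed intro: vec.subspace_scale[OF subspace_HK])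

lemma Vc_vmod: "is_vmod schr_br (Vc \<theta> n)"
proof -
  interpret schr_ops sE sF sH "sP \<theta> n" "sQ \<theta> n" "HK {n..}" \<theta> by (rule schr_ops_s)
  show ?thesis unfolding Vc_def
  proof (rule is_vmodI)
    fix x y v assume v: "v \<in> HK {n..}"
    note r = ef he hf eq ep hp hq fp fq pq[OF v]
    show "schract \<theta> n x (schract \<theta> n y v) = schract \<theta> n y (schract \<theta> n x v) + lc (schract \<theta> n) (schr_br x y) v"
      by (cases x; cases y) (simp_all add: lc_def r lins pqlins)
  qed (auto simp: subspace_HK HK_schract lin_imp_linon lin_schract)
qed

lemma schr_ops_total:
  assumes N: "is_vmod schr_br N" and z: "\<And>v. v \<in> carr N \<Longrightarrow> act N SZ v = vscale \<theta> v"
    and T: "\<And>b. lin (T b)" "\<And>b v. T b v \<in> carr N" "\<And>b v. v \<in> carr N \<Longrightarrow> T b v = act N b v"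
    "\<And>x y v. T x (T y v) = T y (T x v) + lc T (schr_br x y) v"
  shows "schr_ops (T SE) (T SF) (T SH) (T SP) (T SQ) (carr N) \<theta>"
proof (intro schr_ops.intro sl2_ops.intro schr_ops_axioms.intro)
  show "lin (T SE)" "lin (T SF)" "lin (T SH)" "lin (T SP)" "lin (T SQ)" by (rule T(1))+
  show "vec.subspace (carr N)" by (rule vmod_subspace[OF N])
  fix v
  show "T SE (T SF v) = T SF (T SE v) + T SH v" "T SH (T SE v) = T SE (T SH v) + vscale 2 (T SE v)"
    "T SH (T SF v) = T SF (T SH v) - vscale 2 (T SF v)"
    "T SE (T SQ v) = T SQ (T SE v) + T SP v" "T SE (T SP v) = T SP (T SE v)"
    "T SH (T SP v) = T SP (T SH v) + T SP v" "T SH (T SQ v) = T SQ (T SH v) - T SQ v"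
    "T SF (T SP v) = T SP (T SF v) + T SQ v" "T SF (T SQ v) = T SQ (T SF v)"
    using T(4)[of SE SF v] T(4)[of SH SE v] T(4)[of SH SF v] T(4)[of SE SQ v] T(4)[of SE SP v]
      T(4)[of SH SP v] T(4)[of SH SQ v] T(4)[of SF SP v] T(4)[of SF SQ v] by (simp_all add: lc_def)
  assume v: "v \<in> carr N"
  show "T SP v \<in> carr N" "T SF v \<in> carr N" by (rule T(2))+
  show "T SP (T SQ v) = T SQ (T SP v) + vscale \<theta> v"
    using T(4)[of SP SQ v] T(3)[OF v, of SZ] z[OF v] by (simp add: lc_def)
qed

text \<open>The condition on \<open>v\<close> that characterises homomorphisms \<open>V(n,\<theta>) \<rightarrow> N\<close> sending \<open>x\<^sup>n\<close> to \<open>v\<close>: a highest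
  weight vector of weight \<open>n\<close> killed by the lowering operator \<open>(n + 1) q - f p\<close>.\<close>

definition Qs :: "nat \<Rightarrow> schr vobj \<Rightarrow> vec \<Rightarrow> bool" where
  "Qs n N v \<longleftrightarrow> act N SE v = 0 \<and> act N SH v = vscale (of_nat n) v \<and>
     vscale (of_nat (n + 1)) (act N SQ v) = act N SF (act N SP v) \<and> (\<exists>k. (act N SF ^^ k) v = 0)"

section \<open>Universal property of V(n,\<theta>)\<close>

context schr_ops
begin

context
  fixes n :: nat and v :: vec
  assumes vV: "v \<in> V" and ev0: "e v = 0" and hv: "h v = vscale (of_nat n) v"
    and Dv: "vscale (of_nat (n + 1)) (q v) = f (p v)" and fv: "(f ^^ Suc n) v = 0"
begin

lemma u_in: "(p ^^ j) v \<in> V"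
  using pV vV by (rule funpow_in)

lemma u_highest: "e ((p ^^ j) v) = 0"
  by (induction j) (simp_all add: ev0 ep pqlins)

lemma u_weight: "h ((p ^^ j) v) = vscale (of_nat (n + j)) ((p ^^ j) v)"
  by (induction j) (simp_all add: hv hp pqlins vec.scale_left_distrib)

text \<open>With \<open>w = (p ^^ j) v\<close> and \<open>b = n + j + 2\<close>,
  \<open>fp_pow\<close> writes \<open>(f ^^ b) (p w)\<close> as \<open>p\<close> of
  \<open>(f ^^ b) w\<close> plus a multiple of \<open>q\<close> of \<open>(f ^^ (b - 1)) w\<close>,
  and both vanish by induction.\<close>

lemma u_f_pow: "(f ^^ Suc (n + j)) ((p ^^ j) v) = 0"
proof (induction j)
  case 0 show ?case using fv by simp
next
  case (Suc j)
  have "(f ^^ Suc (Suc (n + j))) ((p ^^ j) v) = 0" using Suc by (simp add: lins)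
  then show ?case using Suc fp_pow[of "Suc (Suc (n + j))" "(p ^^ j) v"] by (simp add: pqlins del: funpow.simps) (simp add: pqlins)
qed

text \<open>The counterpart of \<open>(k + 1) q x^k = f p x^k - k (k + 1) \<gamma>_k x^(k-1)\<close>
  in the polynomial model, with \<open>k = n + j\<close>. The induction combines \<open>pq\<close>
  with the recursion for \<gamma>. At \<open>j = 0\<close> the truncated exponent does no harm,
  since the coefficient contains \<open>n \<gamma>_n = 0\<close>.\<close>

lemma u_q: "vscale (of_nat (n + j + 1)) (q ((p ^^ j) v)) =
    f ((p ^^ Suc j) v) - vscale (of_nat (n + j) * of_nat (n + j + 1) * \<gamma> \<theta> n (n + j)) ((p ^^ (j - 1)) v)"
proof (induction j)
  case 0 then show ?case using Dv \<gamma>_n[of n \<theta>] by (simp add: mult.commute[of "of_nat n"] mult.assoc)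
next
  case (Suc j)
  let ?w = "(p ^^ j) v" and ?k = "n + j"
  have c0: "vscale (of_nat ?k * of_nat (?k + 1) * \<gamma> \<theta> n ?k) (p ((p ^^ (j - 1)) v)) =
      vscale (of_nat ?k * of_nat (?k + 1) * \<gamma> \<theta> n ?k) ?w"
    using \<gamma>_n[of n \<theta>] by (cases j) (simp_all add: mult.commute[of "of_nat n"] mult.assoc)
  have "vscale (of_nat (?k + 1)) (p (q ?w)) = p (f (p ?w)) - vscale (of_nat ?k * of_nat (?k + 1) * \<gamma> \<theta> n ?k) ?w"
    using arg_cong[OF Suc.IH, of p] c0 by (simp add: pqlins)
  moreover have "p (q ?w) = q (p ?w) + vscale \<theta> ?w" by (rule pq[OF u_in])
  moreover have "p (f (p ?w)) = f (p (p ?w)) - q (p ?w)" using fp[of "p ?w"] by simp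
  ultimately have e1: "vscale (of_nat (?k + 1)) (q (p ?w) + vscale \<theta> ?w) =
      f (p (p ?w)) - q (p ?w) - vscale (of_nat ?k * of_nat (?k + 1) * \<gamma> \<theta> n ?k) ?w" by simp
  have g: "of_nat (?k + 1) * of_nat (?k + 2) * \<gamma> \<theta> n (?k + 1) = of_nat (?k + 1) * \<theta> + of_nat ?k * of_nat (?k + 1) * \<gamma> \<theta> n ?k"
  proof -
    have "of_nat (?k + 2) * \<gamma> \<theta> n (?k + 1) = \<theta> + of_nat ?k * \<gamma> \<theta> n ?k" using \<gamma>_rec[of n ?k \<theta>] by (simp add: algebra_simps)
    then have "of_nat (?k + 1) * (of_nat (?k + 2) * \<gamma> \<theta> n (?k + 1)) = of_nat (?k + 1) * (\<theta> + of_nat ?k * \<gamma> \<theta> n ?k)" by simp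
    then show ?thesis by (simp only: distrib_left ac_simps)
  qed
  have "vscale (of_nat (?k + 2)) (q (p ?w)) = vscale (of_nat (?k + 1)) (q (p ?w) + vscale \<theta> ?w) + q (p ?w) - vscale (of_nat (?k + 1) * \<theta>) ?w"
    by (rule poly_mapping_eqI, simp only: lookup_add lookup_minus lookup_vscale) (simp add: algebra_simps)
  also have "\<dots> = f (p (p ?w)) - vscale (of_nat (?k + 1) * of_nat (?k + 2) * \<gamma> \<theta> n (?k + 1)) ?w"
    unfolding e1 g by (simp add: vec.scale_left_distrib)
  finally show ?case by (simp add: add.commute add.left_commute)
qed

text \<open>Forced by the model, where x^k is \<open>p ^^ (k - n)\<close> applied to x^n, and
  \<open>f ^^ b\<close> takes x^(a+b) to \<open>(a + b)! / a!\<close> times x^a y^b.\<close>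

definition \<Phi> :: "vec \<Rightarrow> vec" where
  "\<Phi> = lext2 (\<lambda>a b. vscale (fact a / fact (a + b)) ((f ^^ b) ((p ^^ (a + b - n)) v)))"

lemma lin_\<Phi>: "lin \<Phi>"
  by (simp add: \<Phi>_def lin_lext2)

lemma \<Phi>_mon: "\<Phi> (mon a b) = vscale (fact a / fact (a + b)) ((f ^^ b) ((p ^^ (a + b - n)) v))"
  by (simp add: \<Phi>_def)

text \<open>On a single degree \<Phi> is the map belonging to one highest weight vector, so
  compatibility with sl2 is already known.\<close>

lemma \<Phi>_hw_map: "u \<in> HK {k} \<Longrightarrow> \<Phi> u = hw_map f ((p ^^ (k - n)) v) u"
  by (rule HK_ext[OF lin_imp_linon[OF lin_\<Phi>] lin_imp_linon[OF lin_hw_map]]) (auto simp: \<Phi>_mon hw_map_mon)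

lemma \<Phi>_sl2:
  assumes "a + b \<ge> n"
  shows "\<Phi> (sE (mon a b)) = e (\<Phi> (mon a b))" "\<Phi> (sF (mon a b)) = f (\<Phi> (mon a b))" "\<Phi> (sH (mon a b)) = h (\<Phi> (mon a b))"
proof -
  let ?k = "a + b"
  have m: "mon a b \<in> HK {?k}" by simp
  have k: "n + (?k - n) = ?k" using assms by simp
  note w = hw_map_intertwines[OF u_highest u_weight[of "?k - n", unfolded k] u_f_pow[of "?k - n", unfolded k] m]
  show "\<Phi> (sE (mon a b)) = e (\<Phi> (mon a b))" "\<Phi> (sF (mon a b)) = f (\<Phi> (mon a b))" "\<Phi> (sH (mon a b)) = h (\<Phi> (mon a b))"
    using w \<Phi>_hw_map[OF m] \<Phi>_hw_map[OF HK_closed(1)[OF m]] \<Phi>_hw_map[OF HK_closed(2)[OF m]] \<Phi>_hw_map[OF HK_closed(3)[OF m]]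
    by simp_all
qed

lemma q_\<Phi>_aux:
  assumes k: "k = n + j"
  shows "(f ^^ b) (q ((p ^^ j) v)) = vscale (1 / of_nat (k + 1)) ((f ^^ Suc b) ((p ^^ Suc j) v)) -
    vscale (of_nat k * \<gamma> \<theta> n k) ((f ^^ b) ((p ^^ (j - 1)) v))"
proof -
  have nz: "(of_nat (k + 1) :: complex) \<noteq> 0" by (simp only: of_nat_eq_0_iff)
  note l = lin_scale[OF lin_funpow[OF lin_f]] lin_diff[OF lin_funpow[OF lin_f]]
  have "vscale (of_nat (k + 1)) ((f ^^ b) (q ((p ^^ j) v))) =
    (f ^^ Suc b) ((p ^^ Suc j) v) - vscale (of_nat k * of_nat (k + 1) * \<gamma> \<theta> n k) ((f ^^ b) ((p ^^ (j - 1)) v))"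
    using arg_cong[OF u_q[of j], of "f ^^ b"] by (simp only: l k funpow_Suc_right o_apply)
  then have "vscale (1 / of_nat (k + 1)) (vscale (of_nat (k + 1)) ((f ^^ b) (q ((p ^^ j) v)))) =
    vscale (1 / of_nat (k + 1)) ((f ^^ Suc b) ((p ^^ Suc j) v)) -
    vscale (1 / of_nat (k + 1) * (of_nat k * of_nat (k + 1) * \<gamma> \<theta> n k)) ((f ^^ b) ((p ^^ (j - 1)) v))"
    by (simp only: vec.scale_right_diff_distrib vec.scale_scale)
  moreover have "1 / of_nat (k + 1) * (of_nat k * of_nat (k + 1) * \<gamma> \<theta> n k) = of_nat k * \<gamma> \<theta> n k"
    using nz by (simp del: of_nat_add of_nat_Suc)
  moreover have "1 / of_nat (k + 1) * of_nat (k + 1) = (1 :: complex)" using nz by (simp del: of_nat_add of_nat_Suc)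
  ultimately show ?thesis by (simp only: vec.scale_scale vec.scale_one)
qed

lemma \<Phi>_Q:
  assumes n: "a + b \<ge> n" shows "\<Phi> (sQ \<theta> n (mon a b)) = q (\<Phi> (mon a b))"
proof -
  define j where "j = a + b - n"
  have k: "a + b = n + j" using n by (simp add: j_def)
  have "q (\<Phi> (mon a b)) = vscale (fact a / fact (a + b)) ((f ^^ b) (q ((p ^^ j) v)))"
    by (simp add: \<Phi>_mon pqlins fq_pow j_def)
  also have "\<dots> = vscale (fact a / fact (a + b + 1)) ((f ^^ Suc b) ((p ^^ Suc j) v)) -
      vscale (fact a / fact (a + b) * (of_nat (a + b) * \<gamma> \<theta> n (a + b))) ((f ^^ b) ((p ^^ (j - 1)) v))"
    unfolding q_\<Phi>_aux[OF k] by (simp add: vec.scale_right_diff_distrib mult.commute del: funpow.simps of_nat_add)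
  also have "vscale (fact a / fact (a + b + 1)) ((f ^^ Suc b) ((p ^^ Suc j) v)) = \<Phi> (mon a (b + 1))"
  proof -
    have "a + (b + 1) - n = Suc j" using k by simp
    then show ?thesis by (simp add: \<Phi>_mon del: funpow.simps)
  qed
  also have "vscale (fact a / fact (a + b) * (of_nat (a + b) * \<gamma> \<theta> n (a + b))) ((f ^^ b) ((p ^^ (j - 1)) v)) =
      vscale (\<gamma> \<theta> n (a + b) * of_nat a) (\<Phi> (mon (a - 1) b))"
  proof (cases a)
    case 0
    \<comment> \<open>The other side vanishes because of its factor \<open>a\<close>. Here either
      \<open>j = 0\<close> and \<open>n \<gamma>_n = 0\<close>, or \<open>b = n + j\<close> exceeds
      the weight of \<open>(p ^^ (j - 1)) v\<close>, which \<open>f ^^ b\<close> then kills.\<close>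
    have "of_nat b * \<gamma> \<theta> n b = 0 \<or> (f ^^ b) ((p ^^ (j - 1)) v) = 0"
    proof (cases j)
      case 0 then show ?thesis using k \<open>a = 0\<close> \<gamma>_n[of n \<theta>] by simp
    next
      case (Suc i)
      then have "b = Suc (n + i)" using k \<open>a = 0\<close> by simp
      then show ?thesis using u_f_pow[of i] Suc by simp
    qed
    then show ?thesis using 0 by auto
  next
    case (Suc c)
    have e: "a - 1 + b - n = j - 1" using k Suc by simp
    have "fact a / fact (a + b) * (of_nat (a + b) * \<gamma> \<theta> n (a + b)) = \<gamma> \<theta> n (a + b) * of_nat a * (fact (a - 1) / fact (a - 1 + b))"
      using Suc by (simp del: of_nat_Suc of_nat_add)
    then show ?thesis unfolding \<Phi>_mon e by (simp del: of_nat_add)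
  qed
  finally show ?thesis by (simp add: sQ_mon lin_diff[OF lin_\<Phi>] lin_scale[OF lin_\<Phi>])
qed

lemma \<Phi>_P:
  assumes n: "a + b \<ge> n" shows "\<Phi> (sP \<theta> n (mon a b)) = p (\<Phi> (mon a b))"
proof -
  define j where "j = a + b - n"
  have k: "a + b = n + j" using n by (simp add: j_def)
  have e1: "a + 1 + b - n = Suc j" using k by simp
  have "p (\<Phi> (mon a b)) = vscale (fact a / fact (a + b)) (p ((f ^^ b) ((p ^^ j) v)))"
    by (simp add: \<Phi>_mon pqlins j_def)
  \<comment> \<open>Moving \<open>p\<close> past \<open>f ^^ b\<close> costs a term with
    \<open>q\<close>, which \<open>q_\<Phi>_aux\<close> expresses through the neighbouring
    degrees.\<close>
  also have "p ((f ^^ b) ((p ^^ j) v)) = (f ^^ b) ((p ^^ Suc j) v) - vscale (of_nat b) ((f ^^ (b - 1)) (q ((p ^^ j) v)))"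
    using fp_pow[of b "(p ^^ j) v"] by (simp add: fq_pow)
  finally have 1: "p (\<Phi> (mon a b)) = vscale (fact a / fact (a + b))
      ((f ^^ b) ((p ^^ Suc j) v) - vscale (of_nat b) ((f ^^ (b - 1)) (q ((p ^^ j) v))))" .
  show ?thesis
  proof (cases b)
    case 0
    then show ?thesis using 1 e1 by (simp add: sP_mon \<Phi>_mon del: fact_Suc)
  next
    case (Suc c)
    let ?k = "a + b"
    have nz: "(of_nat (?k + 1) :: complex) \<noteq> 0" by (simp only: of_nat_eq_0_iff)
    have e2: "a + c - n = j - 1" using k Suc by simp
    \<comment> \<open>The two contributions to degree \<open>k + 1\<close> combine by
      \<open>1 - b / (k + 1) = (a + 1) / (k + 1)\<close>, where \<open>k = a + b\<close>.\<close>
    have "fact a / fact ?k - fact a / fact ?k * (of_nat b * (1 / of_nat (?k + 1))) = (fact (a + 1) / fact (?k + 1) :: complex)"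
      (is "?c1 = ?c2")
    proof -
      have A: "of_nat (a + 1) = (of_nat (?k + 1) - of_nat b :: complex)" by simp
      have f: "fact (a + 1) = of_nat (a + 1) * (fact a :: complex)" "fact (?k + 1) = of_nat (?k + 1) * (fact ?k :: complex)"
        by (simp_all only: Suc_eq_plus1[symmetric] fact_Suc)
      have *: "x / y - x / y * (t * (1 / s)) = (s - t) * x / (s * y)" if "s \<noteq> 0" "y \<noteq> 0" for x y s t :: complex
        using that by (simp add: field_simps)
      show ?thesis unfolding f A using nz by (intro *) simp_all
    qed
    moreover have "fact a / fact ?k * (of_nat b * (of_nat ?k * \<gamma> \<theta> n ?k)) = \<gamma> \<theta> n ?k * of_nat b * (fact a / fact (a + c))"
      using Suc by (simp del: of_nat_Suc of_nat_add)
    moreover have "p (\<Phi> (mon a b)) = vscale (fact a / fact ?k - fact a / fact ?k * (of_nat b * (1 / of_nat (?k + 1)))) ((f ^^ b) ((p ^^ Suc j) v)) +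
       vscale (fact a / fact ?k * (of_nat b * (of_nat ?k * \<gamma> \<theta> n ?k))) ((f ^^ c) ((p ^^ (j - 1)) v))"
      unfolding 1 using Suc
      by (simp only: diff_Suc_1 q_\<Phi>_aux[OF k] vec.scale_right_diff_distrib vec.scale_scale vec.scale_left_diff_distrib)
        (simp add: algebra_simps del: funpow.simps of_nat_Suc of_nat_add)
    ultimately have "p (\<Phi> (mon a b)) = vscale (fact (a + 1) / fact (?k + 1)) ((f ^^ b) ((p ^^ Suc j) v)) +
       vscale (\<gamma> \<theta> n ?k * of_nat b * (fact a / fact (a + c))) ((f ^^ c) ((p ^^ (j - 1)) v))" by (simp only:)
    also have "\<dots> = \<Phi> (mon (a + 1) b) + vscale (\<gamma> \<theta> n ?k * of_nat b) (\<Phi> (mon a c))"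
      unfolding \<Phi>_mon e1 e2 by (simp del: funpow.simps of_nat_Suc of_nat_add fact_Suc)
    finally show ?thesis using Suc by (simp add: sP_mon lin_add[OF lin_\<Phi>] lin_scale[OF lin_\<Phi>] del: of_nat_Suc of_nat_add)
  qed
qed

lemma \<Phi>_in: "\<Phi> u \<in> V"
  unfolding \<Phi>_def lext2_def lext_def
  by (intro vec.subspace_sum[OF subV] vec.subspace_scale[OF subV] funpow_in[of V f, OF fV] u_in)

lemma \<Phi>_start: "\<Phi> (mon n 0) = v"
  by (simp add: \<Phi>_mon)

lemmas \<Phi>_facts = lin_\<Phi> \<Phi>_in \<Phi>_start \<Phi>_sl2 \<Phi>_P \<Phi>_Q

end

end

text \<open>The action on \<open>N\<close> is first made total. Then \<open>f_pow_highest\<close>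
  sharpens the nilpotency contained in \<open>Qs\<close> to \<open>(f ^^ Suc n) v = 0\<close>, the
  form in which \<Phi> requires it.\<close>

lemma Vc_universal:
  assumes N: "is_vmod schr_br N" and z: "\<And>v. v \<in> carr N \<Longrightarrow> act N SZ v = vscale \<theta> v"
    and v: "v \<in> carr N" and Q: "Qs n N v"
  obtains \<phi> where "lmod_hom (Vc \<theta> n) N \<phi>" "\<phi> (mon n 0) = v"
proof -
  obtain T where T: "\<And>b. lin (T b)" "\<And>b v. T b v \<in> carr N" "\<And>b v. v \<in> carr N \<Longrightarrow> T b v = act N b v"
    "\<And>x y v. T x (T y v) = T y (T x v) + lc T (schr_br x y) v" by (rule total_action[OF N]) (rule that)
  interpret schr_ops "T SE" "T SF" "T SH" "T SP" "T SQ" "carr N" \<theta> by (rule schr_ops_total[OF N z T])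
  have T2: "T SF (T SP v) = act N SF (act N SP v)" using T(3)[OF T(2), of SF SP v] T(3)[OF v, of SP] by metis
  have Tk: "(T SF ^^ k) v = (act N SF ^^ k) v \<and> (T SF ^^ k) v \<in> carr N" for k
  proof (induction k)
    case (Suc k)
    then have "T SF ((T SF ^^ k) v) = act N SF ((act N SF ^^ k) v)" using T(3) by metis
    then show ?case using T(2)[of SF "(T SF ^^ k) v"] by simp
  qed (simp add: v)
  obtain k where k: "(T SF ^^ k) v = 0" using Q Tk unfolding Qs_def by metis
  have ev: "T SE v = 0" and hv: "T SH v = vscale (of_nat n) v" and D: "vscale (of_nat (n + 1)) (T SQ v) = T SF (T SP v)"
    using Q T2 T(3)[OF v] unfolding Qs_def by simp_all
  note F = \<Phi>_facts[OF v ev hv D f_pow_highest[OF ev hv k]]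
  let ?F = "\<Phi> n v"
  have act: "?F (schract \<theta> n b u) = T b (?F u)" if u: "u \<in> HK {n..}" for b u
  proof (rule HK_ext[OF lin_imp_linon[OF lin_compose[OF lin_schract F(1)]] lin_imp_linon[OF lin_compose[OF F(1) T(1)]] _ u])
    fix a c :: nat assume "a + c \<in> {n..}"
    then have n: "n \<le> a + c" by simp
    show "?F (schract \<theta> n b (mon a c)) = T b (?F (mon a c))"
    proof (cases b)
      case SZ
      have "T SZ (?F (mon a c)) = vscale \<theta> (?F (mon a c))" using T(3)[OF F(2)] z[OF F(2)] by simp
      then show ?thesis using SZ by (simp add: lin_scale[OF F(1)])
    qed (simp_all add: F(4-8)[OF n])
  qed
  have "lmod_hom (Vc \<theta> n) N ?F"
    using act T(3)[OF F(2)] by (intro lmod_homI[OF Vc_vmod N lin_imp_linon[OF F(1)] F(2)]) simp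
  then show thesis using that F(3) by blast
qed

lemma lp_in:
  assumes "vec.subspace W" "\<And>v. v \<in> W \<Longrightarrow> T v \<in> W" shows "v \<in> W \<Longrightarrow> lp T ms v \<in> W"
proof (induction ms arbitrary: v)
  case (Cons \<mu> ms)
  have "sh T \<mu> v \<in> W" unfolding sh_def
    by (rule vec.subspace_diff[OF assms(1) assms(2)[OF Cons.prems] vec.subspace_scale[OF assms(1) Cons.prems]])
  then show ?case unfolding lp_Cons by (rule Cons.IH)
qed simp

lemma cf_lp_sH: "cf (lp sH ms v) a b = (\<Prod>\<mu>\<leftarrow>ms. of_nat a - of_nat b - \<mu>) * cf v a b"
  by (induction ms arbitrary: v) (simp_all add: lp_Cons sh_def cf_sH algebra_simps)

text \<open>Projecting a highest weight vector to one of its weights by a polynomial in \<open>h\<close>.\<close>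

lemma isolate_weight:
  assumes W: "vec.subspace W" "\<And>v. v \<in> W \<Longrightarrow> sH v \<in> W" and w: "w \<in> W" "w \<noteq> 0" "sE w = 0"
  obtains k where "mon k 0 \<in> W" "cf w k 0 \<noteq> 0"
proof -
  obtain k b where kb: "cf w k b \<noteq> 0"
    using w(2) cf_eqI[of w 0] by auto
  then have k: "cf w k 0 \<noteq> 0" using ker_sE[OF w(3), of b k] by (cases "b = 0") auto
  have "{j. cf w j 0 \<noteq> 0} \<subseteq> (\<lambda>n. fst (prod_decode n)) ` Poly_Mapping.keys w"
  proof
    fix j assume "j \<in> {j. cf w j 0 \<noteq> 0}"
    then have "prod_encode (j, 0) \<in> Poly_Mapping.keys w" by (simp add: cf_def in_keys_iff)
    then have "fst (prod_decode (prod_encode (j, 0))) \<in> (\<lambda>n. fst (prod_decode n)) ` Poly_Mapping.keys w" by (rule imageI)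
    then show "j \<in> (\<lambda>n. fst (prod_decode n)) ` Poly_Mapping.keys w" by simp
  qed
  then have "finite ({j. cf w j 0 \<noteq> 0} - {k})"
    by (rule finite_Diff[OF finite_subset[OF _ finite_imageI[OF finite_keys]]])
  from finite_list[OF this] obtain ks where ks: "set ks = {j. cf w j 0 \<noteq> 0} - {k}" by (elim exE)
  let ?ms = "map of_nat ks :: complex list"
  let ?c = "(\<Prod>\<mu>\<leftarrow>?ms. of_nat k - \<mu>) * cf w k 0"
  have "lp sH ?ms w = vscale ?c (mon k 0)"
  proof (rule cf_eqI)
    fix a b
    have a: "(\<Prod>\<mu>\<leftarrow>?ms. of_nat a - \<mu>) = 0" if "a \<noteq> k" "cf w a 0 \<noteq> 0"
    proof -
      have "a \<in> set ks" using that ks by simp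
      then show ?thesis by (auto simp: prod_list_zero_iff)
    qed
    show "cf (lp sH ?ms w) a b = cf (vscale ?c (mon k 0)) a b"
    proof (cases "b = 0")
      case True
      then show ?thesis using a by (cases "a = k"; cases "cf w a 0 = 0") (simp_all add: cf_lp_sH)
    qed (use ker_sE[OF w(3), of b a] in \<open>simp add: cf_lp_sH\<close>)
  qed
  moreover have "lp sH ?ms w \<in> W" by (rule lp_in[where T = sH, OF W(1) _ w(1)]) (rule W(2))
  moreover have "(\<Prod>\<mu>\<leftarrow>?ms. of_nat k - \<mu>) \<noteq> 0"
  proof -
    have "k \<notin> set ks" using ks by simp
    then show ?thesis by (auto simp: prod_list_zero_iff)
  qed
  ultimately have "vscale ?c (mon k 0) \<in> W" "?c \<noteq> 0" using k by (metis, metis mult_eq_0_iff)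
  then have "mon k 0 \<in> W" using vec.subspace_scale[OF W(1), of "vscale ?c (mon k 0)" "1 / ?c"] by simp
  then show thesis using k by (rule that)
qed

section \<open>Simplicity of V(n,\<theta>) and homomorphisms between different n\<close>

lemma mon_nonzero: "mon a b \<noteq> 0"
  using cf_mon[of a b a b] by (metis cf_simps(4) zero_neq_one)

text \<open>\<open>p\<close> takes x^k to x^(k+1), and \<open>f\<close> fills up each degree from
  x^k.\<close>

lemma Vc_cyclic:
  assumes W: "submodule W (Vc \<theta> n)" and w: "mon n 0 \<in> W" shows "W = carr (Vc \<theta> n)"
proof -
  have W': "vec.subspace W" "W \<subseteq> HK {n..}" "\<And>b v. v \<in> W \<Longrightarrow> schract \<theta> n b v \<in> W"
    using W by (auto simp: submodule_iff[OF Vc_vmod])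
  have 1: "mon k 0 \<in> W" if "k \<ge> n" for k using that
  proof (induction k rule: dec_induct)
    case (step k)
    then show ?case using W'(3)[of "mon k 0" SP] by (simp add: sP_mon)
  qed (rule w)
  have 2: "mon a b \<in> W" if "a + b \<ge> n" for a b using that
  proof (induction b arbitrary: a)
    case (Suc b)
    then have "mon (Suc a) b \<in> W" by simp
    then have "vscale (1 / of_nat (Suc a)) (sF (mon (Suc a) b)) \<in> W"
      using W'(3)[of _ SF] W'(1) by (auto intro: vec.subspace_scale)
    then show ?case by (simp add: s_mon del: of_nat_Suc)
  qed (use 1 in simp)
  have "HK {n..} \<subseteq> W" unfolding HK_span by (rule vec.span_minimal[OF _ W'(1)]) (use 2 in auto)
  then show ?thesis using W'(2) by auto
qed

text \<open>A nonzero submodule contains some x^k. The operator \<open>(k + 1) q - f p\<close> sends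
  x^k to \<open>- k (k + 1) \<gamma>_k\<close> times x^(k-1), and this scalar is nonzero as long as
  \<open>k > n\<close>, so x^n is reached.\<close>

lemma Vc_contains_lowest:
  assumes \<theta>: "\<theta> \<noteq> 0" and W: "submodule W (Vc \<theta> n)" and ne: "W \<noteq> {0}" shows "mon n 0 \<in> W"
proof -
  have W': "vec.subspace W" "W \<subseteq> HK {n..}" "\<And>b v. v \<in> W \<Longrightarrow> schract \<theta> n b v \<in> W"
    using W by (auto simp: submodule_iff[OF Vc_vmod])
  obtain v where "v \<in> W" "v \<noteq> 0" using ne vec.subspace_0[OF W'(1)] by auto
  then obtain w where w: "w \<in> W" "w \<noteq> 0" "sE w = 0" using sE_kernel_vector[of v W] W'(3)[of _ SE] by auto
  obtain k where k: "mon k 0 \<in> W" using isolate_weight[OF W'(1) _ w] W'(3)[of _ SH] by auto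
  then have "mon k 0 \<in> HK {n..}" using W'(2) by blast
  then have "k \<ge> n" by simp
  then show ?thesis using k
  proof (induction k rule: dec_induct)
    case (step k)
    let ?c = "of_nat (k + 2) * (\<gamma> \<theta> n (k + 1) * of_nat (k + 1))"
    have "vscale (of_nat (k + 2)) (sQ \<theta> n (mon (k + 1) 0)) - sF (sP \<theta> n (mon (k + 1) 0)) \<in> W"
      using step.prems W'(3)[of _ SQ] W'(3)[of _ SF] W'(3)[of _ SP] W'(1)
      by (auto intro!: vec.subspace_diff vec.subspace_scale)
    also have "vscale (of_nat (k + 2)) (sQ \<theta> n (mon (k + 1) 0)) - sF (sP \<theta> n (mon (k + 1) 0)) = vscale (- ?c) (mon k 0)"
      by (simp add: sQ_mon sP_mon s_mon vec.scale_right_diff_distrib)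
    finally have "vscale (- 1 / ?c) (vscale (- ?c) (mon k 0)) \<in> W" by (rule vec.subspace_scale[OF W'(1)])
    moreover have "?c \<noteq> 0" using \<gamma>_nonzero[OF \<theta>, of n "k + 1"] step.hyps(1)
      by (simp del: of_nat_Suc of_nat_add)
    ultimately have "mon k 0 \<in> W" by simp
    then show ?case by (rule step.IH)
  qed simp
qed

lemma Qs_hom:
  assumes M: "is_vmod schr_br M" and N: "is_vmod schr_br N" and f: "lmod_hom M N f" and v: "v \<in> carr M" and Q: "Qs k M v"
  shows "Qs k N (f v)"
proof -
  note h = lmod_homD[OF f M N] and a = vmod_act[OF M]
  have f0: "f 0 = 0" by (rule linon_zero[OF h(1) vec.subspace_0[OF vmod_subspace[OF M]]])
  have p: "(act N SF ^^ j) (f v) = f ((act M SF ^^ j) v) \<and> (act M SF ^^ j) v \<in> carr M" for j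
    by (induction j) (simp_all add: v h(3) a)
  obtain j where "(act M SF ^^ j) v = 0" using Q by (auto simp: Qs_def)
  then have "(act N SF ^^ j) (f v) = 0" using p f0 by metis
  moreover have "act N SE (f v) = 0" "act N SH (f v) = vscale (of_nat k) (f v)"
    using Q h(3)[OF v, of SE] h(3)[OF v, of SH] f0 linon_scale[OF h(1) v] by (simp_all add: Qs_def)
  moreover have "vscale (of_nat (k + 1)) (act N SQ (f v)) = act N SF (act N SP (f v))"
    using arg_cong[of _ _ f, OF conjunct1[OF conjunct2[OF conjunct2[OF Q[unfolded Qs_def]]]]]
    by (simp add: linon_scale[OF h(1)] a v h(3))
  ultimately show ?thesis unfolding Qs_def by blast
qed

lemma sF_pow_mon: "(sF ^^ Suc a) (mon a b) = 0"
proof (induction a arbitrary: b)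
  case (Suc a)
  note l = lin_scale[OF lin_funpow[OF lin_sF]]
  have "(sF ^^ Suc (Suc a)) (mon (Suc a) b) = (sF ^^ Suc a) (sF (mon (Suc a) b))" by (simp only: funpow_Suc_right o_apply)
  also have "\<dots> = 0" unfolding s_mon l using Suc[of "b + 1"] by simp
  finally show ?case .
qed (simp add: s_mon)

lemma sF_pow_mon': "k > a \<Longrightarrow> (sF ^^ k) (mon a b) = 0"
proof -
  assume "k > a"
  then obtain d where "k = d + Suc a" using less_imp_Suc_add[of a k] by auto
  then have "(sF ^^ k) (mon a b) = (sF ^^ d) ((sF ^^ Suc a) (mon a b))" by (simp only: funpow_add o_apply)
  then show ?thesis by (simp only: sF_pow_mon lin_zero[OF lin_funpow[OF lin_sF]])
qed

lemma Qs_Vc_start: "Qs n (Vc \<theta> n) (mon n 0)"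
proof -
  have "\<exists>k. (sF ^^ k) (mon n 0) = 0" using sF_pow_mon by blast
  then show ?thesis using \<gamma>_n[of n \<theta>] unfolding Qs_def
    by (simp add: s_mon sP_mon sQ_mon mult.commute)
qed

text \<open>A vector killed by \<open>sE\<close> is a polynomial in x, and the weight
  \<open>m\<close> singles out x^m.\<close>

lemma Qs_Vc:
  assumes v: "v \<in> HK {n..}" and Q: "Qs m (Vc \<theta> n) v"
  shows "v = vscale (cf v m 0) (mon m 0)"
proof (rule cf_eqI)
  fix a b
  have E: "sE v = 0" and H: "sH v = vscale (of_nat m) v" using Q by (auto simp: Qs_def)
  have "of_nat m * cf v a b = (of_nat a - of_nat b) * cf v a b" using cf_sH[of v a b] H by simp
  then have h: "of_nat m = (of_nat a - of_nat b :: complex) \<or> cf v a b = 0" unfolding mult_cancel_right by blast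
  show "cf v a b = cf (vscale (cf v m 0) (mon m 0)) a b"
  proof (cases "b = 0")
    case True
    then have "m = a \<or> cf v a b = 0" using h by simp
    then show ?thesis using True by auto
  next
    case False
    then show ?thesis using ker_sE[OF E, of b a] by simp
  qed
qed

text \<open>For \<open>m < n\<close> the space contains no x^m. For \<open>m > n\<close> the third
  condition in \<open>Qs\<close> would need \<open>m (m + 1) \<gamma>_m = 0\<close>.\<close>

lemma Qs_Vc_zero:
  assumes \<theta>: "\<theta> \<noteq> 0" and mn: "m \<noteq> n" and v: "v \<in> HK {n..}" and Q: "Qs m (Vc \<theta> n) v"
  shows "v = 0"
proof -
  let ?c = "cf v m 0"
  note e = Qs_Vc[OF v Q]
  have "?c = 0"
  proof (cases "m < n")
    case True then show ?thesis using v by (auto simp: HK_def)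
  next
    case False
    then have mn: "m > n" using mn by simp
    have "vscale (of_nat (m + 1)) (sQ \<theta> n v) = sF (sP \<theta> n v)" using Q by (auto simp: Qs_def)
    then have "vscale (of_nat (m + 1)) (sQ \<theta> n (vscale ?c (mon m 0))) = sF (sP \<theta> n (vscale ?c (mon m 0)))"
      using e by metis
    then have "cf (vscale (of_nat (m + 1)) (sQ \<theta> n (vscale ?c (mon m 0)))) (m - 1) 0 = cf (sF (sP \<theta> n (vscale ?c (mon m 0)))) (m - 1) 0"
      by simp
    then have "of_nat (m + 1) * (?c * (\<gamma> \<theta> n m * of_nat m)) = 0"
      using mn by (simp add: lin_scale[OF lin_sQ] lin_scale[OF lin_sP] sQ_mon sP_mon s_mon s_lins del: of_nat_add of_nat_Suc)
    moreover have "(of_nat (m + 1) :: complex) \<noteq> 0" "(of_nat m :: complex) \<noteq> 0"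
      using mn unfolding of_nat_eq_0_iff by auto
    ultimately show ?thesis using \<gamma>_nonzero[OF \<theta> mn] by simp
  qed
  then show ?thesis using e by simp
qed

lemma Vc_simple_family: "\<theta> \<noteq> 0 \<Longrightarrow> simple_family schr_br (Vc \<theta>)"
proof (rule simple_familyI[where w = "\<lambda>n. mon n 0" and Q = Qs])
  assume \<theta>: "\<theta> \<noteq> 0"
  fix i j k :: nat and W f v
  show "is_vmod schr_br (Vc \<theta> i)" by (rule Vc_vmod)
  show "mon i 0 \<in> carr (Vc \<theta> i)" "mon i 0 \<noteq> 0" by (simp_all add: mon_nonzero)
  show "submodule W (Vc \<theta> i) \<Longrightarrow> mon i 0 \<in> W \<Longrightarrow> W = carr (Vc \<theta> i)" by (rule Vc_cyclic)
  show "submodule W (Vc \<theta> i) \<Longrightarrow> W \<noteq> {0} \<Longrightarrow> mon i 0 \<in> W" by (rule Vc_contains_lowest[OF \<theta>])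
  show "Qs i (Vc \<theta> i) (mon i 0)" by (rule Qs_Vc_start)
  show "lmod_hom (Vc \<theta> i) (Vc \<theta> j) f \<Longrightarrow> v \<in> carr (Vc \<theta> i) \<Longrightarrow> Qs k (Vc \<theta> i) v \<Longrightarrow> Qs k (Vc \<theta> j) (f v)"
    by (rule Qs_hom[OF Vc_vmod Vc_vmod])
  show "v = 0" if "i \<noteq> j" "v \<in> carr (Vc \<theta> j)" "Qs i (Vc \<theta> j) v"
    using Qs_Vc_zero[OF \<theta> that(1)] that by simp
  then show "\<exists>c. v = vscale c (mon j 0)" if "v \<in> carr (Vc \<theta> j)" "Qs i (Vc \<theta> j) v"
    using Qs_Vc[of v j i \<theta>] that by (cases "i = j") (auto intro: exI[of _ 0])
qed

section \<open>Pulling back along the projection onto sl2 and the inclusion of sl2\<close>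

lemma act_pullback:
  assumes "vops A" shows "act (pullback \<phi> A) b = lc (act A) (\<phi> b)"
  using lincomb_act_vops[OF assms] by (auto simp: pullback_def fun_eq_iff)

lemma pullback_simps [simp]: "carr (pullback \<phi> A) = carr A" "vops (pullback \<phi> A) = vops A"
  by (simp_all add: pullback_def vops_def)

lemma act_schr_proj:
  assumes "vops A"
  shows "act (pullback schr_proj A) SE = act A E" "act (pullback schr_proj A) SF = act A F"
    "act (pullback schr_proj A) SH = act A H" "act (pullback schr_proj A) SP = (\<lambda>v. 0)"
    "act (pullback schr_proj A) SQ = (\<lambda>v. 0)" "act (pullback schr_proj A) SZ = (\<lambda>v. 0)"
  by (auto simp: act_pullback[OF assms] lc_def)

lemma act_schr_incl:
  assumes "vops A"
  shows "act (pullback schr_incl A) E = act A SE" "act (pullback schr_incl A) F = act A SF"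
    "act (pullback schr_incl A) H = act A SH"
  by (auto simp: act_pullback[OF assms] lc_def)

lemma restriction_schr_proj: "restriction sl2_br schr_br (pullback schr_proj)"
proof
  fix A B :: "sl2 vobj" and f b t v
  show "carr (pullback schr_proj A) = carr A" by simp
  show "is_vmod schr_br (pullback schr_proj A)" if A: "is_vmod sl2_br A"
  proof -
    note s = vmod_subspace[OF A] and a = act_schr_proj[OF vmod_vops[OF A]]
    have a0: "act A b 0 = 0" for b by (rule linon_zero[OF vmod_linon[OF A] vec.subspace_0[OF s]])
    have "is_vmod schr_br (vmod (carr A) (act (pullback schr_proj A)))"
    proof (rule is_vmodI[OF s])
      fix b v assume v: "v \<in> carr A"
      show "act (pullback schr_proj A) b v \<in> carr A"
        using vmod_act[OF A v] vec.subspace_0[OF s] by (cases b) (simp_all add: a)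
    next
      show "linon (carr A) (act (pullback schr_proj A) b)" for b
        using vmod_linon[OF A] by (cases b) (simp_all add: a linon_def)
    next
      fix x y v assume v: "v \<in> carr A"
      note r = vmod_bracket[OF A v, of E F] vmod_bracket[OF A v, of H E] vmod_bracket[OF A v, of H F]
      show "act (pullback schr_proj A) x (act (pullback schr_proj A) y v) =
        act (pullback schr_proj A) y (act (pullback schr_proj A) x v) + lc (act (pullback schr_proj A)) (schr_br x y) v"
        by (cases x; cases y) (simp_all add: a a0 r lc_def)
    qed
    moreover have "pullback schr_proj A = vmod (carr A) (act (pullback schr_proj A))"
      using vops_eq_vmod[of "pullback schr_proj A"] vmod_vops[OF A] by simp
    ultimately show ?thesis by simp
  qed
  show "lmod_hom (pullback schr_proj A) (pullback schr_proj B) f"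
    if A: "is_vmod sl2_br A" and B: "is_vmod sl2_br B" and f: "lmod_hom A B f"
  proof -
    note h = lmod_homD[OF f A B] and vo = vmod_vops[OF A] vmod_vops[OF B]
    have f0: "f 0 = 0" by (rule linon_zero[OF h(1) vec.subspace_0[OF vmod_subspace[OF A]]])
    have "f (act (pullback schr_proj A) b v) = act (pullback schr_proj B) b (f v)" if "v \<in> carr A" for b v
      using h(3)[OF that] f0 by (cases b) (simp_all add: act_schr_proj[OF vo(1)] act_schr_proj[OF vo(2)])
    then show ?thesis using h(1,2) vo by (subst lmod_hom_vops) simp_all
  qed
  show "act (pullback schr_proj (tensor_mod A B)) b t = act (tensor_mod (pullback schr_proj A) (pullback schr_proj B)) b t"
    if A: "is_vmod sl2_br A" and B: "is_vmod sl2_br B" and t: "t \<in> tspace (carr A) (carr B)"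
  proof -
    note vo = vmod_vops[OF A] vmod_vops[OF B] vmod_vops[OF tensor_mod_vmod[OF A B]]
    note s = vmod_subspace[OF A] vmod_subspace[OF B]
    have z: "linon V (\<lambda>v. 0)" for V by (simp add: linon_def)
    have "tmap (carr A) (carr B) (\<lambda>v. 0) (\<lambda>x. x) t = 0"
      by (rule tspace_ext[OF tmap_linon[OF s z linon_id] z _ t]) (simp add: tmap_tensor[OF s z linon_id])
    moreover have "tmap (carr A) (carr B) (\<lambda>x. x) (\<lambda>v. 0) t = 0"
      by (rule tspace_ext[OF tmap_linon[OF s linon_id z] z _ t]) (simp add: tmap_tensor[OF s linon_id z])
    ultimately show ?thesis
      by (cases b) (simp_all add: act_schr_proj[OF vo(1)] act_schr_proj[OF vo(2)] act_schr_proj[OF vo(3)], simp_all add: tensor_mod_def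
          act_schr_proj[OF vo(1)] act_schr_proj[OF vo(2)])
  qed
  show "act (pullback schr_proj triv_mod) b v = 0" if "v \<in> unit_space"
    using vmod_vops[OF triv_mod_vmod[of sl2_br]] by (cases b) (simp_all add: act_schr_proj)
qed

lemma span_union_submodule:
  assumes M: "is_vmod br M" and N: "is_vmod br N" and S: "is_vmod br S" and f: "lmod_hom M S f" and g: "lmod_hom N S g"
  shows "submodule (vec.span (f ` carr M \<union> g ` carr N)) S"
proof -
  have "submodule (vec.span (\<Union>{f ` carr M, g ` carr N})) S"
    using submodule_image[OF f M S] submodule_image[OF g N S] by (intro submodule_span[OF S]) auto
  then show ?thesis by simp
qed

text \<open>The vectors \<open>n\<close> for which \<open>W\<close> contains all tensors
  \<open>a \<otimes> n\<close> form a submodule of \<open>N\<close> by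
  \<open>tensor_submodule_slice\<close>. It contains the cyclic vector \<open>w\<close>, hence is
  all of \<open>N\<close>.\<close>

lemma tensor_generated:
  assumes A: "is_vmod br A" and N: "is_vmod br N" and W: "submodule W (tensor_mod A N)"
    and cyc: "\<And>U. submodule U N \<Longrightarrow> w \<in> U \<Longrightarrow> U = carr N" and w: "w \<in> carr N"
    and A2: "carr A = vec.span {x, y}" and xw: "tensor_vec x w \<in> W" and yw: "tensor_vec y w \<in> W"
  shows "W = carr (tensor_mod A N)"
proof -
  have W': "vec.subspace W" "W \<subseteq> tspace (carr A) (carr N)"
    using W by (auto simp: submodule_iff[OF tensor_mod_vmod[OF A N]])
  have "tensor_vec a w \<in> W" if "a \<in> carr A" for a
  proof -
    have "a \<in> vec.span {x, y}" using that A2 by simp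
    then show ?thesis
      by (induction rule: vec.span_induct_alt)
        (use xw yw W'(1) in \<open>auto simp: tensor_add_left tensor_scale_left vec.subspace_0 vec.subspace_add vec.subspace_scale\<close>)
  qed
  then have "{n \<in> carr N. \<forall>a\<in>carr A. tensor_vec a n \<in> W} = carr N"
    using w by (intro cyc tensor_submodule_slice[OF A N W]) simp
  then have "tspace (carr A) (carr N) \<subseteq> W" by (intro tspace_minimal[OF W'(1)]) blast
  then show ?thesis using W'(2) by auto
qed

section \<open>Decomposing the tensor product of L(1) and V(n,\<theta>)\<close>

lemma tensor_uminus_left: "tensor_vec (- u) v = - tensor_vec u v"
  using tensor_scale_left[of "-1" u v] by simp

locale std2_module =
  fixes A :: "sl2 vobj" and x y :: vec
  assumes A: "std2 A x y"
begin

lemma A_vmod: "is_vmod sl2_br A" and xy: "x \<in> carr A" "y \<in> carr A" and A_span: "carr A = vec.span {x, y}"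
  and A_ind: "vscale a x + vscale b y = 0 \<Longrightarrow> a = 0 \<and> b = 0"
  and A_act: "act A E x = 0" "act A E y = x" "act A F x = y" "act A F y = 0" "act A H x = x" "act A H y = - y"
  using A by (auto simp: std2_def)

end

text \<open>The vectors \<open>y \<otimes> x\<^sup>k - x \<otimes> x\<^sup>k\<^sup>-\<^sup>1 y\<close> of weight \<open>k - 1\<close> and \<open>x \<otimes> x\<^sup>n\<close> have in their span
  the two highest weight vectors generating \<open>L(1) \<otimes> V(n,\<theta>)\<close>.\<close>

locale std2_tensor_Vc = std2_module A x y for A x y +
  fixes \<theta> :: complex and n :: nat
  assumes \<theta>: "\<theta> \<noteq> 0"
begin

abbreviation "S \<equiv> tensor_mod (pullback schr_proj A) (Vc \<theta> n)"
abbreviation "\<gamma>n \<equiv> \<gamma> \<theta> n"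

lemma rA_vmod: "is_vmod schr_br (pullback schr_proj A)"
  using restriction_schr_proj A_vmod by (simp add: restriction_def)

lemma S_vmod: "is_vmod schr_br S"
  by (rule tensor_mod_vmod[OF rA_vmod Vc_vmod])

lemma carr_S: "carr S = tspace (carr A) (HK {n..})"
  by simp

lemma S_act_x:
  assumes "v \<in> HK {n..}"
  shows "act S SE (tensor_vec x v) = tensor_vec x (sE v)" "act S SF (tensor_vec x v) = tensor_vec y v + tensor_vec x (sF v)"
    "act S SH (tensor_vec x v) = tensor_vec x v + tensor_vec x (sH v)"
    "act S SP (tensor_vec x v) = tensor_vec x (sP \<theta> n v)" "act S SQ (tensor_vec x v) = tensor_vec x (sQ \<theta> n v)"
    "act S SZ (tensor_vec x v) = tensor_vec x (vscale \<theta> v)"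
  using act_tensor_mod[OF rA_vmod Vc_vmod, of x v] xy assms
  by (simp_all add: act_schr_proj[OF vmod_vops[OF A_vmod]] A_act)

lemma S_act_y:
  assumes "v \<in> HK {n..}"
  shows "act S SE (tensor_vec y v) = tensor_vec x v + tensor_vec y (sE v)" "act S SF (tensor_vec y v) = tensor_vec y (sF v)"
    "act S SH (tensor_vec y v) = - tensor_vec y v + tensor_vec y (sH v)"
    "act S SP (tensor_vec y v) = tensor_vec y (sP \<theta> n v)" "act S SQ (tensor_vec y v) = tensor_vec y (sQ \<theta> n v)"
    "act S SZ (tensor_vec y v) = tensor_vec y (vscale \<theta> v)"
  using act_tensor_mod[OF rA_vmod Vc_vmod, of y v] xy assms
  by (simp_all add: act_schr_proj[OF vmod_vops[OF A_vmod]] A_act tensor_uminus_left)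

lemma xS: "v \<in> HK {n..} \<Longrightarrow> tensor_vec x v \<in> carr S" and yS: "v \<in> HK {n..} \<Longrightarrow> tensor_vec y v \<in> carr S"
  using xy by (simp_all add: tensor_in_tspace)

lemma S_sub: "vec.subspace (carr S)"
  by (rule vmod_subspace[OF S_vmod])

lemma S_lin: "u \<in> carr S \<Longrightarrow> v \<in> carr S \<Longrightarrow> act S b (u + v) = act S b u + act S b v"
  "u \<in> carr S \<Longrightarrow> v \<in> carr S \<Longrightarrow> act S b (u - v) = act S b u - act S b v"
  "u \<in> carr S \<Longrightarrow> act S b (vscale c u) = vscale c (act S b u)"
  using linon_add[OF vmod_linon[OF S_vmod]] linon_diff[OF vmod_linon[OF S_vmod] _ _ S_sub] linon_scale[OF vmod_linon[OF S_vmod]]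
  by blast+

lemma S_SZ: "t \<in> carr S \<Longrightarrow> act S SZ t = vscale \<theta> t"
proof -
  assume t: "t \<in> carr S"
  have l: "linon (tspace (carr A) (HK {n..})) (act S SZ)" using vmod_linon[OF S_vmod, of SZ] by simp
  show ?thesis
  proof (rule tspace_ext[OF l linon_smult[OF linon_id]])
    fix a v assume "a \<in> carr A" "v \<in> HK {n..}"
    then show "act S SZ (tensor_vec a v) = vscale \<theta> (tensor_vec a v)"
      by (simp add: act_tensor_mod[OF rA_vmod Vc_vmod] act_schr_proj[OF vmod_vops[OF A_vmod]] tensor_scale_right)
  qed (use t in simp)
qed

text \<open>\<open>D k v = 0\<close> is the third condition in \<open>Qs k S v\<close>.\<close>

definition D :: "nat \<Rightarrow> vec \<Rightarrow> vec" where
  "D k t = vscale (of_nat (k + 1)) (act S SQ t) - act S SF (act S SP t)"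

definition t :: "nat \<Rightarrow> vec" where
  "t k = tensor_vec y (mon k 0) - tensor_vec x (mon (k - 1) 1)"

definition xw :: vec where "xw = tensor_vec x (mon n 0)"

lemma t_in: "k \<ge> n \<Longrightarrow> k \<ge> 1 \<Longrightarrow> t k \<in> carr S"
  unfolding t_def by (intro vec.subspace_diff[OF S_sub] xS yS) auto

lemma xw_in: "xw \<in> carr S"
  unfolding xw_def by (rule xS) simp

text \<open>As \<open>f x = y\<close> and \<open>f y = 0\<close>, the Leibniz rule for powers of
  \<open>f\<close> has at most two terms.\<close>

lemma F_nilpotent: "v \<in> HK {n..} \<Longrightarrow> (act S SF ^^ k) (tensor_vec y v) = tensor_vec y ((sF ^^ k) v) \<and>
    (act S SF ^^ k) (tensor_vec x v) = tensor_vec x ((sF ^^ k) v) + vscale (of_nat k) (tensor_vec y ((sF ^^ (k - 1)) v))"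
proof (induction k)
  case (Suc k)
  have m: "(sF ^^ j) v \<in> HK {n..}" for j using HK_closed(2) Suc.prems by (rule funpow_in)
  have z: "act S SF 0 = 0" by (rule linon_zero[OF vmod_linon[OF S_vmod] vec.subspace_0[OF S_sub]])
  have s: "act S SF (vscale (of_nat k) (tensor_vec y ((sF ^^ (k - 1)) v))) = vscale (of_nat k) (tensor_vec y ((sF ^^ k) v))"
    by (cases k) (simp_all add: S_lin(3) yS[OF m, unfolded carr_S] S_act_y(2)[OF m] z)
  have yk: "vscale (of_nat k) (tensor_vec y ((sF ^^ (k - 1)) v)) \<in> carr S"
    by (rule vec.subspace_scale[OF S_sub yS[OF m]])
  show ?case
    using Suc by (simp only: funpow.simps(2) o_apply S_lin(1)[OF xS[OF m] yk] s S_act_y(2)[OF m] S_act_x(2)[OF m])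
      (simp add: vec.scale_left_distrib)
qed simp

lemma F_pow_add: "u \<in> carr S \<Longrightarrow> v \<in> carr S \<Longrightarrow> (act S SF ^^ k) (vscale c u + vscale d v) = vscale c ((act S SF ^^ k) u) + vscale d ((act S SF ^^ k) v)
   \<and> (act S SF ^^ k) u \<in> carr S"
proof (induction k)
  case (Suc k)
  have 1: "(act S SF ^^ k) u \<in> carr S" "(act S SF ^^ k) v \<in> carr S"
    using funpow_in[of "carr S" "act S SF", OF vmod_act[OF S_vmod]] Suc.prems by blast+
  show ?case using Suc 1 S_lin(1)[of "vscale c ((act S SF ^^ k) u)" "vscale d ((act S SF ^^ k) v)" SF] S_lin(3)[OF 1(1)] S_lin(3)[OF 1(2)]
      vec.subspace_scale[OF S_sub 1(1)] vec.subspace_scale[OF S_sub 1(2)] vmod_act[OF S_vmod 1(1)] by simp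
qed simp

lemma t_nil: "k \<ge> n \<Longrightarrow> k \<ge> 1 \<Longrightarrow> K > k \<Longrightarrow> (act S SF ^^ K) (t k) = 0"
proof -
  assume k: "k \<ge> n" "k \<ge> 1" "K > k"
  have m: "mon k 0 \<in> HK {n..}" "mon (k - 1) 1 \<in> HK {n..}" using k by auto
  have e: "t k = vscale 1 (tensor_vec y (mon k 0)) + vscale (-1) (tensor_vec x (mon (k - 1) 1))" by (simp add: t_def)
  have "K - 1 > k - 1" "K > k - 1" using k by auto
  then show ?thesis unfolding e
    using conjunct1[OF F_pow_add[OF yS[OF m(1)] xS[OF m(2)], of K 1 "-1"]] F_nilpotent[OF m(1), of K] F_nilpotent[OF m(2), of K] k(3)
      sF_pow_mon'[of k K 0] sF_pow_mon'[of "k - 1" K 1] sF_pow_mon'[of "k - 1" "K - 1" 1] by simp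
qed

lemma xw_nil: "K > n + 1 \<Longrightarrow> (act S SF ^^ K) xw = 0"
  using F_nilpotent[of "mon n 0" K] sF_pow_mon'[of n K 0] sF_pow_mon'[of n "K - 1" 0] by (simp add: xw_def)

context
  fixes k :: nat
  assumes k: "k \<ge> n" "k \<ge> 1"
begin

lemma k_mons: "mon k 0 \<in> HK {n..}" "mon (k - 1) 1 \<in> HK {n..}"
  using k by auto

lemma t_E: "act S SE (t k) = 0"
  unfolding t_def S_lin(2)[OF yS[OF k_mons(1)] xS[OF k_mons(2)]] S_act_x(1)[OF k_mons(2)] S_act_y(1)[OF k_mons(1)]
  using k by (simp add: s_mon)

lemma t_H: "act S SH (t k) = vscale (of_nat (k - 1)) (t k)"
  unfolding t_def S_lin(2)[OF yS[OF k_mons(1)] xS[OF k_mons(2)]] S_act_x(3)[OF k_mons(2)] S_act_y(3)[OF k_mons(1)]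
  using k by (simp add: s_mon tensor_scale_right of_nat_diff)
    (rule poly_mapping_eqI, simp add: lookup_add lookup_minus tensor_scale_right tensor_diff_right tensor_add_right algebra_simps)

lemma t_P: "act S SP (t k) = t (k + 1) - vscale (\<gamma>n k) (tensor_vec x (mon (k - 1) 0))"
  unfolding t_def S_lin(2)[OF yS[OF k_mons(1)] xS[OF k_mons(2)]] S_act_x(4)[OF k_mons(2)] S_act_y(4)[OF k_mons(1)]
  using k by (simp add: sP_mon tensor_add_right tensor_scale_right)

end

lemma t_P_n: "n \<ge> 1 \<Longrightarrow> act S SP (t n) = t (n + 1)"
  using t_P[of n] \<gamma>_self[of n \<theta>] by simp

lemma t_F: "k \<ge> n \<Longrightarrow> act S SF (t (k + 1)) = vscale (of_nat k) (tensor_vec y (mon k 1) - tensor_vec x (mon (k - 1) 2))"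
proof -
  assume k: "k \<ge> n"
  have m: "mon (k + 1) 0 \<in> HK {n..}" "mon k 1 \<in> HK {n..}" using k by auto
  have e: "t (k + 1) = tensor_vec y (mon (k + 1) 0) - tensor_vec x (mon k 1)" by (simp add: t_def)
  show ?thesis unfolding e S_lin(2)[OF yS[OF m(1)] xS[OF m(2)]] S_act_x(2)[OF m(2)] S_act_y(2)[OF m(1)]
    by (rule poly_mapping_eqI, simp only: lookup_add lookup_minus lookup_vscale)
      (simp add: s_mon tensor_scale_right numeral_2_eq_2 tensor_add_right lookup_add algebra_simps)
qed

lemma t_Q: "k \<ge> n \<Longrightarrow> k \<ge> 1 \<Longrightarrow> act S SQ (t k) = tensor_vec y (mon k 1) - tensor_vec x (mon (k - 1) 2)
    - vscale (\<gamma>n k) (vscale (of_nat k) (tensor_vec y (mon (k - 1) 0)) - vscale (of_nat (k - 1)) (tensor_vec x (mon (k - 2) 1)))"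
proof -
  assume k: "k \<ge> n" "k \<ge> 1"
  note m = k_mons[OF k]
  show ?thesis unfolding t_def S_lin(2)[OF yS[OF m(1)] xS[OF m(2)]] S_act_x(5)[OF m(2)] S_act_y(5)[OF m(1)]
    using k by (simp add: sQ_mon tensor_diff_right tensor_scale_right numeral_2_eq_2 vec.scale_right_diff_distrib)
qed

lemma D_t_n: "n \<ge> 1 \<Longrightarrow> D (n - 1) (t n) = 0"
  unfolding D_def t_P_n using t_F[of n] t_Q[of n] \<gamma>_self[of n \<theta>] by simp

text \<open>The lowering operator takes the vectors \<open>t\<close> to multiples of each other. The
  factor \<open>k - 1\<close> vanishes for \<open>k = 1\<close>, which is what saves the case
  \<open>n = 0\<close>.\<close>

lemma D_t:
  assumes k: "k > n" shows "D (k - 1) (t k) = vscale (- (\<gamma>n k * of_nat (k - 1) * of_nat (k + 1))) (t (k - 1))"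
proof -
  have k1: "k \<ge> n" "k \<ge> 1" and m: "mon (k - 1) 0 \<in> HK {n..}" using k by auto
  obtain j where j: "k = Suc j" using k by (cases k) auto
  have tk: "t (k + 1) \<in> carr S" using k by (intro t_in) auto
  have "act S SF (act S SP (t k)) = act S SF (t (k + 1)) - vscale (\<gamma>n k) (act S SF (tensor_vec x (mon (k - 1) 0)))"
    unfolding t_P[OF k1] using S_lin(2)[OF tk vec.subspace_scale[OF S_sub xS[OF m]]] S_lin(3)[OF xS[OF m]] by simp
  also have "act S SF (tensor_vec x (mon (k - 1) 0)) = tensor_vec y (mon j 0) + vscale (of_nat j) (tensor_vec x (mon (j - 1) 1))"
    unfolding S_act_x(2)[OF m] by (simp add: s_mon tensor_scale_right j)
  finally have e: "act S SF (act S SP (t k)) = vscale (of_nat k) (tensor_vec y (mon k 1) - tensor_vec x (mon (k - 1) 2)) -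
      vscale (\<gamma>n k) (tensor_vec y (mon j 0) + vscale (of_nat j) (tensor_vec x (mon (j - 1) 1)))"
    unfolding t_F[OF k1(1)] .
  have k1': "k - 1 + 1 = k" "k - 1 = j" "k - 2 = j - 1" using j by auto
  show ?thesis
    unfolding D_def e t_Q[OF k1]
    unfolding k1' t_def
    by (rule poly_mapping_eqI, simp only: lookup_add lookup_minus lookup_vscale) (simp add: j algebra_simps)
qed

lemma D_xw: "D (n + 1) xw = - t (n + 1)"
proof -
  have m: "mon n 0 \<in> HK {n..}" "sP \<theta> n (mon n 0) \<in> HK {n..}" by (simp_all add: sPQ_closed)
  have Q: "sQ \<theta> n (mon n 0) = mon n 1" using \<gamma>_n[of n \<theta>] by (simp add: sQ_mon mult.commute)
  show ?thesis unfolding D_def xw_def S_act_x(5)[OF m(1)] S_act_x(4)[OF m(1)] S_act_x(2)[OF m(2)] Q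
    by (rule poly_mapping_eqI, simp only: lookup_add lookup_minus lookup_vscale lookup_uminus t_def)
      (simp add: sP_mon s_mon tensor_scale_right tensor_add_right lookup_add algebra_simps)
qed

text \<open>Both vectors have weight \<open>n + 1\<close>, and \<open>D (n + 1)\<close> sends them
  to multiples of \<open>t (n + 1)\<close>: the first to
  \<open>- \<gamma>_(n+2) (n + 1) (n + 3) t (n + 1)\<close>, the second to
  \<open>- t (n + 1)\<close>. By \<open>\<gamma>_next2\<close> these coefficients make the two
  contributions cancel.\<close>

definition u_plus :: vec where
  "u_plus = vscale (of_nat (n + 2)) (t (n + 2)) + vscale (- (of_nat ((n + 1) * (2 * n + 3)) * \<theta>)) xw"

text \<open>The vector \<open>t n\<close> has weight \<open>n - 1\<close> and is killed by the
  lowering operator because \<open>\<gamma>_n = 0\<close>. For \<open>n = 0\<close> its place is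
  taken by \<open>t 1\<close>, of weight 0, which generates a copy of V(0,\<theta>): the loop at the
  end of the diagram.\<close>

definition u_minus :: vec where
  "u_minus = t (if n = 0 then 1 else n)"

lemma D_lin: "u \<in> carr S \<Longrightarrow> v \<in> carr S \<Longrightarrow> D k (vscale a u + vscale b v) = vscale a (D k u) + vscale b (D k v)"
proof -
  assume u: "u \<in> carr S" and v: "v \<in> carr S"
  note a = vmod_act[OF S_vmod u] vmod_act[OF S_vmod v]
  have l: "act S c (vscale a u + vscale b v) = vscale a (act S c u) + vscale b (act S c v)" if "u \<in> carr S" "v \<in> carr S" for u v c
    using S_lin(1)[OF vec.subspace_scale[OF S_sub that(1)] vec.subspace_scale[OF S_sub that(2)]] S_lin(3)[OF that(1)] S_lin(3)[OF that(2)]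
    by simp
  show ?thesis unfolding D_def l[OF u v] l[OF a]
    by (rule poly_mapping_eqI, simp only: lookup_add lookup_minus lookup_vscale) (simp add: algebra_simps)
qed

lemma u_plus_in: "u_plus \<in> carr S"
  unfolding u_plus_def by (intro vec.subspace_add[OF S_sub] vec.subspace_scale[OF S_sub] t_in xw_in) auto

lemma Qs_u_plus: "Qs (n + 1) S u_plus"
proof -
  have t2: "t (n + 2) \<in> carr S" by (rule t_in) auto
  note s1 = vec.subspace_scale[OF S_sub t2] and s2 = vec.subspace_scale[OF S_sub xw_in]
  have l: "act S b u_plus = vscale (of_nat (n + 2)) (act S b (t (n + 2))) + vscale (- (of_nat ((n + 1) * (2 * n + 3)) * \<theta>)) (act S b xw)" for b
    unfolding u_plus_def S_lin(1)[OF s1 s2] S_lin(3)[OF t2] S_lin(3)[OF xw_in] ..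
  have m: "mon n 0 \<in> HK {n..}" by simp
  have "act S SE xw = 0" unfolding xw_def S_act_x(1)[OF m] by (simp add: s_mon)
  then have E: "act S SE u_plus = 0" unfolding l using t_E[of "n + 2"] by simp
  have "act S SH xw = vscale (of_nat (n + 1)) xw"
    unfolding xw_def S_act_x(3)[OF m] by (simp add: s_mon tensor_scale_right vec.scale_left_distrib)
  then have H: "act S SH u_plus = vscale (of_nat (n + 1)) u_plus"
    unfolding l using t_H[of "n + 2"]
    by (simp add: u_plus_def vec.scale_right_distrib vec.scale_right_diff_distrib mult.commute)
  have "D (n + 1) u_plus = vscale (of_nat (n + 2)) (D (n + 1) (t (n + 2))) + vscale (- (of_nat ((n + 1) * (2 * n + 3)) * \<theta>)) (D (n + 1) xw)"
    unfolding u_plus_def by (rule D_lin[OF t2 xw_in])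
  also have "\<dots> = 0"
  proof -
    have "D (n + 1) (t (n + 2)) = vscale (- (\<gamma>n (n + 2) * of_nat (n + 1) * of_nat (n + 3))) (t (n + 1))"
      using D_t[of "n + 2"] by (simp add: numeral_2_eq_2 numeral_3_eq_3)
    moreover have "of_nat (n + 2) * (\<gamma>n (n + 2) * of_nat (n + 1) * of_nat (n + 3)) = of_nat ((n + 1) * (2 * n + 3)) * \<theta>"
    proof -
      have "of_nat (n + 2) * (\<gamma>n (n + 2) * of_nat (n + 1) * of_nat (n + 3)) =
        of_nat (n + 1) * (of_nat (n + 2) * of_nat (n + 3) * \<gamma>n (n + 2))" by (simp only: ac_simps)
      then show ?thesis unfolding \<gamma>_next2 by (simp only: of_nat_mult ac_simps)
    qed
    ultimately show ?thesis unfolding D_xw by (simp del: of_nat_add of_nat_mult)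
  qed
  finally have D0: "vscale (of_nat (n + 1 + 1)) (act S SQ u_plus) = act S SF (act S SP u_plus)"
    unfolding D_def by simp
  have "(act S SF ^^ (n + 3)) u_plus = 0"
    unfolding u_plus_def conjunct1[OF F_pow_add[OF t2 xw_in]] using t_nil[of "n + 2" "n + 3"] xw_nil[of "n + 3"] by simp
  then show ?thesis unfolding Qs_def using E H D0 by blast
qed

lemma u_minus_in: "u_minus \<in> carr S"
  unfolding u_minus_def by (rule t_in) auto

lemma Qs_u_minus: "Qs (n - 1) S u_minus"
proof -
  define k where "k = (if n = 0 then 1 else n)"
  have k: "k \<ge> n" "k \<ge> 1" and kn: "k - 1 = n - 1" by (auto simp: k_def)
  have "D (k - 1) (t k) = 0"
  proof (cases "n = 0")
    case True
    then show ?thesis using D_t[of k] by (simp add: k_def)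
  next
    case False
    then show ?thesis using D_t_n by (simp add: k_def)
  qed
  then have D0: "vscale (of_nat (n - 1 + 1)) (act S SQ (t k)) = act S SF (act S SP (t k))" unfolding D_def kn by simp
  have N: "(act S SF ^^ (k + 1)) (t k) = 0" by (rule t_nil[OF k]) simp
  show ?thesis
    unfolding Qs_def u_minus_def k_def[symmetric]
    using t_E[OF k] t_H[OF k] D0 N kn by (intro conjI exI[of _ "k + 1"]) simp_all
qed

lemma t_nonzero: "t k \<noteq> 0"
proof
  assume "t k = 0"
  then have "tensor_vec x (- mon (k - 1) 1) + tensor_vec y (mon k 0) = 0"
    using tensor_scale_right[of x "-1" "mon (k - 1) 1"] by (simp add: t_def)
  from tensor_independent[OF A_ind this] show False using mon_nonzero by blast
qed

lemma u_plus_nonzero: "u_plus \<noteq> 0"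
proof
  assume z: "u_plus = 0"
  have e: "u_plus = tensor_vec x (vscale (- of_nat (n + 2)) (mon (n + 1) 1) + vscale (- (of_nat ((n + 1) * (2 * n + 3)) * \<theta>)) (mon n 0)) +
     tensor_vec y (vscale (of_nat (n + 2)) (mon (n + 2) 0))"
    by (rule poly_mapping_eqI, simp only: u_plus_def t_def xw_def tensor_add_right tensor_scale_right lookup_add lookup_minus lookup_vscale)
      (simp add: algebra_simps)
  have "tensor_vec x (vscale (- of_nat (n + 2)) (mon (n + 1) 1) + vscale (- (of_nat ((n + 1) * (2 * n + 3)) * \<theta>)) (mon n 0)) +
     tensor_vec y (vscale (of_nat (n + 2)) (mon (n + 2) 0)) = 0"
    using z unfolding e .
  from tensor_independent[OF A_ind this] have "vscale (of_nat (n + 2)) (mon (n + 2) 0) = 0" by blast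
  moreover have "(of_nat (n + 2) :: complex) \<noteq> 0" unfolding of_nat_eq_0_iff by simp
  ultimately show False using mon_nonzero by simp
qed

text \<open>From \<open>u_minus\<close>, the operator \<open>p\<close> leads to
  \<open>t (n + 1)\<close> and then to \<open>t (n + 2)\<close> minus a multiple of
  \<open>xw\<close>. Comparison with \<open>u_plus\<close> isolates \<open>xw\<close>, with the
  nonzero coefficient \<open>((n + 1) (2 n + 3) - 1) \<theta>\<close>. Finally \<open>f xw\<close>,
  corrected by \<open>n t_n\<close>, is a multiple of \<open>y \<otimes> x^n\<close>, and
  \<open>tensor_generated\<close> applies.\<close>

lemma generated:
  assumes W: "submodule W S" and um: "u_minus \<in> W" and up: "u_plus \<in> W"
  shows "W = carr S"
proof (rule tensor_generated[OF rA_vmod Vc_vmod W, where w = "mon n 0"])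
  have W': "vec.subspace W" "\<And>b v. v \<in> W \<Longrightarrow> act S b v \<in> W" using W by (auto simp: submodule_iff[OF S_vmod])
  have t1: "t (n + 1) \<in> W"
  proof (cases "n = 0")
    case True then show ?thesis using um unfolding u_minus_def by simp
  next
    case False
    then show ?thesis using W'(2)[OF um, of SP] t_P_n by (simp add: u_minus_def)
  qed
  have "act S SP (t (n + 1)) = t (n + 2) - vscale (\<gamma>n (n + 1)) xw"
    using t_P[of "n + 1"] by (simp add: xw_def numeral_2_eq_2)
  then have "t (n + 2) - vscale (\<gamma>n (n + 1)) xw \<in> W" using W'(2)[OF t1, of SP] by simp
  from vec.subspace_diff[OF W'(1) vec.subspace_scale[OF W'(1) this] up]
  have "vscale (of_nat (n + 2)) (t (n + 2) - vscale (\<gamma>n (n + 1)) xw) - u_plus \<in> W" .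
  also have "vscale (of_nat (n + 2)) (t (n + 2) - vscale (\<gamma>n (n + 1)) xw) - u_plus =
      vscale (of_nat ((n + 1) * (2 * n + 3)) * \<theta> - of_nat (n + 2) * \<gamma>n (n + 1)) xw"
    unfolding u_plus_def
    by (rule poly_mapping_eqI, simp only: lookup_add lookup_minus lookup_vscale) (simp add: algebra_simps del: of_nat_add of_nat_mult)
  also have "of_nat ((n + 1) * (2 * n + 3)) * \<theta> - of_nat (n + 2) * \<gamma>n (n + 1) = of_nat ((n + 1) * (2 * n + 3) - 1) * \<theta>"
    unfolding \<gamma>_next by (simp add: of_nat_diff algebra_simps)
  finally have "vscale (of_nat ((n + 1) * (2 * n + 3) - 1) * \<theta>) xw \<in> W" .
  then have "vscale (1 / (of_nat ((n + 1) * (2 * n + 3) - 1) * \<theta>)) (vscale (of_nat ((n + 1) * (2 * n + 3) - 1) * \<theta>) xw) \<in> W"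
    by (rule vec.subspace_scale[OF W'(1)])
  moreover have "(of_nat ((n + 1) * (2 * n + 3) - 1) :: complex) \<noteq> 0" unfolding of_nat_eq_0_iff by simp
  ultimately have xw: "xw \<in> W" using \<theta> by (simp del: of_nat_diff)
  then show "tensor_vec x (mon n 0) \<in> W" by (simp add: xw_def)
  have "act S SF xw \<in> W" using W'(2) xw by blast
  moreover have m: "mon n 0 \<in> HK {n..}" by simp
  ultimately have *: "tensor_vec y (mon n 0) + vscale (of_nat n) (tensor_vec x (mon (n - 1) 1)) \<in> W"
    unfolding xw_def S_act_x(2)[OF m] by (simp add: s_mon tensor_scale_right)
  show "tensor_vec y (mon n 0) \<in> W"
  proof (cases "n = 0")
    case True then show ?thesis using * by simp
  next
    case False
    then have "t n \<in> W" using um by (simp add: u_minus_def)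
    from vec.subspace_add[OF W'(1) * vec.subspace_scale[OF W'(1) this]]
    have "tensor_vec y (mon n 0) + vscale (of_nat n) (tensor_vec x (mon (n - 1) 1)) + vscale (of_nat n) (t n) \<in> W" .
    also have "tensor_vec y (mon n 0) + vscale (of_nat n) (tensor_vec x (mon (n - 1) 1)) + vscale (of_nat n) (t n) =
       vscale (of_nat (n + 1)) (tensor_vec y (mon n 0))"
      by (rule poly_mapping_eqI, simp only: lookup_add lookup_minus lookup_vscale t_def) (simp add: algebra_simps)
    finally have "vscale (1 / of_nat (n + 1)) (vscale (of_nat (n + 1)) (tensor_vec y (mon n 0))) \<in> W"
      by (rule vec.subspace_scale[OF W'(1)])
    moreover have "(of_nat (n + 1) :: complex) \<noteq> 0" unfolding of_nat_eq_0_iff by simp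
    ultimately show ?thesis by (simp del: of_nat_add)
  qed
  show "carr (pullback schr_proj A) = vec.span {x, y}" unfolding pullback_simps by (rule A_span)
  show "mon n 0 \<in> carr (Vc \<theta> n)" by simp
  show "U = carr (Vc \<theta> n)" if "submodule U (Vc \<theta> n)" "mon n 0 \<in> U" for U using that by (rule Vc_cyclic)
qed

end

lemma tensor_family_Vc: "\<theta> \<noteq> 0 \<Longrightarrow> tensor_family schr_br (Vc \<theta>) (pullback schr_proj)"
proof (intro tensor_family.intro Vc_simple_family restriction_schr_proj tensor_family_axioms.intro)
  fix A x y and n :: nat assume \<theta>: "\<theta> \<noteq> 0" and "std2 A x y"
  then interpret std2_tensor_Vc A x y \<theta> n by unfold_locales
  obtain \<phi> where \<phi>: "lmod_hom (Vc \<theta> (n - 1)) S \<phi>" "\<phi> (mon (n - 1) 0) = u_minus"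
    by (rule Vc_universal[OF S_vmod S_SZ u_minus_in Qs_u_minus])
  obtain \<psi> where \<psi>: "lmod_hom (Vc \<theta> (n + 1)) S \<psi>" "\<psi> (mon (n + 1) 0) = u_plus"
    by (rule Vc_universal[OF S_vmod S_SZ u_plus_in Qs_u_plus])
  have m: "mon (n - 1) 0 \<in> carr (Vc \<theta> (n - 1))" "mon (n + 1) 0 \<in> carr (Vc \<theta> (n + 1))" by simp_all
  let ?W = "vec.span (\<phi> ` carr (Vc \<theta> (n - 1)) \<union> \<psi> ` carr (Vc \<theta> (n + 1)))"
  have "\<phi> (mon (n - 1) 0) \<in> ?W" "\<psi> (mon (n + 1) 0) \<in> ?W"
    by (rule vec.span_base, rule UnI1, rule imageI, rule m(1)) (rule vec.span_base, rule UnI2, rule imageI, rule m(2))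
  then have uW: "u_minus \<in> ?W" "u_plus \<in> ?W" by (simp_all only: \<phi>(2) \<psi>(2))
  have "?W = carr S"
    by (rule generated[OF span_union_submodule[OF Vc_vmod Vc_vmod S_vmod \<phi>(1) \<psi>(1)] uW])
  then have sp: "carr S = ?W" by (rule sym)
  have nz: "\<phi> (mon (n - 1) 0) \<noteq> 0" "\<psi> (mon (n + 1) 0) \<noteq> 0"
    unfolding \<phi>(2) \<psi>(2) u_minus_def by (rule t_nonzero, rule u_plus_nonzero)
  show "\<exists>\<phi> \<psi> u v. lmod_hom (Vc \<theta> (n - 1)) S \<phi> \<and> u \<in> carr (Vc \<theta> (n - 1)) \<and> \<phi> u \<noteq> 0 \<and>
      lmod_hom (Vc \<theta> (n + 1)) S \<psi> \<and> v \<in> carr (Vc \<theta> (n + 1)) \<and> \<psi> v \<noteq> 0 \<and>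
      carr S = vec.span (\<phi> ` carr (Vc \<theta> (n - 1)) \<union> \<psi> ` carr (Vc \<theta> (n + 1)))"
    by (rule exI[of _ \<phi>], rule exI[of _ \<psi>], rule exI[of _ "mon (n - 1) 0"], rule exI[of _ "mon (n + 1) 0"])
      (intro conjI \<phi>(1) \<psi>(1) m nz sp)
qed

section \<open>Restriction of V(n,\<theta>) to sl2, and uniqueness\<close>

definition hom_part :: "nat \<Rightarrow> vec \<Rightarrow> vec" where
  "hom_part k = lext2 (\<lambda>a b. if a + b = k then mon a b else 0)"

lemma lin_hom_part: "lin (hom_part k)"
  by (simp add: hom_part_def lin_lext2)

lemma cf_hom_part [simp]: "cf (hom_part k v) a b = (if a + b = k then cf v a b else 0)"
  by (rule functional_ext2[where f = "\<lambda>v. cf (hom_part k v) a b"])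
    (auto simp: lin_add[OF lin_hom_part] lin_scale[OF lin_hom_part], auto simp: hom_part_def)

lemma hom_part_in: "hom_part k v \<in> HK {k}"
  by (auto simp: HK_def)

lemma hom_part_sl2act: "hom_part k (sl2act b v) = sl2act b (hom_part k v)"
  by (rule cf_eqI) (cases b; auto simp: cf_sE cf_sF cf_sH)

lemma hom_part_HK: "v \<in> HK {j} \<Longrightarrow> hom_part k v = (if j = k then v else 0)"
  by (rule cf_eqI) (auto simp: HK_def)

lemma finite_hom_parts: "finite {k. hom_part k v \<noteq> 0}"
proof (rule finite_subset)
  show "{k. hom_part k v \<noteq> 0} \<subseteq> (\<lambda>n. fst (prod_decode n) + snd (prod_decode n)) ` Poly_Mapping.keys v"
  proof
    fix k assume "k \<in> {k. hom_part k v \<noteq> 0}"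
    then obtain a b where "cf (hom_part k v) a b \<noteq> 0" using cf_eqI[of "hom_part k v" 0] by auto
    then have "a + b = k" "prod_encode (a, b) \<in> Poly_Mapping.keys v" by (auto simp: cf_def[of v] in_keys_iff split: if_splits)
    then show "k \<in> (\<lambda>n. fst (prod_decode n) + snd (prod_decode n)) ` Poly_Mapping.keys v"
      by (auto intro!: image_eqI[of _ _ "prod_encode (a, b)"])
  qed
qed (rule finite_imageI[OF finite_keys])

lemma act_incl_Vc: "act (pullback schr_incl (Vc \<theta> m)) = sl2act"
proof
  fix b show "act (pullback schr_incl (Vc \<theta> m)) b = sl2act b"
    using vmod_vops[OF Vc_vmod] by (cases b) (simp_all add: act_schr_incl)
qed

text \<open>The components are the homogeneous parts, of which a polynomial has finitely many; this
  matches the finite support condition in \<open>dsum\<close>.\<close>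

lemma Vc_sl2_decomposition: "lmod_iso (pullback schr_incl (Vc \<theta> m)) (dsum {m..} L_mod)"
proof -
  have "\<forall>k. \<exists>\<phi>. lin \<phi> \<and> base_iso (Lc k) (L_mod k) \<phi>"
    by (intro allI, rule L_mod_iso) blast
  from choice[OF this] obtain \<psi> where \<psi>: "\<And>k. lin (\<psi> k)" "\<And>k. base_iso (Lc k) (L_mod k) (\<psi> k)" by blast
  have bij: "bij_betw (\<psi> k) (HK {k}) (carr (L_mod k))" and hom: "lmod_hom (Lc k) (L_mod k) (\<psi> k)" for k
    using \<psi>(2)[of k] by (auto simp: base_iso_def)
  have \<psi>_in: "\<psi> k v \<in> carr (L_mod k)" if "v \<in> HK {k}" for k v
    using bij_betw_apply[OF bij that] .
  have \<psi>_act: "\<psi> k (sl2act b v) = act (L_mod k) b (\<psi> k v)" if "v \<in> HK {k}" for k b v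
    using lmod_homD(3)[OF hom Lc_vmod L_mod_spec(1)] that by simp
  have vo: "vops (L_mod k)" for k by (rule vmod_vops[OF L_mod_spec(1)])
  have vo': "vops (pullback schr_incl (Vc \<theta> m))" using vmod_vops[OF Vc_vmod] by simp
  define G where "G v = (\<lambda>k\<in>{m..}. \<psi> k (hom_part k v))" for v
  have G_in: "G v \<in> carr (dsum {m..} L_mod)" for v
  proof -
    have "{k \<in> {m..}. G v k \<noteq> vzero (L_mod k)} \<subseteq> {k. hom_part k v \<noteq> 0}"
      using vo lin_zero[OF \<psi>(1)] by (auto simp: G_def vops_def)
    then have "finite {k \<in> {m..}. G v k \<noteq> vzero (L_mod k)}" using finite_hom_parts finite_subset by blast
    then show ?thesis using \<psi>_in[OF hom_part_in] by (auto simp: dsum_simps G_def)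
  qed
  have "lmod_hom (pullback schr_incl (Vc \<theta> m)) (dsum {m..} L_mod) G"
    unfolding lmod_hom_def clinear_map_def
  proof (intro conjI ballI allI)
    show "G \<in> carr (pullback schr_incl (Vc \<theta> m)) \<rightarrow> carr (dsum {m..} L_mod)" using G_in by blast
    fix u v and c :: complex and b :: sl2
    show "G (vadd (pullback schr_incl (Vc \<theta> m)) u v) = vadd (dsum {m..} L_mod) (G u) (G v)"
      using vo vo' unfolding dsum_simps vops_def
      by (auto simp: G_def lin_add[OF \<psi>(1)] lin_add[OF lin_hom_part] intro!: restrict_ext)
    show "G (vsmul (pullback schr_incl (Vc \<theta> m)) c v) = vsmul (dsum {m..} L_mod) c (G v)"
      using vo vo' unfolding dsum_simps vops_def
      by (auto simp: G_def lin_scale[OF \<psi>(1)] lin_scale[OF lin_hom_part] intro!: restrict_ext)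
    show "G (act (pullback schr_incl (Vc \<theta> m)) b v) = act (dsum {m..} L_mod) b (G v)"
      unfolding dsum_simps act_incl_Vc
      by (auto simp: G_def hom_part_sl2act \<psi>_act[OF hom_part_in] intro!: restrict_ext)
  qed
  moreover have "bij_betw G (HK {m..}) (carr (dsum {m..} L_mod))"
  proof (rule bij_betw_imageI)
    show "inj_on G (HK {m..})"
    proof (rule inj_onI)
      fix u v assume uv: "u \<in> HK {m..}" "v \<in> HK {m..}" "G u = G v"
      show "u = v"
      proof (rule cf_eqI)
        fix a b
        show "cf u a b = cf v a b"
        proof (cases "a + b \<ge> m")
          case True
          have "\<psi> (a + b) (hom_part (a + b) u) = \<psi> (a + b) (hom_part (a + b) v)"
            using fun_cong[OF uv(3), of "a + b"] True by (simp add: G_def)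
          then have "hom_part (a + b) u = hom_part (a + b) v"
            using bij[of "a + b"] hom_part_in by (auto simp: bij_betw_def dest: inj_onD)
          then have "cf (hom_part (a + b) u) a b = cf (hom_part (a + b) v) a b" by simp
          then show ?thesis by simp
        qed (use uv in \<open>auto simp: HK_def\<close>)
      qed
    qed
    show "G ` HK {m..} = carr (dsum {m..} L_mod)"
    proof (intro subset_antisym subsetI)
      show "g \<in> carr (dsum {m..} L_mod)" if "g \<in> G ` HK {m..}" for g using that G_in by blast
      fix g assume "g \<in> carr (dsum {m..} L_mod)"
      then have g: "g \<in> Pi\<^sub>E {m..} (\<lambda>k. carr (L_mod k))" and fin: "finite {k \<in> {m..}. g k \<noteq> 0}"
        using vo by (auto simp: dsum_simps vops_def)
      define u where "u k = inv_into (HK {k}) (\<psi> k) (g k)" for k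
      have u: "u k \<in> HK {k}" "\<psi> k (u k) = g k" if "k \<ge> m" for k
      proof -
        have "g k \<in> \<psi> k ` HK {k}" using g that bij[of k] by (auto simp: bij_betw_def)
        then show "u k \<in> HK {k}" "\<psi> k (u k) = g k"
          unfolding u_def by (rule inv_into_into, rule f_inv_into_f)
      qed
      let ?S = "{k \<in> {m..}. g k \<noteq> 0}"
      let ?v = "\<Sum>k\<in>?S. u k"
      have "?v \<in> HK {m..}"
      proof (rule vec.subspace_sum[OF subspace_HK])
        show "u k \<in> HK {m..}" if "k \<in> ?S" for k using u(1)[of k] that by (auto simp: HK_def)
      qed
      moreover have "G ?v = g"
      proof (rule PiE_ext[of _ "{m..}" "\<lambda>k. carr (L_mod k)", OF _ g])
        show "G ?v \<in> Pi\<^sub>E {m..} (\<lambda>k. carr (L_mod k))" using G_in by (simp add: dsum_simps)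
        fix k assume k: "k \<in> {m..}"
        have "hom_part k ?v = (\<Sum>j\<in>?S. if j = k then u k else 0)"
          unfolding vp.linear_sum[OF lin_hom_part] using hom_part_HK[OF u(1)] by (intro sum.cong) auto
        also have "\<dots> = (if g k \<noteq> 0 then u k else 0)" using fin k by simp
        finally have "\<psi> k (hom_part k ?v) = g k" using u(2)[of k] k lin_zero[OF \<psi>(1), of k] by auto
        then show "G ?v k = g k" using k by (simp add: G_def)
      qed
      ultimately show "g \<in> G ` HK {m..}" by (rule rev_image_eqI[OF _ sym])
    qed
  qed
  ultimately show ?thesis unfolding lmod_iso_def by (intro exI[of _ G]) simp
qed

text \<open>Here \<open>D\<close> stands for an infinite \<open>dsum\<close>, about which only the
  two isomorphisms are used. Closure of the carrier of \<open>B\<close> is enough to invert the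
  second one on the values of the first.\<close>

lemma lmod_iso_cospan:
  assumes A: "lmod_iso A D" and B: "lmod_iso B D"
    and cl: "\<And>u v. u \<in> carr B \<Longrightarrow> v \<in> carr B \<Longrightarrow> vadd B u v \<in> carr B"
      "\<And>c v. v \<in> carr B \<Longrightarrow> vsmul B c v \<in> carr B" "\<And>b v. v \<in> carr B \<Longrightarrow> act B b v \<in> carr B"
  shows "lmod_iso A B"
proof -
  obtain f g where f: "lmod_hom A D f" "bij_betw f (carr A) (carr D)" and g: "lmod_hom B D g" "bij_betw g (carr B) (carr D)"
    using A B by (auto simp: lmod_iso_def)
  let ?g = "the_inv_into (carr B) g"
  have inj: "inj_on g (carr B)" using g(2) by (simp add: bij_betw_def)
  have g': "?g (g b) = b" if "b \<in> carr B" for b using the_inv_into_f_f[OF inj that] .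
  have fa: "\<exists>b\<in>carr B. f a = g b" if "a \<in> carr A" for a
    using f(2) g(2) that unfolding bij_betw_def by (metis imageE imageI)
  note fd = f(1)[unfolded lmod_hom_def clinear_map_def] and gd = g(1)[unfolded lmod_hom_def clinear_map_def]
  have "lmod_hom A B (\<lambda>a. ?g (f a))"
    unfolding lmod_hom_def clinear_map_def
  proof (intro conjI ballI allI)
    show "(\<lambda>a. ?g (f a)) \<in> carr A \<rightarrow> carr B" using fa g' by fastforce
    fix a a' c and b assume a: "a \<in> carr A"
    obtain x where x: "x \<in> carr B" "f a = g x" using fa[OF a] by blast
    show "?g (f (vsmul A c a)) = vsmul B c (?g (f a))"
      using fd gd a x g'[OF x(1)] g'[OF cl(2)[OF x(1), of c]] by simp
    show "?g (f (act A b a)) = act B b (?g (f a))"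
      using fd gd a x g'[OF x(1)] g'[OF cl(3)[OF x(1), of b]] by simp
    assume a': "a' \<in> carr A"
    obtain y where y: "y \<in> carr B" "f a' = g y" using fa[OF a'] by blast
    show "?g (f (vadd A a a')) = vadd B (?g (f a)) (?g (f a'))"
      using fd gd a a' x y g'[OF x(1)] g'[OF y(1)] g'[OF cl(1)[OF x(1) y(1)]] by simp
  qed
  moreover have "bij_betw (\<lambda>a. ?g (f a)) (carr A) (carr B)"
    using bij_betw_trans[OF f(2) bij_betw_the_inv_into[OF g(2)]] by (simp add: o_def)
  ultimately show ?thesis unfolding lmod_iso_def by blast
qed

lemma Vc_simple: "\<theta> \<noteq> 0 \<Longrightarrow> simple_module (Vc \<theta> m)"
  using Vc_simple_family[of \<theta>] by (simp add: simple_family_def)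

text \<open>The restriction to \<open>sl\<^sub>2\<close> provides a highest weight vector of weight \<open>m\<close>, and it satisfies the
  defining conditions \<open>Qs\<close> because there is no highest weight vector of weight \<open>m - 1\<close>.\<close>

lemma schr_module_unique:
  assumes \<theta>: "\<theta> \<noteq> 0" and V: "is_vmod schr_br V" "simple_module V" "\<And>v. v \<in> carr V \<Longrightarrow> act V SZ v = vscale \<theta> v"
    and iso: "lmod_iso (pullback schr_incl V) (dsum {m..} L_mod)"
  shows "\<exists>f. base_iso (Vc \<theta> m) V f"
proof -
  have "lmod_iso (pullback schr_incl V) (pullback schr_incl (Vc \<theta> m))"
  proof (rule lmod_iso_cospan[OF iso Vc_sl2_decomposition])
    note vo = vmod_vops[OF Vc_vmod[of \<theta> m]]
    show "vadd (pullback schr_incl (Vc \<theta> m)) u v \<in> carr (pullback schr_incl (Vc \<theta> m))"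
      if "u \<in> carr (pullback schr_incl (Vc \<theta> m))" "v \<in> carr (pullback schr_incl (Vc \<theta> m))" for u v
      using that by (simp add: pullback_def Vc_def vec.subspace_add[OF subspace_HK])
    show "vsmul (pullback schr_incl (Vc \<theta> m)) c v \<in> carr (pullback schr_incl (Vc \<theta> m))"
      if "v \<in> carr (pullback schr_incl (Vc \<theta> m))" for c v
      using that by (simp add: pullback_def Vc_def vec.subspace_scale[OF subspace_HK])
    show "act (pullback schr_incl (Vc \<theta> m)) b v \<in> carr (pullback schr_incl (Vc \<theta> m))"
      if "v \<in> carr (pullback schr_incl (Vc \<theta> m))" for b v
      using that HK_sl2act by (simp add: act_incl_Vc)
  qed
  then obtain g where gh: "lmod_hom (pullback schr_incl V) (pullback schr_incl (Vc \<theta> m)) g" and gb: "bij_betw g (carr V) (HK {m..})"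
    by (auto simp: lmod_iso_def)
  note vo = vmod_vops[OF V(1)] and sV = vmod_subspace[OF V(1)]
  have vo': "vops (pullback schr_incl V)" "vops (pullback schr_incl (Vc \<theta> m))" using vo vmod_vops[OF Vc_vmod] by simp_all
  have gl: "linon (carr V) g" and g: "\<And>v. v \<in> carr V \<Longrightarrow> g v \<in> HK {m..}"
    and ga: "\<And>b v. v \<in> carr V \<Longrightarrow> g (act (pullback schr_incl V) b v) = sl2act b (g v)"
    using gh unfolding lmod_hom_vops[OF vo'] by (simp_all add: act_incl_Vc)
  have gE: "g (act V SE v) = sE (g v)" and gF: "g (act V SF v) = sF (g v)" and gH: "g (act V SH v) = sH (g v)" if "v \<in> carr V" for v
    using ga[OF that, of E] ga[OF that, of F] ga[OF that, of H] by (simp_all add: act_schr_incl[OF vo])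
  have g0: "g 0 = 0" by (rule linon_zero[OF gl vec.subspace_0[OF sV]])
  have inj: "u = v" if "u \<in> carr V" "v \<in> carr V" "g u = g v" for u v using gb that by (auto simp: bij_betw_def dest: inj_onD)
  have "mon m 0 \<in> g ` carr V" using gb by (simp add: bij_betw_def)
  then obtain v where v: "v \<in> carr V" "g v = mon m 0" by auto
  obtain T where T: "\<And>b. lin (T b)" "\<And>b v. T b v \<in> carr V" "\<And>b v. v \<in> carr V \<Longrightarrow> T b v = act V b v"
    "\<And>x y v. T x (T y v) = T y (T x v) + lc T (schr_br x y) v" by (rule total_action[OF V(1)]) (rule that)
  interpret schr_ops "T SE" "T SF" "T SH" "T SP" "T SQ" "carr V" \<theta> by (rule schr_ops_total[OF V(1) V(3) T])
  have gT: "g (T SE u) = sE (g u)" "g (T SF u) = sF (g u)" "g (T SH u) = sH (g u)" if "u \<in> carr V" for u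
    using gE gF gH T(3) that by simp_all
  have Ev: "T SE v = 0"
    by (rule inj[OF T(2) vec.subspace_0[OF sV]]) (simp add: gT v s_mon g0)
  have Hv: "T SH v = vscale (of_nat m) v"
    by (rule inj[OF T(2) vec.subspace_scale[OF sV v(1)]]) (simp add: gT v s_mon linon_scale[OF gl v(1)])
  have Fk: "(T SF ^^ k) v \<in> carr V \<and> (act V SF ^^ k) v = (T SF ^^ k) v \<and> g ((T SF ^^ k) v) = (sF ^^ k) (mon m 0)" for k
    by (induction k) (auto simp: v T(2) gT T(3)[symmetric])
  have "(T SF ^^ Suc m) v = 0"
    using Fk[of "Suc m"] g0 inj[OF _ vec.subspace_0[OF sV]] sF_pow_mon[of m 0] by simp
  then have Fn: "(act V SF ^^ Suc m) v = 0" using Fk by metis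
  define u where "u = vscale (of_nat (m + 1)) (T SQ v) - T SF (T SP v)"
  have uV: "u \<in> carr V" unfolding u_def by (intro vec.subspace_diff[OF sV] vec.subspace_scale[OF sV] T(2))
  have "T SE u = 0"
    unfolding u_def by (simp add: lins pqlins ef eq ep hp Ev Hv vec.scale_left_distrib)
  then have E0: "sE (g u) = 0" using gT(1)[OF uV] g0 by simp
  have "T SH u = vscale (of_nat m - 1) u"
    unfolding u_def
    by (rule poly_mapping_eqI) (simp add: lins pqlins hf hq hp Hv lookup_add lookup_minus algebra_simps)
  then have H0: "sH (g u) = vscale (of_nat m - 1) (g u)" using gT(3)[OF uV] linon_scale[OF gl uV] by simp
  have "g u = 0"
  proof (rule cf_eqI)
    fix a b
    show "cf (g u) a b = cf 0 a b"
    proof (cases "b = 0")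
      case True
      have "(of_nat m - 1) * cf (g u) a b = (of_nat a - of_nat b) * cf (g u) a b" using cf_sH[of "g u" a b] H0 by simp
      then have "cf (g u) a b = 0 \<or> of_nat a = (of_nat m - 1 :: complex)" using True unfolding mult_cancel_right by auto
      moreover have "of_nat a \<noteq> (of_nat m - 1 :: complex)" if "a \<ge> m"
      proof
        assume "of_nat a = (of_nat m - 1 :: complex)"
        then have "of_nat (a + 1) = (of_nat m :: complex)" by simp
        then show False using that unfolding of_nat_eq_iff by simp
      qed
      ultimately show ?thesis using g[OF uV] True by (cases "a \<ge> m") (auto simp: HK_def)
    qed (simp add: ker_sE[OF E0])
  qed
  then have "u = 0" using inj[OF uV vec.subspace_0[OF sV]] g0 by simp
  then have "vscale (of_nat (m + 1)) (act V SQ v) = act V SF (act V SP v)"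
    unfolding u_def using T(3)[OF v(1)] T(3)[OF T(2)[of SP v]] by simp
  then have Q: "Qs m V v" unfolding Qs_def using Fn Ev Hv T(3)[OF v(1)] by metis
  obtain \<phi> where \<phi>: "lmod_hom (Vc \<theta> m) V \<phi>" "\<phi> (mon m 0) = v"
    by (rule Vc_universal[OF V(1,3) v(1) Q])
  have "v \<noteq> 0" using v(2) g0 mon_nonzero[of m 0] by auto
  then have "bij_betw \<phi> (carr (Vc \<theta> m)) (carr V)"
    using \<phi>(2) by (intro simple_hom_bij[OF Vc_vmod Vc_simple[OF \<theta>] V(1,2) \<phi>(1), of "mon m 0"]) simp_all
  moreover have "\<phi> 0 = vzero V"
    using linon_zero[OF lmod_homD(1)[OF \<phi>(1) Vc_vmod V(1)]] vo vec.subspace_0[OF subspace_HK] by (simp add: vops_def)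
  ultimately show ?thesis using \<phi>(1) unfolding base_iso_def by blast
qed

text \<open>The model meets the specification in \<open>V_mod\<close>, so the chosen module does
  too, and \<open>schr_module_unique\<close> identifies them.\<close>

lemma V_mod_iso:
  assumes \<theta>: "\<theta> \<noteq> 0" shows "\<exists>f. base_iso (Vc \<theta> (nat \<bar>n\<bar>)) (V_mod n \<theta>) f"
proof -
  let ?P = "\<lambda>V. is_vmod schr_br V \<and> simple_module V \<and> (\<forall>v\<in>carr V. act V SZ v = vscale \<theta> v) \<and>
     lmod_iso (pullback schr_incl V) (dsum {nat \<bar>n\<bar>..} L_mod)"
  have "?P (Vc \<theta> (nat \<bar>n\<bar>))"
    using Vc_vmod Vc_simple[OF \<theta>] Vc_sl2_decomposition by simp
  then have "?P (V_mod n \<theta>)" unfolding V_mod_def by (rule someI[of ?P])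
  then show ?thesis using schr_module_unique[OF \<theta>] by blast
qed

theorem X2_simple_transitive_type_T_infinity:
  assumes "\<theta> \<noteq> 0" shows "simple_transitive sl2_fin (X2 \<theta>) \<and> type_T_infinity (X2 \<theta>)"
  unfolding X2_def
proof (rule tensor_family.simple_transitive_type_T_infinity[OF tensor_family_Vc[OF assms]])
  show "\<exists>i f. base_iso (Vc \<theta> i) M f" if "M \<in> {V_mod n \<theta> | n. True}" for M
    using that V_mod_iso[OF assms] by blast
  show "\<exists>M\<in>{V_mod n \<theta> | n. True}. \<exists>f. base_iso (Vc \<theta> i) M f" for i
    using V_mod_iso[OF assms, of "int i"] by (intro bexI[of _ "V_mod (int i) \<theta>"]) auto
qed

section \<open>Whittaker modules\<close>

text \<open>\<open>vp\<close> and its inverse \<open>pv\<close> identify \<open>vec\<close> with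
  \<complex>[h], the basis vector \<open>bas k\<close> being h^k.\<close>

definition vp :: "vec \<Rightarrow> complex poly" where
  "vp v = Abs_poly (lu v)"

definition pv :: "complex poly \<Rightarrow> vec" where
  "pv p = Abs_poly_mapping (coeff p)"

lemma coeff_vp: "coeff (vp v) = lu v"
proof -
  have "\<forall>\<^sub>\<infinity>n. lu v n = 0" using finite_lookup[of v] by (simp add: MOST_iff_cofinite)
  then show ?thesis by (simp add: vp_def Abs_poly_inverse)
qed

lemma lu_pv: "lu (pv p) = coeff p"
proof -
  have "finite {n. coeff p n \<noteq> 0}" using MOST_coeff_eq_0[of p] by (simp add: MOST_iff_cofinite)
  then show ?thesis by (simp add: pv_def)
qed

lemma vp_pv [simp]: "vp (pv p) = p" and pv_vp [simp]: "pv (vp v) = v"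
  by (rule poly_eqI, simp add: coeff_vp lu_pv) (rule poly_mapping_eqI, simp add: coeff_vp lu_pv)

lemma vp_linear: "vp (u + v) = vp u + vp v" "vp (u - v) = vp u - vp v" "vp (vscale c v) = smult c (vp v)"
  by (rule poly_eqI, simp add: coeff_vp lookup_add lookup_minus)+

lemma vp_zero: "vp 0 = 0"
  by (rule poly_eqI) (simp add: coeff_vp)

lemma vp_bas: "vp (bas k) = monom 1 k"
  by (rule poly_eqI) (simp add: coeff_vp bas_def lookup_single when_def)

definition pe :: "vec \<Rightarrow> complex \<Rightarrow> complex" where
  "pe v t = poly (vp v) t"

text \<open>A complex polynomial is determined by its values. Evaluation turns the shifts in
  \<open>wact\<close> into substitutions, so operator identities become identities between
  numbers.\<close>

lemma pe_ext: "(\<And>t. pe u t = pe v t) \<Longrightarrow> u = v"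
  unfolding pe_def by (metis poly_eq_poly_eq_iff ext pv_vp)

lemma pe_linear: "pe (u + v) t = pe u t + pe v t" "pe (u - v) t = pe u t - pe v t" "pe (vscale c v) t = c * pe v t"
  by (simp_all add: pe_def vp_linear)

lemma pe_bas: "pe (bas k) t = t ^ k"
  by (simp add: pe_def vp_bas poly_monom)

lemma vec_induct [case_names bas add scale]:
  assumes "\<And>k. P (bas k)" "\<And>u v. P u \<Longrightarrow> P v \<Longrightarrow> P (u + v)" "\<And>c v. P v \<Longrightarrow> P (vscale c v)"
  shows "P v"
proof -
  have "P (\<Sum>k\<in>K. vscale (lu v k) (bas k))" if "finite K" for K
    using that
  proof induction
    case empty
    then show ?case using assms(3)[OF assms(1)[of 0], of 0] by simp
  qed (simp add: assms)
  from this[OF finite_keys[of v]] show ?thesis using vec_eq_lext[of v] by (simp add: lext_def)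
qed

text \<open>The action on the quotient of \<open>U(sl\<^sub>2)\<close> by the left ideal generated by \<open>c - s\<^sup>2\<close> and \<open>e - \<xi>\<close>, identified
  with \<open>\<complex>[h]\<close>: \<open>e\<close> and \<open>f\<close> shift the argument of \<open>g(h)\<close> by \<open>-2\<close> and \<open>2\<close>.\<close>

fun wact :: "complex \<Rightarrow> complex \<Rightarrow> sl2 \<Rightarrow> vec \<Rightarrow> vec" where
  "wact \<xi> s E v = pv (smult \<xi> (pcompose (vp v) [:-2, 1:]))"
| "wact \<xi> s F v = pv (smult (1 / (4 * \<xi>)) ([:s^2 - 1, -2, -1:] * pcompose (vp v) [:2, 1:]))"
| "wact \<xi> s H v = pv ([:0, 1:] * vp v)"

lemma pe_wact: "pe (wact \<xi> s E v) t = \<xi> * pe v (t - 2)"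
  "pe (wact \<xi> s F v) t = (s^2 - (t + 1)^2) * pe v (t + 2) / (4 * \<xi>)"
  "pe (wact \<xi> s H v) t = t * pe v t"
proof -
  have "poly [:s^2 - 1, -2, -1:] t = s^2 - (t + 1)^2" by (simp add: power2_eq_square algebra_simps)
  then show "pe (wact \<xi> s F v) t = (s^2 - (t + 1)^2) * pe v (t + 2) / (4 * \<xi>)"
    unfolding wact.simps pe_def vp_pv poly_smult poly_mult by (simp add: poly_pcompose add.commute)
qed (simp_all add: pe_def poly_pcompose)

declare wact.simps [simp del]

lemma wact_linear: "wact \<xi> s b (u + v) = wact \<xi> s b u + wact \<xi> s b v" "wact \<xi> s b (vscale c v) = vscale c (wact \<xi> s b v)"
  by (rule pe_ext, cases b, simp_all add: pe_wact pe_linear algebra_simps add_divide_distrib diff_divide_distrib)+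

lemma lin_wact: "lin (wact \<xi> s b)"
  by (rule linI) (rule wact_linear)+

lemma wact_H_bas: "wact \<xi> s H (bas k) = bas (Suc k)"
  by (rule pe_ext) (simp add: pe_wact pe_bas)

lemma wact_E_bas0: "wact \<xi> s E (bas 0) = vscale \<xi> (bas 0)"
  by (rule pe_ext) (simp add: pe_wact pe_bas pe_linear)

text \<open>The shifts of \<open>e\<close> and \<open>f\<close> cancel, and \<open>4 f e\<close> is
  multiplication by \<open>s^2 - (h + 1)^2\<close>.\<close>

lemma wact_casimir:
  assumes "\<xi> \<noteq> 0"
  shows "wact \<xi> s H (wact \<xi> s H v) + vscale 2 (wact \<xi> s H v) + v + vscale 4 (wact \<xi> s F (wact \<xi> s E v)) = vscale (s^2) v"
  by (rule pe_ext) (use assms in \<open>simp add: pe_wact pe_linear field_simps power2_eq_square\<close>)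

lemma wact_sl2:
  assumes "\<xi> \<noteq> 0"
  shows "wact \<xi> s E (wact \<xi> s F v) = wact \<xi> s F (wact \<xi> s E v) + wact \<xi> s H v"
    "wact \<xi> s H (wact \<xi> s E v) = wact \<xi> s E (wact \<xi> s H v) + vscale 2 (wact \<xi> s E v)"
    "wact \<xi> s H (wact \<xi> s F v) = wact \<xi> s F (wact \<xi> s H v) - vscale 2 (wact \<xi> s F v)"
  by (rule pe_ext, use assms in \<open>simp add: pe_wact pe_linear field_simps power2_eq_square\<close>)+

text \<open>The positive half-integers. Since the square of \<open>\<nu> + 1\<close> is all that
  matters for M(\<nu>,\<xi>), they index the modules up to the sign of
  \<open>\<nu> + 1\<close>.\<close>

definition hw :: "nat \<Rightarrow> complex" where
  "hw i = of_nat i + 1/2"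

lemma hw_nonzero: "hw i \<noteq> 0"
proof
  assume "hw i = 0"
  then have "of_nat (2 * i + 1) = (0 :: complex)" by (simp add: hw_def field_simps)
  then show False unfolding of_nat_eq_0_iff by simp
qed

text \<open>\<open>hw i + hw j = i + j + 1\<close> is never zero. Through the Casimir eigenvalue
  this separates the modules.\<close>

lemma hw_square_inj: "(hw i)^2 = (hw j)^2 \<Longrightarrow> i = j"
proof -
  assume "(hw i)^2 = (hw j)^2"
  then consider "hw i = hw j" | "hw i = - hw j" using power2_eq_iff by blast
  then show "i = j"
  proof cases
    case 2
    have "of_nat (i + j + 1) = hw i + hw j" by (simp add: hw_def)
    also have "\<dots> = 0" using 2 by simp
    finally have "of_nat (i + j + 1) = (0 :: complex)" .
    then show ?thesis unfolding of_nat_eq_0_iff by simp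
  qed (simp add: hw_def)
qed

text \<open>At \<open>i = 0\<close> both sides are 1/4: stepping down from 1/2 gives -1/2, which has
  the same square. This is the loop at \<open>X 0\<close>.\<close>

lemma hw_pred: "(hw (i - 1))^2 = (hw i - 1)^2"
proof (cases i)
  case (Suc j)
  then have "hw i - 1 = hw (i - 1)" by (simp add: hw_def)
  then show ?thesis by (simp only:)
qed (simp add: hw_def power2_eq_square)

lemma hw_succ: "hw (i + 1) = hw i + 1"
  by (simp add: hw_def)

definition Ws :: "complex \<Rightarrow> nat \<Rightarrow> sl2 vobj" where
  "Ws \<xi> i = vmod UNIV (wact \<xi> (hw i))"

lemma Ws_simps [simp]: "carr (Ws \<xi> i) = UNIV" "act (Ws \<xi> i) = wact \<xi> (hw i)"
  by (simp_all add: Ws_def)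

lemma Ws_vmod: "\<xi> \<noteq> 0 \<Longrightarrow> is_vmod sl2_br (Ws \<xi> i)"
  unfolding Ws_def by (rule sl2_vmodI) (simp_all add: lin_imp_linon[OF lin_wact] wact_sl2)

text \<open>Says that \<open>e - \<xi>\<close> and \<open>c - (hw i)^2\<close>, the generators of
  the left ideal, annihilate \<open>v\<close>; the Casimir element is written out as
  \<open>h^2 + 2 h + 1 + 4 f e\<close>.\<close>

definition Qw :: "complex \<Rightarrow> nat \<Rightarrow> sl2 vobj \<Rightarrow> vec \<Rightarrow> bool" where
  "Qw \<xi> i N v \<longleftrightarrow> act N E v = vscale \<xi> v \<and>
     act N H (act N H v) + vscale 2 (act N H v) + v + vscale 4 (act N F (act N E v)) = vscale ((hw i)^2) v"

text \<open>The polynomial takes its value at 0 at infinitely many points.\<close>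

lemma periodic_poly_const:
  fixes p :: "complex poly"
  assumes "pcompose p [:-2, 1:] = p" shows "p = [:poly p 0:]"
proof -
  have per: "poly p (t - 2) = poly p t" for t
    using arg_cong[OF assms, of "\<lambda>q. poly q t"] by (simp add: poly_pcompose)
  have "poly p (- 2 * of_nat k) = poly p 0" for k
  proof (induction k)
    case (Suc k)
    have "- 2 * of_nat (Suc k) = (- 2 * of_nat k - 2 :: complex)" by simp
    then show ?case using per[of "- 2 * of_nat k"] Suc by (simp only:)
  qed simp
  then have "range (\<lambda>k::nat. - 2 * of_nat k) \<subseteq> {t. poly (p - [:poly p 0:]) t = 0}" by auto
  moreover have "infinite (range (\<lambda>k::nat. - 2 * of_nat k :: complex))"
    by (rule range_inj_infinite) (simp add: inj_def)
  ultimately have "infinite {t. poly (p - [:poly p 0:]) t = 0}" using finite_subset by blast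
  then have "p - [:poly p 0:] = 0" using poly_roots_finite by blast
  then show ?thesis by simp
qed

text \<open>As \<open>e\<close> acts by \<xi> times a shift by 2, a Whittaker vector is a periodic
  polynomial, hence constant.\<close>

lemma Ws_whittaker:
  assumes "\<xi> \<noteq> 0" "wact \<xi> s E v = vscale \<xi> v" obtains c where "v = vscale c (bas 0)"
proof -
  have "vp (vscale \<xi> v) = smult \<xi> (pcompose (vp v) [:-2, 1:])" using assms(2)[symmetric] by (simp add: wact.simps)
  then have "smult \<xi> (pcompose (vp v) [:-2, 1:]) = smult \<xi> (vp v)" by (simp add: vp_linear)
  from arg_cong[OF this, of "smult (1 / \<xi>)"] have "pcompose (vp v) [:-2, 1:] = vp v" using assms(1) by simp
  from periodic_poly_const[OF this] have "vp v = [:poly (vp v) 0:]" .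
  then have "v = vscale (poly (vp v) 0) (bas 0)"
    by (intro pe_ext) (simp add: pe_linear pe_bas, metis pe_def poly_const_conv poly_pCons mult_zero_right add.right_neutral poly_0)
  then show thesis by (rule that)
qed

text \<open>A shift preserves degree and leading coefficient, so the leading terms cancel.\<close>

lemma degree_shift_diff:
  fixes p :: "complex poly"
  assumes "degree p > 0" shows "degree (pcompose p [:c, 1:] - p) < degree p"
proof -
  have d: "degree (pcompose p [:c, 1:]) = degree p" by (simp add: degree_pcompose)
  have l: "lead_coeff (pcompose p [:c, 1:]) = lead_coeff p" by (subst lead_coeff_comp) simp_all
  have "coeff (pcompose p [:c, 1:] - p) n = 0" if "n > degree p - 1" for n
  proof (cases "n = degree p")
    case True then show ?thesis using d l by simp
  next
    case False
    then have "n > degree p" using that by simp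
    then show ?thesis using d by (simp add: coeff_eq_0)
  qed
  then have "degree (pcompose p [:c, 1:] - p) \<le> degree p - 1" by (intro degree_le) auto
  then show ?thesis using assms by simp
qed

text \<open>The operator \<open>e / \<xi> - 1\<close> lowers the degree. Induction on the degree
  ends at a vector that it kills, and such a vector is constant.\<close>

lemma Ws_contains_generator:
  assumes \<xi>: "\<xi> \<noteq> 0" and W: "vec.subspace W" "\<And>v. v \<in> W \<Longrightarrow> wact \<xi> s E v \<in> W" and v: "v \<in> W" "v \<noteq> 0"
  shows "bas 0 \<in> W"
  using v
proof (induction "degree (vp v)" arbitrary: v rule: less_induct)
  case less
  define u where "u = vscale (1 / \<xi>) (wact \<xi> s E v) - v"
  have uW: "u \<in> W" unfolding u_def
    by (rule vec.subspace_diff[OF W(1) vec.subspace_scale[OF W(1) W(2)[OF less.prems(1)]] less.prems(1)])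
  have vu: "vp u = pcompose (vp v) [:-2, 1:] - vp v" using \<xi> by (simp add: u_def vp_linear wact.simps)
  show ?case
  proof (cases "u = 0")
    case True
    have "vscale \<xi> u = wact \<xi> s E v - vscale \<xi> v" using \<xi> by (simp add: u_def vec.scale_right_diff_distrib)
    then have "wact \<xi> s E v = vscale \<xi> v" using True by simp
    then obtain c where c: "v = vscale c (bas 0)" by (rule Ws_whittaker[OF \<xi>])
    then have "c \<noteq> 0" using less.prems(2) by auto
    then have "vscale (1 / c) v = bas 0" using c by simp
    then show ?thesis using vec.subspace_scale[OF W(1) less.prems(1), of "1 / c"] by simp
  next
    case False
    have "degree (vp v) > 0"
    proof (rule ccontr)
      assume "\<not> degree (vp v) > 0"
      then obtain c where "vp v = [:c:]" by (metis degree_eq_zeroE gr0I)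
      then have "vp u = vp 0" using vu by (simp add: vp_zero pcompose_pCons)
      then show False using False by (metis pv_vp)
    qed
    then have "degree (vp u) < degree (vp v)" unfolding vu by (rule degree_shift_diff)
    then show ?thesis using less.hyps uW False by blast
  qed
qed

lemma Ws_cyclic:
  assumes W: "vec.subspace W" "\<And>v. v \<in> W \<Longrightarrow> wact \<xi> s H v \<in> W" "bas 0 \<in> W" shows "W = UNIV"
proof -
  have "bas k \<in> W" for k
    by (induction k) (use W(2,3) wact_H_bas[of \<xi> s] in \<open>metis\<close>)+
  then have "v \<in> W" for v by (induction v rule: vec_induct) (simp_all add: vec.subspace_add[OF W(1)] vec.subspace_scale[OF W(1)])
  then show ?thesis by blast
qed

lemma bas_nonzero: "bas k \<noteq> 0"
  using pe_bas[of k 1] pe_linear(3)[of 0 0 1] by auto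

lemma Qw_Ws: "\<xi> \<noteq> 0 \<Longrightarrow> Qw \<xi> i (Ws \<xi> i) (bas 0)"
  unfolding Qw_def Ws_simps using wact_E_bas0 wact_casimir by blast

lemma Ws_simple_family:
  assumes \<xi>: "\<xi> \<noteq> 0" shows "simple_family sl2_br (Ws \<xi>)"
proof (rule simple_familyI[where w = "\<lambda>i. bas 0" and Q = "Qw \<xi>"])
  note vm = Ws_vmod[OF \<xi>]
  fix i j k :: nat and W f v
  show "is_vmod sl2_br (Ws \<xi> i)" by (rule vm)
  show "bas 0 \<in> carr (Ws \<xi> i)" by simp
  show "bas 0 \<noteq> 0" by (rule bas_nonzero)
  show "W = carr (Ws \<xi> i)" if "submodule W (Ws \<xi> i)" "bas 0 \<in> W"
    using that Ws_cyclic[of W \<xi> "hw i"] by (simp add: submodule_iff[OF vm])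
  show "bas 0 \<in> W" if W: "submodule W (Ws \<xi> i)" "W \<noteq> {0}"
  proof -
    have s: "vec.subspace W" "\<And>v. v \<in> W \<Longrightarrow> wact \<xi> (hw i) E v \<in> W" using W(1) by (simp_all add: submodule_iff[OF vm])
    obtain v where "v \<in> W" "v \<noteq> 0" using W(2) vec.subspace_0[OF s(1)] by auto
    then show ?thesis using Ws_contains_generator[where W = W and s = "hw i", OF \<xi> s(1)] s(2) by blast
  qed
  show "Qw \<xi> i (Ws \<xi> i) (bas 0)" by (rule Qw_Ws[OF \<xi>])
  show "Qw \<xi> k (Ws \<xi> j) (f v)" if f: "lmod_hom (Ws \<xi> i) (Ws \<xi> j) f" and Q: "Qw \<xi> k (Ws \<xi> i) v"
  proof -
    note h = lmod_homD[OF f vm vm]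
    have l: "f (a + b) = f a + f b" "f (vscale c a) = vscale c (f a)" for a b c
      using linon_add[OF h(1)] linon_scale[OF h(1)] by simp_all
    have a: "f (wact \<xi> (hw i) b u) = wact \<xi> (hw j) b (f u)" for b u using h(3)[of u b] by simp
    show ?thesis using Q arg_cong[of _ _ f] unfolding Qw_def Ws_simps by (metis l a)
  qed
  show "\<exists>c. v = vscale c (bas 0)" if "Qw \<xi> i (Ws \<xi> j) v"
    using that Ws_whittaker[OF \<xi>] unfolding Qw_def Ws_simps by metis
  show "v = 0" if "i \<noteq> j" "Qw \<xi> i (Ws \<xi> j) v"
  proof -
    have "vscale ((hw j)^2) v = vscale ((hw i)^2) v"
      using that(2) wact_casimir[OF \<xi>, of "hw j" v] unfolding Qw_def Ws_simps by metis
    then have "hw j ^ 2 = hw i ^ 2 \<or> v = 0" by (simp only: vec.scale_cancel_right)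
    then show ?thesis using hw_square_inj[of j i] that(1) by blast
  qed
qed

text \<open>The map sends h^k to \<open>(T H ^^ k) v\<close>, so compatibility with \<open>H\<close>
  is built in. That with \<open>E\<close> and \<open>F\<close> has to be checked at the generator
  and then carried to all powers.\<close>

lemma Ws_universal:
  assumes \<xi>: "\<xi> \<noteq> 0" and N: "is_vmod sl2_br N" and v: "v \<in> carr N" and Q: "Qw \<xi> i N v"
  obtains \<phi> where "lmod_hom (Ws \<xi> i) N \<phi>" "\<phi> (bas 0) = v"
proof -
  obtain T where T: "\<And>b. lin (T b)" "\<And>b v. T b v \<in> carr N" "\<And>b v. v \<in> carr N \<Longrightarrow> T b v = act N b v"
    "\<And>x y v. T x (T y v) = T y (T x v) + lc T (sl2_br x y) v" by (rule total_action[OF N]) (rule that)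
  interpret sl2_ops "T E" "T F" "T H" by (rule sl2_ops_total[OF T(1,4)])
  let ?s = "hw i"
  let ?W = "wact \<xi> ?s"
  define \<phi> where "\<phi> = lext (\<lambda>k. (T H ^^ k) v)"
  have l\<phi>: "lin \<phi>" by (simp add: \<phi>_def lin_lext)
  have b\<phi>: "\<phi> (bas k) = (T H ^^ k) v" for k by (simp add: \<phi>_def)
  note l = lin_add[OF l\<phi>] lin_scale[OF l\<phi>] lin_diff[OF l\<phi>]
  have Hk: "(T H ^^ k) v \<in> carr N" for k by (induction k) (simp_all add: v T(2))
  have in_N: "\<phi> u \<in> carr N" for u
    by (induction u rule: vec_induct)
      (simp_all add: b\<phi> Hk l vec.subspace_add[OF vmod_subspace[OF N]] vec.subspace_scale[OF vmod_subspace[OF N]])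
  have H: "\<phi> (?W H u) = T H (\<phi> u)" for u
    by (induction u rule: vec_induct) (simp_all add: wact_H_bas b\<phi> l wact_linear lins)
  have Tv: "T E v = vscale \<xi> v" "T H (T H v) + vscale 2 (T H v) + v + vscale 4 (T F (T E v)) = vscale (?s^2) v"
  proof -
    show e: "T E v = vscale \<xi> v" using Q T(3)[OF v] by (simp add: Qw_def)
    show "T H (T H v) + vscale 2 (T H v) + v + vscale 4 (T F (T E v)) = vscale (?s^2) v"
      unfolding T(3)[OF v] T(3)[OF vmod_act[OF N v]] by (rule conjunct2[OF Q[unfolded Qw_def]])
  qed
  \<comment> \<open>With \<open>e v = \<xi> v\<close> the Casimir equation can be solved for
    \<open>f v\<close> in terms of \<open>h\<close>; the same formula holds for the generator of the
    model.\<close>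
  have F0: "vscale (4 * \<xi>) (T F v) = vscale (?s^2) v - (T H (T H v) + vscale 2 (T H v) + v)"
    using Tv(2) unfolding Tv(1) by (simp add: lins algebra_simps)
  have "vscale (4 * \<xi>) (?W F (bas 0)) = vscale (?s^2) (bas 0) - (?W H (?W H (bas 0)) + vscale 2 (?W H (bas 0)) + bas 0)"
    using wact_casimir[OF \<xi>, of ?s "bas 0"] unfolding wact_E_bas0 by (simp add: wact_linear algebra_simps)
  from arg_cong[OF this, of \<phi>] have "vscale (4 * \<xi>) (\<phi> (?W F (bas 0))) = vscale (4 * \<xi>) (T F v)"
    unfolding F0 by (simp add: l H b\<phi>)
  then have F1: "\<phi> (?W F (bas 0)) = T F v" using \<xi> by (simp add: vec.scale_cancel_left)
  \<comment> \<open>The brackets with \<open>H\<close> carry compatibility with \<open>E\<close> and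
    \<open>F\<close> from one power of h to the next.\<close>
  have E: "\<phi> (?W E (bas k)) = T E (\<phi> (bas k)) \<and> \<phi> (?W F (bas k)) = T F (\<phi> (bas k))" for k
  proof (induction k)
    case 0 then show ?case using F1 by (simp add: wact_E_bas0 l b\<phi> Tv(1))
  next
    case (Suc k)
    have "?W E (?W H (bas k)) = ?W H (?W E (bas k)) - vscale 2 (?W E (bas k))"
      "?W F (?W H (bas k)) = ?W H (?W F (bas k)) + vscale 2 (?W F (bas k))"
      using wact_sl2(2,3)[OF \<xi>, of ?s "bas k"] by simp_all
    then have "\<phi> (?W E (bas (Suc k))) = T H (T E (\<phi> (bas k))) - vscale 2 (T E (\<phi> (bas k)))"
      "\<phi> (?W F (bas (Suc k))) = T H (T F (\<phi> (bas k))) + vscale 2 (T F (\<phi> (bas k)))"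
      using Suc unfolding wact_H_bas by (simp_all add: l H)
    then show ?case by (simp add: b\<phi> he hf)
  qed
  have "\<phi> (?W b u) = T b (\<phi> u)" for b u
  proof (cases b)
    case E': E show ?thesis unfolding E' by (induction u rule: vec_induct) (simp_all add: E l wact_linear lins)
  next
    case F show ?thesis unfolding F by (induction u rule: vec_induct) (simp_all add: E l wact_linear lins)
  qed (simp add: H)
  then have "lmod_hom (Ws \<xi> i) N \<phi>"
    by (intro lmod_homI[OF Ws_vmod[OF \<xi>] N lin_imp_linon[OF l\<phi>] in_N]) (simp add: T(3)[OF in_N])
  then show thesis by (rule that) (simp add: b\<phi>)
qed

section \<open>Decomposing the tensor product of L(1) and a Whittaker module\<close>

locale std2_tensor_Ws = std2_module A x y for A x y +
  fixes \<xi> :: complex and i :: nat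
  assumes \<xi>: "\<xi> \<noteq> 0"
begin

abbreviation "S \<equiv> tensor_mod A (Ws \<xi> i)"
abbreviation "W \<equiv> wact \<xi> (hw i)"

lemma S_vmod: "is_vmod sl2_br S"
  by (rule tensor_mod_vmod[OF A_vmod Ws_vmod[OF \<xi>]])

lemma S_in: "tensor_vec x v \<in> carr S" "tensor_vec y v \<in> carr S"
  using xy by (simp_all add: tensor_in_tspace)

lemma S_act: "act S b (tensor_vec x v + tensor_vec y w) = act S b (tensor_vec x v) + act S b (tensor_vec y w)"
  by (rule linon_add[OF vmod_linon[OF S_vmod] S_in(1) S_in(2)])

lemma S_act_xy:
  "act S E (tensor_vec x v + tensor_vec y w) = tensor_vec x (W E v + w) + tensor_vec y (W E w)"
  "act S F (tensor_vec x v + tensor_vec y w) = tensor_vec x (W F v) + tensor_vec y (v + W F w)"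
  "act S H (tensor_vec x v + tensor_vec y w) = tensor_vec x (W H v + v) + tensor_vec y (W H w - w)"
  using act_tensor_mod[OF A_vmod Ws_vmod[OF \<xi>], of x v] act_tensor_mod[OF A_vmod Ws_vmod[OF \<xi>], of y w] xy
  by (simp_all add: S_act A_act tensor_add_right tensor_diff_right tensor_uminus_left)

text \<open>For \<open>x \<otimes> a + y \<otimes> 1\<close> to be a Whittaker vector,
  \<open>e a + 1 = \<xi> a\<close> is required, that is \<open>a(h) - a(h - 2) = 1 / \<xi>\<close>.
  The polynomial solutions are \<open>(h + \<alpha>) / (2 \<xi>)\<close> with a free constant
  \<alpha>.\<close>

definition wv :: "complex \<Rightarrow> vec" where
  "wv \<alpha> = vscale (1 / (2 * \<xi>)) (bas 1 + vscale \<alpha> (bas 0))"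

definition wt :: "complex \<Rightarrow> vec" where
  "wt \<alpha> = tensor_vec x (wv \<alpha>) + tensor_vec y (bas 0)"

lemma wt_in: "wt \<alpha> \<in> carr S"
  unfolding wt_def by (rule vec.subspace_add[OF vmod_subspace[OF S_vmod] S_in])

lemma wt_E: "act S E (wt \<alpha>) = vscale \<xi> (wt \<alpha>)"
proof -
  have "W E (wv \<alpha>) + bas 0 = vscale \<xi> (wv \<alpha>)"
    by (rule pe_ext) (use \<xi> in \<open>simp add: wv_def pe_wact pe_linear pe_bas field_simps\<close>)
  then show ?thesis
    unfolding wt_def S_act_xy wact_E_bas0 by (simp add: tensor_scale_right vec.scale_right_distrib)
qed

text \<open>The free constant is fixed by asking for a Casimir eigenvector. With
  \<open>s = hw i\<close> the condition allows \<open>\<alpha> = 1 + s\<close> and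
  \<open>\<alpha> = 1 - s\<close>, with eigenvalues \<open>(s + 1)^2\<close> and
  \<open>(s - 1)^2\<close>.\<close>

lemma wt_casimir:
  assumes "(\<alpha> - 1)^2 = (hw i)^2"
  shows "act S H (act S H (wt \<alpha>)) + vscale 2 (act S H (wt \<alpha>)) + wt \<alpha> + vscale 4 (act S F (act S E (wt \<alpha>))) =
    vscale ((hw i)^2 + 2 * \<alpha> - 1) (wt \<alpha>)"
proof -
  let ?s = "hw i" and ?a = "wv \<alpha>"
  have e: "vscale (1 / \<xi>) (wt \<alpha>) \<in> carr S" by (rule vec.subspace_scale[OF vmod_subspace[OF S_vmod] wt_in])
  have F: "act S F (act S E (wt \<alpha>)) = vscale \<xi> (tensor_vec x (W F ?a) + tensor_vec y (?a + W F (bas 0)))"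
    unfolding wt_E linon_scale[OF vmod_linon[OF S_vmod] wt_in] by (simp only: wt_def S_act_xy)
  let ?x = "W H (W H ?a + ?a) + (W H ?a + ?a) + vscale 2 (W H ?a + ?a) + ?a + vscale (4 * \<xi>) (W F ?a)"
  let ?y = "W H (W H (bas 0) - bas 0) - (W H (bas 0) - bas 0) + vscale 2 (W H (bas 0) - bas 0) + bas 0
    + vscale (4 * \<xi>) (?a + W F (bas 0))"
  have "act S H (act S H (wt \<alpha>)) + vscale 2 (act S H (wt \<alpha>)) + wt \<alpha> + vscale 4 (act S F (act S E (wt \<alpha>))) =
    tensor_vec x ?x + tensor_vec y ?y"
    unfolding F unfolding wt_def S_act_xy unfolding tensor_add_right tensor_scale_right tensor_diff_right
    by (rule poly_mapping_eqI, simp only: lookup_add lookup_minus lookup_vscale) (simp add: algebra_simps)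
  also have "?x = vscale (?s^2 + 2 * \<alpha> - 1) ?a"
  proof (rule pe_ext)
    fix t
    have "pe ?x t = ((t + 2)^2 * (t + \<alpha>) + (?s^2 - (t + 1)^2) * (t + 2 + \<alpha>)) / (2 * \<xi>)"
      by (simp only: wv_def pe_wact pe_linear pe_bas) (use \<xi> in \<open>simp add: field_simps power2_eq_square\<close>)
    \<comment> \<open>The term not proportional to \<open>t + \<alpha>\<close> is the obstruction to
      being an eigenvector; the hypothesis on \<alpha> removes it.\<close>
    also have "(t + 2)^2 * (t + \<alpha>) + (?s^2 - (t + 1)^2) * (t + 2 + \<alpha>) =
      (?s^2 + 2 * \<alpha> - 1) * (t + \<alpha>) + 2 * (?s^2 - (\<alpha> - 1)^2)" by (simp add: power2_eq_square algebra_simps)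
    finally show "pe ?x t = pe (vscale (?s^2 + 2 * \<alpha> - 1) ?a) t"
      using assms \<xi> by (simp add: wv_def pe_linear pe_bas)
  qed
  also have "?y = vscale (?s^2 + 2 * \<alpha> - 1) (bas 0)"
    by (rule pe_ext, simp only: wv_def pe_wact pe_linear pe_bas) (use \<xi> in \<open>simp add: field_simps power2_eq_square\<close>)
  finally show ?thesis by (simp add: wt_def tensor_scale_right vec.scale_right_distrib)
qed

lemma Qw_wt: "Qw \<xi> (i + 1) S (wt (1 + hw i))" "Qw \<xi> (i - 1) S (wt (1 - hw i))"
proof -
  have "(hw i)^2 + 2 * (1 + hw i) - 1 = (hw (i + 1))^2" unfolding hw_succ by (simp add: power2_eq_square algebra_simps)
  then show "Qw \<xi> (i + 1) S (wt (1 + hw i))" unfolding Qw_def using wt_casimir[of "1 + hw i"] by (simp add: wt_E)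
  have "(hw i)^2 + 2 * (1 - hw i) - 1 = (hw (i - 1))^2" unfolding hw_pred by (simp add: power2_eq_square algebra_simps)
  then show "Qw \<xi> (i - 1) S (wt (1 - hw i))" unfolding Qw_def using wt_casimir[of "1 - hw i"] by (simp add: wt_E)
qed

lemma wt_nonzero: "wt \<alpha> \<noteq> 0"
proof
  assume "wt \<alpha> = 0"
  then have "tensor_vec x (wv \<alpha>) + tensor_vec y (bas 0) = 0" by (simp only: wt_def)
  from tensor_independent[OF A_ind this] show False using bas_nonzero by blast
qed

text \<open>The two vectors differ by \<open>hw i / \<xi>\<close> times
  \<open>x \<otimes> 1\<close>, which is nonzero. From \<open>x \<otimes> 1\<close> the action of
  \<open>h\<close> yields \<open>x \<otimes> h\<close>, and subtracting the first component of
  \<open>wt\<close> leaves \<open>y \<otimes> 1\<close>.\<close>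

lemma generated:
  assumes U: "submodule U S" and u: "wt (1 + hw i) \<in> U" "wt (1 - hw i) \<in> U" shows "U = carr S"
proof (rule tensor_generated[OF A_vmod Ws_vmod[OF \<xi>] U, where w = "bas 0"])
  have U': "vec.subspace U" "\<And>b v. v \<in> U \<Longrightarrow> act S b v \<in> U" using U by (auto simp: submodule_iff[OF S_vmod])
  have "wt (1 + hw i) - wt (1 - hw i) = vscale (hw i / \<xi>) (tensor_vec x (bas 0))"
    unfolding wt_def wv_def tensor_scale_right tensor_add_right
    by (rule poly_mapping_eqI, simp only: lookup_add lookup_minus lookup_vscale) (use \<xi> in \<open>simp add: field_simps\<close>)
  then have "vscale (hw i / \<xi>) (tensor_vec x (bas 0)) \<in> U" using vec.subspace_diff[OF U'(1) u] by simp
  from vec.subspace_scale[OF U'(1) this, of "\<xi> / hw i"]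
  show x: "tensor_vec x (bas 0) \<in> U" using \<xi> hw_nonzero by simp
  have "act S H (tensor_vec x (bas 0)) = tensor_vec x (bas 1) + tensor_vec x (bas 0)"
    using S_act_xy(3)[of "bas 0" 0] wact_H_bas[of \<xi> "hw i" 0] lin_zero[OF lin_wact, of \<xi> "hw i" H]
    by (simp add: tensor_add_right)
  then have "tensor_vec x (bas 1) + tensor_vec x (bas 0) \<in> U" using U'(2)[OF x, of H] by simp
  from vec.subspace_diff[OF U'(1) this x] have "tensor_vec x (bas 1) \<in> U" by simp
  then have "tensor_vec x (wv (1 + hw i)) \<in> U"
    unfolding wv_def tensor_scale_right tensor_add_right using x
    by (intro vec.subspace_scale[OF U'(1)] vec.subspace_add[OF U'(1)])
  from vec.subspace_diff[OF U'(1) u(1) this] show "tensor_vec y (bas 0) \<in> U" by (simp add: wt_def)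
  show "carr A = vec.span {x, y}" by (rule A_span)
  show "bas 0 \<in> carr (Ws \<xi> i)" by simp
  show "N = carr (Ws \<xi> i)" if "submodule N (Ws \<xi> i)" "bas 0 \<in> N" for N
    using that Ws_cyclic[of N \<xi> "hw i"] by (simp add: submodule_iff[OF Ws_vmod[OF \<xi>]])
qed

end

lemma tensor_family_Ws: "\<xi> \<noteq> 0 \<Longrightarrow> tensor_family sl2_br (Ws \<xi>) (\<lambda>A. A)"
proof (intro tensor_family.intro Ws_simple_family restriction_id tensor_family_axioms.intro)
  fix A x y and i :: nat assume \<xi>: "\<xi> \<noteq> 0" and "std2 A x y"
  then interpret std2_tensor_Ws A x y \<xi> i by unfold_locales
  obtain \<phi> where \<phi>: "lmod_hom (Ws \<xi> (i - 1)) S \<phi>" "\<phi> (bas 0) = wt (1 - hw i)"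
    by (rule Ws_universal[OF \<xi> S_vmod wt_in Qw_wt(2)])
  obtain \<psi> where \<psi>: "lmod_hom (Ws \<xi> (i + 1)) S \<psi>" "\<psi> (bas 0) = wt (1 + hw i)"
    by (rule Ws_universal[OF \<xi> S_vmod wt_in Qw_wt(1)])
  have m: "bas 0 \<in> carr (Ws \<xi> j)" for j by simp
  let ?W = "vec.span (\<phi> ` carr (Ws \<xi> (i - 1)) \<union> \<psi> ` carr (Ws \<xi> (i + 1)))"
  have "\<phi> (bas 0) \<in> ?W" "\<psi> (bas 0) \<in> ?W"
    by (rule vec.span_base, rule UnI1, rule imageI, rule m) (rule vec.span_base, rule UnI2, rule imageI, rule m)
  then have uW: "wt (1 - hw i) \<in> ?W" "wt (1 + hw i) \<in> ?W" by (simp_all only: \<phi>(2) \<psi>(2))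
  have "?W = carr S"
    by (rule generated[OF span_union_submodule[OF Ws_vmod[OF \<xi>] Ws_vmod[OF \<xi>] S_vmod \<phi>(1) \<psi>(1)] uW(2,1)])
  then have sp: "carr S = ?W" by (rule sym)
  have nz: "\<phi> (bas 0) \<noteq> 0" "\<psi> (bas 0) \<noteq> 0"
    unfolding \<phi>(2) \<psi>(2) by (rule wt_nonzero)+
  show "\<exists>\<phi> \<psi> u v. lmod_hom (Ws \<xi> (i - 1)) S \<phi> \<and> u \<in> carr (Ws \<xi> (i - 1)) \<and> \<phi> u \<noteq> 0 \<and>
      lmod_hom (Ws \<xi> (i + 1)) S \<psi> \<and> v \<in> carr (Ws \<xi> (i + 1)) \<and> \<psi> v \<noteq> 0 \<and>
      carr S = vec.span (\<phi> ` carr (Ws \<xi> (i - 1)) \<union> \<psi> ` carr (Ws \<xi> (i + 1)))"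
    by (rule exI[of _ \<phi>], rule exI[of _ \<psi>], rule exI[of _ "bas 0"], rule exI[of _ "bas 0"])
      (intro conjI \<phi>(1) \<psi>(1) m nz sp)
qed

section \<open>Quotients of the enveloping algebra\<close>

lemma poly_mapping_single_induct [case_names single add]:
  fixes f :: "'k \<Rightarrow>\<^sub>0 'r::comm_monoid_add"
  assumes "\<And>k v. P (Poly_Mapping.single k v)" "\<And>f g. P f \<Longrightarrow> P g \<Longrightarrow> P (f + g)"
  shows "P f"
proof -
  have "P (\<Sum>k\<in>K. Poly_Mapping.single k (Poly_Mapping.lookup f k))" if "finite K" for K
    using that
  proof induction
    case empty then show ?case using assms(1)[of undefined 0] by simp
  qed (simp add: assms)
  moreover have "(\<Sum>k\<in>Poly_Mapping.keys f. Poly_Mapping.single k (Poly_Mapping.lookup f k)) = f"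
    by (rule poly_mapping_eqI) (simp add: lookup_sum lookup_single when_def in_keys_iff)
  ultimately show ?thesis by (metis finite_keys)
qed

lemma uconst_simps:
  "uconst (a + b) = uconst a + uconst b" "uconst (a * b) = uconst a * uconst b" "uconst 0 = 0" "uconst 1 = 1"
  and uconst_commute: "uconst a * u = u * uconst a"
proof -
  show "uconst (a + b) = uconst a + uconst b"
    by transfer (simp add: fconst_def single_add usl2_rel_def two_sided_ideal.zero)
  show "uconst (a * b) = uconst a * uconst b"
    by transfer (simp add: fconst_def mult_single plus_list_def usl2_rel_def two_sided_ideal.zero)
  show "uconst 0 = 0"
    by transfer (simp add: fconst_def usl2_rel_def two_sided_ideal.zero)
  show "uconst 1 = 1"
    by transfer (simp add: fconst_def usl2_rel_def two_sided_ideal.zero single_one[symmetric] zero_list_def del: single_one)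
  show "uconst a * u = u * uconst a"
  proof transfer
    fix a and u :: "sl2 free_alg"
    have "fconst a * u = u * fconst a"
    proof (induction u rule: poly_mapping_single_induct)
      case (single k v)
      then show ?case by (simp add: fconst_def mult_single plus_list_def mult.commute)
    qed (simp add: distrib_left distrib_right)
    then show "usl2_rel (fconst a * u) (u * fconst a)" by (simp add: usl2_rel_def two_sided_ideal.zero)
  qed
qed

lemma uconst_diff: "uconst (a - b) = uconst a - uconst b"
  using uconst_simps(1)[of "a - b" b] by simp

lemma uconst_numeral: "uconst (numeral n) = numeral n"
proof -
  have "uconst (of_nat m) = of_nat m" for m by (induction m) (simp_all add: uconst_simps)
  then show ?thesis by (metis of_nat_numeral)
qed

lemma ugen_bracket:
  "ugen E * ugen F = ugen F * ugen E + ugen H"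
  "ugen H * ugen E = ugen E * ugen H + uconst 2 * ugen E"
  "ugen H * ugen F = ugen F * ugen H - uconst 2 * ugen F"
proof -
  have r: "fgen x * fgen y - fgen y * fgen x - (\<Sum>(c, b)\<leftarrow>sl2_br x y. fconst c * fgen b) \<in> two_sided_ideal (lie_relations sl2_br)" for x y
    using two_sided_ideal.gen[of "fgen x * fgen y - fgen y * fgen x - (\<Sum>(c, b)\<leftarrow>sl2_br x y. fconst c * fgen b)" "lie_relations sl2_br" 1 1]
    by (auto simp: lie_relations_def)
  have one: "fconst 1 = (1 :: sl2 free_alg)" by (simp add: fconst_def single_one[symmetric] zero_list_def del: single_one)
  have neg: "fconst (-2) = - (fconst 2 :: sl2 free_alg)" by (simp add: fconst_def single_uminus)
  show "ugen E * ugen F = ugen F * ugen E + ugen H"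
    by transfer (use r[of E F] in \<open>simp add: usl2_rel_def one algebra_simps\<close>)
  show "ugen H * ugen E = ugen E * ugen H + uconst 2 * ugen E"
    by transfer (use r[of H E] in \<open>simp add: usl2_rel_def algebra_simps\<close>)
  show "ugen H * ugen F = ugen F * ugen H - uconst 2 * ugen F"
    by transfer (use r[of H F] in \<open>simp add: usl2_rel_def neg algebra_simps\<close>)
qed

text \<open>Words span the algebra, and a word arises by repeated left multiplication with
  generators.\<close>

lemma usl2_induct [case_names const gen add]:
  assumes "\<And>c. P (uconst c)" "\<And>b u. P u \<Longrightarrow> P (ugen b * u)" "\<And>u v. P u \<Longrightarrow> P v \<Longrightarrow> P (u + v)"
  shows "P u"
proof -
  have s: "P (abs_usl2 (Poly_Mapping.single w c))" for w c
  proof (induction w)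
    case Nil
    have "abs_usl2 (Poly_Mapping.single [] c) = uconst c" by (simp add: uconst.abs_eq fconst_def)
    then show ?case using assms(1) by simp
  next
    case (Cons b w)
    have "ugen b * abs_usl2 (Poly_Mapping.single w c) = abs_usl2 (Poly_Mapping.single (b # w) c)"
      by (simp add: ugen.abs_eq times_usl2.abs_eq fgen_def mult_single plus_list_def)
    then show ?case using assms(2)[OF Cons] by metis
  qed
  have "P (abs_usl2 a)" for a
  proof (induction a rule: poly_mapping_single_induct)
    case (add f g)
    then show ?case using assms(3) by (simp add: plus_usl2.abs_eq[symmetric])
  qed (rule s)
  then show ?thesis by (metis Quotient3_abs_rep Quotient3_usl2)
qed

text \<open>A word acts by composing its letters. This makes \<open>vec\<close> a module over the
  free algebra, and over the enveloping algebra once the relations act as zero.\<close>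

definition word_act :: "('b \<Rightarrow> vec \<Rightarrow> vec) \<Rightarrow> 'b free_alg \<Rightarrow> vec \<Rightarrow> vec" where
  "word_act T a v = (\<Sum>w\<in>Poly_Mapping.keys a. vscale (Poly_Mapping.lookup a w) (foldr T w v))"

lemma word_act_superset:
  "finite K \<Longrightarrow> Poly_Mapping.keys a \<subseteq> K \<Longrightarrow> word_act T a v = (\<Sum>w\<in>K. vscale (Poly_Mapping.lookup a w) (foldr T w v))"
  unfolding word_act_def by (rule sum.mono_neutral_left) (auto simp: in_keys_iff)

lemma word_act_add: "word_act T (a + b) v = word_act T a v + word_act T b v"
proof -
  let ?K = "Poly_Mapping.keys a \<union> Poly_Mapping.keys b"
  have "Poly_Mapping.keys (a + b) \<subseteq> ?K" by (rule keys_add)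
  then show ?thesis
    using word_act_superset[of ?K "a + b" T v] word_act_superset[of ?K a T v] word_act_superset[of ?K b T v]
    by (simp add: lookup_add vec.scale_left_distrib sum.distrib)
qed

lemma word_act_single: "word_act T (Poly_Mapping.single w c) v = vscale c (foldr T w v)"
  by (cases "c = 0") (simp_all add: word_act_def)

lemma word_act_diff: "word_act T (a - b) v = word_act T a v - word_act T b v"
  using word_act_add[of T "a - b" b v] by simp

context
  fixes T :: "'b \<Rightarrow> vec \<Rightarrow> vec"
  assumes T: "\<And>b. lin (T b)"
begin

lemma lin_foldr: "lin (foldr T w)"
  by (induction w) (auto intro!: linI simp: lin_add[OF T] lin_scale[OF T] lin_add lin_scale)

lemma lin_word_act: "lin (word_act T a)"
  unfolding word_act_def
  by (rule linI) (simp_all add: lin_add[OF lin_foldr] lin_scale[OF lin_foldr] vec.scale_right_distrib sum.distrib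
      vec.scale_sum_right mult.commute)

lemma word_act_mult: "word_act T (a * b) v = word_act T a (word_act T b v)"
proof (induction a rule: poly_mapping_single_induct)
  case (single w c)
  show ?case
  proof (induction b rule: poly_mapping_single_induct)
    case (single w' c')
    show ?case by (simp add: mult_single plus_list_def word_act_single lin_scale[OF lin_foldr])
  qed (simp add: distrib_left word_act_add lin_add[OF lin_word_act])
qed (simp add: distrib_right word_act_add)

lemma word_act_relations:
  assumes rel: "\<And>x y v. T x (T y v) = T y (T x v) + lc T (br x y) v"
    and a: "a \<in> two_sided_ideal (lie_relations br)"
  shows "word_act T a v = 0"
  using a
proof (induction arbitrary: v)
  case zero then show ?case by (simp add: word_act_def)
next
  case (gen s a b)
  have g: "word_act T (fgen x) v = T x v" "word_act T (fconst c) v = vscale c v" for x c v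
    by (simp_all add: fgen_def fconst_def word_act_single)
  obtain x y where s: "s = fgen x * fgen y - fgen y * fgen x - (\<Sum>(c, b)\<leftarrow>br x y. fconst c * fgen b)"
    using gen by (auto simp: lie_relations_def)
  have l: "word_act T (\<Sum>(c, b)\<leftarrow>l. fconst c * fgen b) v = lc T l v" for l v
    by (induction l) (auto simp: lc_def word_act_add word_act_mult g, simp add: word_act_def)
  have "word_act T s v = 0" for v
    unfolding s word_act_diff word_act_mult g l using rel[of x y v] by simp
  then show ?case by (simp add: word_act_mult lin_zero[OF lin_word_act])
qed (simp add: word_act_add)

end

context
  fixes \<xi> s :: complex
  assumes \<xi>: "\<xi> \<noteq> 0"
begin

text \<open>Computed on a chosen representative; \<open>urho_abs\<close> shows independence of the
  choice.\<close>

definition urho :: "usl2 \<Rightarrow> vec \<Rightarrow> vec" where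
  "urho u = word_act (wact \<xi> s) (rep_usl2 u)"

lemma urho_abs: "urho (abs_usl2 a) v = word_act (wact \<xi> s) a v"
proof -
  have rel: "wact \<xi> s x (wact \<xi> s y v) = wact \<xi> s y (wact \<xi> s x v) + lc (wact \<xi> s) (sl2_br x y) v" for x y v
    by (cases x; cases y) (simp_all add: lc_def wact_sl2[OF \<xi>])
  have "usl2_rel (rep_usl2 (abs_usl2 a)) a"
    by (metis Quotient3_rel_rep Quotient3_rep_abs Quotient3_usl2 equivp_reflp equivp_usl2_rel)
  then have "word_act (wact \<xi> s) (rep_usl2 (abs_usl2 a) - a) v = 0"
    unfolding usl2_rel_def by (rule word_act_relations[OF lin_wact rel])
  then show ?thesis by (simp add: urho_def word_act_diff)
qed

lemma urho_simps: "urho (u + u') v = urho u v + urho u' v" "urho (u * u') v = urho u (urho u' v)"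
  "urho (ugen b) v = wact \<xi> s b v" "urho (uconst c) v = vscale c v" "urho u 0 = 0"
proof -
  obtain a a' where a: "u = abs_usl2 a" "u' = abs_usl2 a'" by (metis Quotient3_abs_rep Quotient3_usl2)
  show "urho (u + u') v = urho u v + urho u' v" "urho (u * u') v = urho u (urho u' v)" "urho u 0 = 0"
    unfolding a by (simp_all add: plus_usl2.abs_eq times_usl2.abs_eq urho_abs word_act_add word_act_mult lin_wact
        lin_zero[OF lin_word_act])
  show "urho (ugen b) v = wact \<xi> s b v" "urho (uconst c) v = vscale c v"
    by (simp_all add: ugen.abs_eq uconst.abs_eq urho_abs fgen_def fconst_def word_act_single)
qed

definition wJ :: "usl2 set" where
  "wJ = left_ideal {casimir - uconst (s^2), ugen E - uconst \<xi>}"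

lemma urho_diff: "urho (u - u') v = urho u v - urho u' v"
  using urho_simps(1)[of "u - u'" u' v] by simp

lemma urho_casimir: "urho casimir v = vscale (s^2) v"
proof -
  have c: "casimir = ugen H * ugen H + uconst 2 * ugen H + uconst 1 + uconst 4 * (ugen F * ugen E)"
    by (simp add: casimir_def power2_eq_square algebra_simps uconst_numeral uconst_simps mult_2)
  show ?thesis unfolding c urho_simps using wact_casimir[OF \<xi>, of s v] by simp
qed

text \<open>The left ideal annihilates the generator of the model, so acting on \<open>bas 0\<close>
  is well defined on cosets. This keeps distinct polynomials in h distinct modulo the ideal.\<close>

lemma urho_wJ: "u \<in> wJ \<Longrightarrow> urho u (bas 0) = 0"
  unfolding wJ_def
proof (induction rule: left_ideal.induct)
  case (2 g a)
  then have "urho g (bas 0) = 0" by (auto simp: urho_diff urho_casimir urho_simps wact_E_bas0)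
  then show ?case by (simp add: urho_simps)
next
  case 1 then show ?case using urho_simps(4)[of 0 "bas 0"] by (simp add: uconst_simps)
qed (simp add: urho_simps)

lemma wJ_mult: "u \<in> wJ \<Longrightarrow> a * u \<in> wJ"
  unfolding wJ_def
proof (induction rule: left_ideal.induct)
  case (2 g b)
  then show ?case using left_ideal.intros(2)[of g _ "a * b"] by (simp add: mult.assoc)
qed (auto simp: distrib_left intro: left_ideal.intros)

lemma wJ_zero: "0 \<in> wJ" and wJ_add: "u \<in> wJ \<Longrightarrow> u' \<in> wJ \<Longrightarrow> u + u' \<in> wJ"
  unfolding wJ_def by (rule left_ideal.intros, assumption?)+

lemma wJ_uminus: "u \<in> wJ \<Longrightarrow> - u \<in> wJ"
  using wJ_mult[of u "- 1"] by simp

lemma wJ_diff: "u \<in> wJ \<Longrightarrow> u' \<in> wJ \<Longrightarrow> u - u' \<in> wJ"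
  using wJ_add[OF _ wJ_uminus, of u u'] by simp

lemma wJ_gens: "casimir - uconst (s^2) \<in> wJ" "ugen E - uconst \<xi> \<in> wJ"
  using left_ideal.intros(2)[of "casimir - uconst (s^2)" _ 1] left_ideal.intros(2)[of "ugen E - uconst \<xi>" _ 1]
  unfolding wJ_def by simp_all

text \<open>The polynomial \<open>v\<close> evaluated at the element h of the enveloping
  algebra.\<close>

definition uh :: "vec \<Rightarrow> usl2" where
  "uh v = (\<Sum>k\<in>Poly_Mapping.keys v. uconst (lu v k) * ugen H ^ k)"

lemma uh_superset: "finite K \<Longrightarrow> Poly_Mapping.keys v \<subseteq> K \<Longrightarrow> uh v = (\<Sum>k\<in>K. uconst (lu v k) * ugen H ^ k)"
  unfolding uh_def by (rule sum.mono_neutral_left) (auto simp: in_keys_iff uconst_simps)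

lemma uh_add: "uh (u + v) = uh u + uh v"
proof -
  let ?K = "Poly_Mapping.keys u \<union> Poly_Mapping.keys v"
  have "Poly_Mapping.keys (u + v) \<subseteq> ?K" by (rule keys_add)
  then show ?thesis using uh_superset[of ?K "u + v"] uh_superset[of ?K u] uh_superset[of ?K v]
    by (simp add: lookup_add uconst_simps distrib_right sum.distrib)
qed

lemma uh_scale: "uh (vscale c v) = uconst c * uh v"
proof -
  have "Poly_Mapping.keys (vscale c v) \<subseteq> Poly_Mapping.keys v" by (metis in_keys_iff lookup_vscale mult_zero_right subsetI)
  then show ?thesis using uh_superset[of "Poly_Mapping.keys v" "vscale c v"]
    by (simp add: uh_def uconst_simps sum_distrib_left mult.assoc)
qed

lemma uh_diff: "uh (u - v) = uh u - uh v"
  using uh_add[of "u - v" v] by simp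

lemma uh_bas: "uh (bas k) = ugen H ^ k"
  by (simp add: uh_def bas_def uconst_simps)

lemma uh_H: "uh (wact \<xi> s H v) = ugen H * uh v"
proof (induction v rule: vec_induct)
  case (scale c v)
  have "uconst c * (ugen H * uh v) = ugen H * (uconst c * uh v)" by (metis mult.assoc uconst_commute)
  then show ?case using scale by (simp add: wact_linear uh_scale)
qed (simp_all add: wact_H_bas uh_bas wact_linear uh_add distrib_left)

text \<open>Modulo the left ideal, left multiplication by \<open>e\<close> or \<open>f\<close> on
  polynomials in h is given by \<open>wact\<close>. Moving \<open>h\<close> to the left past
  \<open>e\<close> or \<open>f\<close> reduces the claim to the generator: the error for h^(k+1) is
  a left multiple of the error for h^k.\<close>

lemma uh_E_F: "uh (wact \<xi> s E v) - ugen E * uh v \<in> wJ" "uh (wact \<xi> s F v) - ugen F * uh v \<in> wJ"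
proof -
  have step: "uh (wact \<xi> s b v) - ugen b * uh v \<in> wJ"
    if 0: "uh (wact \<xi> s b (bas 0)) - ugen b \<in> wJ"
      and w: "\<And>v. wact \<xi> s b (wact \<xi> s H v) = wact \<xi> s H (wact \<xi> s b v) + vscale d (wact \<xi> s b v)"
      and u: "ugen b * ugen H = ugen H * ugen b + uconst d * ugen b" for b d v
  proof (induction v rule: vec_induct)
    case (bas k)
    show ?case
    proof (induction k)
      case 0 then show ?case using that(1) by (simp add: uh_bas)
    next
      case (Suc k)
      have "uh (wact \<xi> s b (bas (Suc k))) - ugen b * uh (bas (Suc k)) =
        ugen H * uh (wact \<xi> s b (bas k)) + uconst d * uh (wact \<xi> s b (bas k)) - ugen b * ugen H * uh (bas k)"
        unfolding wact_H_bas[of \<xi> s k, symmetric] w uh_add uh_scale uh_H by (simp add: mult.assoc)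
      also have "\<dots> = (ugen H + uconst d) * (uh (wact \<xi> s b (bas k)) - ugen b * uh (bas k))"
        unfolding u by (simp add: algebra_simps)
      finally show ?case using wJ_mult[OF Suc, of "ugen H + uconst d"] by simp
    qed
  next
    case (add u v)
    then show ?case using wJ_add[OF add] by (simp add: wact_linear uh_add algebra_simps)
  next
    case (scale c v)
    have "uconst c * (ugen b * uh v) = ugen b * (uconst c * uh v)" by (metis mult.assoc uconst_commute)
    then show ?case using wJ_mult[OF scale, of "uconst c"] by (simp add: wact_linear uh_scale right_diff_distrib)
  qed
  have E0: "uh (wact \<xi> s E (bas 0)) - ugen E \<in> wJ"
    using wJ_uminus[OF wJ_gens(2)] by (simp add: wact_E_bas0 uh_scale uh_bas)
  show "uh (wact \<xi> s E v) - ugen E * uh v \<in> wJ"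
  proof (rule step[where d = "-2", OF E0])
    show "ugen E * ugen H = ugen H * ugen E + uconst (-2) * ugen E"
      using ugen_bracket(2) uconst_diff[of 0 2] by (simp add: uconst_simps)
    show "wact \<xi> s E (wact \<xi> s H v) = wact \<xi> s H (wact \<xi> s E v) + vscale (-2) (wact \<xi> s E v)" for v
      using wact_sl2(2)[OF \<xi>, of s v] by simp
  qed
  have "vscale (4 * \<xi>) (wact \<xi> s F (bas 0)) = vscale (s^2) (bas 0) - (bas 2 + vscale 2 (bas 1) + bas 0)"
    using wact_casimir[OF \<xi>, of s "bas 0"] unfolding wact_E_bas0
    by (simp add: wact_linear wact_H_bas numeral_2_eq_2 algebra_simps)
  from arg_cong[OF this, of uh]
  have "uconst (4 * \<xi>) * uh (wact \<xi> s F (bas 0)) = uconst (s^2) - (ugen H ^ 2 + uconst 2 * ugen H + 1)"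
    by (simp only: uh_scale uh_diff uh_add uh_bas) simp
  \<comment> \<open>Modulo the ideal \<open>4 \<xi> f\<close> is \<open>s^2 - (h + 1)^2\<close>; the
    combination of the two generators that shows it is
    \<open>4 f (e - \<xi>) - (c - s^2)\<close>.\<close>
  then have "uconst (4 * \<xi>) * (uh (wact \<xi> s F (bas 0)) - ugen F) =
      uconst 4 * ugen F * (ugen E - uconst \<xi>) - (casimir - uconst (s^2))"
    by (simp add: casimir_def uconst_simps(2) uconst_numeral algebra_simps power2_eq_square uconst_commute[of \<xi>] mult_2)
  also have "\<dots> \<in> wJ" by (rule wJ_diff[OF wJ_mult[OF wJ_gens(2)] wJ_gens(1)])
  finally have "uconst (1 / (4 * \<xi>)) * (uconst (4 * \<xi>) * (uh (wact \<xi> s F (bas 0)) - ugen F)) \<in> wJ" by (rule wJ_mult)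
  moreover have "uconst (1 / (4 * \<xi>)) * uconst (4 * \<xi>) = 1"
    using \<xi> by (simp add: uconst_simps(2)[symmetric] uconst_simps(4))
  ultimately have F0: "uh (wact \<xi> s F (bas 0)) - ugen F \<in> wJ" by (simp add: mult.assoc[symmetric])
  show "uh (wact \<xi> s F v) - ugen F * uh v \<in> wJ"
  proof (rule step[where d = 2, OF F0])
    show "ugen F * ugen H = ugen H * ugen F + uconst 2 * ugen F"
      using ugen_bracket(3) by simp
    show "wact \<xi> s F (wact \<xi> s H v) = wact \<xi> s H (wact \<xi> s F v) + vscale 2 (wact \<xi> s F v)" for v
      using wact_sl2(3)[OF \<xi>, of s v] by simp
  qed
qed

lemma uh_act: "uh (wact \<xi> s b v) - ugen b * uh v \<in> wJ"
  using uh_E_F by (cases b) (simp_all add: uh_H wJ_zero)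

text \<open>By \<open>uh_act\<close> the generators map cosets of polynomials in h to such cosets,
  and the constants are among them.\<close>

lemma uh_surj: "\<exists>v. u - uh v \<in> wJ"
proof (induction u rule: usl2_induct)
  case (const c)
  have "uconst c - uh (vscale c (bas 0)) = 0" by (simp add: uh_scale uh_bas)
  then show ?case using wJ_zero by metis
next
  case (gen b u)
  then obtain v where "u - uh v \<in> wJ" by blast
  from wJ_diff[OF wJ_mult[OF this, of "ugen b"] uh_act[of b v]] have "ugen b * u - uh (wact \<xi> s b v) \<in> wJ"
    by (simp add: algebra_simps)
  then show ?case by blast
next
  case (add u u')
  then obtain v v' where "u - uh v \<in> wJ" "u' - uh v' \<in> wJ" by blast
  from wJ_add[OF this] have "u + u' - uh (v + v') \<in> wJ" by (simp add: uh_add algebra_simps)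
  then show ?case by blast
qed

lemma urho_uh: "urho (uh v) (bas 0) = v"
proof (induction v rule: vec_induct)
  case (bas k)
  show ?case
  proof (induction k)
    case 0 then show ?case using urho_simps(4)[of 1 "bas 0"] by (simp add: uh_bas uconst_simps)
  next
    case (Suc k) then show ?case by (simp add: uh_bas urho_simps wact_H_bas)
  qed
qed (simp_all add: uh_add uh_scale urho_simps)

definition ucos :: "usl2 \<Rightarrow> usl2 set" where
  "ucos u = {u + j | j. j \<in> wJ}"

lemma ucos_mem: "a \<in> ucos u \<longleftrightarrow> a - u \<in> wJ"
  unfolding ucos_def by (auto intro!: exI[of _ "a - u"])

lemma ucos_eqI: "u - u' \<in> wJ \<Longrightarrow> ucos u = ucos u'"
proof (rule set_eqI)
  fix a assume "u - u' \<in> wJ"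
  then show "a \<in> ucos u \<longleftrightarrow> a \<in> ucos u'"
    unfolding ucos_mem using wJ_add[of "a - u" "u - u'"] wJ_diff[of "a - u'" "u - u'"] by auto
qed

lemma usl2_quot_simps:
  "carr (usl2_quot wJ) = range ucos" "vzero (usl2_quot wJ) = ucos 0"
  "vadd (usl2_quot wJ) (ucos u) (ucos u') = ucos (u + u')"
  "vsmul (usl2_quot wJ) c (ucos u) = ucos (uconst c * u)"
  "act (usl2_quot wJ) b (ucos u) = ucos (ugen b * u)"
proof -
  show "carr (usl2_quot wJ) = range ucos" "vzero (usl2_quot wJ) = ucos 0"
    by (auto simp: usl2_quot_def ucos_def)
  show "vadd (usl2_quot wJ) (ucos u) (ucos u') = ucos (u + u')"
  proof (rule set_eqI)
    fix a
    have "a \<in> vadd (usl2_quot wJ) (ucos u) (ucos u') \<longleftrightarrow> (\<exists>b c. a = b + c \<and> b - u \<in> wJ \<and> c - u' \<in> wJ)"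
      by (auto simp: usl2_quot_def ucos_mem)
    also have "\<dots> \<longleftrightarrow> a - (u + u') \<in> wJ"
    proof
      assume "\<exists>b c. a = b + c \<and> b - u \<in> wJ \<and> c - u' \<in> wJ"
      then obtain b c where "a = b + c" "b - u \<in> wJ" "c - u' \<in> wJ" by blast
      then show "a - (u + u') \<in> wJ" using wJ_add[of "b - u" "c - u'"] by (simp add: algebra_simps)
    next
      assume "a - (u + u') \<in> wJ"
      then show "\<exists>b c. a = b + c \<and> b - u \<in> wJ \<and> c - u' \<in> wJ"
        using wJ_zero by (intro exI[of _ u] exI[of _ "a - u"]) (simp add: algebra_simps)
    qed
    finally show "a \<in> vadd (usl2_quot wJ) (ucos u) (ucos u') \<longleftrightarrow> a \<in> ucos (u + u')" by (simp only: ucos_mem)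
  qed
  have m: "{x * a + j | a j. a \<in> ucos u \<and> j \<in> wJ} = ucos (x * u)" for x
  proof (rule set_eqI)
    fix c
    have "(\<exists>a j. c = x * a + j \<and> a - u \<in> wJ \<and> j \<in> wJ) \<longleftrightarrow> c - x * u \<in> wJ"
    proof
      assume "\<exists>a j. c = x * a + j \<and> a - u \<in> wJ \<and> j \<in> wJ"
      then obtain a j where "c = x * a + j" "a - u \<in> wJ" "j \<in> wJ" by blast
      then show "c - x * u \<in> wJ" using wJ_add[OF wJ_mult[of "a - u" x], of j] by (simp add: algebra_simps)
    next
      assume "c - x * u \<in> wJ"
      then show "\<exists>a j. c = x * a + j \<and> a - u \<in> wJ \<and> j \<in> wJ"
        using wJ_zero by (intro exI[of _ u] exI[of _ "c - x * u"]) simp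
    qed
    then show "c \<in> {x * a + j | a j. a \<in> ucos u \<and> j \<in> wJ} \<longleftrightarrow> c \<in> ucos (x * u)" by (simp add: ucos_mem)
  qed
  show "vsmul (usl2_quot wJ) c (ucos u) = ucos (uconst c * u)" "act (usl2_quot wJ) b (ucos u) = ucos (ugen b * u)"
    using m by (simp_all add: usl2_quot_def)
qed

text \<open>Surjectivity is \<open>uh_surj\<close>. For injectivity, the coset of
  \<open>uh v\<close> acts on \<open>bas 0\<close> and gives back \<open>v\<close> by
  \<open>urho_uh\<close>.\<close>

lemma usl2_quot_base_iso: "base_iso (vmod UNIV (wact \<xi> s)) (usl2_quot wJ) (\<lambda>v. ucos (uh v))"
  unfolding base_iso_def
proof (intro conjI)
  show "lmod_hom (vmod UNIV (wact \<xi> s)) (usl2_quot wJ) (\<lambda>v. ucos (uh v))"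
    unfolding lmod_hom_def clinear_map_def vmod_simps usl2_quot_simps
    by (auto simp: uh_add uh_scale intro!: ucos_eqI uh_act)
  show "bij_betw (\<lambda>v. ucos (uh v)) (carr (vmod UNIV (wact \<xi> s))) (carr (usl2_quot wJ))"
    unfolding vmod_simps usl2_quot_simps
  proof (rule bij_betw_imageI)
    show "inj (\<lambda>v. ucos (uh v))"
    proof (rule injI)
      fix v v' assume "ucos (uh v) = ucos (uh v')"
      then have "uh v - uh v' \<in> wJ" using ucos_mem[of "uh v" "uh v"] ucos_mem[of "uh v" "uh v'"] wJ_zero by simp
      from urho_wJ[OF this] show "v = v'" by (simp add: urho_diff urho_uh)
    qed
    show "range (\<lambda>v. ucos (uh v)) = range ucos"
    proof (intro subset_antisym subsetI)
      fix A assume "A \<in> range ucos"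
      then obtain u where u: "A = ucos u" by blast
      obtain v where "u - uh v \<in> wJ" using uh_surj by blast
      from ucos_eqI[OF this] show "A \<in> range (\<lambda>v. ucos (uh v))" using u by blast
    qed blast
  qed
  show "ucos (uh 0) = vzero (usl2_quot wJ)" by (simp add: usl2_quot_simps uh_def)
qed

end

text \<open>Only the square of \<open>\<nu> + 1\<close> enters the ideal, so \<nu> and
  \<open>-2 - \<nu>\<close> define the same module.\<close>

lemma M_mod_iso:
  assumes "\<xi> \<noteq> 0" "(\<nu> + 1)^2 = (hw i)^2" shows "\<exists>f. base_iso (Ws \<xi> i) (M_mod \<nu> \<xi>) f"
  using usl2_quot_base_iso[OF assms(1), of "hw i"] unfolding M_mod_def Ws_def wJ_def[OF assms(1)] assms(2) by blast

theorem X1_simple_transitive_type_T_infinity: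
  assumes \<xi>: "\<xi> \<noteq> 0" and \<mu>: "\<exists>k::int. \<mu> = of_int k + 1/2"
  shows "simple_transitive sl2_fin (X1 \<mu> \<xi>) \<and> type_T_infinity (X1 \<mu> \<xi>)"
  unfolding X1_def
proof (rule tensor_family.simple_transitive_type_T_infinity[OF tensor_family_Ws[OF \<xi>]])
  obtain k :: int where k: "\<mu> = of_int k + 1/2" using \<mu> by blast
  have sq: "\<exists>j. (\<mu> + of_int i + 1)^2 = (hw j)^2" for i :: int
  proof (cases "k + i + 1 \<ge> 0")
    case True
    then have "\<mu> + of_int i + 1 = hw (nat (k + i + 1))" by (simp add: k hw_def of_nat_nat)
    then show ?thesis by metis
  next
    case False
    \<comment> \<open>Here \<open>\<mu> + i + 1 = k + i + 3/2\<close> is negative, and its negative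
      is the half-integer with index \<open>- k - i - 2\<close>.\<close>
    then have "\<mu> + of_int i + 1 = - hw (nat (- k - i - 2))" by (simp add: k hw_def of_nat_nat)
    then show ?thesis by (metis power2_minus)
  qed
  show "\<exists>i f. base_iso (Ws \<xi> i) M f" if mem: "M \<in> {M_mod (\<mu> + of_int i) \<xi> | i. True}" for M
  proof -
    obtain i where i: "M = M_mod (\<mu> + of_int i) \<xi>" using mem by blast
    obtain j where "(\<mu> + of_int i + 1)^2 = (hw j)^2" using sq[of i] by blast
    from M_mod_iso[OF \<xi> this] show ?thesis using i by blast
  qed
  show "\<exists>M\<in>{M_mod (\<mu> + of_int i) \<xi> | i. True}. \<exists>f. base_iso (Ws \<xi> i) M f" for i
  proof -
    \<comment> \<open>The shift is chosen so that the resulting parameter plus 1 is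
      \<open>hw i\<close> itself; hence every index occurs.\<close>
    have "\<mu> + of_int (int i - k - 1) + 1 = hw i" by (simp add: k hw_def)
    then have "\<exists>f. base_iso (Ws \<xi> i) (M_mod (\<mu> + of_int (int i - k - 1)) \<xi>) f" by (intro M_mod_iso[OF \<xi>]) (simp only:)
    then show ?thesis by (intro bexI[of _ "M_mod (\<mu> + of_int (int i - k - 1)) \<xi>"]) blast+
  qed
qed

theorem proposition21:
  fixes \<xi> \<mu> \<theta> :: complex
  assumes "\<xi> \<noteq> 0"
    and "\<exists>k::int. \<mu> = of_int k + 1/2"
    and "\<theta> \<noteq> 0"
  shows "(simple_transitive sl2_fin (X1 \<mu> \<xi>) \<and> type_T_infinity (X1 \<mu> \<xi>)) \<and>
         (simple_transitive sl2_fin (X2 \<theta>) \<and> type_T_infinity (X2 \<theta>))"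
  using X1_simple_transitive_type_T_infinity[OF assms(1,2)] X2_simple_transitive_type_T_infinity[OF assms(3)]
  by (intro conjI) (elim conjE, assumption)+

end
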